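(* Let $(\Gamma,\Gamma',\Omega)$ be one of the triples of the table in the context, with $\Omega=\Gamma'/\Gamma$, so that the McKay quiver of $\Gamma$ is built on a Dynkin diagram of type $A_{2r-1}$, $D_{r+1}$ or $E_6$. Then (for a suitable orientation of the McKay quiver) there exists an action of $\Omega$ on $M(\Gamma)$ that is symplectic and induces the natural action of $\Omega$ on the simple singularity $\mathbb{C}^2/\Gamma$.
   Context: The base field is $\mathbb{C}$. $\mathcal{C}_n$, $\mathcal{D}_n$, $\mathcal{T}$, $\mathcal{O}$ denote the cyclic group of order $n$, the binary dihedral group of order $4n$, the binary tetrahedral group and the binary octahedral group, as subgroups of $\mathrm{SU}_2$. The triples $(\Gamma,\Gamma',\Omega)$, with $\Gamma$ normal in $\Gamma'\subset\mathrm{SU}_2$ and $\Omega=\Gamma'/\Gamma$, are: - $(A_{2r-1},\mathbb{Z}/2\mathbb{Z})$, $r\ge2$: $\Gamma=\mathcal{C}_{2r}$, $\Gamma'=\mathcal{D}_r$; - $(D_{r+1},\mathbb{Z}/2\mathbb{Z})$, $r\ge3$: $\Gamma=\mathcal{D}_{r-1}$, $\Gamma'=\mathcal{D}_{2(r-1)}$; - $(E_6,\mathbb{Z}/2\mathbb{Z})$: $\Gamma=\mathcal{T}$, $\Gamma'=\mathcal{O}$; - $(D_4,\mathfrak{S}_3)$: $\Gamma=\mathcal{D}_2$, $\Gamma'=\mathcal{O}$. The natural action of $\Omega$ on $\mathbb{C}^2/\Gamma$ is induced by the linear action of $\Gamma'$ on $\mathbb{C}^2$. McKay quiver. Let $\widetilde\Delta(\Gamma)$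 be the extended Dynkin diagram, $0$ its additional vertex, and $d_i$ the coordinates of its minimal imaginary root (equivalently the dimensions of the irreducible representations of $\Gamma$). The McKay quiver $Q$ has the vertices of $\widetilde\Delta(\Gamma)$ and, for each edge, two opposite arrows $a,\bar a$; $Q_1$ is its arrow set, $s(a),t(a)$ the source and target of $a$. Put $M(\Gamma)=\bigoplus_{a\in Q_1}\mathrm{Hom}(\mathbb{C}^{d_{s(a)}},\mathbb{C}^{d_{t(a)}})$ and $G(\Gamma)=(\prod_i\mathrm{GL}_{d_i}(\mathbb{C}))/\mathbb{C}^*$, acting by simultaneous conjugation. An orientation is a function $\epsilon:Q_1\to\{\pm1\}$ with $\epsilon(\bar a)=-\epsilon(a)$. It defines the symplectic form $\langle\varphi,\psi\rangle=\sum_{a\in Q_1}\epsilon(a)\mathrm{Tr}(\varphi_a\psi_{\bar a})$ and the moment map $\mu_{CS}$ with $i$-th entry $\sum_{a:\,t(a)=i}\epsilon(a)\varphi_a\varphi_{\bar a}$. One has $\mu_{CS}^{-1}(0)//G(\Gamma)\cong\mathbb{C}^2/\Gamma$. An action is symplectic if it preserves $\langle\cdot,\cdot\rangle$. Action on the diagram. $\Omega$ acts on $\widetilde\Delta(\Gamma)$ fixing the vertex $0$: - $A_{2r-1}$: vertices $0,\dots,2r-1$ in a cycle, the generator sends $i\mapsto 2r-i$ for $1\le i\le 2r-1$; - $(D_{r+1},\mathbb{Z}/2\mathbb{Z})$: chain $2,\dots,r-1$ with $0,1$ attached to $2$ and $r,r+1$ attached to $r-1$; the generator exchanges $r$ and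 $r+1$ and fixes the others; - $E_6$: central vertex $6$ with three branches $6-3-0$, $6-4-1$, $6-5-2$; the generator exchanges $1\leftrightarrow2$, $4\leftrightarrow5$ and fixes the others; - $(D_4,\mathfrak{S}_3)$: central vertex $2$ joined to $0,1,3,4$; $\mathfrak{S}_3$ permutes $1,3,4$. Actions on $M(\Gamma)$. By an action of $\Omega$ on $M(\Gamma)$ is meant one lifting the action on the extended Dynkin diagram: a linear action of the form $(\varpi.\varphi)_{\varpi(a)}=c_{\varpi,a}\,\varphi_a$ with scalars $c_{\varpi,a}\in\mathbb{C}^*$ (using $d_{\varpi(i)}=d_i$), where $c_{\varpi,a}=1$ whenever $\varpi(a)=a$. "Induces the natural action on $\mathbb{C}^2/\Gamma$" means that the induced action on $\mu_{CS}^{-1}(0)//G(\Gamma)$ corresponds, under an isomorphism $\mu_{CS}^{-1}(0)//G(\Gamma)\cong\mathbb{C}^2/\Gamma$, to the natural action of $\Omega=\Gamma'/\Gamma$. *)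

theory Defs
  imports
    "Jordan_Normal_Form.Schur_Decomposition"
    "HOL-Algebra.Product_Groups"
    "HOL-Algebra.Group_Action"
    "HOL-Algebra.Generated_Groups"
    "HOL-Combinatorics.Permutations"
begin

section \<open>Finite subgroups of \<open>SU\<^sub>2\<close>\<close>

definition SU2 :: "complex mat monoid" where
  "SU2 = \<lparr>carrier = {A \<in> carrier_mat 2 2. mat_adjoint A * A = 1\<^sub>m 2 \<and> det A = 1},
          monoid.mult = (*), one = 1\<^sub>m 2\<rparr>"

definition mat22 :: "complex \<Rightarrow> complex \<Rightarrow> complex \<Rightarrow> complex \<Rightarrow> complex mat" where
  "mat22 a b c d = mat_of_rows_list 2 [[a, b], [c, d]]"

definition rot :: "nat \<Rightarrow> complex mat" where
  "rot n = mat22 (cis (2 * pi / real n)) 0 0 (cis (- (2 * pi / real n)))"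

text \<open>Under the usual identification of \<open>SU\<^sub>2\<close> with the unit quaternions, \<open>rot 4\<close>, \<open>matJ\<close>,
  \<open>matH\<close> and \<open>rot 8\<close> are \<open>i\<close>, \<open>j\<close>, \<open>(1 + i + j + k) / 2\<close> and \<open>(1 + i) / \<surd>2\<close>.\<close>

definition matJ :: "complex mat" where
  "matJ = mat22 0 1 (- 1) 0"

definition matH :: "complex mat" where
  "matH = mat22 ((1 + \<i>) / 2) ((1 + \<i>) / 2) ((- 1 + \<i>) / 2) ((1 - \<i>) / 2)"

definition cyclic_grp :: "nat \<Rightarrow> complex mat set" where
  "cyclic_grp n = generate SU2 {rot n}"

text \<open>Of order \<open>4 n\<close>.\<close>

definition binary_dihedral_grp :: "nat \<Rightarrow> complex mat set" where
  "binary_dihedral_grp n = generate SU2 {rot (2 * n), matJ}"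

definition binary_tetrahedral_grp :: "complex mat set" where
  "binary_tetrahedral_grp = generate SU2 {rot 4, matJ, matH}"

definition binary_octahedral_grp :: "complex mat set" where
  "binary_octahedral_grp = generate SU2 {rot 8, rot 4, matJ, matH}"

section \<open>The triples \<open>(\<Gamma>, \<Gamma>', \<Omega>)\<close>\<close>

text \<open>\<open>A_Z2 r\<close> and \<open>D_Z2 r\<close> stand for types \<open>A\<^bsub>2r-1\<^esub>\<close> and \<open>D\<^bsub>r+1\<^esub>\<close>.\<close>

datatype mckay_triple = A_Z2 nat | D_Z2 nat | E6_Z2 | D4_S3

fun valid_triple :: "mckay_triple \<Rightarrow> bool" where
  "valid_triple (A_Z2 r) \<longleftrightarrow> r \<ge> 2"
| "valid_triple (D_Z2 r) \<longleftrightarrow> r \<ge> 3"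
| "valid_triple E6_Z2 \<longleftrightarrow> True"
| "valid_triple D4_S3 \<longleftrightarrow> True"

fun small_grp :: "mckay_triple \<Rightarrow> complex mat set" where
  "small_grp (A_Z2 r) = cyclic_grp (2 * r)"
| "small_grp (D_Z2 r) = binary_dihedral_grp (r - 1)"
| "small_grp E6_Z2 = binary_tetrahedral_grp"
| "small_grp D4_S3 = binary_dihedral_grp 2"

fun big_grp :: "mckay_triple \<Rightarrow> complex mat set" where
  "big_grp (A_Z2 r) = binary_dihedral_grp r"
| "big_grp (D_Z2 r) = binary_dihedral_grp (2 * (r - 1))"
| "big_grp E6_Z2 = binary_octahedral_grp"
| "big_grp D4_S3 = binary_octahedral_grp"

definition Omega :: "mckay_triple \<Rightarrow> complex mat set monoid" where
  "Omega X = (SU2\<lparr>carrier := big_grp X\<rparr>) Mod small_grp X"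

section \<open>Extended Dynkin diagrams and McKay quivers\<close>

fun verts :: "mckay_triple \<Rightarrow> nat set" where
  "verts (A_Z2 r) = {..<2 * r}"
| "verts (D_Z2 r) = {..r + 1}"
| "verts E6_Z2 = {..6}"
| "verts D4_S3 = {..4}"

text \<open>One ordered pair for each edge of the diagram.\<close>

fun half_edges :: "mckay_triple \<Rightarrow> (nat \<times> nat) set" where
  "half_edges (A_Z2 r) = {(i, (i + 1) mod (2 * r)) |i. i < 2 * r}"
| "half_edges (D_Z2 r) =
     {(0, 2), (1, 2), (r - 1, r), (r - 1, r + 1)} \<union> {(i, i + 1) |i. 2 \<le> i \<and> i < r - 1}"
| "half_edges E6_Z2 = {(6, 3), (3, 0), (6, 4), (4, 1), (6, 5), (5, 2)}"
| "half_edges D4_S3 = {(2, 0), (2, 1), (2, 3), (2, 4)}"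

text \<open>All the diagrams are simple graphs, so an arrow is given by its source \<open>fst a\<close> and its
  target \<open>snd a\<close>, and the opposite arrow is \<open>prod.swap a\<close>.\<close>

definition arrows :: "mckay_triple \<Rightarrow> (nat \<times> nat) set" where
  "arrows X = half_edges X \<union> (half_edges X)\<inverse>"

fun dims :: "mckay_triple \<Rightarrow> nat \<Rightarrow> nat" where
  "dims (A_Z2 r) i = 1"
| "dims (D_Z2 r) i = (if i \<in> {0, 1, r, r + 1} then 1 else 2)"
| "dims E6_Z2 i = (if i \<le> 2 then 1 else if i \<le> 5 then 2 else 3)"
| "dims D4_S3 i = (if i = 2 then 2 else 1)"

text \<open>\<open>dims X\<close> is the minimal imaginary root: by the following lemma it is a positive vector in
  the kernel of the Cartan matrix of the diagram, and it is primitive since one coordinate is 1.\<close>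

lemma dims_imaginary_root:
  assumes "valid_triple X"
  shows "dims X 0 = 1" "\<forall>i \<in> verts X. dims X i > 0"
    "\<forall>i \<in> verts X. (\<Sum>j | (i, j) \<in> arrows X. dims X j) = 2 * dims X i"
proof -
  show "dims X 0 = 1"
    by (cases X) auto
  show "\<forall>i \<in> verts X. dims X i > 0"
    by (cases X) auto
  show "\<forall>i \<in> verts X. (\<Sum>j | (i, j) \<in> arrows X. dims X j) = 2 * dims X i"
  proof (cases X)
    case (A_Z2 r)
    then have r: "r \<ge> 2" using assms by simp
    have "card {j. (i, j) \<in> arrows X} = 2" if i: "i < 2 * r" for i
    proof -
      define p q where "p = (if i = 2 * r - 1 then 0 else i + 1)"
        and "q = (if i = 0 then 2 * r - 1 else i - 1)"
      have m: "(k + 1) mod (2 * r) = (if k = 2 * r - 1 then 0 else k + 1)" if "k < 2 * r" for k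
        using that r by auto
      have "(i, j) \<in> arrows X \<longleftrightarrow> j = p \<or> j = q" for j
      proof -
        have "(i, j) \<in> arrows X \<longleftrightarrow>
            j = (i + 1) mod (2 * r) \<or> (j < 2 * r \<and> i = (j + 1) mod (2 * r))"
          using i by (auto simp: A_Z2 arrows_def)
        also have "j = (i + 1) mod (2 * r) \<longleftrightarrow> j = p"
          using m[OF i] by (simp add: p_def)
        also have "(j < 2 * r \<and> i = (j + 1) mod (2 * r)) \<longleftrightarrow>
            (j < 2 * r \<and> i = (if j = 2 * r - 1 then 0 else j + 1))"
          using m by metis
        also have "\<dots> \<longleftrightarrow> j = q"
          using i r by (auto simp: q_def split: if_splits)
        finally show ?thesis .
      qed
      then have "{j. (i, j) \<in> arrows X} = {p, q}" by auto
      moreover have "p \<noteq> q" using r i by (auto simp: p_def q_def)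
      ultimately show ?thesis by simp
    qed
    then show ?thesis by (simp add: A_Z2)
  next
    case (D_Z2 r)
    then have r: "r \<ge> 3" using assms by simp
    show ?thesis
    proof
      fix i assume "i \<in> verts X"
      then have i: "i \<le> r + 1" by (simp add: D_Z2)
      have mem: "(k, l) \<in> {(i, i + 1) |i. 2 \<le> i \<and> i < r - 1} \<longleftrightarrow> 2 \<le> k \<and> k < r - 1 \<and> l = k + 1"
        for k l by blast
      have *: "(i, j) \<in> arrows X \<longleftrightarrow>
          i = 0 \<and> j = 2 \<or> i = 1 \<and> j = 2 \<or> i = r - 1 \<and> j = r \<or> i = r - 1 \<and> j = r + 1 \<or>
          2 \<le> i \<and> i < r - 1 \<and> j = i + 1 \<or>
          j = 0 \<and> i = 2 \<or> j = 1 \<and> i = 2 \<or> j = r - 1 \<and> i = r \<or> j = r - 1 \<and> i = r + 1 \<or>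
          2 \<le> j \<and> j < r - 1 \<and> i = j + 1" for j
        unfolding D_Z2 arrows_def half_edges.simps
        by (simp only: Un_iff converse_iff insert_iff empty_iff prod.inject mem disj_assoc simp_thms)
      have "i = 0 \<or> i = 1 \<or> i = r \<or> i = r + 1 \<or> i = 2 \<and> r = 3 \<or> i = 2 \<and> r > 3 \<or>
          3 \<le> i \<and> i = r - 1 \<or> 3 \<le> i \<and> i + 2 \<le> r"
        using i r by linarith
      then consider "i = 0" | "i = 1" | "i = r" | "i = r + 1" | "i = 2" "r = 3" | "i = 2" "r > 3"
        | s where "i = s + 3" "r = s + 4" | s t where "i = s + 3" "r = s + t + 5"
      proof (elim disjE conjE)
        assume "3 \<le> i" "i = r - 1"
        then have "i = (i - 3) + 3" "r = (i - 3) + 4" by linarith+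
        then show thesis by (rule that(7))
      next
        assume "3 \<le> i" "i + 2 \<le> r"
        then have "i = (i - 3) + 3" "r = (i - 3) + (r - i - 2) + 5" by linarith+
        then show thesis by (rule that(8))
      qed (use that(1-6) in blast)+
      then show "(\<Sum>j | (i, j) \<in> arrows X. dims X j) = 2 * dims X i"
      proof cases
        case 1
        then have "j \<in> {j. (i, j) \<in> arrows X} \<longleftrightarrow> j \<in> {2}" for j
          unfolding mem_Collect_eq * using r by auto
        then have "{j. (i, j) \<in> arrows X} = {2}" by blast
        then show ?thesis using 1 r by (auto simp: D_Z2)
      next
        case 2
        then have "j \<in> {j. (i, j) \<in> arrows X} \<longleftrightarrow> j \<in> {2}" for j
          unfolding mem_Collect_eq * using r by auto
        then have "{j. (i, j) \<in> arrows X} = {2}" by blast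
        then show ?thesis using 2 r by (auto simp: D_Z2)
      next
        case 3
        then have "j \<in> {j. (i, j) \<in> arrows X} \<longleftrightarrow> j \<in> {r - 1}" for j
          unfolding mem_Collect_eq * using r by auto
        then have "{j. (i, j) \<in> arrows X} = {r - 1}" by blast
        then show ?thesis using 3 r by (auto simp: D_Z2)
      next
        case 4
        then have "j \<in> {j. (i, j) \<in> arrows X} \<longleftrightarrow> j \<in> {r - 1}" for j
          unfolding mem_Collect_eq * using r by auto
        then have "{j. (i, j) \<in> arrows X} = {r - 1}" by blast
        then show ?thesis using 4 r by (auto simp: D_Z2)
      next
        case 5
        then have "j \<in> {j. (i, j) \<in> arrows X} \<longleftrightarrow> j \<in> {0, 1, 3, 4}" for j
          unfolding mem_Collect_eq * using r by auto
        then have "{j. (i, j) \<in> arrows X} = {0, 1, 3, 4}" by blast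
        then show ?thesis using 5 r by (auto simp: D_Z2)
      next
        case 6
        then have "j \<in> {j. (i, j) \<in> arrows X} \<longleftrightarrow> j \<in> {0, 1, 3}" for j
          unfolding mem_Collect_eq * using r by auto
        then have "{j. (i, j) \<in> arrows X} = {0, 1, 3}" by blast
        then show ?thesis using 6 r by (auto simp: D_Z2)
      next
        case (7 s)
        then have "j \<in> {j. (i, j) \<in> arrows X} \<longleftrightarrow> j \<in> {s + 2, s + 4, s + 5}" for j
          unfolding mem_Collect_eq * using r by auto
        then have "{j. (i, j) \<in> arrows X} = {s + 2, s + 4, s + 5}" by blast
        then show ?thesis using 7 r by (auto simp: D_Z2)
      next
        case (8 s t)
        then have "j \<in> {j. (i, j) \<in> arrows X} \<longleftrightarrow> j \<in> {s + 2, s + 4}" for j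
          unfolding mem_Collect_eq * using r by auto
        then have "{j. (i, j) \<in> arrows X} = {s + 2, s + 4}" by blast
        then show ?thesis using 8 r by (auto simp: D_Z2)
      qed
    qed
  next
    case E6_Z2
    have "(i, j) \<in> arrows X \<longleftrightarrow>
        (i, j) \<in> {(6, 3), (3, 0), (6, 4), (4, 1), (6, 5), (5, 2)} \<or>
        (j, i) \<in> {(6, 3), (3, 0), (6, 4), (4, 1), (6, 5), (5, 2)}" for i j
      unfolding E6_Z2 arrows_def half_edges.simps by (simp only: Un_iff converse_iff)
    then have "{j. (0, j) \<in> arrows X} = {3}" "{j. (1, j) \<in> arrows X} = {4}"
      "{j. (2, j) \<in> arrows X} = {5}" "{j. (3, j) \<in> arrows X} = {0, 6}"
      "{j. (4, j) \<in> arrows X} = {1, 6}" "{j. (5, j) \<in> arrows X} = {2, 6}"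
      "{j. (6, j) \<in> arrows X} = {3, 4, 5}"
      by (simp_all add: set_eq_iff)
    moreover have "verts X = {0, 1, 2, 3, 4, 5, 6}"
      by (auto simp: E6_Z2)
    ultimately show ?thesis by (simp add: E6_Z2)
  next
    case D4_S3
    have "(i, j) \<in> arrows X \<longleftrightarrow>
        (i, j) \<in> {(2, 0), (2, 1), (2, 3), (2, 4)} \<or> (j, i) \<in> {(2, 0), (2, 1), (2, 3), (2, 4)}" for i j
      unfolding D4_S3 arrows_def half_edges.simps by (simp only: Un_iff converse_iff)
    then have "{j. (0, j) \<in> arrows X} = {2}" "{j. (1, j) \<in> arrows X} = {2}"
      "{j. (2, j) \<in> arrows X} = {0, 1, 3, 4}" "{j. (3, j) \<in> arrows X} = {2}"
      "{j. (4, j) \<in> arrows X} = {2}"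
      by (simp_all add: set_eq_iff)
    moreover have "verts X = {0, 1, 2, 3, 4}"
      by (auto simp: D4_S3)
    ultimately show ?thesis by (simp add: D4_S3)
  qed
qed

section \<open>The action on the diagram\<close>

fun diagram_perms :: "mckay_triple \<Rightarrow> (nat \<Rightarrow> nat) set" where
  "diagram_perms (A_Z2 r) = {id, \<lambda>i. if 1 \<le> i \<and> i < 2 * r then 2 * r - i else i}"
| "diagram_perms (D_Z2 r) = {id, transpose r (r + 1)}"
| "diagram_perms E6_Z2 = {id, transpose 1 2 \<circ> transpose 4 5}"
| "diagram_perms D4_S3 = {p. p permutes {1, 3, 4}}"

definition diagram_sym_grp :: "mckay_triple \<Rightarrow> (nat \<Rightarrow> nat) monoid" where
  "diagram_sym_grp X = \<lparr>carrier = diagram_perms X, monoid.mult = (\<circ>), one = id\<rparr>"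

text \<open>An action of \<open>\<Omega>\<close> on the diagram as prescribed, i.e.\ an identification of \<open>\<Omega>\<close> with the
  prescribed group of diagram automorphisms. It is unique if \<open>\<Omega>\<close> has order 2; for
  \<open>\<Omega> \<cong> S\<^sub>3\<close> there are six, which differ by relabelling the vertices 1, 3, 4.\<close>

definition diagram_action :: "mckay_triple \<Rightarrow> (complex mat set \<Rightarrow> nat \<Rightarrow> nat) \<Rightarrow> bool" where
  "diagram_action X \<alpha> \<longleftrightarrow> \<alpha> \<in> iso (Omega X) (diagram_sym_grp X)"

section \<open>The representation space and its gauge group\<close>

type_synonym quiver_rep = "nat \<times> nat \<Rightarrow> complex mat"

definition rep_space :: "mckay_triple \<Rightarrow> quiver_rep set" where
  "rep_space X = (\<Pi>\<^sub>E a \<in> arrows X. carrier_mat (dims X (snd a)) (dims X (fst a)))"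

abbreviation mat_ring :: "nat \<Rightarrow> complex mat ring" where
  "mat_ring n \<equiv> ring_mat TYPE(complex) n ()"

definition GL_prod :: "mckay_triple \<Rightarrow> (nat \<Rightarrow> complex mat) monoid" where
  "GL_prod X = product_group (verts X) (\<lambda>i. units_of (mat_ring (dims X i)))"

definition scalars :: "mckay_triple \<Rightarrow> (nat \<Rightarrow> complex mat) set" where
  "scalars X = {\<lambda>i \<in> verts X. c \<cdot>\<^sub>m 1\<^sub>m (dims X i) |c. c \<noteq> 0}"

definition gauge_grp :: "mckay_triple \<Rightarrow> (nat \<Rightarrow> complex mat) set monoid" where
  "gauge_grp X = GL_prod X Mod scalars X"

definition conj_act :: "mckay_triple \<Rightarrow> (nat \<Rightarrow> complex mat) \<Rightarrow> quiver_rep \<Rightarrow> quiver_rep" where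
  "conj_act X g \<phi> =
     (\<lambda>a \<in> arrows X. g (snd a) * \<phi> a * inv\<^bsub>mat_ring (dims X (fst a))\<^esub> (g (fst a)))"

text \<open>Scalars act trivially, so the choice of a representative of the coset is immaterial, see
  \<open>gauge_act_eq_conj_act\<close>.\<close>

definition gauge_act :: "mckay_triple \<Rightarrow> (nat \<Rightarrow> complex mat) set \<Rightarrow> quiver_rep \<Rightarrow> quiver_rep" where
  "gauge_act X K = conj_act X (SOME g. g \<in> K)"

lemma gauge_act_eq_conj_act:
  assumes X: "valid_triple X" and K: "K \<in> carrier (gauge_grp X)" and g: "g \<in> K"
    and \<phi>: "\<phi> \<in> rep_space X"
  shows "gauge_act X K \<phi> = conj_act X g \<phi>"
proof -
  have ends: "fst a \<in> verts X" "snd a \<in> verts X" if "a \<in> arrows X" for a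
    using that X by (cases X; auto simp: arrows_def)+
  have ss: "a \<cdot>\<^sub>m (b \<cdot>\<^sub>m A) = (a * b) \<cdot>\<^sub>m A" "1 \<cdot>\<^sub>m A = A" for a b :: complex and A
    by (rule eq_matI; simp)+
  obtain h where h: "h \<in> carrier (GL_prod X)" and Kh: "K = scalars X #>\<^bsub>GL_prod X\<^esub> h"
    using K by (auto simp: gauge_grp_def carrier_FactGroup)
  have *: "conj_act X g' \<phi> = conj_act X h \<phi>" if g': "g' \<in> K" for g'
  proof -
    obtain c where c: "c \<noteq> 0" and
      g'_def: "g' = (\<lambda>i \<in> verts X. (c \<cdot>\<^sub>m 1\<^sub>m (dims X i)) * h i)"
      using g' unfolding Kh r_coset_def scalars_def
      by (auto simp: GL_prod_def product_group_def units_of_def ring_mat_def cong: restrict_cong)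
    have hU: "h i \<in> Units (mat_ring (dims X i))" if "i \<in> verts X" for i
      using h that by (auto simp: GL_prod_def product_group_def units_of_def)
    have hC: "h i \<in> carrier_mat (dims X i) (dims X i)" if "i \<in> verts X" for i
      using hU[OF that] by (auto simp: Units_def ring_mat_def)
    have gi: "g' i = c \<cdot>\<^sub>m h i" if "i \<in> verts X" for i
      using hC[OF that] that by (auto simp: g'_def)
    have inv: "inv\<^bsub>mat_ring (dims X i)\<^esub> (g' i) = inverse c \<cdot>\<^sub>m inv\<^bsub>mat_ring (dims X i)\<^esub> (h i)"
      "inv\<^bsub>mat_ring (dims X i)\<^esub> (h i) \<in> carrier_mat (dims X i) (dims X i)"
      if i: "i \<in> verts X" for i
    proof -
      let ?R = "mat_ring (dims X i)" and ?n = "dims X i"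
      interpret R: ring ?R by (rule ring_mat)
      have k: "inv\<^bsub>?R\<^esub> (h i) \<in> carrier_mat ?n ?n"
        using R.Units_inv_closed[OF hU[OF i]] by (simp add: ring_mat_def)
      show "inv\<^bsub>?R\<^esub> (h i) \<in> carrier_mat ?n ?n" by (rule k)
      have l: "inv\<^bsub>?R\<^esub> (h i) * h i = 1\<^sub>m ?n" "h i * inv\<^bsub>?R\<^esub> (h i) = 1\<^sub>m ?n"
        using R.Units_l_inv[OF hU[OF i]] R.Units_r_inv[OF hU[OF i]] by (simp_all add: ring_mat_def)
      have "inv\<^bsub>?R\<^esub> (c \<cdot>\<^sub>m h i) = inverse c \<cdot>\<^sub>m inv\<^bsub>?R\<^esub> (h i)"
      proof (rule R.inv_char)
        show "c \<cdot>\<^sub>m h i \<otimes>\<^bsub>?R\<^esub> (inverse c \<cdot>\<^sub>m inv\<^bsub>?R\<^esub> (h i)) = \<one>\<^bsub>?R\<^esub>"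
          using l c k hC[OF i]
          by (simp add: ss ring_mat_simps mult_smult_assoc_mat[of _ ?n ?n] mult_smult_distrib[of _ ?n ?n])
        show "(inverse c \<cdot>\<^sub>m inv\<^bsub>?R\<^esub> (h i)) \<otimes>\<^bsub>?R\<^esub> (c \<cdot>\<^sub>m h i) = \<one>\<^bsub>?R\<^esub>"
          using l c k hC[OF i]
          by (simp add: ss ring_mat_simps mult_smult_assoc_mat[of _ ?n ?n] mult_smult_distrib[of _ ?n ?n])
      qed (use k hC[OF i] in \<open>auto simp: ring_mat_simps\<close>)
      then show "inv\<^bsub>?R\<^esub> (g' i) = inverse c \<cdot>\<^sub>m inv\<^bsub>?R\<^esub> (h i)"
        by (simp add: gi i)
    qed
    show ?thesis
      unfolding conj_act_def
    proof (rule restrict_ext)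
      fix a assume a: "a \<in> arrows X"
      have p: "\<phi> a \<in> carrier_mat (dims X (snd a)) (dims X (fst a))"
        using \<phi> a by (auto simp: rep_space_def)
      note e = ends[OF a]
      have "h (snd a) * \<phi> a \<in> carrier_mat (dims X (snd a)) (dims X (fst a))"
        using hC[OF e(2)] p by simp
      then show "g' (snd a) * \<phi> a * inv\<^bsub>mat_ring (dims X (fst a))\<^esub> (g' (fst a)) =
          h (snd a) * \<phi> a * inv\<^bsub>mat_ring (dims X (fst a))\<^esub> (h (fst a))"
        using c inv[OF e(1)] gi[OF e(2)] p hC[OF e(2)]
        by (simp add: ss mult_smult_assoc_mat[of _ "dims X (snd a)" "dims X (fst a)"]
            mult_smult_assoc_mat[of _ "dims X (snd a)" "dims X (snd a)"]
            mult_smult_distrib[of _ "dims X (snd a)" "dims X (fst a)"])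
    qed
  qed
  have "(SOME g. g \<in> K) \<in> K" by (rule someI[of "\<lambda>g. g \<in> K", OF g])
  then show ?thesis by (simp add: gauge_act_def * g)
qed

section \<open>Orientation, symplectic form and moment map\<close>

definition orientation :: "mckay_triple \<Rightarrow> (nat \<times> nat \<Rightarrow> int) \<Rightarrow> bool" where
  "orientation X \<epsilon> \<longleftrightarrow>
     (\<forall>a \<in> arrows X. \<epsilon> a \<in> {1, - 1} \<and> \<epsilon> (prod.swap a) = - \<epsilon> a)"

definition mat_tr :: "complex mat \<Rightarrow> complex" where
  "mat_tr A = (\<Sum>i < dim_row A. A $$ (i, i))"

definition symp_form ::
    "mckay_triple \<Rightarrow> (nat \<times> nat \<Rightarrow> int) \<Rightarrow> quiver_rep \<Rightarrow> quiver_rep \<Rightarrow> complex" where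
  "symp_form X \<epsilon> \<phi> \<psi> = (\<Sum>a \<in> arrows X. of_int (\<epsilon> a) * mat_tr (\<phi> a * \<psi> (prod.swap a)))"

definition moment_map ::
    "mckay_triple \<Rightarrow> (nat \<times> nat \<Rightarrow> int) \<Rightarrow> quiver_rep \<Rightarrow> nat \<Rightarrow> complex mat" where
  "moment_map X \<epsilon> \<phi> = (\<lambda>i \<in> verts X. mat (dims X i) (dims X i) (\<lambda>kl.
     \<Sum>a | a \<in> arrows X \<and> snd a = i. of_int (\<epsilon> a) * (\<phi> a * \<phi> (prod.swap a)) $$ kl))"

definition moment_zero_set :: "mckay_triple \<Rightarrow> (nat \<times> nat \<Rightarrow> int) \<Rightarrow> quiver_rep set" where
  "moment_zero_set X \<epsilon> =
     {\<phi> \<in> rep_space X. \<forall>i \<in> verts X. moment_map X \<epsilon> \<phi> i = 0\<^sub>m (dims X i) (dims X i)}"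

section \<open>Affine varieties and quotients\<close>

text \<open>An affine variety over the complex numbers is represented by its set of closed points
  together with its algebra of regular functions, viewed as functions on that set (extensional,
  i.e.\ \<open>undefined\<close> outside it).\<close>

record 'p variety =
  points :: "'p set"
  regular :: "('p \<Rightarrow> complex) set"

definition variety_iso :: "'p variety \<Rightarrow> 'q variety \<Rightarrow> ('p \<Rightarrow> 'q) \<Rightarrow> bool" where
  "variety_iso V W F \<longleftrightarrow> bij_betw F (points V) (points W) \<and>
     (\<forall>h \<in> regular W. restrict (h \<circ> F) (points V) \<in> regular V) \<and>
     (\<forall>f \<in> regular V. restrict (f \<circ> inv_into (points V) F) (points W) \<in> regular W)"

inductive_set generated_algebra :: "('p \<Rightarrow> complex) set \<Rightarrow> ('p \<Rightarrow> complex) set"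
  for B :: "('p \<Rightarrow> complex) set" where
  const: "(\<lambda>_. c) \<in> generated_algebra B"
| gen: "f \<in> B \<Longrightarrow> f \<in> generated_algebra B"
| add: "f \<in> generated_algebra B \<Longrightarrow> g \<in> generated_algebra B
    \<Longrightarrow> (\<lambda>p. f p + g p) \<in> generated_algebra B"
| mult: "f \<in> generated_algebra B \<Longrightarrow> g \<in> generated_algebra B
    \<Longrightarrow> (\<lambda>p. f p * g p) \<in> generated_algebra B"

text \<open>The subset \<open>Z\<close> of an affine space with coordinate functions \<open>B\<close>.\<close>

definition embedded_variety :: "('p \<Rightarrow> complex) set \<Rightarrow> 'p set \<Rightarrow> 'p variety" where
  "embedded_variety B Z = \<lparr>points = Z, regular = (\<lambda>f. restrict f Z) ` generated_algebra B\<rparr>"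

text \<open>The quotient of \<open>V\<close> by the fibres of \<open>\<pi>\<close>. Its regular functions correspond to the regular
  functions on \<open>V\<close> that are constant on these fibres.\<close>

definition quotient_variety :: "('p \<Rightarrow> 'q) \<Rightarrow> 'p variety \<Rightarrow> 'q variety" where
  "quotient_variety \<pi> V = \<lparr>points = \<pi> ` points V,
     regular = {h \<in> extensional (\<pi> ` points V). restrict (h \<circ> \<pi>) (points V) \<in> regular V}\<rparr>"

subsection \<open>The simple singularity \<open>\<complex>\<^sup>2 / \<Gamma>\<close>\<close>

definition plane :: "complex vec variety" where
  "plane = embedded_variety {\<lambda>v. v $ 0, \<lambda>v. v $ 1} (carrier_vec 2)"

definition plane_orbit :: "mckay_triple \<Rightarrow> complex vec \<Rightarrow> complex vec set" where
  "plane_orbit X = orbit (SU2\<lparr>carrier := small_grp X\<rparr>) (*\<^sub>v)"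

definition simple_singularity :: "mckay_triple \<Rightarrow> complex vec set variety" where
  "simple_singularity X = quotient_variety (plane_orbit X) plane"

text \<open>The coset \<open>\<Gamma> g\<close> sends the orbit \<open>\<Gamma> v\<close> to \<open>\<Gamma> g \<Gamma> v = \<Gamma> (g v)\<close>.\<close>

definition natural_act :: "complex mat set \<Rightarrow> complex vec set \<Rightarrow> complex vec set" where
  "natural_act \<omega> P = {g *\<^sub>v v |g v. g \<in> \<omega> \<and> v \<in> P}"

subsection \<open>The quotient \<open>\<mu>\<^bsup>-1\<^esup>(0) // G(\<Gamma>)\<close>\<close>

definition moment_zero_variety :: "mckay_triple \<Rightarrow> (nat \<times> nat \<Rightarrow> int) \<Rightarrow> quiver_rep variety" where
  "moment_zero_variety X \<epsilon> = embedded_variety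
     {\<lambda>\<phi>. \<phi> a $$ (k, l) |a k l. a \<in> arrows X \<and> k < dims X (snd a) \<and> l < dims X (fst a)}
     (moment_zero_set X \<epsilon>)"

definition invariant_funs ::
    "mckay_triple \<Rightarrow> (nat \<times> nat \<Rightarrow> int) \<Rightarrow> (quiver_rep \<Rightarrow> complex) set" where
  "invariant_funs X \<epsilon> = {f \<in> regular (moment_zero_variety X \<epsilon>).
     \<forall>K \<in> carrier (gauge_grp X). \<forall>\<phi> \<in> moment_zero_set X \<epsilon>. f (gauge_act X K \<phi>) = f \<phi>}"

text \<open>\<open>G(\<Gamma>)\<close> is reductive, so the closed points of the spectrum of the algebra of invariants are
  the classes of points of \<open>\<mu>\<^bsup>-1\<^esup>(0)\<close> that are not separated by the invariants.\<close>

definition git_class ::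
    "mckay_triple \<Rightarrow> (nat \<times> nat \<Rightarrow> int) \<Rightarrow> quiver_rep \<Rightarrow> quiver_rep set" where
  "git_class X \<epsilon> \<phi> =
     {\<psi> \<in> moment_zero_set X \<epsilon>. \<forall>f \<in> invariant_funs X \<epsilon>. f \<psi> = f \<phi>}"

definition git_quotient ::
    "mckay_triple \<Rightarrow> (nat \<times> nat \<Rightarrow> int) \<Rightarrow> quiver_rep set variety" where
  "git_quotient X \<epsilon> = quotient_variety (git_class X \<epsilon>) (moment_zero_variety X \<epsilon>)"

section \<open>Actions of \<open>\<Omega>\<close> on the representation space\<close>

definition lifted_action ::
    "mckay_triple \<Rightarrow> (complex mat set \<Rightarrow> nat \<Rightarrow> nat)
      \<Rightarrow> (complex mat set \<Rightarrow> quiver_rep \<Rightarrow> quiver_rep) \<Rightarrow> bool" where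
  "lifted_action X \<alpha> \<rho> \<longleftrightarrow> group_action (Omega X) (rep_space X) \<rho> \<and>
     (\<exists>c :: complex mat set \<Rightarrow> nat \<times> nat \<Rightarrow> complex.
        \<forall>\<omega> \<in> carrier (Omega X). \<forall>a \<in> arrows X.
          c \<omega> a \<noteq> 0 \<and>
          (map_prod (\<alpha> \<omega>) (\<alpha> \<omega>) a = a \<longrightarrow> c \<omega> a = 1) \<and>
          (\<forall>\<phi> \<in> rep_space X. \<rho> \<omega> \<phi> (map_prod (\<alpha> \<omega>) (\<alpha> \<omega>) a) = c \<omega> a \<cdot>\<^sub>m \<phi> a))"

definition symplectic_action ::
    "mckay_triple \<Rightarrow> (nat \<times> nat \<Rightarrow> int)
      \<Rightarrow> (complex mat set \<Rightarrow> quiver_rep \<Rightarrow> quiver_rep) \<Rightarrow> bool" where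
  "symplectic_action X \<epsilon> \<rho> \<longleftrightarrow>
     (\<forall>\<omega> \<in> carrier (Omega X). \<forall>\<phi> \<in> rep_space X. \<forall>\<psi> \<in> rep_space X.
        symp_form X \<epsilon> (\<rho> \<omega> \<phi>) (\<rho> \<omega> \<psi>) = symp_form X \<epsilon> \<phi> \<psi>)"

text \<open>The last equation also makes the induced action on the quotient well defined, as \<open>F\<close> is
  injective.\<close>

definition induces_natural_action ::
    "mckay_triple \<Rightarrow> (nat \<times> nat \<Rightarrow> int)
      \<Rightarrow> (complex mat set \<Rightarrow> quiver_rep \<Rightarrow> quiver_rep) \<Rightarrow> bool" where
  "induces_natural_action X \<epsilon> \<rho> \<longleftrightarrow>
     (\<exists>F. variety_iso (git_quotient X \<epsilon>) (simple_singularity X) F \<and>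
        (\<forall>\<omega> \<in> carrier (Omega X). \<forall>\<phi> \<in> moment_zero_set X \<epsilon>.
           \<rho> \<omega> \<phi> \<in> moment_zero_set X \<epsilon> \<and>
           F (git_class X \<epsilon> (\<rho> \<omega> \<phi>)) = natural_act \<omega> (F (git_class X \<epsilon> \<phi>))))"

end

(* Let W be the space of families T = (T_i) of d_i x d_i matrices.
   A representation phi in the zero fibre of the moment map gives two operators X1, X2 on W, built
   from phi and from a fixed linear family of representations Phi(v), v in C^2 (the slice), and these
   operators commute.  A joint eigenvector with eigenvalue v is a morphism from Phi(v) to phi.
   If v is not zero, the translates under Gamma, which acts freely on C^2 - 0, give |Gamma| = dim W
   independent eigenvectors with distinct eigenvalues; they span W, so the morphism is invertible and
   phi is gauge equivalent to Phi(v).  If all joint eigenvalues vanish, then phi is nilpotent and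
   degenerates to 0.  Hence invariant functions are determined on the slice, and conversely a
   Gamma-invariant polynomial p extends to an invariant function by evaluating p at (X1, X2): this is
   the isomorphism of the quotient with C^2 / Gamma.  Finally Omega acts by permuting the arrows, all
   scalars being 1, and an element g of Gamma' sends Phi(v) to a gauge transform of the permuted
   Phi(g v); this only has to be checked for generators. *)

theory Submission
  imports Defs "HOL-Library.Function_Algebras"
begin

section \<open>Zero-padded matrices of size at most three\<close>

text \<open>On a slice point \<Phi>(v) with v nonzero, W becomes the space of functions on the orbit
  \<Gamma>v, and the two operators multiply by the coordinates. They commute on the whole zero fibre
  because contracting two consecutive slice arrows with the area form of the plane gives an
  intertwiner between irreducible representations of \<Gamma>: by Schur it vanishes except for a
  pair of opposite arrows, where it is a scalar, so the commutator is a multiple of the moment map.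
  The slices are explicit tables of such intertwiners. All scalars can be 1 because the orientation
  is chosen invariant under the diagram automorphisms. On the cycle the flip reverses arrows, so the
  signs change half way round, and the slice makes up for it by factors i. The isomorphism \<alpha>
  is given in advance: for \<Omega> of order two it is forced, for S3 the leaves of the slice are
  relabelled to fit it. The spaces at the vertices have dimension 1, 2 or 3; padding with zeros puts
  all matrices into one ring, where products carry no size conditions.\<close>

datatype m3 = M3 complex complex complex complex complex complex complex complex complex

fun ent :: "m3 \<Rightarrow> nat \<Rightarrow> nat \<Rightarrow> complex" where
  "ent (M3 a b c d e f g h i) k l =
     (if k = 0 then if l = 0 then a else if l = 1 then b else if l = 2 then c else 0
      else if k = 1 then if l = 0 then d else if l = 1 then e else if l = 2 then f else 0
      else if k = 2 then if l = 0 then g else if l = 1 then h else if l = 2 then i else 0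
      else 0)"

definition mk :: "(nat \<Rightarrow> nat \<Rightarrow> complex) \<Rightarrow> m3" where
  "mk f = M3 (f 0 0) (f 0 1) (f 0 2) (f 1 0) (f 1 1) (f 1 2) (f 2 0) (f 2 1) (f 2 2)"

lemma less_3_cases: "(k::nat) < 3 \<longleftrightarrow> k = 0 \<or> k = 1 \<or> k = 2"
  by auto

lemma ent_mk: "ent (mk f) k l = (if k < 3 \<and> l < 3 then f k l else 0)"
  by (auto simp: mk_def less_3_cases)

lemma ent_outside: "\<not> k < 3 \<or> \<not> l < 3 \<Longrightarrow> ent A k l = 0"
  by (cases A) auto

lemma m3_eqI:
  assumes "\<And>k l. k < 3 \<Longrightarrow> l < 3 \<Longrightarrow> ent A k l = ent B k l"
  shows "A = B"
proof -
  have "ent A 0 0 = ent B 0 0" "ent A 0 1 = ent B 0 1" "ent A 0 2 = ent B 0 2"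
    "ent A 1 0 = ent B 1 0" "ent A 1 1 = ent B 1 1" "ent A 1 2 = ent B 1 2"
    "ent A 2 0 = ent B 2 0" "ent A 2 1 = ent B 2 1" "ent A 2 2 = ent B 2 2"
    using assms by simp_all
  then show ?thesis by (cases A; cases B) simp
qed

lemma sum_less_3: "(\<Sum>m<(3::nat). f m) = f 0 + f 1 + (f 2 :: 'a::comm_monoid_add)"
  by (simp add: numeral_3_eq_3 numeral_2_eq_2 add.assoc)

instantiation m3 :: ring_1
begin
definition "0 = mk (\<lambda>k l. 0)"
definition "1 = mk (\<lambda>k l. if k = l then 1 else 0)"
definition "A + B = mk (\<lambda>k l. ent A k l + ent B k l)"
definition "A - B = mk (\<lambda>k l. ent A k l - ent B k l)"
definition "- A = mk (\<lambda>k l. - ent A k l)"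
definition "A * B = mk (\<lambda>k l. \<Sum>m<3. ent A k m * ent B m l)"

instance
proof
  fix a b c :: m3
  show "a * b * c = a * (b * c)"
    by (rule m3_eqI) (simp add: times_m3_def ent_mk sum_less_3 algebra_simps)
  show "a + b + c = a + (b + c)" "a + b = b + a" "0 + a = a" "- a + a = 0" "a - b = a + - b"
    by (rule m3_eqI; simp add: plus_m3_def minus_m3_def uminus_m3_def zero_m3_def ent_mk)+
  show "(a + b) * c = a * c + b * c" "a * (b + c) = a * b + a * c"
    by (rule m3_eqI; simp add: plus_m3_def times_m3_def ent_mk sum_less_3 algebra_simps)+
  show "1 * a = a" "a * 1 = a"
    by (rule m3_eqI; auto simp: one_m3_def times_m3_def ent_mk sum_less_3 less_3_cases)+
  show "(0::m3) \<noteq> 1"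
    by (simp add: zero_m3_def one_m3_def mk_def)
qed
end

lemma ent_simps [simp]:
  "ent 0 k l = 0" "ent (A + B) k l = ent A k l + ent B k l"
  "ent (A - B) k l = ent A k l - ent B k l" "ent (- A) k l = - ent A k l"
  by (auto simp: plus_m3_def minus_m3_def uminus_m3_def zero_m3_def ent_mk ent_outside)

lemma ent_mult: "ent (A * B) k l = (\<Sum>m<3. ent A k m * ent B m l)"
  by (auto simp: times_m3_def ent_mk ent_outside)

lemma ent_sum: "ent (sum f S) k l = (\<Sum>x\<in>S. ent (f x) k l)"
  by (induction S rule: infinite_finite_induct) simp_all

lemma M3_ops:
  "M3 a b c d e f g h i + M3 a' b' c' d' e' f' g' h' i' =
     M3 (a + a') (b + b') (c + c') (d + d') (e + e') (f + f') (g + g') (h + h') (i + i')"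
  "M3 a b c d e f g h i - M3 a' b' c' d' e' f' g' h' i' =
     M3 (a - a') (b - b') (c - c') (d - d') (e - e') (f - f') (g - g') (h - h') (i - i')"
  "- M3 a b c d e f g h i = M3 (- a) (- b) (- c) (- d) (- e) (- f) (- g) (- h) (- i)"
  "M3 a b c d e f g h i * M3 a' b' c' d' e' f' g' h' i' =
     M3 (a * a' + b * d' + c * g') (a * b' + b * e' + c * h') (a * c' + b * f' + c * i')
        (d * a' + e * d' + f * g') (d * b' + e * e' + f * h') (d * c' + e * f' + f * i')
        (g * a' + h * d' + i * g') (g * b' + h * e' + i * h') (g * c' + h * f' + i * i')"
  "0 = M3 0 0 0 0 0 0 0 0 0"
  by (simp_all add: plus_m3_def minus_m3_def uminus_m3_def times_m3_def zero_m3_def mk_def sum_less_3)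

text \<open>The full scalar matrix, not a padded one: it is central in \<open>m3\<close>, so scalars
  move freely through products of any shape.\<close>

definition sc :: "complex \<Rightarrow> m3" where
  "sc c = M3 c 0 0 0 c 0 0 0 c"

lemma ent_sc_mult [simp]: "ent (sc c * A) k l = c * ent A k l"
  by (cases A) (simp add: sc_def M3_ops)

lemma sc_simps: "sc 0 = 0" "sc 1 = 1" "sc (a + b) = sc a + sc b" "sc (a * b) = sc a * sc b"
  "sc (- a) = - sc a" "sc (a - b) = sc a - sc b"
  by (simp_all add: sc_def M3_ops one_m3_def mk_def)

lemma sc_commute: "A * sc c = sc c * A"
  by (cases A) (simp add: sc_def M3_ops)

lemma sc_commute_left: "A * (sc c * B) = sc c * (A * B)"
  by (metis mult.assoc sc_commute)

text \<open>The unit of the corner of n x n matrices. The conditions \<open>un n * A = A\<close> and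
  \<open>A * un m = A\<close> encode that \<open>A\<close> is an n x m matrix padded by
  zeros.\<close>

definition un :: "nat \<Rightarrow> m3" where
  "un n = mk (\<lambda>k l. if k = l \<and> k < n then 1 else 0)"

lemma un_M3: "un 0 = 0" "un (Suc 0) = M3 1 0 0 0 0 0 0 0 0" "un 2 = M3 1 0 0 0 1 0 0 0 0"
  "un 3 = M3 1 0 0 0 1 0 0 0 1"
  by (simp_all add: un_def mk_def M3_ops)

lemma ent_un: "ent (un n) k l = (if k = l \<and> k < n \<and> k < 3 then 1 else 0)"
  by (auto simp: un_def ent_mk)

lemma ent_un_left: "ent (un n * A) k l = (if k < n then ent A k l else 0)"
proof (cases "k < 3")
  case True
  have "ent (un n * A) k l = (\<Sum>m<3. (if m = k then if k < n then ent A k l else 0 else 0))"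
    unfolding ent_mult by (rule sum.cong) (use True in \<open>auto simp: ent_un\<close>)
  then show ?thesis using True by simp
next
  case False then show ?thesis by (simp add: ent_outside)
qed

lemma ent_un_right: "ent (A * un n) k l = (if l < n then ent A k l else 0)"
proof (cases "l < 3")
  case True
  have "ent (A * un n) k l = (\<Sum>m<3. (if m = l then if l < n then ent A k l else 0 else 0))"
    unfolding ent_mult by (rule sum.cong) (use True in \<open>auto simp: ent_un\<close>)
  then show ?thesis using True by simp
next
  case False then show ?thesis by (simp add: ent_outside)
qed

lemma un_idem: "un n * un n = un n"
  by (rule m3_eqI) (simp add: ent_un_left ent_un)

lemma un_left_iff: "un n * A = A \<longleftrightarrow> (\<forall>k\<ge>n. \<forall>l. ent A k l = 0)"
proof
  assume "un n * A = A"
  then show "\<forall>k\<ge>n. \<forall>l. ent A k l = 0" by (metis ent_un_left not_less)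
next
  assume "\<forall>k\<ge>n. \<forall>l. ent A k l = 0"
  then show "un n * A = A" by (intro m3_eqI) (auto simp: ent_un_left)
qed

lemma un_right_iff: "A * un n = A \<longleftrightarrow> (\<forall>l\<ge>n. \<forall>k. ent A k l = 0)"
proof
  assume "A * un n = A"
  then show "\<forall>l\<ge>n. \<forall>k. ent A k l = 0" by (metis ent_un_right not_less)
next
  assume "\<forall>l\<ge>n. \<forall>k. ent A k l = 0"
  then show "A * un n = A" by (intro m3_eqI) (auto simp: ent_un_right)
qed

definition of_mat :: "nat \<Rightarrow> nat \<Rightarrow> complex mat \<Rightarrow> m3" where
  "of_mat n m A = mk (\<lambda>k l. if k < n \<and> l < m then A $$ (k, l) else 0)"

definition to_mat :: "nat \<Rightarrow> nat \<Rightarrow> m3 \<Rightarrow> complex mat" where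
  "to_mat n m A = mat n m (\<lambda>(k, l). ent A k l)"

lemma to_mat_carrier [simp]: "to_mat n m A \<in> carrier_mat n m"
  by (simp add: to_mat_def)

lemma ent_of_mat:
  "n \<le> 3 \<Longrightarrow> m \<le> 3 \<Longrightarrow> ent (of_mat n m A) k l = (if k < n \<and> l < m then A $$ (k, l) else 0)"
  by (auto simp: of_mat_def ent_mk)

lemma to_mat_of_mat: "n \<le> 3 \<Longrightarrow> m \<le> 3 \<Longrightarrow> A \<in> carrier_mat n m \<Longrightarrow> to_mat n m (of_mat n m A) = A"
  by (rule eq_matI) (auto simp: to_mat_def ent_of_mat)

lemma of_mat_to_mat:
  "n \<le> 3 \<Longrightarrow> m \<le> 3 \<Longrightarrow> un n * A = A \<Longrightarrow> A * un m = A \<Longrightarrow> of_mat n m (to_mat n m A) = A"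
  unfolding un_left_iff un_right_iff by (rule m3_eqI) (auto simp: to_mat_def ent_of_mat)

lemma un_of_mat:
  assumes "n \<le> 3" "m \<le> 3"
  shows "un n * of_mat n m A = of_mat n m A" "of_mat n m A * un m = of_mat n m A"
  using assms by (auto simp: un_left_iff un_right_iff ent_of_mat)

lemma of_mat_mult:
  assumes "n \<le> 3" "m \<le> 3" "p \<le> 3" and A: "A \<in> carrier_mat n m" and B: "B \<in> carrier_mat m p"
  shows "of_mat n p (A * B) = of_mat n m A * of_mat m p B"
proof (rule m3_eqI)
  fix k l :: nat
  have "(\<Sum>i<3. ent (of_mat n m A) k i * ent (of_mat m p B) i l) =
      (\<Sum>i<m. ent (of_mat n m A) k i * ent (of_mat m p B) i l)"
    by (rule sum.mono_neutral_right) (use assms(1-3) in \<open>auto simp: ent_of_mat\<close>)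
  moreover have "(\<Sum>i<m. ent (of_mat n m A) k i * ent (of_mat m p B) i l) =
      (if k < n \<and> l < p then \<Sum>i<m. A $$ (k, i) * B $$ (i, l) else 0)"
    using assms(1-3) by (auto simp: ent_of_mat)
  ultimately show "ent (of_mat n p (A * B)) k l = ent (of_mat n m A * of_mat m p B) k l"
    using A B assms(1-3)
    by (auto simp: ent_of_mat ent_mult scalar_prod_def lessThan_atLeast0)
qed

lemma to_mat_mult:
  assumes "n \<le> 3" "m \<le> 3" "p \<le> 3" "un n * A = A" "A * un m = A" "un m * B = B" "B * un p = B"
  shows "to_mat n p (A * B) = to_mat n m A * to_mat m p B"
proof -
  have "of_mat n p (to_mat n m A * to_mat m p B) = A * B"
    using assms by (simp add: of_mat_mult[of n m p] of_mat_to_mat)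
  then have "to_mat n p (A * B) = to_mat n p (of_mat n p (to_mat n m A * to_mat m p B))"
    by simp
  also have "\<dots> = to_mat n m A * to_mat m p B"
    by (rule to_mat_of_mat) (use assms in \<open>auto intro: mult_carrier_mat[of _ n m]\<close>)
  finally show ?thesis .
qed

lemma to_mat_un: "n \<le> 3 \<Longrightarrow> to_mat n n (un n) = 1\<^sub>m n"
  by (rule eq_matI) (auto simp: to_mat_def ent_un)

lemma of_mat_one: "n \<le> 3 \<Longrightarrow> of_mat n n (1\<^sub>m n) = un n"
  by (rule m3_eqI) (auto simp: ent_of_mat ent_un)

text \<open>The corner cut out by \<open>un n\<close> is the ring of n x n matrices, where a
  one-sided inverse is two-sided.\<close>

lemma right_inverse_imp_left_inverse:
  assumes "n \<le> 3" "un n * A = A" "A * un n = A" "un n * B = B" "B * un n = B" "A * B = un n"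
  shows "B * A = un n"
proof -
  have "to_mat n n A * to_mat n n B = 1\<^sub>m n"
    using assms by (simp flip: to_mat_mult add: to_mat_un)
  then have "to_mat n n B * to_mat n n A = 1\<^sub>m n"
    by (rule mat_mult_left_right_inverse[rotated 2]) simp_all
  then have "to_mat n n (B * A) = 1\<^sub>m n"
    using assms by (simp add: to_mat_mult)
  moreover have "of_mat n n (to_mat n n (B * A)) = B * A"
    using assms(1,2,4) by (intro of_mat_to_mat) (simp_all add: assms(1,3-5) mult.assoc flip: mult.assoc[of _ B A])
  ultimately show ?thesis
    using of_mat_one assms(1) by simp
qed

section \<open>Commuting operators on a finite-dimensional space\<close>

locale complex_space = vector_space scale
  for scale :: "complex \<Rightarrow> 'b::ab_group_add \<Rightarrow> 'b" (infixr "*s" 75)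
begin

definition lin :: "('b \<Rightarrow> 'b) \<Rightarrow> bool" where
  "lin X \<longleftrightarrow> (\<forall>u v. X (u + v) = X u + X v) \<and> (\<forall>c u. X (c *s u) = c *s X u)"

lemma lin_zero: "lin X \<Longrightarrow> X 0 = 0"
  by (metis lin_def scale_zero_left)

lemma lin_sum: "lin X \<Longrightarrow> X (sum f S) = (\<Sum>x\<in>S. X (f x))"
  by (induction S rule: infinite_finite_induct) (simp_all add: lin_zero, simp add: lin_def)

lemma lin_scale: "lin X \<Longrightarrow> X (c *s u) = c *s X u"
  by (simp add: lin_def)

lemma funpow_lin: "lin X \<Longrightarrow> (X ^^ n) 0 = 0"
  by (induction n) (simp_all add: lin_zero)

definition poly_op :: "('b \<Rightarrow> 'b) \<Rightarrow> complex poly \<Rightarrow> 'b \<Rightarrow> 'b" where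
  "poly_op X q w = (\<Sum>k\<le>degree q. coeff q k *s (X ^^ k) w)"

lemma poly_op_eq: "degree q \<le> n \<Longrightarrow> poly_op X q w = (\<Sum>k\<le>n. coeff q k *s (X ^^ k) w)"
  unfolding poly_op_def by (rule sum.mono_neutral_left) (auto simp: coeff_eq_0)

lemma poly_op_linear_factor:
  assumes "lin X"
  shows "poly_op X ([:- c, 1:] * r) w = X (poly_op X r w) - c *s poly_op X r w"
proof -
  let ?n = "degree r"
  have deg: "degree ([:- c, 1:] * r) \<le> Suc ?n"
    by (rule order.trans[OF degree_mult_le]) simp
  have "poly_op X ([:- c, 1:] * r) w =
      (\<Sum>k\<le>Suc ?n. coeff (smult (- c) r + pCons 0 r) k *s (X ^^ k) w)"
    by (subst poly_op_eq[OF deg]) simp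
  also have "\<dots> = (\<Sum>k\<le>Suc ?n. (- c * coeff r k) *s (X ^^ k) w) +
      (\<Sum>k\<le>Suc ?n. coeff (pCons 0 r) k *s (X ^^ k) w)"
    by (simp only: coeff_add coeff_smult scale_left_distrib sum.distrib)
  also have "(\<Sum>k\<le>Suc ?n. (- c * coeff r k) *s (X ^^ k) w) = - (c *s poly_op X r w)"
    by (simp add: poly_op_def coeff_eq_0 scale_sum_right sum_negf)
  also have "(\<Sum>k\<le>Suc ?n. coeff (pCons 0 r) k *s (X ^^ k) w) = X (poly_op X r w)"
    unfolding sum.atMost_Suc_shift poly_op_def
    using assms by (simp add: lin_sum lin_scale)
  finally show ?thesis by simp
qed

text \<open>The N + 1 vectors w, X w, ..., X^N w lie in the span of at most N vectors, and a linear
  relation between them is a polynomial in X that kills w.\<close>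

lemma annihilating_poly:
  assumes t: "finite t" "card t \<le> N" and sp: "\<And>k. (X ^^ k) w \<in> span t"
  shows "\<exists>q. q \<noteq> 0 \<and> degree q \<le> N \<and> poly_op X q w = 0"
proof -
  let ?f = "\<lambda>k. (X ^^ k) w"
  have "\<exists>c. (\<exists>k\<le>N. c k \<noteq> 0) \<and> (\<Sum>k\<le>N. c k *s ?f k) = 0"
  \<comment> \<open>Dependence is a notion for sets, so a repetition among the powers is treated
    apart: it yields the relation t^i - t^j.\<close>
  proof (cases "inj_on ?f {..N}")
    case True
    have "dependent (?f ` {..N})"
    proof (rule ccontr)
      assume "\<not> dependent (?f ` {..N})"
      then have "card (?f ` {..N}) \<le> card t"
        using independent_span_bound[OF t(1), of "?f ` {..N}"] sp by auto
      then show False using True t(2) by (simp add: card_image)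
    qed
    then obtain u v where "v \<in> ?f ` {..N}" "u v \<noteq> 0" "(\<Sum>v\<in>?f ` {..N}. u v *s v) = 0"
      using dependent_finite[of "?f ` {..N}"] by auto
    then show ?thesis
      by (intro exI[of _ "\<lambda>k. u (?f k)"]) (auto simp: sum.reindex[OF True])
  next
    case False
    then obtain i j where ij: "i \<le> N" "j \<le> N" "i \<noteq> j" "?f i = ?f j"
      by (auto simp: inj_on_def)
    define c :: "nat \<Rightarrow> complex" where "c = (\<lambda>k. (if k = i then 1 else 0) - (if k = j then 1 else 0))"
    have d: "(if k = m then 1 else 0) *s x = (if k = m then x else 0)" for k m :: nat and x
      by simp
    have "(\<Sum>k\<le>N. c k *s ?f k) = ?f i - ?f j"
      using ij(1,2) by (simp add: c_def scale_left_diff_distrib sum_subtractf d)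
    then show ?thesis
      using ij by (intro exI[of _ c]) (auto simp: c_def)
  qed
  then obtain c where c: "\<exists>k\<le>N. c k \<noteq> 0" "(\<Sum>k\<le>N. c k *s ?f k) = 0" by blast
  define q where "q = (\<Sum>k\<le>N. monom (c k) k)"
  have coeff: "coeff q k = (if k \<le> N then c k else 0)" for k
    by (simp add: q_def coeff_sum)
  have "q \<noteq> 0" using c(1) coeff by (metis coeff_0)
  moreover have deg: "degree q \<le> N" by (rule degree_le) (simp add: coeff)
  moreover have "poly_op X q w = 0"
    unfolding poly_op_eq[OF deg] using c(2) by (simp add: coeff)
  ultimately show ?thesis by blast
qed

text \<open>If q = (t - c) r has minimal degree among the nonzero polynomials killing w, then r(X) w
  is nonzero and X - c kills it. So every root of q is an eigenvalue, with an eigenvector of the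
  form r(X) w, which stays in any X-stable subspace containing w.\<close>

lemma minimal_annihilating_poly:
  assumes X: "lin X" and t: "finite t" "card t \<le> N" and sp: "\<And>k. (X ^^ k) w \<in> span t" and w: "w \<noteq> 0"
  obtains q where "degree q > 0" "degree q \<le> N" "poly_op X q w = 0"
    "\<And>c. poly q c = 0 \<Longrightarrow> \<exists>r. poly_op X r w \<noteq> 0 \<and> X (poly_op X r w) = c *s poly_op X r w"
proof -
  let ?P = "\<lambda>q. q \<noteq> 0 \<and> poly_op X q w = 0"
  obtain q0 where q0: "?P q0" "degree q0 \<le> N" using annihilating_poly[OF t, of X w] sp by blast
  define q where "q = arg_min degree ?P"
  have q: "?P q" and min: "\<And>p. ?P p \<Longrightarrow> degree q \<le> degree p"
    using arg_min_nat_lemma[of ?P q0 degree] q0 by (auto simp: q_def)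
  show thesis
  proof (rule that[of q])
    show "degree q > 0"
    proof (rule ccontr)
      assume "\<not> degree q > 0"
      then obtain a where a: "q = [:a:]" by (metis degree_eq_zeroE gr0I)
      then have "a *s w = 0" using q by (auto simp: poly_op_def)
      then have "a = 0" using w scale_eq_0_iff[of a w] by blast
      then show False using a q by simp
    qed
    show "degree q \<le> N" using min[OF q0(1)] q0(2) by simp
    show "poly_op X q w = 0" using q by simp
    fix c assume "poly q c = 0"
    then obtain r where r: "q = [:- c, 1:] * r"
      by (metis dvdE poly_eq_0_iff_dvd)
    then have "r \<noteq> 0" using q by auto
    then have "degree q = Suc (degree r)" by (simp add: r degree_mult_eq del: mult_pCons_left)
    then have "poly_op X r w \<noteq> 0" using min[of r] \<open>r \<noteq> 0\<close> by auto
    moreover have "X (poly_op X r w) - c *s poly_op X r w = 0"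
      using q by (simp add: r poly_op_linear_factor[OF X] del: mult_pCons_left)
    ultimately show "\<exists>r. poly_op X r w \<noteq> 0 \<and> X (poly_op X r w) = c *s poly_op X r w"
      by (intro exI[of _ r]) simp
  qed
qed

lemma funpow_closed: "(\<And>u. u \<in> U \<Longrightarrow> X u \<in> U) \<Longrightarrow> w \<in> U \<Longrightarrow> (X ^^ k) w \<in> U"
  by (induction k) auto

lemma poly_op_closed:
  assumes "subspace U" "\<And>u. u \<in> U \<Longrightarrow> X u \<in> U" "w \<in> U"
  shows "poly_op X r w \<in> U"
  unfolding poly_op_def
  using funpow_closed[of U X w] assms by (intro subspace_sum subspace_scale) auto

lemma exists_eigenvector:
  assumes X: "lin X" and U: "subspace U" "\<And>u. u \<in> U \<Longrightarrow> X u \<in> U" "U \<subseteq> span t" and t: "finite t"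
    and w: "w \<in> U" "w \<noteq> 0"
  shows "\<exists>c u. u \<in> U \<and> u \<noteq> 0 \<and> X u = c *s u"
proof -
  have "\<And>k. (X ^^ k) w \<in> span t" using funpow_closed[of U X w] U w by blast
  then obtain q where q: "degree q > 0"
    "\<And>c. poly q c = 0 \<Longrightarrow> \<exists>r. poly_op X r w \<noteq> 0 \<and> X (poly_op X r w) = c *s poly_op X r w"
    using minimal_annihilating_poly[OF X t le_refl _ w(2)] by metis
  obtain c where "poly q c = 0"
    using fundamental_theorem_of_algebra[of q] q(1) constant_degree[of q] by auto
  then show ?thesis using q(2) poly_op_closed[of U X, OF U(1,2) w(1)] by blast
qed

text \<open>Every root of the minimal polynomial of w is an eigenvalue, hence 0; over the complex
  numbers the polynomial is then a monomial a t^m with m \<le> N.\<close>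

lemma nilpotent_if_no_eigenvalue:
  assumes X: "lin X" and U: "subspace U" "\<And>u. u \<in> U \<Longrightarrow> X u \<in> U" "U \<subseteq> span t"
    and t: "finite t" "card t \<le> N"
    and ev: "\<And>c u. u \<in> U \<Longrightarrow> u \<noteq> 0 \<Longrightarrow> X u = c *s u \<Longrightarrow> c = 0" and w: "w \<in> U"
  shows "(X ^^ N) w = 0"
proof (cases "w = 0")
  case True then show ?thesis by (simp add: funpow_lin X)
next
  case False
  have "\<And>k. (X ^^ k) w \<in> span t" using funpow_closed[of U X w] U w by blast
  then obtain q where q: "degree q > 0" "degree q \<le> N" "poly_op X q w = 0"
    "\<And>c. poly q c = 0 \<Longrightarrow> \<exists>r. poly_op X r w \<noteq> 0 \<and> X (poly_op X r w) = c *s poly_op X r w"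
    using minimal_annihilating_poly[OF X t _ False] by metis
  have root: "c = 0" if "poly q c = 0" for c
    using q(4)[OF that] ev poly_op_closed[of U X, OF U(1,2) w] by blast
  have "q \<noteq> 0" using q(1) by auto
  then obtain r where r: "q = [:0, 1:] ^ order 0 q * r" "\<not> [:0, 1:] dvd r"
    using order_decomp[of q 0] by auto
  have "constant (poly r)"
  proof (rule ccontr)
    assume "\<not> constant (poly r)"
    then obtain c where c: "poly r c = 0" using fundamental_theorem_of_algebra by blast
    then have "poly q c = 0" by (subst r) simp
    then have "c = 0" by (rule root)
    then show False using c r(2) by (simp add: poly_eq_0_iff_dvd)
  qed
  then obtain a where a: "r = [:a:]" using constant_degree[of r] by (metis degree_eq_zeroE)
  let ?m = "order 0 q"
  have "a \<noteq> 0" using \<open>q \<noteq> 0\<close> r a by auto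
  have qm: "q = monom a ?m"
    by (subst r(1)) (simp add: a monom_altdef)
  then have dm: "degree q = ?m" using \<open>a \<noteq> 0\<close> by (metis degree_monom_eq)
  have cf: "coeff q k = (if k = ?m then a else 0)" for k
    using arg_cong[OF qm, of "\<lambda>p. coeff p k"] by (simp only: coeff_monom) auto
  have "poly_op X q w = (\<Sum>k\<le>?m. (if k = ?m then a *s (X ^^ ?m) w else 0))"
    unfolding poly_op_def dm by (intro sum.cong) (auto simp: cf)
  then have "a *s (X ^^ ?m) w = 0" using q(3) by simp
  then have "(X ^^ ?m) w = 0" using \<open>a \<noteq> 0\<close> by simp
  moreover have "N = (N - ?m) + ?m" using q(2) dm by simp
  ultimately show ?thesis by (metis comp_apply funpow_add funpow_lin[OF X])
qed

text \<open>Applying X - a_k and Y - b_k to a relation removes the term k and multiplies the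
  coefficient i by a_i - a_k and b_i - b_k respectively; one of these two numbers is
  nonzero.\<close>

lemma joint_eigenvector_coeffs:
  assumes X: "lin X" "lin Y" and fin: "finite I"
    and e: "\<And>i. i \<in> I \<Longrightarrow> e i \<noteq> 0 \<and> X (e i) = a i *s e i \<and> Y (e i) = b i *s e i"
    and d: "\<And>i j. i \<in> I \<Longrightarrow> j \<in> I \<Longrightarrow> i \<noteq> j \<Longrightarrow> a i \<noteq> a j \<or> b i \<noteq> b j"
    and s: "(\<Sum>i\<in>I. c i *s e i) = 0" and i: "i \<in> I"
  shows "c i = 0"
  using fin e d s i
proof (induction I arbitrary: c i rule: finite_induct)
  case (insert k I)
  have rel: "(\<Sum>i\<in>I. (c i * (z i - z k)) *s e i) = 0"
    if Z: "lin Z" and ze: "\<And>i. i \<in> insert k I \<Longrightarrow> Z (e i) = z i *s e i" for Z z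
  proof -
    have "(\<Sum>i\<in>insert k I. (c i * (z i - z k)) *s e i) =
        Z (\<Sum>i\<in>insert k I. c i *s e i) - z k *s (\<Sum>i\<in>insert k I. c i *s e i)"
      unfolding lin_sum[OF Z] lin_scale[OF Z] scale_sum_right sum_subtractf[symmetric]
      by (rule sum.cong) (simp_all add: ze right_diff_distrib scale_left_diff_distrib mult.commute)
    then show ?thesis using insert.prems(3) insert.hyps by (simp add: lin_zero[OF Z])
  qed
  have z: "c i = 0" if i: "i \<in> I" for i
  proof -
    have "c i * (a i - a k) = 0"
      using rel[OF X(1), of a] insert.prems(1,2) i by (intro insert.IH[of "\<lambda>i. c i * (a i - a k)"]) auto
    moreover have "c i * (b i - b k) = 0"
      using rel[OF X(2), of b] insert.prems(1,2) i by (intro insert.IH[of "\<lambda>i. c i * (b i - b k)"]) auto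
    moreover have "a i \<noteq> a k \<or> b i \<noteq> b k"
      using insert.prems(2)[of i k] i insert.hyps by auto
    ultimately show ?thesis by auto
  qed
  then have "c k *s e k = 0" using insert.prems(3) insert.hyps by simp
  then have "c k = 0" using insert.prems(1)[of k] by simp
  then show ?case using z insert.prems(4) by auto
qed simp

text \<open>Joint eigenvectors with distinct pairs of eigenvalues are independent, and there are at
  least as many of them as elements in the spanning set \<open>t\<close>.\<close>

lemma joint_eigenvectors_span:
  assumes X: "lin X" "lin Y" and fin: "finite I"
    and e: "\<And>i. i \<in> I \<Longrightarrow> e i \<noteq> 0 \<and> X (e i) = a i *s e i \<and> Y (e i) = b i *s e i"
    and d: "\<And>i j. i \<in> I \<Longrightarrow> j \<in> I \<Longrightarrow> i \<noteq> j \<Longrightarrow> a i \<noteq> a j \<or> b i \<noteq> b j"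
    and t: "finite t" "e ` I \<subseteq> span t" "card t \<le> card I" and u: "u \<in> span t"
  shows "\<exists>c. u = (\<Sum>i\<in>I. c i *s e i)"
proof -
  note coeffs = joint_eigenvector_coeffs[where e = e and a = a and b = b, OF X fin]
  have inj: "inj_on e I"
  proof (rule inj_onI, rule ccontr)
    fix i j assume ij: "i \<in> I" "j \<in> I" "e i = e j" "i \<noteq> j"
    then have "(a i - a j) *s e i = 0" "(b i - b j) *s e i = 0"
      using e[OF ij(1)] e[OF ij(2)] by (auto simp: scale_left_diff_distrib)
    then show False using d[OF ij(1,2,4)] e[OF ij(1)] by auto
  qed
  have ind: "independent (e ` I)"
  proof
    assume "dependent (e ` I)"
    then obtain g v where g: "v \<in> e ` I" "g v \<noteq> 0" "(\<Sum>v\<in>e ` I. g v *s v) = 0"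
      using dependent_finite[of "e ` I"] fin by auto
    have "(\<Sum>i\<in>I. g (e i) *s e i) = 0"
      using g(3) by (simp add: sum.reindex[OF inj])
    obtain i where i: "i \<in> I" "v = e i" using g(1) by blast
    have "g (e i) = 0"
      using e d \<open>(\<Sum>i\<in>I. g (e i) *s e i) = 0\<close> i(1) by (rule coeffs)
    then show False using g(2) i by simp
  qed
  have "u \<in> span (e ` I)"
  proof (rule ccontr)
    assume n: "u \<notin> span (e ` I)"
    then have "independent (insert u (e ` I))" using ind by (simp add: independent_insertI)
    then have "card (insert u (e ` I)) \<le> card t"
      using independent_span_bound[OF t(1)] t(2) u by auto
    moreover have "u \<notin> e ` I" using n span_base by blast
    ultimately show False using t(3) fin by (simp add: card_image[OF inj])
  qed
  then obtain g where "u = (\<Sum>v\<in>e ` I. g v *s v)"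
    using span_finite[of "e ` I"] fin by auto
  then show ?thesis by (intro exI[of _ "\<lambda>i. g (e i)"]) (simp add: sum.reindex[OF inj])
qed

end

section \<open>Quiver representations with zero-padded matrices\<close>

lemma arrows_ends:
  assumes "valid_triple X" "a \<in> arrows X"
  shows "fst a \<in> verts X" "snd a \<in> verts X"
  using assms by (cases X; auto simp: arrows_def)+

lemma swap_arrows: "a \<in> arrows X \<Longrightarrow> prod.swap a \<in> arrows X"
  by (cases a) (auto simp: arrows_def)

lemma finite_verts: "finite (verts X)"
  by (cases X) auto

lemma finite_arrows: "valid_triple X \<Longrightarrow> finite (arrows X)"
  using arrows_ends by (intro finite_subset[OF _ finite_cartesian_product[OF finite_verts finite_verts], of _ X X]) force

lemma dims_le_3: "dims X i \<le> 3"
  by (cases X) auto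

lemma dims_pos: "valid_triple X \<Longrightarrow> i \<in> verts X \<Longrightarrow> dims X i > 0"
  using dims_imaginary_root(2) by blast

text \<open>The inverse is relative to \<open>un\<close>: a padded matrix is in general singular in
  \<open>m3\<close>, so its partner \<open>h'\<close> is carried along as data.\<close>

definition gauge_pair :: "mckay_triple \<Rightarrow> (nat \<Rightarrow> m3) \<Rightarrow> (nat \<Rightarrow> m3) \<Rightarrow> bool" where
  "gauge_pair X h h' \<longleftrightarrow> (\<forall>i\<in>verts X.
     un (dims X i) * h i = h i \<and> h i * un (dims X i) = h i \<and>
     un (dims X i) * h' i = h' i \<and> h' i * un (dims X i) = h' i \<and>
     h i * h' i = un (dims X i) \<and> h' i * h i = un (dims X i))"

definition padded_rep :: "mckay_triple \<Rightarrow> (nat \<times> nat \<Rightarrow> m3) \<Rightarrow> bool" where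
  "padded_rep X \<psi> \<longleftrightarrow>
     (\<forall>a\<in>arrows X. un (dims X (snd a)) * \<psi> a = \<psi> a \<and> \<psi> a * un (dims X (fst a)) = \<psi> a)"

definition in_arrows :: "mckay_triple \<Rightarrow> nat \<Rightarrow> (nat \<times> nat) set" where
  "in_arrows X j = {a \<in> arrows X. snd a = j}"

definition moment_vanishes :: "mckay_triple \<Rightarrow> (nat \<times> nat \<Rightarrow> int) \<Rightarrow> (nat \<times> nat \<Rightarrow> m3) \<Rightarrow> bool" where
  "moment_vanishes X \<epsilon> \<psi> \<longleftrightarrow>
     (\<forall>j\<in>verts X. (\<Sum>a\<in>in_arrows X j. sc (of_int (\<epsilon> a)) * (\<psi> a * \<psi> (prod.swap a))) = 0)"

lemma gauge_pair_sym: "gauge_pair X h h' \<Longrightarrow> gauge_pair X h' h"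
  by (auto simp: gauge_pair_def)

lemma gauge_pair_mult:
  assumes g: "gauge_pair X g g'" and h: "gauge_pair X h h'"
  shows "gauge_pair X (\<lambda>i. g i * h i) (\<lambda>i. h' i * g' i)"
  unfolding gauge_pair_def
proof
  fix i assume i: "i \<in> verts X"
  let ?u = "un (dims X i)"
  have G: "?u * g i = g i" "g i * ?u = g i" "?u * g' i = g' i" "g' i * ?u = g' i" "g i * g' i = ?u" "g' i * g i = ?u"
    and H: "?u * h i = h i" "h i * ?u = h i" "?u * h' i = h' i" "h' i * ?u = h' i" "h i * h' i = ?u" "h' i * h i = ?u"
    using g h i unfolding gauge_pair_def by blast+
  have "(g i * h i) * (h' i * g' i) = g i * (h i * h' i) * g' i"
    by (simp only: mult.assoc)
  then have 1: "(g i * h i) * (h' i * g' i) = ?u" using G H by simp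
  have "(h' i * g' i) * (g i * h i) = h' i * (g' i * g i) * h i"
    by (simp only: mult.assoc)
  then have 2: "(h' i * g' i) * (g i * h i) = ?u" using G H by simp
  show "?u * (g i * h i) = g i * h i \<and> g i * h i * ?u = g i * h i \<and>
        ?u * (h' i * g' i) = h' i * g' i \<and> h' i * g' i * ?u = h' i * g' i \<and>
        g i * h i * (h' i * g' i) = ?u \<and> h' i * g' i * (g i * h i) = ?u"
    using 1 2 G H by (metis mult.assoc)
qed

definition pair_act :: "(nat \<Rightarrow> m3) \<Rightarrow> (nat \<Rightarrow> m3) \<Rightarrow> (nat \<times> nat \<Rightarrow> m3) \<Rightarrow> nat \<times> nat \<Rightarrow> m3" where
  "pair_act h h' \<psi> a = h (snd a) * \<psi> a * h' (fst a)"

text \<open>As for the echelon form, the proof runs through the rows.\<close>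

lemma right_ideal_idempotent:
  fixes K :: "m3 set"
  assumes zero: "0 \<in> K" and add: "\<And>U V. U \<in> K \<Longrightarrow> V \<in> K \<Longrightarrow> U - V \<in> K"
    and mult: "\<And>U V. U \<in> K \<Longrightarrow> U * V \<in> K"
  shows "\<exists>P\<in>K. \<forall>U\<in>K. P * U = U"
proof -
  define L where "L m = {U \<in> K. \<forall>k\<ge>m. \<forall>l. ent U k l = 0}" for m
  have "\<exists>P\<in>L m. \<forall>U\<in>L m. P * U = U" for m
  proof (induction m)
    case 0
    have "U = 0" if "U \<in> L 0" for U
      using that by (intro m3_eqI) (simp add: L_def)
    then show ?case using zero by (intro bexI[of _ 0]) (auto simp: L_def)
  next
    case (Suc m)
    then obtain P where P: "P \<in> L m" "\<And>U. U \<in> L m \<Longrightarrow> P * U = U" by blast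
    have PK: "P \<in> K" and P0: "ent P k l = 0" if "k \<ge> m" for k l
      using P(1) that by (auto simp: L_def)
    have PP: "P * P = P" using P by blast
    show ?case
    proof (cases "\<forall>U\<in>L (Suc m). \<forall>l. ent U m l = 0")
      case True
      then have "L (Suc m) \<subseteq> L m"
        by (auto simp: L_def) (metis le_antisym not_less_eq_eq)
      moreover have "L m \<subseteq> L (Suc m)" by (auto simp: L_def)
      ultimately show ?thesis using P by blast
    next
      case False
      then obtain U l where U: "U \<in> L (Suc m)" "ent U m l \<noteq> 0" by blast
      then have ml: "m < 3" "l < 3" using ent_outside by blast+
      \<comment> \<open>Right multiplication by \<open>M\<close> moves column \<open>l\<close> of
        \<open>U\<close> to column \<open>m\<close>, clears all other columns and normalizes the
        pivot in row \<open>m\<close> to 1.\<close>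
      define M where "M = mk (\<lambda>p q. if p = l \<and> q = m then 1 / ent U m l else 0)"
      have UM: "ent (U * M) p q = (if q = m then ent U p l / ent U m l else 0)" for p q
      proof -
        have "ent (U * M) p q = (\<Sum>i<3. if i = l then (if q = m then ent U p l / ent U m l else 0) else 0)"
          unfolding ent_mult by (rule sum.cong) (auto simp: M_def ent_mk ml)
        then show ?thesis using ml by simp
      qed
      \<comment> \<open>The correction achieves \<open>P * u = 0\<close> and leaves row
        \<open>m\<close> alone, because the rows of \<open>P\<close> from \<open>m\<close> on
        vanish. The next projection is \<open>P + u\<close>.\<close>
      define u where "u = U * M - P * (U * M)"
      have uK: "u \<in> K" using U mult add PK unfolding u_def by (metis (no_types, lifting) L_def mem_Collect_eq order_refl)
      have PU: "ent (P * Z) k q = 0" if "k \<ge> m" for k q Z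
        using P0 that by (simp add: ent_mult)
      have u0: "ent u k q = 0" if "k \<ge> Suc m" for k q
        using U(1) that by (simp add: u_def PU UM L_def)
      have um: "ent u m q = (if q = m then 1 else 0)" for q
        using U(2) by (simp add: u_def PU UM)
      have Pu: "P * u = 0"
        by (simp add: u_def right_diff_distrib flip: mult.assoc, simp add: PP)
      have "P + u \<in> L (Suc m)"
      proof -
        have "P - (0 - u) \<in> K" using PK uK zero add by blast
        then show ?thesis using u0 P0 by (simp add: L_def)
      qed
      moreover have "(P + u) * w = w" if w: "w \<in> L (Suc m)" for w
      proof -
        have row: "ent (u * w) m q = ent w m q" for q
        proof -
          have "ent (u * w) m q = (\<Sum>i<3. if i = m then ent w m q else 0)"
            unfolding ent_mult by (rule sum.cong) (auto simp: um)
          then show ?thesis using ml by simp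
        qed
        \<comment> \<open>Subtracting \<open>u * w\<close> clears row \<open>m\<close> of
          \<open>w\<close>, so the induction hypothesis applies to the rest.\<close>
        have "w - u * w \<in> L m"
        proof -
          have "ent (w - u * w) k q = 0" if "k \<ge> m" for k q
          proof (cases "k = m")
            case True then show ?thesis by (simp add: row)
          next
            case False
            then have "k \<ge> Suc m" using that by simp
            then show ?thesis using w by (simp add: ent_mult u0 L_def)
          qed
          moreover have "w - u * w \<in> K" using w uK mult add by (simp add: L_def)
          ultimately show ?thesis by (simp add: L_def)
        qed
        then have "P * (w - u * w) = w - u * w" by (rule P(2))
        then have "P * w = w - u * w"
          by (simp add: right_diff_distrib Pu flip: mult.assoc)
        then show ?thesis by (simp add: distrib_right)
      qed
      ultimately show ?thesis by blast
    qed
  qed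
  from this[of 3] obtain P where P: "P \<in> L 3" "\<And>U. U \<in> L 3 \<Longrightarrow> P * U = U" by blast
  have "L 3 = K" by (auto simp: L_def ent_outside)
  then show ?thesis using P by blast
qed

text \<open>The socle filtration: stage \<open>m\<close> consists of the matrices whose columns are
  killed by all paths of length \<open>m\<close> starting at \<open>i\<close>. Right ideals of
  matrices stand in for subspaces.\<close>

fun kernel_filtration :: "mckay_triple \<Rightarrow> (nat \<times> nat \<Rightarrow> m3) \<Rightarrow> nat \<Rightarrow> nat \<Rightarrow> m3 set" where
  "kernel_filtration X \<psi> 0 i = {0}"
| "kernel_filtration X \<psi> (Suc m) i = {U. un (dims X i) * U = U \<and>
     (\<forall>b\<in>arrows X. fst b = i \<longrightarrow> \<psi> b * U \<in> kernel_filtration X \<psi> m (snd b))}"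

lemma kernel_filtration_SucD:
  "U \<in> kernel_filtration X \<psi> (Suc m) i \<Longrightarrow> b \<in> arrows X \<Longrightarrow> fst b = i \<Longrightarrow>
     \<psi> b * U \<in> kernel_filtration X \<psi> m (snd b)"
  "U \<in> kernel_filtration X \<psi> (Suc m) i \<Longrightarrow> un (dims X i) * U = U"
  by simp_all

lemma kernel_filtration_SucI:
  "un (dims X i) * U = U \<Longrightarrow>
   (\<And>b. b \<in> arrows X \<Longrightarrow> fst b = i \<Longrightarrow> \<psi> b * U \<in> kernel_filtration X \<psi> m (snd b)) \<Longrightarrow>
   U \<in> kernel_filtration X \<psi> (Suc m) i"
  by simp

lemma kernel_filtration_right_ideal:
  "0 \<in> kernel_filtration X \<psi> m i"
  "U \<in> kernel_filtration X \<psi> m i \<Longrightarrow> V \<in> kernel_filtration X \<psi> m i \<Longrightarrow> U - V \<in> kernel_filtration X \<psi> m i"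
  "U \<in> kernel_filtration X \<psi> m i \<Longrightarrow> U * Z \<in> kernel_filtration X \<psi> m i"
proof (induction m arbitrary: i U V)
  case (Suc m)
  { case 1 show ?case using Suc(1) by simp }
  { case 2 then show ?case using Suc(2) by (simp add: right_diff_distrib) }
  { case 3 then show ?case using Suc(3) by (simp flip: mult.assoc) }
qed simp_all

lemma kernel_filtration_add:
  "U \<in> kernel_filtration X \<psi> m i \<Longrightarrow> V \<in> kernel_filtration X \<psi> m i \<Longrightarrow> U + V \<in> kernel_filtration X \<psi> m i"
  using kernel_filtration_right_ideal(2)[of U X \<psi> m i "0 - V"]
    kernel_filtration_right_ideal(2)[of 0 X \<psi> m i V] kernel_filtration_right_ideal(1)[of X \<psi> m i] by simp

lemma kernel_filtration_mono: "kernel_filtration X \<psi> m i \<subseteq> kernel_filtration X \<psi> (Suc m) i"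
proof (induction m arbitrary: i)
  case 0 show ?case by simp
next
  case (Suc m)
  show ?case
  proof
    fix U assume "U \<in> kernel_filtration X \<psi> (Suc m) i"
    then show "U \<in> kernel_filtration X \<psi> (Suc (Suc m)) i"
      using Suc by (simp only: kernel_filtration.simps(2) mem_Collect_eq) blast
  qed
qed

definition nilpotent_rep :: "mckay_triple \<Rightarrow> (nat \<times> nat \<Rightarrow> m3) \<Rightarrow> nat \<Rightarrow> bool" where
  "nilpotent_rep X \<psi> m \<longleftrightarrow> (\<forall>i\<in>verts X. un (dims X i) \<in> kernel_filtration X \<psi> m i)"

lemma nilpotent_rep_1:
  assumes "valid_triple X" "padded_rep X \<psi>" "nilpotent_rep X \<psi> 1" "a \<in> arrows X"
  shows "\<psi> a = 0"
proof -
  have "un (dims X (fst a)) \<in> kernel_filtration X \<psi> 1 (fst a)"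
    using assms arrows_ends(1) by (auto simp: nilpotent_rep_def)
  then have "\<psi> a * un (dims X (fst a)) = 0" using assms(4) by auto
  then show ?thesis using assms(2,4) by (simp add: padded_rep_def)
qed

text \<open>\<open>P i\<close> projects onto the common kernel of the arrows leaving
  \<open>i\<close>, the first stage of the filtration. It is the idempotent of
  \<open>right_ideal_idempotent\<close>, cut down by \<open>un\<close> on the right.\<close>

lemma kernel_idempotents:
  fixes \<psi> :: "nat \<times> nat \<Rightarrow> m3"
  obtains P where
    "\<And>i. un (dims X i) * P i = P i" "\<And>i. P i * un (dims X i) = P i" "\<And>i. P i * P i = P i"
    "\<And>b. b \<in> arrows X \<Longrightarrow> \<psi> b * P (fst b) = 0"
    "\<And>i U. U \<in> kernel_filtration X \<psi> 1 i \<Longrightarrow> P i * U = U"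
proof -
  have "\<exists>P. un (dims X i) * P = P \<and> P * un (dims X i) = P \<and> P * P = P \<and>
      (\<forall>b\<in>arrows X. fst b = i \<longrightarrow> \<psi> b * P = 0) \<and> (\<forall>U\<in>kernel_filtration X \<psi> 1 i. P * U = U)" for i
  proof -
    let ?u = "un (dims X i)"
    obtain P where P: "P \<in> kernel_filtration X \<psi> 1 i" "\<And>U. U \<in> kernel_filtration X \<psi> 1 i \<Longrightarrow> P * U = U"
      using right_ideal_idempotent[of "kernel_filtration X \<psi> 1 i"] kernel_filtration_right_ideal by blast
    have uP: "?u * P = P" and "\<And>b. b \<in> arrows X \<Longrightarrow> fst b = i \<Longrightarrow> \<psi> b * P = 0"
      using P(1) by auto
    moreover have "P * ?u * U = U" if "U \<in> kernel_filtration X \<psi> 1 i" for U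
      using P(2)[OF that] that by (simp add: mult.assoc)
    moreover have "P * ?u * (P * ?u) = P * ?u"
    proof -
      have "P * ?u * (P * ?u) = P * (?u * P) * ?u" by (simp only: mult.assoc)
      then show ?thesis using uP P by simp
    qed
    ultimately show ?thesis
      by (intro exI[of _ "P * ?u"]) (simp add: mult.assoc[symmetric], simp add: mult.assoc un_idem)
  qed
  then obtain P where "\<forall>i. un (dims X i) * P i = P i \<and> P i * un (dims X i) = P i \<and> P i * P i = P i \<and>
      (\<forall>b\<in>arrows X. fst b = i \<longrightarrow> \<psi> b * P i = 0) \<and> (\<forall>U\<in>kernel_filtration X \<psi> 1 i. P i * U = U)"
    by metis
  then show thesis by (intro that[of P]) auto
qed

text \<open>One step of the degeneration of a nilpotent representation to zero: the part of \<open>\<psi>\<close> that maps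
  into the common kernels is scaled down by a one-parameter group of gauge transformations.\<close>

lemma nilpotent_degeneration:
  assumes X: "valid_triple X" and \<psi>: "padded_rep X \<psi>" "moment_vanishes X \<epsilon> \<psi>"
    and nil: "nilpotent_rep X \<psi> (Suc m)" and m: "m > 0"
  obtains \<psi>' \<beta> where "padded_rep X \<psi>'" "padded_rep X \<beta>" "moment_vanishes X \<epsilon> \<psi>'" "nilpotent_rep X \<psi>' m"
    "\<And>t. t \<noteq> 0 \<Longrightarrow> \<exists>h h'. gauge_pair X h h' \<and> (\<forall>a\<in>arrows X. pair_act h h' \<psi> a = \<psi>' a + sc t * \<beta> a)"
proof -
  obtain P where P: "\<And>i. un (dims X i) * P i = P i" "\<And>i. P i * un (dims X i) = P i" "\<And>i. P i * P i = P i"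
    "\<And>b. b \<in> arrows X \<Longrightarrow> \<psi> b * P (fst b) = 0"
    "\<And>i U. U \<in> kernel_filtration X \<psi> 1 i \<Longrightarrow> P i * U = U"
    using kernel_idempotents[of X \<psi>] by blast
  define \<beta> where "\<beta> b = P (snd b) * \<psi> b" for b
  define \<psi>' where "\<psi>' b = \<psi> b - \<beta> b" for b
  have rep: "un (dims X (snd a)) * \<psi> a = \<psi> a" "\<psi> a * un (dims X (fst a)) = \<psi> a" if "a \<in> arrows X" for a
    using \<psi>(1) that by (auto simp: padded_rep_def)
  have rep\<beta>: "padded_rep X \<beta>"
    unfolding padded_rep_def \<beta>_def by (simp add: rep mult.assoc) (simp add: P flip: mult.assoc)
  show thesis
  proof (rule that[of \<psi>' \<beta>])
    show "padded_rep X \<psi>'"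
      using rep\<beta> rep by (simp add: padded_rep_def \<psi>'_def left_diff_distrib right_diff_distrib)
    show "padded_rep X \<beta>" by (rule rep\<beta>)
    show "moment_vanishes X \<epsilon> \<psi>'"
      unfolding moment_vanishes_def
    proof
      fix j assume j: "j \<in> verts X"
      \<comment> \<open>Arrows vanish on the common kernels, so the projection between the two
        factors drops out and only the outer factor \<open>un - P\<close> remains.\<close>
      have "\<psi>' a * \<psi>' (prod.swap a) = (un (dims X j) - P j) * (\<psi> a * \<psi> (prod.swap a))"
        if "a \<in> in_arrows X j" for a
      proof -
        have a: "a \<in> arrows X" "snd a = j" using that by (auto simp: in_arrows_def)
        have "\<psi>' a * \<psi>' (prod.swap a) = (\<psi> a - P j * \<psi> a) * (\<psi> (prod.swap a) - P (fst a) * \<psi> (prod.swap a))"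
          by (simp add: \<psi>'_def \<beta>_def a)
        also have "\<dots> = (\<psi> a - P j * \<psi> a) * \<psi> (prod.swap a) -
            (\<psi> a * P (fst a) - P j * (\<psi> a * P (fst a))) * \<psi> (prod.swap a)"
          by (simp add: algebra_simps)
        also have "\<dots> = (un (dims X j) * \<psi> a - P j * \<psi> a) * \<psi> (prod.swap a)"
          using P(4)[OF a(1)] rep(1)[OF a(1)] a(2) by simp
        finally show ?thesis by (simp add: algebra_simps)
      qed
      then have "(\<Sum>a\<in>in_arrows X j. sc (of_int (\<epsilon> a)) * (\<psi>' a * \<psi>' (prod.swap a))) =
          (un (dims X j) - P j) * (\<Sum>a\<in>in_arrows X j. sc (of_int (\<epsilon> a)) * (\<psi> a * \<psi> (prod.swap a)))"
        by (simp add: sum_distrib_left sc_commute_left)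
      then show "(\<Sum>a\<in>in_arrows X j. sc (of_int (\<epsilon> a)) * (\<psi>' a * \<psi>' (prod.swap a))) = 0"
        using \<psi>(2) j by (simp add: moment_vanishes_def)
    qed
    \<comment> \<open>Passing to \<open>\<psi>'\<close> shortens the filtration by one stage: an
      arrow of \<open>\<psi>'\<close> kills what \<open>\<psi>\<close> maps into the common kernels,
      and the correction term \<open>P * (\<psi> b * U)\<close> is itself killed by every arrow of
      \<open>\<psi>'\<close>.\<close>
    have filt: "kernel_filtration X \<psi> (Suc (Suc k)) i \<subseteq> kernel_filtration X \<psi>' (Suc k) i" for k i
    proof (induction k arbitrary: i)
      case 0
      show ?case
      proof
        fix U assume U: "U \<in> kernel_filtration X \<psi> (Suc (Suc 0)) i"
        have "\<psi>' b * U = 0" if b: "b \<in> arrows X" "fst b = i" for b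
        proof -
          have "\<psi> b * U \<in> kernel_filtration X \<psi> 1 (snd b)"
            using kernel_filtration_SucD(1)[OF U b] by simp
          from P(5)[OF this] show ?thesis
            by (simp add: \<psi>'_def \<beta>_def left_diff_distrib mult.assoc)
        qed
        then show "U \<in> kernel_filtration X \<psi>' (Suc 0) i"
          by (intro kernel_filtration_SucI kernel_filtration_SucD(2)[OF U]) simp
      qed
    next
      case (Suc k)
      have kk: "kernel_filtration X \<psi>' (Suc 0) i \<subseteq> kernel_filtration X \<psi>' (Suc k) i" for i
        by (induction k) (blast, meson kernel_filtration_mono order_trans)
      show ?case
      proof
        fix U assume U: "U \<in> kernel_filtration X \<psi> (Suc (Suc (Suc k))) i"
        have "\<psi>' b * U \<in> kernel_filtration X \<psi>' (Suc k) (snd b)" if b: "b \<in> arrows X" "fst b = i" for b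
        proof -
          have "\<psi> b * U \<in> kernel_filtration X \<psi> (Suc (Suc k)) (snd b)"
            using kernel_filtration_SucD(1)[OF U b] .
          then have 1: "\<psi> b * U \<in> kernel_filtration X \<psi>' (Suc k) (snd b)" using Suc by blast
          have "\<psi>' c * (P (snd b) * (\<psi> b * U)) = 0" if c: "c \<in> arrows X" "fst c = snd b" for c
          proof -
            have "\<psi>' c * (P (snd b) * (\<psi> b * U)) =
                (\<psi> c * P (fst c)) * (\<psi> b * U) - P (snd c) * (\<psi> c * P (fst c)) * (\<psi> b * U)"
              using c by (simp add: \<psi>'_def \<beta>_def left_diff_distrib mult.assoc)
            then show ?thesis using P(4)[OF c(1)] by simp
          qed
          then have "P (snd b) * (\<psi> b * U) \<in> kernel_filtration X \<psi>' (Suc 0) (snd b)"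
            by (intro kernel_filtration_SucI) (simp_all add: P(1) flip: mult.assoc)
          then have "P (snd b) * (\<psi> b * U) \<in> kernel_filtration X \<psi>' (Suc k) (snd b)" using kk by blast
          from kernel_filtration_right_ideal(2)[OF 1 this] show ?thesis
            by (simp add: \<psi>'_def \<beta>_def left_diff_distrib mult.assoc)
        qed
        then show "U \<in> kernel_filtration X \<psi>' (Suc (Suc k)) i"
          by (rule kernel_filtration_SucI[OF kernel_filtration_SucD(2)[OF U]])
      qed
    qed
    obtain k where "m = Suc k" using m by (metis gr0_implies_Suc)
    then show "nilpotent_rep X \<psi>' m" using nil filt[of k] unfolding nilpotent_rep_def by blast
  next
    fix t :: complex assume t: "t \<noteq> 0"
    \<comment> \<open>Multiplication by \<open>t\<close> on the common kernel, the identity on its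
      complement. At the source of an arrow it has no effect, since the arrow vanishes on the
      kernel; at the target it scales exactly the part \<open>\<beta>\<close>.\<close>
    define h where "h t i = un (dims X i) - P i + sc t * P i" for t i
    have hmult: "h s i * h t i = h (s * t) i" for s t i
    proof -
      have "P i * (sc t * P i) = sc t * P i" "un (dims X i) * (sc t * P i) = sc t * P i"
        by (simp_all add: sc_commute_left P)
      then show ?thesis
        by (simp add: h_def distrib_left distrib_right left_diff_distrib right_diff_distrib mult.assoc
            P un_idem sc_simps)
    qed
    have h1: "h 1 i = un (dims X i)" for i by (simp add: h_def sc_simps)
    have hu: "un (dims X i) * h t i = h t i" "h t i * un (dims X i) = h t i" for i t
      unfolding h1[symmetric] hmult by simp_all
    have "gauge_pair X (h t) (h (1 / t))"
      using t by (simp add: gauge_pair_def hu hmult h1)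
    moreover have "pair_act (h t) (h (1 / t)) \<psi> a = \<psi>' a + sc t * \<beta> a" if a: "a \<in> arrows X" for a
    proof -
      have "\<psi> a * h (1 / t) (fst a) = \<psi> a"
        using P(4)[OF a] rep(2)[OF a] by (simp add: h_def distrib_left right_diff_distrib sc_commute_left)
      then have "pair_act (h t) (h (1 / t)) \<psi> a = h t (snd a) * \<psi> a"
        by (simp add: pair_act_def mult.assoc)
      also have "\<dots> = \<psi>' a + sc t * \<beta> a"
        using rep(1)[OF a] by (simp add: h_def \<psi>'_def \<beta>_def distrib_right left_diff_distrib mult.assoc)
      finally show ?thesis .
    qed
    ultimately show "\<exists>h h'. gauge_pair X h h' \<and> (\<forall>a\<in>arrows X. pair_act h h' \<psi> a = \<psi>' a + sc t * \<beta> a)"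
      by blast
  qed
qed

section \<open>\<open>SU\<^sub>2\<close>\<close>

lemma mat22_simps [simp]:
  "dim_row (mat22 a b c d) = 2" "dim_col (mat22 a b c d) = 2" "mat22 a b c d \<in> carrier_mat 2 2"
  "mat22 a b c d $$ (0, 0) = a" "mat22 a b c d $$ (0, 1) = b"
  "mat22 a b c d $$ (1, 0) = c" "mat22 a b c d $$ (1, 1) = d"
  "mat22 a b c d $$ (0, Suc 0) = b" "mat22 a b c d $$ (Suc 0, 0) = c" "mat22 a b c d $$ (Suc 0, Suc 0) = d"
  by (auto simp: mat22_def mat_of_rows_list_def intro!: carrier_matI)

lemma less_2_cases': "(k::nat) < 2 \<longleftrightarrow> k = 0 \<or> k = 1"
  by auto

lemma mat22_eqI: "A \<in> carrier_mat 2 2 \<Longrightarrow> A = mat22 (A $$ (0, 0)) (A $$ (0, 1)) (A $$ (1, 0)) (A $$ (1, 1))"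
  by (rule eq_matI) (auto simp: less_2_cases')

lemma mat22_eq_iff: "mat22 a b c d = mat22 a' b' c' d' \<longleftrightarrow> a = a' \<and> b = b' \<and> c = c' \<and> d = d'"
  by (metis mat22_simps(4-7))

lemma sum_upto_2: "(\<Sum>i = 0..<(2::nat). f i) = f 0 + (f 1 :: complex)"
  by (simp add: numeral_2_eq_2)

lemma mat22_mult: "mat22 a b c d * mat22 a' b' c' d' =
    mat22 (a * a' + b * c') (a * b' + b * d') (c * a' + d * c') (c * b' + d * d')"
  by (rule eq_matI) (auto simp: less_2_cases' scalar_prod_def sum_upto_2)

lemma mat22_one: "1\<^sub>m 2 = mat22 1 0 0 1"
  by (rule eq_matI) (auto simp: less_2_cases')

lemma mat22_vec:
  assumes "v \<in> carrier_vec 2"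
  shows "(mat22 a b c d *\<^sub>v v) $ 0 = a * v $ 0 + b * v $ 1" "(mat22 a b c d *\<^sub>v v) $ 1 = c * v $ 0 + d * v $ 1"
    "(mat22 a b c d *\<^sub>v v) $ Suc 0 = c * v $ 0 + d * v $ 1"
  using assms by (auto simp: scalar_prod_def numeral_2_eq_2)

lemma mat22_adjoint: "mat_adjoint (mat22 a b c d) = mat22 (cnj a) (cnj c) (cnj b) (cnj d)"
  by (rule eq_matI) (auto simp: mat_adjoint_def less_2_cases' mat_of_rows_index)

lemma mat22_det: "det (mat22 a b c d) = a * d - b * c"
proof -
  have "det (mat22 a b c d) = (\<Sum>i<2. mat22 a b c d $$ (i, 0) * cofactor (mat22 a b c d) i 0)"
    by (rule laplace_expansion_column) auto
  then show ?thesis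
    by (simp add: numeral_2_eq_2 cofactor_def mat_delete_def det_single)
qed

text \<open>The inverse of a unitary matrix of determinant 1 is both its adjoint and its adjugate;
  comparing entries fixes the second row.\<close>

lemma SU2_iff:
  "A \<in> carrier SU2 \<longleftrightarrow> (\<exists>a b. A = mat22 a b (- cnj b) (cnj a) \<and> a * cnj a + b * cnj b = 1)"
proof
  assume "A \<in> carrier SU2"
  then have A: "A \<in> carrier_mat 2 2" "mat_adjoint A * A = 1\<^sub>m 2" "det A = 1"
    by (auto simp: SU2_def)
  obtain a b c d where abcd: "A = mat22 a b c d" using mat22_eqI[OF A(1)] by blast
  have e: "cnj a * a + cnj c * c = 1" "cnj a * b + cnj c * d = 0" "a * d - b * c = 1"
    using A(2,3) by (simp_all add: abcd mat22_adjoint mat22_mult mat22_one mat22_eq_iff mat22_det)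
  have "d = (cnj a * a + cnj c * c) * d" by (simp add: e)
  also have "\<dots> = cnj a * (a * d) + c * (cnj c * d)" by (simp add: algebra_simps)
  also have "cnj c * d = - (cnj a * b)" using e(2) by (simp add: eq_neg_iff_add_eq_0 add.commute)
  also have "cnj a * (a * d) + c * - (cnj a * b) = cnj a * (a * d - b * c)" by (simp add: algebra_simps)
  finally have d: "d = cnj a" using e(3) by simp
  have "b = (cnj a * a + cnj c * c) * b" by (simp add: e)
  also have "\<dots> = a * (cnj a * b) + cnj c * (b * c)" by (simp add: algebra_simps)
  also have "cnj a * b = - (cnj c * d)" using e(2) by (simp add: eq_neg_iff_add_eq_0)
  also have "a * - (cnj c * d) + cnj c * (b * c) = - cnj c * (a * d - b * c)" by (simp add: algebra_simps)
  finally have b: "b = - cnj c" using e(3) by simp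
  show "\<exists>a b. A = mat22 a b (- cnj b) (cnj a) \<and> a * cnj a + b * cnj b = 1"
    using e(1) by (intro exI[of _ a] exI[of _ b]) (simp add: abcd b d mult.commute)
next
  assume "\<exists>a b. A = mat22 a b (- cnj b) (cnj a) \<and> a * cnj a + b * cnj b = 1"
  then show "A \<in> carrier SU2"
    by (auto simp: SU2_def mat22_adjoint mat22_mult mat22_one mat22_eq_iff mat22_det algebra_simps)
qed

lemma SU2_simps [simp]: "x \<otimes>\<^bsub>SU2\<^esub> y = x * y" "\<one>\<^bsub>SU2\<^esub> = 1\<^sub>m 2"
  by (simp_all add: SU2_def)

lemma SU2_carrier_mat: "g \<in> carrier SU2 \<Longrightarrow> g \<in> carrier_mat 2 2"
  by (simp add: SU2_def)

lemma group_SU2: "group SU2"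
proof (rule groupI)
  fix x y assume "x \<in> carrier SU2" "y \<in> carrier SU2"
  then obtain a b a' b' where x: "x = mat22 a b (- cnj b) (cnj a)" "a * cnj a + b * cnj b = 1"
    and y: "y = mat22 a' b' (- cnj b') (cnj a')" "a' * cnj a' + b' * cnj b' = 1"
    by (auto simp: SU2_iff)
  have "(a * a' - b * cnj b') * cnj (a * a' - b * cnj b') + (a * b' + b * cnj a') * cnj (a * b' + b * cnj a') =
      (a * cnj a + b * cnj b) * (a' * cnj a' + b' * cnj b')"
    by (simp add: algebra_simps)
  then show "x \<otimes>\<^bsub>SU2\<^esub> y \<in> carrier SU2"
    unfolding SU2_iff
    by (intro exI[of _ "a * a' - b * cnj b'"] exI[of _ "a * b' + b * cnj a'"])
      (simp add: x y mat22_mult mat22_eq_iff)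
next
  show "\<one>\<^bsub>SU2\<^esub> \<in> carrier SU2" by (auto simp: SU2_iff mat22_one mat22_eq_iff)
next
  fix x y z assume "x \<in> carrier SU2" "y \<in> carrier SU2" "z \<in> carrier SU2"
  then show "x \<otimes>\<^bsub>SU2\<^esub> y \<otimes>\<^bsub>SU2\<^esub> z = x \<otimes>\<^bsub>SU2\<^esub> (y \<otimes>\<^bsub>SU2\<^esub> z)"
    by (simp add: assoc_mult_mat[of _ 2 2 _ 2 _ 2] SU2_carrier_mat)
next
  fix x assume x: "x \<in> carrier SU2"
  then show "\<one>\<^bsub>SU2\<^esub> \<otimes>\<^bsub>SU2\<^esub> x = x" using left_mult_one_mat[OF SU2_carrier_mat] by simp
  from x obtain a b where "x = mat22 a b (- cnj b) (cnj a)" "a * cnj a + b * cnj b = 1"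
    by (auto simp: SU2_iff)
  then show "\<exists>y\<in>carrier SU2. y \<otimes>\<^bsub>SU2\<^esub> x = \<one>\<^bsub>SU2\<^esub>"
    by (intro bexI[of _ "mat22 (cnj a) (- b) (cnj b) a"])
      (auto simp: SU2_iff mat22_mult mat22_one mat22_eq_iff algebra_simps)
qed

interpretation SU2: group SU2 by (rule group_SU2)

definition act_fst :: "complex mat \<Rightarrow> complex \<Rightarrow> complex \<Rightarrow> complex" where
  "act_fst g x y = g $$ (0, 0) * x + g $$ (0, 1) * y"

definition act_snd :: "complex mat \<Rightarrow> complex \<Rightarrow> complex \<Rightarrow> complex" where
  "act_snd g x y = g $$ (1, 0) * x + g $$ (1, 1) * y"

text \<open>The difference of two elements again has rows (p, q) and (- cnj q, cnj p), with
  determinant |p|^2 + |q|^2, so a nonzero vector in its kernel forces p = q = 0.\<close>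

lemma SU2_free_action:
  assumes "g \<in> carrier SU2" "h \<in> carrier SU2" "act_fst g x y = act_fst h x y" "act_snd g x y = act_snd h x y"
    and "x \<noteq> 0 \<or> y \<noteq> 0"
  shows "g = h"
proof -
  obtain a b where g: "g = mat22 a b (- cnj b) (cnj a)" using assms(1) by (auto simp: SU2_iff)
  obtain a' b' where h: "h = mat22 a' b' (- cnj b') (cnj a')" using assms(2) by (auto simp: SU2_iff)
  define p q where "p = a - a'" and "q = b - b'"
  have 1: "p * x + q * y = 0" "- cnj q * x + cnj p * y = 0"
    using assms(3,4) by (simp_all add: g h act_fst_def act_snd_def p_def q_def algebra_simps)
  have "(cnj p * p + cnj q * q) * x = cnj p * (p * x + q * y) - q * (- cnj q * x + cnj p * y)"
    "(cnj p * p + cnj q * q) * y = cnj q * (p * x + q * y) + p * (- cnj q * x + cnj p * y)"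
    by (simp_all add: algebra_simps)
  then have "cnj p * p + cnj q * q = 0" using 1 assms(5) by auto
  then have "complex_of_real ((cmod p)\<^sup>2 + (cmod q)\<^sup>2) = 0"
    by (simp only: of_real_add complex_norm_square mult.commute)
  then have "(cmod p)\<^sup>2 + (cmod q)\<^sup>2 = 0" by (simp only: of_real_eq_0_iff)
  then have "p = 0" "q = 0" by (simp_all add: sum_power2_eq_zero_iff)
  then show ?thesis by (simp add: g h p_def q_def)
qed

section \<open>Slices\<close>

definition slice_rep :: "(nat \<times> nat \<Rightarrow> m3) \<Rightarrow> (nat \<times> nat \<Rightarrow> m3) \<Rightarrow> complex \<Rightarrow> complex \<Rightarrow> nat \<times> nat \<Rightarrow> m3" where
  "slice_rep A1 A2 x y a = sc x * A1 a + sc y * A2 a"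

text \<open>One gauge pair has to serve all points (x, y). For \<open>\<sigma> = id\<close> it
  describes the action of \<open>g\<close> in the representations at the vertices.\<close>

definition twisted_equivariant ::
    "mckay_triple \<Rightarrow> (nat \<times> nat \<Rightarrow> m3) \<Rightarrow> (nat \<times> nat \<Rightarrow> m3) \<Rightarrow> complex mat \<Rightarrow> (nat \<Rightarrow> nat) \<Rightarrow> bool" where
  "twisted_equivariant X A1 A2 g \<sigma> \<longleftrightarrow> (\<exists>h h'. gauge_pair X h h' \<and> (\<forall>x y. \<forall>a\<in>arrows X.
     slice_rep A1 A2 (act_fst g x y) (act_snd g x y) (map_prod \<sigma> \<sigma> a) =
     pair_act h h' (slice_rep A1 A2 x y) a))"

text \<open>With \<open>C\<close> equal to \<open>C1\<close> or \<open>C2\<close> below, these are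
  the two operators of the overview: \<open>\<psi>\<close> acts on the left, the slice on the
  right.\<close>

definition path_op :: "mckay_triple \<Rightarrow> (nat \<times> nat \<Rightarrow> m3) \<Rightarrow> (nat \<times> nat \<Rightarrow> m3) \<Rightarrow> (nat \<Rightarrow> m3) \<Rightarrow> nat \<Rightarrow> m3" where
  "path_op X C \<psi> T = (\<lambda>j. if j \<in> verts X then \<Sum>a\<in>in_arrows X j. \<psi> a * T (fst a) * C a else 0)"

definition test_space :: "mckay_triple \<Rightarrow> (nat \<Rightarrow> m3) set" where
  "test_space X = {T. (\<forall>i\<in>verts X. un (dims X i) * T i = T i \<and> T i * un (dims X i) = T i) \<and>
     (\<forall>i. i \<notin> verts X \<longrightarrow> T i = 0)}"

section \<open>The space W of families of matrices and its dimension\<close>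

interpretation fv: complex_space "\<lambda>c (T :: nat \<Rightarrow> m3) i. sc c * T i"
  by unfold_locales (simp_all add: fun_eq_iff distrib_left distrib_right sc_simps mult.assoc)

lemma lin_path_op: "fv.lin (path_op X C \<psi>)"
  unfolding fv.lin_def
  by (auto simp: path_op_def fun_eq_iff distrib_left distrib_right sum.distrib sum_distrib_left
      sc_commute_left mult.assoc)

lemma subspace_test_space: "fv.subspace (test_space X)"
  unfolding fv.subspace_def
  by (auto simp: test_space_def distrib_left distrib_right sc_commute_left mult.assoc)

lemma finite_in_arrows: "valid_triple X \<Longrightarrow> finite (in_arrows X j)"
  by (simp add: in_arrows_def finite_arrows)

text \<open>The matrix units of the blocks. Their number, the sum of the squares of the dimensions,
  is to be matched by elements of \<Gamma> in \<open>translates_span\<close>.\<close>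

definition elem_basis :: "mckay_triple \<Rightarrow> (nat \<Rightarrow> m3) set" where
  "elem_basis X = (\<lambda>(i, k, l) j. if j = i then mk (\<lambda>p q. if p = k \<and> q = l then 1 else 0) else 0) `
     (SIGMA i:verts X. {..<dims X i} \<times> {..<dims X i})"

lemma finite_elem_basis: "finite (elem_basis X)"
  by (simp add: elem_basis_def finite_verts)

lemma card_elem_basis: "card (elem_basis X) \<le> (\<Sum>i\<in>verts X. (dims X i)\<^sup>2)"
proof -
  have "card (elem_basis X) \<le> card (SIGMA i:verts X. {..<dims X i} \<times> {..<dims X i})"
    unfolding elem_basis_def by (rule card_image_le) (simp add: finite_verts)
  then show ?thesis by (simp add: finite_verts card_cartesian_product power2_eq_square)
qed

lemma test_space_span: "test_space X \<subseteq> fv.span (elem_basis X)"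
proof
  fix T assume T: "T \<in> test_space X"
  define E where "E i k l = (\<lambda>j. if j = i then mk (\<lambda>p q. if p = k \<and> q = l then 1 else 0) else 0)" for i k l :: nat
  let ?S = "SIGMA i:verts X. {..<dims X i} \<times> {..<dims X i}"
  have "T = (\<Sum>(i, k, l)\<in>?S. (\<lambda>j. sc (ent (T i) k l) * E i k l j))"
  proof
    fix j
    have "ent (T j) p q = ent ((\<Sum>(i, k, l)\<in>?S. (\<lambda>j. sc (ent (T i) k l) * E i k l j)) j) p q"
      if pq: "p < 3" "q < 3" for p q
    proof -
      have "ent ((\<Sum>(i, k, l)\<in>?S. (\<lambda>j. sc (ent (T i) k l) * E i k l j)) j) p q =
          (\<Sum>s\<in>?S. ent (case s of (i, k, l) \<Rightarrow> sc (ent (T i) k l) * E i k l j) p q)"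
      proof -
        have "(\<Sum>s\<in>S. f s) j = (\<Sum>s\<in>S. f s j)" for S and f :: "nat \<times> nat \<times> nat \<Rightarrow> nat \<Rightarrow> m3"
          by (induction S rule: infinite_finite_induct) simp_all
        then show ?thesis by (simp add: ent_sum case_prod_beta)
      qed
      also have "\<dots> = (\<Sum>s\<in>?S. if s = (j, p, q) then ent (T j) p q else 0)"
        by (rule sum.cong) (auto simp: E_def ent_mk pq split: if_splits)
      also have "\<dots> = ent (T j) p q"
      proof (cases "(j, p, q) \<in> ?S")
        case False
        then have "ent (T j) p q = 0"
          using T unfolding test_space_def mem_Collect_eq un_left_iff un_right_iff
          by (cases "j \<in> verts X") auto
        then show ?thesis by (simp cong: if_cong)
      qed (simp add: finite_verts)
      finally show ?thesis by simp
    qed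
    then show "T j = (\<Sum>(i, k, l)\<in>?S. (\<lambda>j. sc (ent (T i) k l) * E i k l j)) j" by (rule m3_eqI)
  qed
  also have "\<dots> \<in> fv.span (elem_basis X)"
  proof (rule fv.span_sum)
    fix s assume s: "s \<in> ?S"
    obtain i k l where ikl: "s = (i, k, l)" by (cases s)
    have "E i k l \<in> elem_basis X" using s unfolding elem_basis_def E_def ikl by (force simp: image_iff)
    then have "(\<lambda>j. sc (ent (T i) k l) * E i k l j) \<in> fv.span (elem_basis X)"
      by (intro fv.span_scale fv.span_base)
    then show "(case s of (i, k, l) \<Rightarrow> \<lambda>j. sc (ent (T i) k l) * E i k l j) \<in> fv.span (elem_basis X)"
      by (simp add: ikl)
  qed
  finally show "T \<in> fv.span (elem_basis X)" .
qed

lemma sc_sc: "sc a * (sc b * M) = sc (a * b) * M"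
  by (simp add: sc_simps mult.assoc)

lemma scalars_pull: "(sc a * A) * (sc b * B) = sc (a * b) * (A * B)"
  by (simp only: mult.assoc sc_commute_left[of A] sc_sc)

text \<open>\<open>wedge\<close> and \<open>square\<close> are relations between intertwiners from
  C^2 tensor R_i to R_j, where R_i is the representation at vertex i. In \<open>wedge\<close> the
  antisymmetric contraction along a path of length two is an intertwiner of irreducibles: a scalar
  if the path returns to its start, 0 otherwise. \<open>square\<close> says that the moment map,
  polarized at slice points (x, y) and (x', y'), is (x y' - y x') d_j. The factors d_j fix the
  normalization, and \<open>large\<close> provides as many group elements as W has
  dimensions.\<close>

locale mckay_slice =
  fixes X :: mckay_triple and \<epsilon> :: "nat \<times> nat \<Rightarrow> int" and A1 A2 :: "nat \<times> nat \<Rightarrow> m3"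
  assumes valid: "valid_triple X"
    and orient: "orientation X \<epsilon>"
    and padded: "padded_rep X A1" "padded_rep X A2"
    and wedge: "\<And>a b. a \<in> arrows X \<Longrightarrow> b \<in> arrows X \<Longrightarrow> snd a = fst b \<Longrightarrow>
      A1 b * A2 a - A2 b * A1 a =
      (if b = prod.swap a then sc (of_int (\<epsilon> b) * of_nat (dims X (fst b))) * un (dims X (snd b)) else 0)"
    and square: "\<And>j. j \<in> verts X \<Longrightarrow>
      (\<Sum>a\<in>in_arrows X j. sc (of_int (\<epsilon> a)) * (A1 a * A2 (prod.swap a))) = sc (of_nat (dims X j)) * un (dims X j)"
      "\<And>j. j \<in> verts X \<Longrightarrow>
      (\<Sum>a\<in>in_arrows X j. sc (of_int (\<epsilon> a)) * (A2 a * A1 (prod.swap a))) = - (sc (of_nat (dims X j)) * un (dims X j))"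
      "\<And>j. j \<in> verts X \<Longrightarrow> (\<Sum>a\<in>in_arrows X j. sc (of_int (\<epsilon> a)) * (A1 a * A1 (prod.swap a))) = 0"
      "\<And>j. j \<in> verts X \<Longrightarrow> (\<Sum>a\<in>in_arrows X j. sc (of_int (\<epsilon> a)) * (A2 a * A2 (prod.swap a))) = 0"
    and small: "small_grp X \<subseteq> carrier SU2"
    and equivariant: "\<And>g. g \<in> small_grp X \<Longrightarrow> twisted_equivariant X A1 A2 g id"
    and large: "\<exists>S\<subseteq>small_grp X. finite S \<and> (\<Sum>i\<in>verts X. (dims X i)\<^sup>2) \<le> card S"
begin

abbreviation d where "d \<equiv> dims X"
abbreviation slice where "slice \<equiv> slice_rep A1 A2"

lemma fin [simp]: "finite (in_arrows X j)"
  by (rule finite_in_arrows[OF valid])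

lemma in_arrowsD: "a \<in> in_arrows X j \<Longrightarrow> a \<in> arrows X" "a \<in> in_arrows X j \<Longrightarrow> snd a = j"
  "a \<in> in_arrows X j \<Longrightarrow> fst a \<in> verts X"
  using arrows_ends(1)[OF valid] by (auto simp: in_arrows_def)

lemma pad: "a \<in> arrows X \<Longrightarrow> un (d (snd a)) * A1 a = A1 a" "a \<in> arrows X \<Longrightarrow> A1 a * un (d (fst a)) = A1 a"
  "a \<in> arrows X \<Longrightarrow> un (d (snd a)) * A2 a = A2 a" "a \<in> arrows X \<Longrightarrow> A2 a * un (d (fst a)) = A2 a"
  using padded by (auto simp: padded_rep_def)

lemma eps: "a \<in> arrows X \<Longrightarrow> of_int (\<epsilon> a) * of_int (\<epsilon> a) = (1::complex)"
  "a \<in> arrows X \<Longrightarrow> \<epsilon> (prod.swap a) = - \<epsilon> a"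
  using orient by (auto simp: orientation_def)

lemma d_nz: "i \<in> verts X \<Longrightarrow> (of_nat (d i) :: complex) \<noteq> 0"
  using dims_pos[OF valid, of i] by simp

lemma padded_slice: "padded_rep X (slice x y)"
  using pad by (simp add: padded_rep_def slice_rep_def distrib_left distrib_right sc_commute_left mult.assoc)

lemma moment_vanishes_slice: "moment_vanishes X \<epsilon> (slice x y)"
  unfolding moment_vanishes_def
proof
  fix j assume j: "j \<in> verts X"
  have "sc (of_int (\<epsilon> a)) * (slice x y a * slice x y (prod.swap a)) =
      sc (x * x) * (sc (of_int (\<epsilon> a)) * (A1 a * A1 (prod.swap a))) +
      sc (x * y) * (sc (of_int (\<epsilon> a)) * (A1 a * A2 (prod.swap a))) +
      sc (x * y) * (sc (of_int (\<epsilon> a)) * (A2 a * A1 (prod.swap a))) +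
      sc (y * y) * (sc (of_int (\<epsilon> a)) * (A2 a * A2 (prod.swap a)))" for a
    unfolding slice_rep_def
    by (simp only: distrib_left distrib_right scalars_pull sc_sc) (simp add: ac_simps)
  then show "(\<Sum>a\<in>in_arrows X j. sc (of_int (\<epsilon> a)) * (slice x y a * slice x y (prod.swap a))) = 0"
    by (simp add: sum.distrib square[OF j] flip: sum_distrib_left)
qed

text \<open>The frame dual to \<open>A1\<close> and \<open>A2\<close>: by \<open>square\<close>, the
  sums of \<open>slice x y a * C1 a\<close> and \<open>slice x y a * C2 a\<close> over the arrows
  into a vertex are the scalars x and y, and \<open>completeness\<close> is the dual
  relation.\<close>

definition C1 where "C1 a = sc (of_int (\<epsilon> a) / of_nat (d (snd a))) * A2 (prod.swap a)"
definition C2 where "C2 a = sc (- (of_int (\<epsilon> a) / of_nat (d (snd a)))) * A1 (prod.swap a)"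

text \<open>This is \<open>wedge\<close> for the opposite arrows. Only paths that turn back survive,
  which is why the commutator of the two operators involves nothing but the moment map.\<close>

lemma C_wedge:
  assumes a: "a \<in> arrows X" and b: "b \<in> arrows X" and ab: "snd a = fst b"
  shows "C2 a * C1 b - C1 a * C2 b =
    (if a = prod.swap b then sc (of_int (\<epsilon> b) / of_nat (d (snd b))) * un (d (snd b)) else 0)"
proof -
  let ?s = "\<lambda>a. of_int (\<epsilon> a) / of_nat (d (snd a)) :: complex"
  have "C2 a * C1 b - C1 a * C2 b = sc (- (?s a * ?s b)) *
      (A1 (prod.swap a) * A2 (prod.swap b) - A2 (prod.swap a) * A1 (prod.swap b))"
    unfolding C1_def C2_def scalars_pull by (simp add: sc_simps right_diff_distrib)
  also have "A1 (prod.swap a) * A2 (prod.swap b) - A2 (prod.swap a) * A1 (prod.swap b) =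
    (if prod.swap a = b then sc (of_int (\<epsilon> b) * of_nat (d (fst b))) * un (d (snd b)) else 0)"
    using wedge[of "prod.swap b" "prod.swap a"] swap_arrows[OF a] swap_arrows[OF b] ab by auto
  also have "sc (- (?s a * ?s b)) * \<dots> =
      (if a = prod.swap b then sc (?s b) * un (d (snd b)) else 0)"
  proof (cases "a = prod.swap b")
    case True
    have "- (?s a * ?s b) * (of_int (\<epsilon> b) * of_nat (d (fst b))) =
        of_int (\<epsilon> b) * of_int (\<epsilon> b) * of_int (\<epsilon> b) / of_nat (d (snd b)) * (of_nat (d (fst b)) / of_nat (d (fst b)))"
      by (simp add: True eps(2)[OF b])
    also have "\<dots> = ?s b"
      using eps(1)[OF b] d_nz[OF arrows_ends(1)[OF valid b]] by simp
    finally show ?thesis using True by (simp flip: mult.assoc sc_simps(4))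
  qed auto
  finally show ?thesis .
qed

lemma completeness:
  assumes a: "a \<in> arrows X" and b: "b \<in> arrows X" and ab: "snd a = snd b"
  shows "C1 a * A1 b + C2 a * A2 b = (if a = b then un (d (fst b)) else 0)"
proof -
  let ?s = "of_int (\<epsilon> a) / of_nat (d (snd a)) :: complex"
  have "C1 a * A1 b + C2 a * A2 b = sc (- ?s) * (A1 (prod.swap a) * A2 b - A2 (prod.swap a) * A1 b)"
    by (simp add: C1_def C2_def sc_simps right_diff_distrib mult.assoc)
  also have "A1 (prod.swap a) * A2 b - A2 (prod.swap a) * A1 b =
      (if a = b then sc (of_int (- \<epsilon> a) * of_nat (d (snd a))) * un (d (fst a)) else 0)"
    using wedge[OF b swap_arrows[OF a]] ab eps(2)[OF a] by (auto simp: prod_eq_iff)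
  also have "sc (- ?s) * \<dots> = (if a = b then un (d (fst b)) else 0)"
  proof (cases "a = b")
    case True
    have "- ?s * (of_int (- \<epsilon> a) * of_nat (d (snd a))) =
        (of_int (\<epsilon> a) * of_int (\<epsilon> a)) * (of_nat (d (snd a)) / of_nat (d (snd a)))" by simp
    also have "\<dots> = 1" using eps(1)[OF a] d_nz[OF arrows_ends(2)[OF valid a]] by simp
    finally have "sc (- ?s) * sc (of_int (- \<epsilon> a) * of_nat (d (snd a))) = 1"
      by (simp only: sc_simps(2) flip: sc_simps(4))
    then show ?thesis using True by (simp flip: mult.assoc)
  qed auto
  finally show ?thesis .
qed

lemma C_pad:
  assumes "a \<in> arrows X"
  shows "C1 a * un (d (snd a)) = C1 a" "C2 a * un (d (snd a)) = C2 a"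
  using pad[OF swap_arrows[OF assms]] by (simp_all add: C1_def C2_def mult.assoc)

abbreviation W where "W \<equiv> test_space X"

lemma W_pad: "T \<in> W \<Longrightarrow> i \<in> verts X \<Longrightarrow> un (d i) * T i = T i" "T \<in> W \<Longrightarrow> i \<in> verts X \<Longrightarrow> T i * un (d i) = T i"
  by (auto simp: test_space_def)

lemma rep_pad: "padded_rep X \<psi> \<Longrightarrow> a \<in> arrows X \<Longrightarrow> un (d (snd a)) * \<psi> a = \<psi> a"
  "padded_rep X \<psi> \<Longrightarrow> a \<in> arrows X \<Longrightarrow> \<psi> a * un (d (fst a)) = \<psi> a"
  by (auto simp: padded_rep_def)

lemma path_op_closed:
  assumes "padded_rep X \<psi>"
    and C: "\<And>a. a \<in> arrows X \<Longrightarrow> C a * un (d (snd a)) = C a"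
  shows "path_op X C \<psi> T \<in> W"
proof -
  have "un (d i) * path_op X C \<psi> T i = path_op X C \<psi> T i"
    "path_op X C \<psi> T i * un (d i) = path_op X C \<psi> T i" if i: "i \<in> verts X" for i
  proof -
    have "un (d i) * (\<psi> a * T (fst a) * C a) = \<psi> a * T (fst a) * C a"
      "\<psi> a * T (fst a) * C a * un (d i) = \<psi> a * T (fst a) * C a" if "a \<in> in_arrows X i" for a
      using rep_pad(1)[OF assms(1) in_arrowsD(1)[OF that]] C[OF in_arrowsD(1)[OF that]] in_arrowsD(2)[OF that]
      by (simp_all add: mult.assoc) (simp flip: mult.assoc)
    then show "un (d i) * path_op X C \<psi> T i = path_op X C \<psi> T i"
      "path_op X C \<psi> T i * un (d i) = path_op X C \<psi> T i"
      using i by (simp_all add: path_op_def sum_distrib_left sum_distrib_right)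
  qed
  then show ?thesis by (auto simp: test_space_def path_op_def)
qed

lemma op1_closed: "padded_rep X \<psi> \<Longrightarrow> path_op X C1 \<psi> T \<in> W"
  and op2_closed: "padded_rep X \<psi> \<Longrightarrow> path_op X C2 \<psi> T \<in> W"
  using path_op_closed C_pad by blast+

text \<open>By \<open>C_wedge\<close> the commutator at \<open>l\<close> is the moment map of
  \<open>\<psi>\<close> at \<open>l\<close>, divided by d_l and applied to
  \<open>T l\<close>.\<close>

lemma path_op_commute:
  assumes \<psi>: "padded_rep X \<psi>" "moment_vanishes X \<epsilon> \<psi>" and T: "T \<in> W"
  shows "path_op X C1 \<psi> (path_op X C2 \<psi> T) = path_op X C2 \<psi> (path_op X C1 \<psi> T)"
proof
  fix l
  show "path_op X C1 \<psi> (path_op X C2 \<psi> T) l = path_op X C2 \<psi> (path_op X C1 \<psi> T) l"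
  proof (cases "l \<in> verts X")
    case True
    have expand: "path_op X C \<psi> (path_op X C' \<psi> T) l =
        (\<Sum>b\<in>in_arrows X l. \<Sum>a\<in>in_arrows X (fst b). \<psi> b * \<psi> a * T (fst a) * (C' a * C b))" for C C'
      using True in_arrowsD(3)
      by (simp add: path_op_def sum_distrib_left sum_distrib_right mult.assoc cong: sum.cong)
    have "path_op X C1 \<psi> (path_op X C2 \<psi> T) l - path_op X C2 \<psi> (path_op X C1 \<psi> T) l =
        (\<Sum>b\<in>in_arrows X l. \<Sum>a\<in>in_arrows X (fst b). \<psi> b * \<psi> a * T (fst a) * (C2 a * C1 b - C1 a * C2 b))"
      unfolding expand by (simp only: sum_subtractf[symmetric] right_diff_distrib)
    also have "\<dots> = (\<Sum>b\<in>in_arrows X l. \<Sum>a\<in>in_arrows X (fst b).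
        if a = prod.swap b then sc (of_int (\<epsilon> b) / of_nat (d l)) * (\<psi> b * \<psi> (prod.swap b)) * T l else 0)"
    proof (intro sum.cong refl)
      fix b a assume b: "b \<in> in_arrows X l" and a: "a \<in> in_arrows X (fst b)"
      have "snd a = fst b" using in_arrowsD(2)[OF a] .
      then show "\<psi> b * \<psi> a * T (fst a) * (C2 a * C1 b - C1 a * C2 b) =
        (if a = prod.swap b then sc (of_int (\<epsilon> b) / of_nat (d l)) * (\<psi> b * \<psi> (prod.swap b)) * T l else 0)"
        using C_wedge[OF in_arrowsD(1)[OF a] in_arrowsD(1)[OF b]] in_arrowsD(2)[OF b] W_pad(2)[OF T True]
        by (auto simp: sc_commute_left mult.assoc)
    qed
    also have "\<dots> = (\<Sum>b\<in>in_arrows X l. sc (of_int (\<epsilon> b) / of_nat (d l)) * (\<psi> b * \<psi> (prod.swap b)) * T l)"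
    proof (rule sum.cong[OF refl])
      fix b assume "b \<in> in_arrows X l"
      then have "prod.swap b \<in> in_arrows X (fst b)" using swap_arrows by (auto simp: in_arrows_def)
      then show "(\<Sum>a\<in>in_arrows X (fst b). if a = prod.swap b then
          sc (of_int (\<epsilon> b) / of_nat (d l)) * (\<psi> b * \<psi> (prod.swap b)) * T l else 0) =
          sc (of_int (\<epsilon> b) / of_nat (d l)) * (\<psi> b * \<psi> (prod.swap b)) * T l"
        by simp
    qed
    also have "\<dots> = sc (1 / of_nat (d l)) * (\<Sum>b\<in>in_arrows X l. sc (of_int (\<epsilon> b)) * (\<psi> b * \<psi> (prod.swap b))) * T l"
      unfolding sum_distrib_left sum_distrib_right
      by (rule sum.cong) (simp_all add: mult.assoc[symmetric] flip: sc_simps(4))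
    also have "\<dots> = 0" using \<psi>(2) True by (simp add: moment_vanishes_def)
    finally show ?thesis by simp
  qed (simp add: path_op_def)
qed

text \<open>\<open>completeness\<close> collapses the sum over arrows to the single arrow
  \<open>b\<close>. So the two operators together determine \<open>\<psi>\<close>, which turns joint
  eigenvectors into morphisms and nilpotent operators into a nilpotent representation.\<close>

lemma path_op_recover:
  assumes \<psi>: "padded_rep X \<psi>" and b: "b \<in> arrows X" and T: "T \<in> W"
  shows "path_op X C1 \<psi> T (snd b) * A1 b + path_op X C2 \<psi> T (snd b) * A2 b = \<psi> b * T (fst b)"
proof -
  have v: "snd b \<in> verts X" and v': "fst b \<in> verts X" using arrows_ends[OF valid b] by auto
  have "path_op X C1 \<psi> T (snd b) * A1 b + path_op X C2 \<psi> T (snd b) * A2 b =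
      (\<Sum>a\<in>in_arrows X (snd b). \<psi> a * T (fst a) * (C1 a * A1 b + C2 a * A2 b))"
    using v by (simp add: path_op_def sum_distrib_right distrib_left mult.assoc sum.distrib)
  also have "\<dots> = (\<Sum>a\<in>in_arrows X (snd b). if a = b then \<psi> b * T (fst b) else 0)"
  proof (rule sum.cong[OF refl])
    fix a assume a: "a \<in> in_arrows X (snd b)"
    show "\<psi> a * T (fst a) * (C1 a * A1 b + C2 a * A2 b) = (if a = b then \<psi> b * T (fst b) else 0)"
      using completeness[OF in_arrowsD(1)[OF a] b] in_arrowsD(2)[OF a] W_pad(2)[OF T v']
      by (auto simp: mult.assoc)
  qed
  also have "\<dots> = \<psi> b * T (fst b)"
    using b by (simp add: in_arrows_def[of X "snd b"] finite_arrows[OF valid])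
  finally show ?thesis .
qed

section \<open>Morphisms from slice points and joint eigenvectors\<close>

definition slice_morphism :: "(nat \<times> nat \<Rightarrow> m3) \<Rightarrow> (nat \<Rightarrow> m3) \<Rightarrow> complex \<Rightarrow> complex \<Rightarrow> bool" where
  "slice_morphism \<psi> T x y \<longleftrightarrow> (\<forall>a\<in>arrows X. \<psi> a * T (fst a) = T (snd a) * slice x y a)"

definition joint_eigen :: "(nat \<times> nat \<Rightarrow> m3) \<Rightarrow> (nat \<Rightarrow> m3) \<Rightarrow> complex \<Rightarrow> complex \<Rightarrow> bool" where
  "joint_eigen \<psi> T x y \<longleftrightarrow>
     path_op X C1 \<psi> T = (\<lambda>i. sc x * T i) \<and> path_op X C2 \<psi> T = (\<lambda>i. sc y * T i)"

lemma joint_eigen_imp_morphism: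
  assumes \<psi>: "padded_rep X \<psi>" and T: "T \<in> W" and e: "joint_eigen \<psi> T x y"
  shows "slice_morphism \<psi> T x y"
  unfolding slice_morphism_def
proof
  fix b assume b: "b \<in> arrows X"
  show "\<psi> b * T (fst b) = T (snd b) * slice x y b"
    using path_op_recover[OF \<psi> b T] e
    by (simp add: joint_eigen_def slice_rep_def distrib_left sc_commute_left mult.assoc)
qed

text \<open>A morphism carries the arrows of \<open>\<psi>\<close> to slice arrows on the right of
  \<open>T\<close>; there \<open>square\<close> evaluates the sums against \<open>C1\<close> and
  \<open>C2\<close> to x and y.\<close>

lemma morphism_imp_joint_eigen:
  assumes T: "T \<in> W" and m: "slice_morphism \<psi> T x y"
  shows "joint_eigen \<psi> T x y"
proof -
  have "path_op X C1 \<psi> T j = sc x * T j \<and> path_op X C2 \<psi> T j = sc y * T j" for j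
  proof (cases "j \<in> verts X")
    case True
    have rw: "\<psi> a * T (fst a) * C a = T j * (slice x y a * C a)" if "a \<in> in_arrows X j" for a C
      using m in_arrowsD[OF that] by (simp add: slice_morphism_def mult.assoc)
    have red: "path_op X C \<psi> T j = T j * (\<Sum>a\<in>in_arrows X j. slice x y a * C a)" for C
      using True rw by (simp add: path_op_def sum_distrib_left)
    have c1: "slice x y a * C1 a = sc (x / of_nat (d j)) * (sc (of_int (\<epsilon> a)) * (A1 a * A2 (prod.swap a))) +
        sc (y / of_nat (d j)) * (sc (of_int (\<epsilon> a)) * (A2 a * A2 (prod.swap a)))" if "a \<in> in_arrows X j" for a
      using in_arrowsD(2)[OF that]
      unfolding slice_rep_def C1_def
      by (simp only: distrib_right scalars_pull sc_sc) (simp add: ac_simps)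
    have c2: "slice x y a * C2 a = - (sc (x / of_nat (d j)) * (sc (of_int (\<epsilon> a)) * (A1 a * A1 (prod.swap a)))) -
        sc (y / of_nat (d j)) * (sc (of_int (\<epsilon> a)) * (A2 a * A1 (prod.swap a)))" if "a \<in> in_arrows X j" for a
      using in_arrowsD(2)[OF that]
      unfolding slice_rep_def C2_def
      by (simp only: distrib_right scalars_pull sc_sc) (simp add: ac_simps sc_simps(5))
    have "(\<Sum>a\<in>in_arrows X j. slice x y a * C1 a) = sc (x / of_nat (d j)) * (sc (of_nat (d j)) * un (d j))"
      by (simp add: c1 sum.distrib square[OF True] flip: sum_distrib_left)
    also have "\<dots> = sc x * un (d j)" using d_nz[OF True] by (simp flip: mult.assoc sc_simps(4))
    finally have 1: "(\<Sum>a\<in>in_arrows X j. slice x y a * C1 a) = sc x * un (d j)" .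
    have "(\<Sum>a\<in>in_arrows X j. slice x y a * C2 a) = sc (y / of_nat (d j)) * (sc (of_nat (d j)) * un (d j))"
      by (simp add: c2 sum_subtractf sum_negf square[OF True] flip: sum_distrib_left)
    also have "\<dots> = sc y * un (d j)" using d_nz[OF True] by (simp flip: mult.assoc sc_simps(4))
    finally have 2: "(\<Sum>a\<in>in_arrows X j. slice x y a * C2 a) = sc y * un (d j)" .
    show ?thesis unfolding red 1 2 using W_pad(2)[OF T True] by (simp add: sc_commute_left)
  next
    case False
    then show ?thesis using T by (simp add: path_op_def test_space_def)
  qed
  then show ?thesis by (auto simp: joint_eigen_def)
qed

text \<open>A nonzero morphism from the slice at \<open>v \<noteq> 0\<close> can be translated by \<open>\<Gamma>\<close> to the points of \<open>\<Gamma>v\<close>,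
  which gives as many independent joint eigenvectors as the test space has dimensions.\<close>

lemma translates_span:
  assumes \<psi>: "padded_rep X \<psi>" and T: "T \<in> W" "T \<noteq> 0" and m: "slice_morphism \<psi> T x y" and xy: "x \<noteq> 0 \<or> y \<noteq> 0"
  obtains S R where "finite S" "S \<subseteq> small_grp X"
    "\<And>g. g \<in> small_grp X \<Longrightarrow> R g \<in> W" "\<And>g. g \<in> small_grp X \<Longrightarrow> (\<lambda>i. T i * R g i) \<in> W"
    "\<And>g. g \<in> small_grp X \<Longrightarrow> (\<lambda>i. T i * R g i) \<noteq> 0"
    "\<And>g. g \<in> small_grp X \<Longrightarrow> slice_morphism \<psi> (\<lambda>i. T i * R g i) (act_fst g x y) (act_snd g x y)"
    "\<And>U. U \<in> W \<Longrightarrow> \<exists>c. U = (\<Sum>g\<in>S. (\<lambda>i. sc (c g) * (T i * R g i)))"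
proof -
  obtain S where S: "S \<subseteq> small_grp X" "finite S" "(\<Sum>i\<in>verts X. (d i)\<^sup>2) \<le> card S" using large by blast
  have "\<exists>h h'. gauge_pair X h h' \<and> (\<forall>a\<in>arrows X. slice (act_fst g x y) (act_snd g x y) a = pair_act h h' (slice x y) a)"
    if "g \<in> small_grp X" for g
    using equivariant[OF that, unfolded twisted_equivariant_def map_prod.id id_apply] by blast
  then obtain h h' where hh: "\<And>g. g \<in> small_grp X \<Longrightarrow> gauge_pair X (h g) (h' g)"
    "\<And>g a. g \<in> small_grp X \<Longrightarrow> a \<in> arrows X \<Longrightarrow> slice (act_fst g x y) (act_snd g x y) a = pair_act (h g) (h' g) (slice x y) a"
    by metis
  \<comment> \<open>By equivariance, composing \<open>T\<close> with \<open>h' g\<close> moves the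
    source of the morphism from v to g v. The value 0 outside the diagram keeps the family in
    \<open>W\<close>.\<close>
  define R where "R g i = (if i \<in> verts X then h' g i else 0)" for g i
  have RW: "R g \<in> W" if "g \<in> small_grp X" for g
    using hh(1)[OF that] by (auto simp: R_def test_space_def gauge_pair_def)
  have TRW: "(\<lambda>i. T i * R g i) \<in> W" if "g \<in> small_grp X" for g
    unfolding test_space_def using W_pad(1)[OF T(1)] W_pad(2)[OF RW[OF that]] T(1)
    by (auto simp: mult.assoc) (simp_all add: mult.assoc[symmetric] test_space_def)
  have mor: "slice_morphism \<psi> (\<lambda>i. T i * R g i) (act_fst g x y) (act_snd g x y)" if g: "g \<in> small_grp X" for g
    unfolding slice_morphism_def
  proof
    fix a assume a: "a \<in> arrows X"
    have v: "fst a \<in> verts X" "snd a \<in> verts X" using arrows_ends[OF valid a] by auto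
    have "\<psi> a * (T (fst a) * R g (fst a)) = T (snd a) * slice x y a * h' g (fst a)"
      using m a v by (simp add: slice_morphism_def R_def flip: mult.assoc)
    also have "\<dots> = T (snd a) * un (d (snd a)) * slice x y a * h' g (fst a)"
      by (simp add: W_pad(2)[OF T(1) v(2)])
    also have "un (d (snd a)) = h' g (snd a) * h g (snd a)"
      using hh(1)[OF g] v(2) by (simp add: gauge_pair_def)
    finally show "\<psi> a * (T (fst a) * R g (fst a)) = T (snd a) * R g (snd a) * slice (act_fst g x y) (act_snd g x y) a"
      using v by (simp add: hh(2)[OF g a] pair_act_def R_def mult.assoc)
  qed
  have nz: "(\<lambda>i. T i * R g i) \<noteq> 0" if g: "g \<in> small_grp X" for g
  proof
    assume z: "(\<lambda>i. T i * R g i) = 0"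
    have "T i = 0" for i
    proof (cases "i \<in> verts X")
      case True
      have "T i * h' g i = 0" using fun_cong[OF z, of i] True by (simp add: R_def)
      then have "T i * (h' g i * h g i) = 0" by (simp flip: mult.assoc)
      then show ?thesis using hh(1)[OF g] True W_pad(2)[OF T(1) True] by (simp add: gauge_pair_def)
    qed (use T in \<open>auto simp: test_space_def\<close>)
    then show False using T(2) by auto
  qed
  have span: "\<exists>c. U = (\<Sum>g\<in>S. (\<lambda>i. sc (c g) * (T i * R g i)))" if U: "U \<in> W" for U
  proof (rule fv.joint_eigenvectors_span[OF lin_path_op lin_path_op S(2), of _ X C1 \<psi> "\<lambda>g. act_fst g x y" X C2 \<psi> "\<lambda>g. act_snd g x y"
        "elem_basis X"])
    fix g assume "g \<in> S"
    then have g: "g \<in> small_grp X" using S(1) by blast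
    show "(\<lambda>i. T i * R g i) \<noteq> 0 \<and>
      path_op X C1 \<psi> (\<lambda>i. T i * R g i) = (\<lambda>i. sc (act_fst g x y) * (T i * R g i)) \<and>
      path_op X C2 \<psi> (\<lambda>i. T i * R g i) = (\<lambda>i. sc (act_snd g x y) * (T i * R g i))"
      using nz[OF g] morphism_imp_joint_eigen[OF TRW[OF g] mor[OF g]] by (simp add: joint_eigen_def)
  next
    fix g g' assume "g \<in> S" "g' \<in> S" "g \<noteq> g'"
    then show "act_fst g x y \<noteq> act_fst g' x y \<or> act_snd g x y \<noteq> act_snd g' x y"
      using SU2_free_action[of g g' x y] S(1) small xy by blast
  next
    show "(\<lambda>g i. T i * R g i) ` S \<subseteq> fv.span (elem_basis X)" using TRW S(1) test_space_span by blast
    show "card (elem_basis X) \<le> card S" using card_elem_basis S(3) le_trans by blast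
    show "U \<in> fv.span (elem_basis X)" using U test_space_span by blast
  qed (rule finite_elem_basis)
  show thesis by (rule that[OF S(2,1) RW TRW nz mor span])
qed

lemma identity_in_W: "(\<lambda>i. if i \<in> verts X then un (d i) else 0) \<in> W"
  by (auto simp: test_space_def un_idem)

lemma sum_fun_apply: "(\<Sum>s\<in>S. f s) j = (\<Sum>s\<in>S. f s j)" for f :: "'s \<Rightarrow> nat \<Rightarrow> m3"
  by (induction S rule: infinite_finite_induct) simp_all

text \<open>The identity family is a combination of the translates \<open>T i * R g i\<close>, so
  \<open>T\<close> has a right inverse \<open>Q\<close> at every vertex; as the blocks are square,
  it is two-sided.\<close>

lemma gauge_equivalent_to_slice:
  assumes \<psi>: "padded_rep X \<psi>" and T: "T \<in> W" "T \<noteq> 0" and m: "slice_morphism \<psi> T x y" and xy: "x \<noteq> 0 \<or> y \<noteq> 0"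
  shows "\<exists>h h'. gauge_pair X h h' \<and> (\<forall>a\<in>arrows X. \<psi> a = pair_act h h' (slice x y) a)"
proof -
  obtain S :: "complex mat set" and R where S: "finite S" "S \<subseteq> small_grp X" "\<And>g. g \<in> small_grp X \<Longrightarrow> R g \<in> W"
    "\<And>U. U \<in> W \<Longrightarrow> \<exists>c. U = (\<Sum>g\<in>S. (\<lambda>i. sc (c g) * (T i * R g i)))"
    by (rule translates_span[OF assms], rule that, assumption+)
  obtain c where c: "(\<lambda>i. if i \<in> verts X then un (d i) else 0) = (\<Sum>g\<in>S. (\<lambda>i. sc (c g) * (T i * R g i)))"
    using S(4)[OF identity_in_W] by blast
  define Q where "Q i = (\<Sum>g\<in>S. sc (c g) * R g i)" for i
  have TQ: "T i * Q i = un (d i)" if "i \<in> verts X" for i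
    using fun_cong[OF c, of i] that by (simp add: sum_fun_apply Q_def sum_distrib_left sc_commute_left)
  have QW: "un (d i) * Q i = Q i" "Q i * un (d i) = Q i" if "i \<in> verts X" for i
    using W_pad[OF S(3)[OF subsetD[OF S(2)]] that]
    by (simp_all add: Q_def sum_distrib_left sum_distrib_right sc_commute_left mult.assoc)
  have QT: "Q i * T i = un (d i)" if i: "i \<in> verts X" for i
    by (rule right_inverse_imp_left_inverse[OF dims_le_3 W_pad[OF T(1) i] QW[OF i] TQ[OF i]])
  have "gauge_pair X T Q"
    using W_pad[OF T(1)] QW TQ QT by (simp add: gauge_pair_def)
  moreover have "\<psi> a = pair_act T Q (slice x y) a" if a: "a \<in> arrows X" for a
  proof -
    have v: "fst a \<in> verts X" using arrows_ends[OF valid a] by auto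
    have "\<psi> a = \<psi> a * (T (fst a) * Q (fst a))" by (simp add: TQ[OF v] rep_pad(2)[OF \<psi> a])
    then show ?thesis using m a by (simp add: pair_act_def slice_morphism_def flip: mult.assoc)
  qed
  ultimately show ?thesis by blast
qed

lemma identity_slice_morphism:
  "slice_morphism (slice x y) (\<lambda>i. if i \<in> verts X then un (d i) else 0) x y"
  using padded_slice arrows_ends[OF valid] by (auto simp: slice_morphism_def padded_rep_def)

lemma identity_nz: "(\<lambda>i. if i \<in> verts X then un (d i) else 0) \<noteq> 0"
proof -
  have v: "0 \<in> verts X" using valid by (cases X) auto
  then have "ent (un (d 0)) 0 0 \<noteq> ent 0 0 0" using dims_pos[OF valid] by (simp add: ent_un)
  then have "un (d 0) \<noteq> 0" by metis
  then show ?thesis using v by (auto simp: fun_eq_iff)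
qed

text \<open>The translates of the identity at the slice point (1, 0) are joint eigenvectors with
  distinct eigenvalues. Those indexed by the finite set \<open>S\<close> already span W, so one more
  group element would contradict independence.\<close>

lemma finite_small: "finite (small_grp X)"
proof -
  let ?T = "\<lambda>i. if i \<in> verts X then un (d i) else 0"
  have "(1::complex) \<noteq> 0 \<or> (0::complex) \<noteq> 0" by simp
  note * = translates_span[OF padded_slice identity_in_W identity_nz identity_slice_morphism this]
  obtain S R where S: "finite S" "S \<subseteq> small_grp X"
    "\<And>g. g \<in> small_grp X \<Longrightarrow> (\<lambda>i. ?T i * R g i) \<in> W"
    "\<And>g. g \<in> small_grp X \<Longrightarrow> (\<lambda>i. ?T i * R g i) \<noteq> 0"
    "\<And>g. g \<in> small_grp X \<Longrightarrow> slice_morphism (slice 1 0) (\<lambda>i. ?T i * R g i) (act_fst g 1 0) (act_snd g 1 0)"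
    "\<And>U. U \<in> W \<Longrightarrow> \<exists>c. U = (\<Sum>g\<in>S. (\<lambda>i. sc (c g) * (?T i * R g i)))"
    by (rule *, rule that, assumption+)
  define e where "e g = (\<lambda>i. ?T i * R g i)" for g
  note S' = S(3-6)[folded e_def]
  have "small_grp X \<subseteq> S"
  proof (rule subsetI, rule ccontr)
    fix g assume g: "g \<in> small_grp X" "g \<notin> S"
    obtain c where c: "e g = (\<Sum>g\<in>S. (\<lambda>i. sc (c g) * e g i))"
      using S'(4)[OF S'(1)[OF g(1)]] by (auto simp: e_def)
    \<comment> \<open>The coefficient -1 turns the expansion of \<open>e g\<close> over
      \<open>S\<close> into a relation in which \<open>g\<close> really occurs.\<close>
    define c' where "c' k = (if k = g then -1 else c k)" for k
    have "c' g = 0"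
    proof (rule fv.joint_eigenvector_coeffs[OF lin_path_op lin_path_op, of "insert g S" e X C1 "slice 1 0"
          "\<lambda>g. act_fst g 1 0" X C2 "slice 1 0" "\<lambda>g. act_snd g 1 0"])
      fix k assume "k \<in> insert g S"
      then have k: "k \<in> small_grp X" using g S(2) by blast
      show "e k \<noteq> 0 \<and> path_op X C1 (slice 1 0) (e k) = (\<lambda>i. sc (act_fst k 1 0) * e k i) \<and>
          path_op X C2 (slice 1 0) (e k) = (\<lambda>i. sc (act_snd k 1 0) * e k i)"
        using S'(2)[OF k] morphism_imp_joint_eigen[OF S'(1,3)[OF k]] by (simp add: joint_eigen_def)
    next
      fix k l assume "k \<in> insert g S" "l \<in> insert g S" "k \<noteq> l"
      then show "act_fst k 1 0 \<noteq> act_fst l 1 0 \<or> act_snd k 1 0 \<noteq> act_snd l 1 0"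
        using SU2_free_action[of k l 1 0] g(1) S(2) small by auto
    next
      have "(\<Sum>k\<in>S. (\<lambda>i. sc (c' k) * e k i)) = (\<Sum>k\<in>S. (\<lambda>i. sc (c k) * e k i))"
        by (rule sum.cong) (use g(2) in \<open>auto simp: c'_def\<close>)
      moreover have "(\<lambda>i. sc (c' g) * e g i) = - e g"
        by (simp add: c'_def sc_simps fun_eq_iff)
      ultimately show "(\<Sum>k\<in>insert g S. (\<lambda>i. sc (c' k) * e k i)) = 0"
        using S(1) g(2) c by simp
    qed (use S(1) in auto)
    then show False by (simp add: c'_def)
  qed
  then show ?thesis using S(1) finite_subset by blast
qed

text \<open>By \<open>path_op_recover\<close> an arrow applied to T is a combination of the two
  operators applied to T, so paths of length m are governed by words of length m in the operators.
  These commute, and in a word of 2 N letters one of them occurs at least N times.\<close>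

lemma nilpotent_if_ops_nilpotent:
  assumes \<psi>: "padded_rep X \<psi>" "moment_vanishes X \<epsilon> \<psi>"
    and n: "\<And>T. T \<in> W \<Longrightarrow> (path_op X C1 \<psi> ^^ N) T = 0" "\<And>T. T \<in> W \<Longrightarrow> (path_op X C2 \<psi> ^^ N) T = 0"
  shows "nilpotent_rep X \<psi> (2 * N)"
proof -
  let ?P = "path_op X C1 \<psi>" and ?Q = "path_op X C2 \<psi>"
  have cl: "(?Q ^^ j) T \<in> W" "(?P ^^ j) T \<in> W" if "T \<in> W" for T j
    using that op1_closed[OF \<psi>(1)] op2_closed[OF \<psi>(1)] by (induction j) auto
  have comm: "(?Q ^^ j) (?P T) = ?P ((?Q ^^ j) T)" if "T \<in> W" for T j
    by (induction j) (simp_all add: path_op_commute[OF \<psi> cl(1)[OF that]])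
  have filt: "T i \<in> kernel_filtration X \<psi> m i"
    if "T \<in> W" "\<And>k l. k + l = m \<Longrightarrow> (?P ^^ k) ((?Q ^^ l) T) = 0" "i \<in> verts X" for m T i
    using that
  proof (induction m arbitrary: T i)
    case 0
    from 0(2)[of 0 0] show ?case by simp
  next
    case (Suc m)
    show ?case
    proof (rule kernel_filtration_SucI[OF W_pad(1)[OF Suc(2,4)]])
      fix b assume b: "b \<in> arrows X" "fst b = i"
      have v: "snd b \<in> verts X" using arrows_ends[OF valid b(1)] by auto
      have "?P T (snd b) \<in> kernel_filtration X \<psi> m (snd b)"
      proof (rule Suc(1)[OF op1_closed[OF \<psi>(1)] _ v])
        fix k l assume "k + l = m"
        then show "(?P ^^ k) ((?Q ^^ l) (?P T)) = 0"
          using Suc(3)[of "Suc k" l] comm[OF Suc(2), of l] by (simp add: funpow_swap1 zero_fun_def)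
      qed
      moreover have "?Q T (snd b) \<in> kernel_filtration X \<psi> m (snd b)"
      proof (rule Suc(1)[OF op2_closed[OF \<psi>(1)] _ v])
        fix k l assume "k + l = m"
        then show "(?P ^^ k) ((?Q ^^ l) (?Q T)) = 0"
          using Suc(3)[of k "Suc l"] by (simp add: funpow_swap1 zero_fun_def)
      qed
      ultimately have "?P T (snd b) * A1 b + ?Q T (snd b) * A2 b \<in> kernel_filtration X \<psi> m (snd b)"
        by (intro kernel_filtration_add kernel_filtration_right_ideal(3))
      then show "\<psi> b * T i \<in> kernel_filtration X \<psi> m (snd b)"
        using path_op_recover[OF \<psi>(1) b(1) Suc(2)] b(2) by simp
    qed
  qed
  have "(?P ^^ k) ((?Q ^^ l) T) = 0" if T: "T \<in> W" and kl: "k + l = 2 * N" for T k l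
  proof (cases "k \<ge> N")
    case True
    then have "(?P ^^ k) ((?Q ^^ l) T) = (?P ^^ (k - N)) ((?P ^^ N) ((?Q ^^ l) T))"
      by (metis comp_apply funpow_add le_add_diff_inverse2)
    then show ?thesis using n(1)[OF cl(1)[OF T]] by (simp add: fv.funpow_lin[OF lin_path_op])
  next
    case False
    then have "l = (l - N) + N" using kl by simp
    then have "(?Q ^^ l) T = (?Q ^^ (l - N)) ((?Q ^^ N) T)"
      by (metis comp_apply funpow_add)
    then show ?thesis using n(2)[OF T] by (simp add: fv.funpow_lin[OF lin_path_op])
  qed
  from filt[OF identity_in_W this[OF identity_in_W]]
  show ?thesis unfolding nilpotent_rep_def by force
qed

lemma moment_zero_dichotomy:
  assumes \<psi>: "padded_rep X \<psi>" "moment_vanishes X \<epsilon> \<psi>"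
  shows "(\<exists>x y h h'. gauge_pair X h h' \<and> (\<forall>a\<in>arrows X. \<psi> a = pair_act h h' (slice x y) a)) \<or>
    (\<exists>m. nilpotent_rep X \<psi> m)"
proof -
  let ?P = "path_op X C1 \<psi>" and ?Q = "path_op X C2 \<psi>"
  \<comment> \<open>A nonzero eigenvalue of either operator is enough: its eigenspace is stable
    under the other operator, which therefore has an eigenvector in it.\<close>
  have joint: "\<exists>T x y. T \<in> W \<and> T \<noteq> 0 \<and> joint_eigen \<psi> T x y \<and> (x \<noteq> 0 \<or> y \<noteq> 0)"
    if T: "T \<in> W" "T \<noteq> 0" "c \<noteq> 0" and Z: "Z T = (\<lambda>i. sc c * T i)"
      and cases: "Z = ?P \<and> Z' = ?Q \<or> Z = ?Q \<and> Z' = ?P" for T c Z Z'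
  proof -
    have Zs: "fv.lin Z" "fv.lin Z'" "\<And>T. Z' T \<in> W" "\<And>T. T \<in> W \<Longrightarrow> Z (Z' T) = Z' (Z T)"
      using cases lin_path_op op1_closed[OF \<psi>(1)] op2_closed[OF \<psi>(1)] path_op_commute[OF \<psi>] by auto
    define U where "U = {T \<in> W. Z T = (\<lambda>i. sc c * T i)}"
    have sub: "fv.subspace U"
    proof (rule fv.subspaceI)
      show "0 \<in> U"
        using fv.subspace_0[OF subspace_test_space[of X]] fv.lin_zero[OF Zs(1)]
        by (simp add: U_def zero_fun_def)
    next
      fix S T assume ST: "S \<in> U" "T \<in> U"
      have "Z (S + T) = Z S + Z T" using Zs(1) by (simp add: fv.lin_def)
      then show "S + T \<in> U"
        using ST fv.subspace_add[OF subspace_test_space[of X]]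
        by (simp add: U_def fun_eq_iff distrib_left)
    next
      fix k S assume S: "S \<in> U"
      have "Z (\<lambda>i. sc k * S i) = (\<lambda>i. sc k * Z S i)" using Zs(1) by (simp add: fv.lin_def)
      then show "(\<lambda>i. sc k * S i) \<in> U"
        using S fv.subspace_scale[OF subspace_test_space[of X]]
        by (simp add: U_def fun_eq_iff sc_sc mult.commute)
    qed
    have stable: "Z' T \<in> U" if "T \<in> U" for T
      using that Zs fv.lin_scale[OF Zs(2), of c T] by (auto simp: U_def)
    have "U \<subseteq> fv.span (elem_basis X)" using test_space_span by (auto simp: U_def)
    from fv.exists_eigenvector[OF Zs(2) sub stable this finite_elem_basis _ T(2)] T Z
    obtain c' T' where "T' \<in> U" "T' \<noteq> 0" "Z' T' = (\<lambda>i. sc c' * T' i)" by (auto simp: U_def)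
    then show ?thesis using cases T(3) by (auto simp: U_def joint_eigen_def)
  qed
  show ?thesis
  proof (cases "\<exists>T x y. T \<in> W \<and> T \<noteq> 0 \<and> joint_eigen \<psi> T x y \<and> (x \<noteq> 0 \<or> y \<noteq> 0)")
    case True
    then obtain T x y where "T \<in> W" "T \<noteq> 0" "joint_eigen \<psi> T x y" "x \<noteq> 0 \<or> y \<noteq> 0" by blast
    then show ?thesis
      using gauge_equivalent_to_slice[OF \<psi>(1) _ _ joint_eigen_imp_morphism[OF \<psi>(1)]] by blast
  next
    case False
    then have ev: "c = 0" if "T \<in> W" "T \<noteq> 0" "Z T = (\<lambda>i. sc c * T i)" "Z = ?P \<or> Z = ?Q" for T c Z
      using joint[of T c Z ?Q] joint[of T c Z ?P] that by blast
    have "(?P ^^ card (elem_basis X)) T = 0" "(?Q ^^ card (elem_basis X)) T = 0" if "T \<in> W" for T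
      by (rule fv.nilpotent_if_no_eigenvalue[OF lin_path_op subspace_test_space _ test_space_span finite_elem_basis le_refl _ that];
          use op1_closed[OF \<psi>(1)] op2_closed[OF \<psi>(1)] ev in blast)+
    then show ?thesis using nilpotent_if_ops_nilpotent[OF \<psi>] by blast
  qed
qed

end

section \<open>Comparison with quiver representations by matrices\<close>

definition lift_rep :: "mckay_triple \<Rightarrow> quiver_rep \<Rightarrow> nat \<times> nat \<Rightarrow> m3" where
  "lift_rep X \<phi> a = of_mat (dims X (snd a)) (dims X (fst a)) (\<phi> a)"

definition drop_rep :: "mckay_triple \<Rightarrow> (nat \<times> nat \<Rightarrow> m3) \<Rightarrow> quiver_rep" where
  "drop_rep X \<psi> = (\<lambda>a\<in>arrows X. to_mat (dims X (snd a)) (dims X (fst a)) (\<psi> a))"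

lemma padded_lift_rep: "padded_rep X (lift_rep X \<phi>)"
  by (simp add: padded_rep_def lift_rep_def un_of_mat dims_le_3)

lemma drop_rep_in_rep_space: "drop_rep X \<psi> \<in> rep_space X"
  by (simp add: rep_space_def drop_rep_def)

lemma lift_drop_rep: "padded_rep X \<psi> \<Longrightarrow> a \<in> arrows X \<Longrightarrow> lift_rep X (drop_rep X \<psi>) a = \<psi> a"
  by (simp add: lift_rep_def drop_rep_def padded_rep_def of_mat_to_mat dims_le_3)

lemma drop_rep_cong: "(\<And>a. a \<in> arrows X \<Longrightarrow> \<psi> a = \<psi>' a) \<Longrightarrow> drop_rep X \<psi> = drop_rep X \<psi>'"
  by (auto simp: drop_rep_def)

lemma rep_space_carrier: "\<phi> \<in> rep_space X \<Longrightarrow> a \<in> arrows X \<Longrightarrow> \<phi> a \<in> carrier_mat (dims X (snd a)) (dims X (fst a))"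
  by (auto simp: rep_space_def)

lemma drop_lift_rep:
  assumes "\<phi> \<in> rep_space X"
  shows "drop_rep X (lift_rep X \<phi>) = \<phi>"
proof
  fix a
  show "drop_rep X (lift_rep X \<phi>) a = \<phi> a"
  proof (cases "a \<in> arrows X")
    case True
    then show ?thesis using rep_space_carrier[OF assms True]
      by (simp add: drop_rep_def lift_rep_def to_mat_of_mat dims_le_3)
  next
    case False
    then show ?thesis using PiE_arb[OF assms[unfolded rep_space_def]] by (simp add: drop_rep_def)
  qed
qed

lemma rep_eqI:
  assumes "\<phi> \<in> rep_space X" "\<phi>' \<in> rep_space X" "\<And>a. a \<in> arrows X \<Longrightarrow> lift_rep X \<phi> a = lift_rep X \<phi>' a"
  shows "\<phi> = \<phi>'"
  using drop_rep_cong[of X "lift_rep X \<phi>" "lift_rep X \<phi>'"] assms by (simp add: drop_lift_rep)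

lemma moment_zero_set_iff:
  assumes \<phi>: "\<phi> \<in> rep_space X"
  shows "\<phi> \<in> moment_zero_set X \<epsilon> \<longleftrightarrow> moment_vanishes X \<epsilon> (lift_rep X \<phi>)"
proof -
  have "moment_map X \<epsilon> \<phi> i = 0\<^sub>m (dims X i) (dims X i) \<longleftrightarrow>
      (\<Sum>a\<in>in_arrows X i. sc (of_int (\<epsilon> a)) * (lift_rep X \<phi> a * lift_rep X \<phi> (prod.swap a))) = 0"
    if i: "i \<in> verts X" for i
  proof -
    let ?d = "dims X i"
    let ?M = "\<lambda>k l. \<Sum>a\<in>in_arrows X i. of_int (\<epsilon> a) * (\<phi> a * \<phi> (prod.swap a)) $$ (k, l)"
    have prod: "lift_rep X \<phi> a * lift_rep X \<phi> (prod.swap a) = of_mat ?d ?d (\<phi> a * \<phi> (prod.swap a))"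
      if "a \<in> in_arrows X i" for a
    proof -
      have a: "a \<in> arrows X" "snd a = i" using that by (auto simp: in_arrows_def)
      show ?thesis
        using rep_space_carrier[OF \<phi> a(1)] rep_space_carrier[OF \<phi> swap_arrows[OF a(1)]] a(2)
        by (simp add: lift_rep_def of_mat_mult[of _ "dims X (fst a)"] dims_le_3)
    qed
    have ent: "ent (\<Sum>a\<in>in_arrows X i. sc (of_int (\<epsilon> a)) * (lift_rep X \<phi> a * lift_rep X \<phi> (prod.swap a))) k l =
        (if k < ?d \<and> l < ?d then ?M k l else 0)" for k l
      by (auto simp: ent_sum prod ent_of_mat dims_le_3 intro!: sum.cong)
    have mm: "moment_map X \<epsilon> \<phi> i = mat ?d ?d (\<lambda>(k, l). ?M k l)"
      using i by (auto simp: moment_map_def in_arrows_def)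
    have "moment_map X \<epsilon> \<phi> i = 0\<^sub>m ?d ?d \<longleftrightarrow> (\<forall>k<?d. \<forall>l<?d. ?M k l = 0)"
      unfolding mm by (auto simp: mat_eq_iff)
    also have "\<dots> \<longleftrightarrow> (\<Sum>a\<in>in_arrows X i. sc (of_int (\<epsilon> a)) * (lift_rep X \<phi> a * lift_rep X \<phi> (prod.swap a))) = 0"
    proof
      assume "\<forall>k<?d. \<forall>l<?d. ?M k l = 0"
      then show "(\<Sum>a\<in>in_arrows X i. sc (of_int (\<epsilon> a)) * (lift_rep X \<phi> a * lift_rep X \<phi> (prod.swap a))) = 0"
        by (intro m3_eqI) (simp add: ent)
    next
      assume z: "(\<Sum>a\<in>in_arrows X i. sc (of_int (\<epsilon> a)) * (lift_rep X \<phi> a * lift_rep X \<phi> (prod.swap a))) = 0"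
      show "\<forall>k<?d. \<forall>l<?d. ?M k l = 0"
        using ent[unfolded z] by (metis ent_simps(1))
    qed
    finally show ?thesis .
  qed
  then show ?thesis using \<phi> by (auto simp: moment_zero_set_def moment_vanishes_def)
qed

definition gauge_eq :: "mckay_triple \<Rightarrow> quiver_rep \<Rightarrow> quiver_rep \<Rightarrow> bool" where
  "gauge_eq X \<phi> \<phi>' \<longleftrightarrow> (\<exists>h h'. gauge_pair X h h' \<and>
     (\<forall>a\<in>arrows X. lift_rep X \<phi>' a = pair_act h h' (lift_rep X \<phi>) a))"

lemma mat_ring_inv:
  assumes "A \<in> carrier_mat n n" "B \<in> carrier_mat n n" "A * B = 1\<^sub>m n" "B * A = 1\<^sub>m n"
  shows "A \<in> Units (mat_ring n)" "inv\<^bsub>mat_ring n\<^esub> A = B"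
proof -
  interpret R: ring "mat_ring n" by (rule ring_mat)
  show "A \<in> Units (mat_ring n)" using assms by (auto simp: Units_def ring_mat_def)
  show "inv\<^bsub>mat_ring n\<^esub> A = B"
    by (rule R.inv_char) (use assms in \<open>auto simp: ring_mat_def\<close>)
qed

lemma GL_prod_in_coset:
  assumes "g \<in> carrier (GL_prod X)"
  shows "g \<in> scalars X #>\<^bsub>GL_prod X\<^esub> g"
proof -
  have g: "g i \<in> carrier_mat (dims X i) (dims X i)" if "i \<in> verts X" for i
    using assms that by (auto simp: GL_prod_def product_group_def units_of_def Units_def ring_mat_def)
  define e where "e = (\<lambda>i\<in>verts X. 1 \<cdot>\<^sub>m 1\<^sub>m (dims X i) :: complex mat)"
  have "e \<in> scalars X" unfolding scalars_def e_def by (intro CollectI exI[of _ 1]) auto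
  moreover have "e \<otimes>\<^bsub>GL_prod X\<^esub> g = g"
  proof
    fix i
    have "(1::complex) \<cdot>\<^sub>m 1\<^sub>m (dims X i) = 1\<^sub>m (dims X i)" by (rule eq_matI) auto
    moreover have "g i = undefined" if "i \<notin> verts X"
      using assms that by (auto simp: GL_prod_def product_group_def PiE_def extensional_def)
    ultimately show "(e \<otimes>\<^bsub>GL_prod X\<^esub> g) i = g i"
      using g[of i] by (auto simp: GL_prod_def product_group_def units_of_def ring_mat_def e_def)
  qed
  ultimately show ?thesis unfolding r_coset_def by force
qed

lemma gauge_pair_to_gauge_grp:
  assumes X: "valid_triple X" and h: "gauge_pair X h h'"
  obtains K where "K \<in> carrier (gauge_grp X)"
    "\<And>\<phi> a. \<phi> \<in> rep_space X \<Longrightarrow> a \<in> arrows X \<Longrightarrow> lift_rep X (gauge_act X K \<phi>) a = pair_act h h' (lift_rep X \<phi>) a"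
    "\<And>\<phi>. \<phi> \<in> rep_space X \<Longrightarrow> gauge_act X K \<phi> \<in> rep_space X"
proof -
  define g where "g = (\<lambda>i\<in>verts X. to_mat (dims X i) (dims X i) (h i))"
  have h_simps: "un (dims X i) * h i = h i" "h i * un (dims X i) = h i" "un (dims X i) * h' i = h' i"
    "h' i * un (dims X i) = h' i" "h i * h' i = un (dims X i)" "h' i * h i = un (dims X i)" if "i \<in> verts X" for i
    using h that unfolding gauge_pair_def by blast+
  have inv: "to_mat (dims X i) (dims X i) (h i) \<in> Units (mat_ring (dims X i))"
    "inv\<^bsub>mat_ring (dims X i)\<^esub> (to_mat (dims X i) (dims X i) (h i)) = to_mat (dims X i) (dims X i) (h' i)"
    if "i \<in> verts X" for i
    using mat_ring_inv[of "to_mat (dims X i) (dims X i) (h i)" "dims X i" "to_mat (dims X i) (dims X i) (h' i)"]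
    by (simp_all add: to_mat_mult[symmetric] h_simps[OF that] dims_le_3 to_mat_un)
  have g: "g \<in> carrier (GL_prod X)"
    using inv(1) by (auto simp: GL_prod_def product_group_def units_of_def g_def)
  define K where "K = scalars X #>\<^bsub>GL_prod X\<^esub> g"
  have K: "K \<in> carrier (gauge_grp X)"
    using g by (auto simp: gauge_grp_def carrier_FactGroup K_def)
  have gK: "g \<in> K" using GL_prod_in_coset[OF g] by (simp add: K_def)
  have act: "gauge_act X K \<phi> a = to_mat (dims X (snd a)) (dims X (snd a)) (h (snd a)) * \<phi> a *
      to_mat (dims X (fst a)) (dims X (fst a)) (h' (fst a))"
    if "\<phi> \<in> rep_space X" "a \<in> arrows X" for \<phi> a
    using gauge_act_eq_conj_act[OF X K gK that(1)] that(2) arrows_ends[OF X that(2)] inv(2)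
    by (simp add: conj_act_def g_def)
  show thesis
  proof (rule that[OF K])
    fix \<phi> assume \<phi>: "\<phi> \<in> rep_space X"
    have e: "gauge_act X K \<phi> = (\<lambda>a\<in>arrows X. gauge_act X K \<phi> a)"
      using gauge_act_eq_conj_act[OF X K gK \<phi>] by (simp add: conj_act_def fun_eq_iff)
    show "gauge_act X K \<phi> \<in> rep_space X"
      unfolding rep_space_def by (subst e, unfold restrict_PiE_iff)
        (use act[OF \<phi>] rep_space_carrier[OF \<phi>] in \<open>metis mult_carrier_mat to_mat_carrier\<close>)
    fix a assume a: "a \<in> arrows X"
    have i: "fst a \<in> verts X" "snd a \<in> verts X" using arrows_ends[OF X a] by auto
    note c = rep_space_carrier[OF \<phi> a]
    show "lift_rep X (gauge_act X K \<phi>) a = pair_act h h' (lift_rep X \<phi>) a"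
      using c mult_carrier_mat[OF to_mat_carrier c]
      by (simp add: act[OF \<phi> a] lift_rep_def pair_act_def dims_le_3
          of_mat_mult[of _ "dims X (fst a)"] of_mat_mult[of _ "dims X (snd a)" "dims X (fst a)"]
          of_mat_to_mat h_simps[OF i(1)] h_simps[OF i(2)])
  qed
qed

lemma gauge_grp_to_gauge_pair:
  assumes X: "valid_triple X" and K: "K \<in> carrier (gauge_grp X)" and \<phi>: "\<phi> \<in> rep_space X"
  shows "gauge_eq X \<phi> (gauge_act X K \<phi>)" "gauge_act X K \<phi> \<in> rep_space X"
proof -
  obtain g where g: "g \<in> carrier (GL_prod X)" and Kg: "K = scalars X #>\<^bsub>GL_prod X\<^esub> g"
    using K by (auto simp: gauge_grp_def carrier_FactGroup)
  have gK: "g \<in> K" using GL_prod_in_coset[OF g] by (simp add: Kg)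
  have gU: "g i \<in> Units (mat_ring (dims X i))" if "i \<in> verts X" for i
    using g that by (auto simp: GL_prod_def product_group_def units_of_def)
  define k where "k i = inv\<^bsub>mat_ring (dims X i)\<^esub> (g i)" for i
  have c: "g i \<in> carrier_mat (dims X i) (dims X i)" "k i \<in> carrier_mat (dims X i) (dims X i)"
    "g i * k i = 1\<^sub>m (dims X i)" "k i * g i = 1\<^sub>m (dims X i)" if i: "i \<in> verts X" for i
  proof -
    interpret R: ring "mat_ring (dims X i)" by (rule ring_mat)
    show "g i \<in> carrier_mat (dims X i) (dims X i)" "k i \<in> carrier_mat (dims X i) (dims X i)"
      "g i * k i = 1\<^sub>m (dims X i)" "k i * g i = 1\<^sub>m (dims X i)"
      using R.Units_closed[OF gU[OF i]] R.Units_inv_closed[OF gU[OF i]] R.Units_r_inv[OF gU[OF i]]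
        R.Units_l_inv[OF gU[OF i]] by (simp_all add: ring_mat_def k_def)
  qed
  have act: "gauge_act X K \<phi> = (\<lambda>a\<in>arrows X. g (snd a) * \<phi> a * k (fst a))"
    unfolding gauge_act_eq_conj_act[OF X K gK \<phi>] conj_act_def k_def ..
  have i: "fst a \<in> verts X" "snd a \<in> verts X" if "a \<in> arrows X" for a using arrows_ends[OF X that] by auto
  show "gauge_act X K \<phi> \<in> rep_space X"
    unfolding act rep_space_def restrict_PiE_iff
    using c(1,2) i rep_space_carrier[OF \<phi>] mult_carrier_mat by metis
  let ?h = "\<lambda>i. of_mat (dims X i) (dims X i) (g i)" and ?h' = "\<lambda>i. of_mat (dims X i) (dims X i) (k i)"
  have "gauge_pair X ?h ?h'"
    unfolding gauge_pair_def using c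
    by (simp add: un_of_mat dims_le_3 of_mat_mult[symmetric] of_mat_one)
  moreover have "lift_rep X (gauge_act X K \<phi>) a = pair_act ?h ?h' (lift_rep X \<phi>) a" if a: "a \<in> arrows X" for a
  proof -
    note p = rep_space_carrier[OF \<phi> a]
    show ?thesis
      using a p c[OF i(1)[OF a]] c[OF i(2)[OF a]] mult_carrier_mat[OF c(1)[OF i(2)[OF a]] p]
      by (simp add: act lift_rep_def pair_act_def dims_le_3
          of_mat_mult[of _ "dims X (fst a)"] of_mat_mult[of _ "dims X (snd a)" "dims X (fst a)"] mult.assoc)
  qed
  ultimately show "gauge_eq X \<phi> (gauge_act X K \<phi>)" unfolding gauge_eq_def by blast
qed

lemma moment_vanishes_pair_act:
  assumes X: "valid_triple X" and h: "gauge_pair X h h'" and \<psi>: "padded_rep X \<psi>" "moment_vanishes X \<epsilon> \<psi>"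
  shows "moment_vanishes X \<epsilon> (pair_act h h' \<psi>)"
  unfolding moment_vanishes_def
proof
  fix j assume j: "j \<in> verts X"
  have "pair_act h h' \<psi> a * pair_act h h' \<psi> (prod.swap a) = h j * (\<psi> a * \<psi> (prod.swap a)) * h' j"
    if "a \<in> in_arrows X j" for a
  proof -
    have a: "a \<in> arrows X" "snd a = j" using that by (auto simp: in_arrows_def)
    have "pair_act h h' \<psi> a * pair_act h h' \<psi> (prod.swap a) =
        h j * (\<psi> a * (h' (fst a) * h (fst a))) * \<psi> (prod.swap a) * h' j"
      by (simp add: pair_act_def a mult.assoc)
    moreover have "h' (fst a) * h (fst a) = un (dims X (fst a))" "\<psi> a * un (dims X (fst a)) = \<psi> a"
      using h arrows_ends(1)[OF X a(1)] \<psi>(1) a(1) by (auto simp: gauge_pair_def padded_rep_def)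
    ultimately show ?thesis by (simp add: mult.assoc)
  qed
  then have "(\<Sum>a\<in>in_arrows X j. sc (of_int (\<epsilon> a)) * (pair_act h h' \<psi> a * pair_act h h' \<psi> (prod.swap a))) =
      h j * (\<Sum>a\<in>in_arrows X j. sc (of_int (\<epsilon> a)) * (\<psi> a * \<psi> (prod.swap a))) * h' j"
    by (simp add: sum_distrib_left sum_distrib_right sc_commute_left mult.assoc)
  then show "(\<Sum>a\<in>in_arrows X j. sc (of_int (\<epsilon> a)) * (pair_act h h' \<psi> a * pair_act h h' \<psi> (prod.swap a))) = 0"
    using \<psi>(2) j by (simp add: moment_vanishes_def)
qed

lemma moment_vanishes_cong:
  assumes "\<And>a. a \<in> arrows X \<Longrightarrow> \<psi> a = \<psi>' a"
  shows "moment_vanishes X \<epsilon> \<psi> \<longleftrightarrow> moment_vanishes X \<epsilon> \<psi>'"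
  unfolding moment_vanishes_def
  by (intro ball_cong refl arg_cong[of _ _ "\<lambda>x. x = 0"] sum.cong)
    (auto simp: in_arrows_def assms swap_arrows)

lemma drop_rep_in_moment_zero_set:
  assumes "padded_rep X \<psi>" "moment_vanishes X \<epsilon> \<psi>"
  shows "drop_rep X \<psi> \<in> moment_zero_set X \<epsilon>"
  using moment_zero_set_iff[OF drop_rep_in_rep_space] assms(2)
    moment_vanishes_cong[of X "lift_rep X (drop_rep X \<psi>)" \<psi>, OF lift_drop_rep[OF assms(1)]] by blast

lemma gauge_eq_moment_zero:
  assumes X: "valid_triple X" and "gauge_eq X \<phi> \<phi>'" "\<phi> \<in> moment_zero_set X \<epsilon>" "\<phi>' \<in> rep_space X"
  shows "\<phi>' \<in> moment_zero_set X \<epsilon>"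
proof -
  obtain h h' where h: "gauge_pair X h h'" "\<And>a. a \<in> arrows X \<Longrightarrow> lift_rep X \<phi>' a = pair_act h h' (lift_rep X \<phi>) a"
    using assms(2) by (auto simp: gauge_eq_def)
  have "\<phi> \<in> rep_space X" using assms(3) by (simp add: moment_zero_set_def)
  then have "moment_vanishes X \<epsilon> (lift_rep X \<phi>)" using assms(3) moment_zero_set_iff by blast
  from moment_vanishes_pair_act[OF X h(1) padded_lift_rep this]
  show ?thesis
    using moment_zero_set_iff[OF assms(4)]
      moment_vanishes_cong[of X "lift_rep X \<phi>'" "pair_act h h' (lift_rep X \<phi>)", OF h(2)] by simp
qed

text \<open>Gauge transforms of points of the zero fibre stay in the zero fibre, so invariance can
  be tested by gauge pairs between such points instead of cosets of scalars.\<close>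

lemma invariant_funs_iff:
  assumes X: "valid_triple X"
  shows "f \<in> invariant_funs X \<epsilon> \<longleftrightarrow> f \<in> regular (moment_zero_variety X \<epsilon>) \<and>
    (\<forall>\<phi>\<in>moment_zero_set X \<epsilon>. \<forall>\<phi>'\<in>moment_zero_set X \<epsilon>. gauge_eq X \<phi> \<phi>' \<longrightarrow> f \<phi>' = f \<phi>)"
proof
  assume f: "f \<in> invariant_funs X \<epsilon>"
  have "f \<phi>' = f \<phi>" if \<phi>: "\<phi> \<in> moment_zero_set X \<epsilon>" "\<phi>' \<in> moment_zero_set X \<epsilon>" "gauge_eq X \<phi> \<phi>'" for \<phi> \<phi>'
  proof -
    have r: "\<phi> \<in> rep_space X" "\<phi>' \<in> rep_space X" using \<phi> by (auto simp: moment_zero_set_def)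
    obtain h h' where h: "gauge_pair X h h'" "\<forall>a\<in>arrows X. lift_rep X \<phi>' a = pair_act h h' (lift_rep X \<phi>) a"
      using \<phi>(3) by (auto simp: gauge_eq_def)
    obtain K where K: "K \<in> carrier (gauge_grp X)"
      "\<And>\<phi> a. \<phi> \<in> rep_space X \<Longrightarrow> a \<in> arrows X \<Longrightarrow> lift_rep X (gauge_act X K \<phi>) a = pair_act h h' (lift_rep X \<phi>) a"
      "\<And>\<phi>. \<phi> \<in> rep_space X \<Longrightarrow> gauge_act X K \<phi> \<in> rep_space X"
      using gauge_pair_to_gauge_grp[OF X h(1)] by blast
    have "gauge_act X K \<phi> = \<phi>'" by (rule rep_eqI[OF K(3)[OF r(1)] r(2)]) (simp add: K(2)[OF r(1)] h(2))
    then show ?thesis using f K(1) \<phi>(1) by (auto simp: invariant_funs_def)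
  qed
  then show "f \<in> regular (moment_zero_variety X \<epsilon>) \<and>
    (\<forall>\<phi>\<in>moment_zero_set X \<epsilon>. \<forall>\<phi>'\<in>moment_zero_set X \<epsilon>. gauge_eq X \<phi> \<phi>' \<longrightarrow> f \<phi>' = f \<phi>)"
    using f by (auto simp: invariant_funs_def)
next
  assume f: "f \<in> regular (moment_zero_variety X \<epsilon>) \<and>
    (\<forall>\<phi>\<in>moment_zero_set X \<epsilon>. \<forall>\<phi>'\<in>moment_zero_set X \<epsilon>. gauge_eq X \<phi> \<phi>' \<longrightarrow> f \<phi>' = f \<phi>)"
  have "f (gauge_act X K \<phi>) = f \<phi>" if "K \<in> carrier (gauge_grp X)" "\<phi> \<in> moment_zero_set X \<epsilon>" for K \<phi>
  proof -
    have "\<phi> \<in> rep_space X" using that(2) by (simp add: moment_zero_set_def)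
    from gauge_grp_to_gauge_pair[OF X that(1) this] show ?thesis
      using f that(2) gauge_eq_moment_zero[OF X] by blast
  qed
  then show "f \<in> invariant_funs X \<epsilon>" using f by (simp add: invariant_funs_def)
qed

section \<open>Polynomial functions\<close>

definition rep_coords :: "mckay_triple \<Rightarrow> (quiver_rep \<Rightarrow> complex) set" where
  "rep_coords X = {\<lambda>\<phi>. \<phi> a $$ (k, l) |a k l. a \<in> arrows X \<and> k < dims X (snd a) \<and> l < dims X (fst a)}"

definition plane_coords :: "(complex vec \<Rightarrow> complex) set" where
  "plane_coords = {\<lambda>v. v $ 0, \<lambda>v. v $ 1}"

lemma regular_moment_zero_variety:
  "regular (moment_zero_variety X \<epsilon>) = (\<lambda>f. restrict f (moment_zero_set X \<epsilon>)) ` generated_algebra (rep_coords X)"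
  "points (moment_zero_variety X \<epsilon>) = moment_zero_set X \<epsilon>"
  by (simp_all add: moment_zero_variety_def embedded_variety_def rep_coords_def)

lemma regular_plane:
  "regular plane = (\<lambda>f. restrict f (carrier_vec 2)) ` generated_algebra plane_coords"
  "points plane = carrier_vec 2"
  by (simp_all add: plane_def embedded_variety_def plane_coords_def)

lemma generated_algebra_sum:
  "(\<And>s. s \<in> S \<Longrightarrow> f s \<in> generated_algebra B) \<Longrightarrow> (\<lambda>p. \<Sum>s\<in>S. f s p) \<in> generated_algebra B"
  by (induction S rule: infinite_finite_induct) (auto intro: generated_algebra.intros)

lemma generated_algebra_prod:
  "(\<And>s. s \<in> S \<Longrightarrow> f s \<in> generated_algebra B) \<Longrightarrow> (\<lambda>p. \<Prod>s\<in>S. f s p) \<in> generated_algebra B"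
  by (induction S rule: infinite_finite_induct) (auto intro: generated_algebra.intros)

lemma generated_algebra_substitute:
  assumes "\<And>b. b \<in> B \<Longrightarrow> \<exists>q\<in>generated_algebra C. \<forall>s\<in>S. b (F s) = q s" and "f \<in> generated_algebra B"
  shows "\<exists>q\<in>generated_algebra C. \<forall>s\<in>S. f (F s) = q s"
  using assms(2)
proof induction
  case (const c) show ?case by (intro bexI[of _ "\<lambda>_. c"]) (auto intro: generated_algebra.const)
next
  case (gen f) then show ?case using assms(1) by blast
next
  case (add f g)
  then obtain p q where "p \<in> generated_algebra C" "q \<in> generated_algebra C"
    "\<forall>s\<in>S. f (F s) = p s" "\<forall>s\<in>S. g (F s) = q s" by blast
  then show ?case by (intro bexI[of _ "\<lambda>s. p s + q s"]) (auto intro: generated_algebra.add)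
next
  case (mult f g)
  then obtain p q where "p \<in> generated_algebra C" "q \<in> generated_algebra C"
    "\<forall>s\<in>S. f (F s) = p s" "\<forall>s\<in>S. g (F s) = q s" by blast
  then show ?case by (intro bexI[of _ "\<lambda>s. p s * q s"]) (auto intro: generated_algebra.mult)
qed

lemma ent_lift_rep_polynomial:
  assumes a: "a \<in> arrows X"
  shows "(\<lambda>\<phi>. ent (lift_rep X \<phi> a) k l) \<in> generated_algebra (rep_coords X)"
proof (cases "k < dims X (snd a) \<and> l < dims X (fst a)")
  case True
  then have "(\<lambda>\<phi>. ent (lift_rep X \<phi> a) k l) = (\<lambda>\<phi>. \<phi> a $$ (k, l))"
    by (simp add: lift_rep_def ent_of_mat dims_le_3)
  moreover have "(\<lambda>\<phi>. \<phi> a $$ (k, l)) \<in> rep_coords X" using True a unfolding rep_coords_def by blast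
  ultimately show ?thesis by (simp add: generated_algebra.gen)
next
  case False
  then have "(\<lambda>\<phi>. ent (lift_rep X \<phi> a) k l) = (\<lambda>\<phi>. 0)"
    by (auto simp: lift_rep_def ent_of_mat dims_le_3)
  then show ?thesis by (simp add: generated_algebra.const)
qed

text \<open>Coordinates are affine in \<open>t\<close> along the line. Continuity at 0 is the form
  in which limits of orbits enter.\<close>

lemma polynomial_along_line_continuous:
  assumes "f \<in> generated_algebra (rep_coords X)"
  shows "isCont (\<lambda>t. f (drop_rep X (\<lambda>a. \<psi> a + sc t * \<beta> a))) 0"
  using assms
proof induction
  case (gen f)
  then obtain a k l where f: "f = (\<lambda>\<phi>. \<phi> a $$ (k, l))" "a \<in> arrows X" "k < dims X (snd a)" "l < dims X (fst a)"
    by (auto simp: rep_coords_def)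
  have "(\<lambda>t. f (drop_rep X (\<lambda>a. \<psi> a + sc t * \<beta> a))) = (\<lambda>t. ent (\<psi> a) k l + t * ent (\<beta> a) k l)"
    using f by (simp add: drop_rep_def to_mat_def)
  then show ?case by (simp add: continuous_intros)
qed (auto intro: continuous_intros)

text \<open>For t \<noteq> 0 the points \<psi>' + t \<beta> of the degeneration are gauge equivalent
  to \<psi>, so \<open>f\<close> is constant along them; by continuity it has the same value at
  \<psi>', where paths vanish one step earlier.\<close>

lemma invariant_fun_nilpotent:
  assumes X: "valid_triple X" and f: "f \<in> invariant_funs X \<epsilon>"
    and "padded_rep X \<psi>" "moment_vanishes X \<epsilon> \<psi>" "nilpotent_rep X \<psi> (Suc m)"
  shows "f (drop_rep X \<psi>) = f (drop_rep X (\<lambda>_. 0))"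
  using assms(3-5)
proof (induction m arbitrary: \<psi>)
  case 0
  then show ?case using nilpotent_rep_1[OF X 0(1)] drop_rep_cong[of X \<psi> "\<lambda>_. 0"] by simp
next
  case (Suc m)
  obtain \<psi>' \<beta> where d: "padded_rep X \<psi>'" "padded_rep X \<beta>" "moment_vanishes X \<epsilon> \<psi>'" "nilpotent_rep X \<psi>' (Suc m)"
    "\<And>t. t \<noteq> 0 \<Longrightarrow> \<exists>h h'. gauge_pair X h h' \<and> (\<forall>a\<in>arrows X. pair_act h h' \<psi> a = \<psi>' a + sc t * \<beta> a)"
    using nilpotent_degeneration[OF X Suc.prems] by (metis zero_less_Suc)
  obtain q where q: "q \<in> generated_algebra (rep_coords X)" "f = restrict q (moment_zero_set X \<epsilon>)"
    using f by (auto simp: invariant_funs_def regular_moment_zero_variety)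
  let ?\<phi> = "\<lambda>t. drop_rep X (\<lambda>a. \<psi>' a + sc t * \<beta> a)"
  have in0: "drop_rep X \<psi> \<in> moment_zero_set X \<epsilon>" if "padded_rep X \<psi>" "moment_vanishes X \<epsilon> \<psi>" for \<psi>
    by (rule drop_rep_in_moment_zero_set[OF that])
  have const: "q (?\<phi> t) = f (drop_rep X \<psi>)" if t: "t \<noteq> 0" for t
  proof -
    obtain h h' where h: "gauge_pair X h h'" "\<And>a. a \<in> arrows X \<Longrightarrow> pair_act h h' \<psi> a = \<psi>' a + sc t * \<beta> a"
      using d(5)[OF t] by blast
    have pad: "padded_rep X (\<lambda>a. \<psi>' a + sc t * \<beta> a)"
      using d(1,2) by (simp add: padded_rep_def distrib_left distrib_right sc_commute_left mult.assoc)
    have "gauge_eq X (drop_rep X \<psi>) (?\<phi> t)"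
      unfolding gauge_eq_def
      by (intro exI conjI, rule h(1))
        (simp add: lift_drop_rep[OF pad] h(2)[symmetric] pair_act_def lift_drop_rep[OF Suc.prems(1)])
    moreover have "?\<phi> t \<in> moment_zero_set X \<epsilon>"
      by (rule gauge_eq_moment_zero[OF X calculation in0[OF Suc.prems(1,2)] drop_rep_in_rep_space])
    ultimately show ?thesis
      using f in0[OF Suc.prems(1,2)] q(2) unfolding invariant_funs_iff[OF X] by (metis restrict_apply')
  qed
  have "((\<lambda>t. q (?\<phi> t)) \<longlongrightarrow> q (?\<phi> 0)) (at 0)"
    using polynomial_along_line_continuous[OF q(1), of \<psi>' \<beta>] by (simp add: isCont_def)
  moreover have "((\<lambda>t. q (?\<phi> t)) \<longlongrightarrow> f (drop_rep X \<psi>)) (at 0)"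
    by (rule tendsto_eventually) (auto simp: eventually_at_filter const)
  ultimately have "q (?\<phi> 0) = f (drop_rep X \<psi>)" using LIM_unique by blast
  then have "f (drop_rep X \<psi>) = f (drop_rep X \<psi>')"
    using in0[OF d(1,3)] by (simp add: q(2) sc_simps)
  then show ?case using Suc.IH[OF d(1,3,4)] by simp
qed

section \<open>The induced action\<close>

definition diagram_aut :: "mckay_triple \<Rightarrow> (nat \<Rightarrow> nat) \<Rightarrow> bool" where
  "diagram_aut X \<sigma> \<longleftrightarrow> bij \<sigma> \<and> \<sigma> ` verts X = verts X \<and> (\<forall>a\<in>arrows X. map_prod \<sigma> \<sigma> a \<in> arrows X) \<and>
     (\<forall>i\<in>verts X. dims X (\<sigma> i) = dims X i)"

abbreviation perm_inv :: "('a \<Rightarrow> 'b) \<Rightarrow> 'b \<Rightarrow> 'a" where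
  "perm_inv \<equiv> inv_into UNIV"

lemma diagram_aut_inv:
  assumes X: "valid_triple X" and \<sigma>: "diagram_aut X \<sigma>"
  shows "diagram_aut X (perm_inv \<sigma>)"
proof -
  have b: "bij \<sigma>" and v: "\<sigma> ` verts X = verts X" using \<sigma> by (auto simp: diagram_aut_def)
  have iv: "perm_inv \<sigma> ` verts X = verts X" using v b by (metis bij_def image_inv_f_f)
  \<comment> \<open>\<open>diagram_aut\<close> asks only that arrows go to arrows; since there are
    finitely many, the injective map is onto, and its inverse preserves arrows too.\<close>
  have "inj_on (map_prod \<sigma> \<sigma>) (arrows X)"
    using b by (auto simp: inj_on_def bij_def dest: injD)
  moreover have "map_prod \<sigma> \<sigma> ` arrows X \<subseteq> arrows X" using \<sigma> by (auto simp: diagram_aut_def)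
  ultimately have surj: "map_prod \<sigma> \<sigma> ` arrows X = arrows X"
    using endo_inj_surj[OF finite_arrows[OF X]] by blast
  have "map_prod (perm_inv \<sigma>) (perm_inv \<sigma>) a \<in> arrows X" if "a \<in> arrows X" for a
  proof -
    have "a \<in> map_prod \<sigma> \<sigma> ` arrows X" by (simp only: surj that)
    then obtain c where c: "c \<in> arrows X" "a = map_prod \<sigma> \<sigma> c" by (rule imageE)
    have "perm_inv \<sigma> (\<sigma> k) = k" for k using b by (simp add: bij_is_inj)
    then show ?thesis using c by (cases c) simp
  qed
  moreover have "dims X (perm_inv \<sigma> i) = dims X i" if "i \<in> verts X" for i
  proof -
    have "perm_inv \<sigma> i \<in> verts X" using iv that by blast
    then have "dims X (\<sigma> (perm_inv \<sigma> i)) = dims X (perm_inv \<sigma> i)" using \<sigma> by (auto simp: diagram_aut_def)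
    then show ?thesis using b by (simp add: bij_is_surj surj_f_inv_f)
  qed
  ultimately show ?thesis using iv b by (auto simp: diagram_aut_def bij_imp_bij_inv)
qed

text \<open>The action with all scalars 1. The matrix at an arrow is moved to the image of that
  arrow under \<open>\<sigma>\<close>, hence the inverse in the formula.\<close>

definition pull :: "mckay_triple \<Rightarrow> (nat \<Rightarrow> nat) \<Rightarrow> quiver_rep \<Rightarrow> quiver_rep" where
  "pull X \<sigma> \<phi> = (\<lambda>b\<in>arrows X. \<phi> (map_prod (perm_inv \<sigma>) (perm_inv \<sigma>) b))"

lemma diagram_autD:
  assumes "diagram_aut X \<sigma>"
  shows "bij \<sigma>" "a \<in> arrows X \<Longrightarrow> map_prod \<sigma> \<sigma> a \<in> arrows X" "i \<in> verts X \<Longrightarrow> \<sigma> i \<in> verts X"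
    "i \<in> verts X \<Longrightarrow> dims X (\<sigma> i) = dims X i"
  using assms by (auto simp: diagram_aut_def)

lemma pull_in_rep_space:
  assumes X: "valid_triple X" and \<sigma>: "diagram_aut X \<sigma>" and \<phi>: "\<phi> \<in> rep_space X"
  shows "pull X \<sigma> \<phi> \<in> rep_space X"
  unfolding rep_space_def pull_def restrict_PiE_iff
proof
  fix a assume a: "a \<in> arrows X"
  note i = diagram_autD[OF diagram_aut_inv[OF X \<sigma>]]
  show "\<phi> (map_prod (perm_inv \<sigma>) (perm_inv \<sigma>) a) \<in> carrier_mat (dims X (snd a)) (dims X (fst a))"
    using rep_space_carrier[OF \<phi> i(2)[OF a]] i(4)[OF arrows_ends(1)[OF X a]] i(4)[OF arrows_ends(2)[OF X a]]
    by (cases a) simp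
qed

lemma lift_pull:
  assumes X: "valid_triple X" and \<sigma>: "diagram_aut X \<sigma>" and a: "a \<in> arrows X"
  shows "lift_rep X (pull X \<sigma> \<phi>) a = lift_rep X \<phi> (map_prod (perm_inv \<sigma>) (perm_inv \<sigma>) a)"
  using diagram_autD(4)[OF diagram_aut_inv[OF X \<sigma>]] arrows_ends[OF X a] a
  by (cases a) (simp add: lift_rep_def pull_def)

lemma map_prod_inv:
  assumes "bij \<sigma>"
  shows "map_prod \<sigma> \<sigma> (map_prod (perm_inv \<sigma>) (perm_inv \<sigma>) a) = a" "map_prod (perm_inv \<sigma>) (perm_inv \<sigma>) (map_prod \<sigma> \<sigma> a) = a"
  using assms by (cases a; simp add: bij_is_surj bij_is_inj surj_f_inv_f)+

lemma swap_map_prod: "prod.swap (map_prod \<sigma> \<sigma> a) = map_prod \<sigma> \<sigma> (prod.swap a)"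
  by (cases a) simp

lemma bij_betw_in_arrows:
  assumes X: "valid_triple X" and \<sigma>: "diagram_aut X \<sigma>"
  shows "bij_betw (map_prod \<sigma> \<sigma>) (in_arrows X (perm_inv \<sigma> j)) (in_arrows X j)"
proof (rule bij_betwI[where g = "map_prod (perm_inv \<sigma>) (perm_inv \<sigma>)"])
  note b = diagram_autD(1)[OF \<sigma>]
  show "map_prod \<sigma> \<sigma> \<in> in_arrows X (perm_inv \<sigma> j) \<rightarrow> in_arrows X j"
    using diagram_autD(2)[OF \<sigma>] b by (auto simp: in_arrows_def bij_is_surj surj_f_inv_f)
  show "map_prod (perm_inv \<sigma>) (perm_inv \<sigma>) \<in> in_arrows X j \<rightarrow> in_arrows X (perm_inv \<sigma> j)"
    using diagram_autD(2)[OF diagram_aut_inv[OF X \<sigma>]] by (auto simp: in_arrows_def)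
qed (use map_prod_inv[OF diagram_autD(1)[OF \<sigma>]] in blast)+

lemma bij_betw_arrows:
  assumes X: "valid_triple X" and \<sigma>: "diagram_aut X \<sigma>"
  shows "bij_betw (map_prod \<sigma> \<sigma>) (arrows X) (arrows X)"
proof (rule bij_betwI[where g = "map_prod (perm_inv \<sigma>) (perm_inv \<sigma>)"])
  show "map_prod \<sigma> \<sigma> \<in> arrows X \<rightarrow> arrows X" using diagram_autD(2)[OF \<sigma>] by auto
  show "map_prod (perm_inv \<sigma>) (perm_inv \<sigma>) \<in> arrows X \<rightarrow> arrows X"
    using diagram_autD(2)[OF diagram_aut_inv[OF X \<sigma>]] by auto
qed (use map_prod_inv[OF diagram_autD(1)[OF \<sigma>]] in blast)+

lemma pull_moment_zero:
  assumes X: "valid_triple X" and \<sigma>: "diagram_aut X \<sigma>"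
    and \<epsilon>: "\<And>a. a \<in> arrows X \<Longrightarrow> \<epsilon> (map_prod \<sigma> \<sigma> a) = \<epsilon> a" and \<phi>: "\<phi> \<in> moment_zero_set X \<epsilon>"
  shows "pull X \<sigma> \<phi> \<in> moment_zero_set X \<epsilon>"
proof -
  have r: "\<phi> \<in> rep_space X" using \<phi> by (simp add: moment_zero_set_def)
  have m: "moment_vanishes X \<epsilon> (lift_rep X \<phi>)" using \<phi> moment_zero_set_iff[OF r] by blast
  have "(\<Sum>a\<in>in_arrows X j. sc (of_int (\<epsilon> a)) * (lift_rep X (pull X \<sigma> \<phi>) a * lift_rep X (pull X \<sigma> \<phi>) (prod.swap a))) = 0"
    if j: "j \<in> verts X" for j
  proof -
    have "(\<Sum>a\<in>in_arrows X j. sc (of_int (\<epsilon> a)) * (lift_rep X (pull X \<sigma> \<phi>) a * lift_rep X (pull X \<sigma> \<phi>) (prod.swap a))) =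
      (\<Sum>a\<in>in_arrows X (perm_inv \<sigma> j). sc (of_int (\<epsilon> a)) * (lift_rep X \<phi> a * lift_rep X \<phi> (prod.swap a)))"
    proof (rule sum.reindex_bij_betw[OF bij_betw_in_arrows[OF X \<sigma>, of j], symmetric, THEN trans])
      show "(\<Sum>a\<in>in_arrows X (perm_inv \<sigma> j). sc (of_int (\<epsilon> (map_prod \<sigma> \<sigma> a))) *
          (lift_rep X (pull X \<sigma> \<phi>) (map_prod \<sigma> \<sigma> a) * lift_rep X (pull X \<sigma> \<phi>) (prod.swap (map_prod \<sigma> \<sigma> a)))) =
        (\<Sum>a\<in>in_arrows X (perm_inv \<sigma> j). sc (of_int (\<epsilon> a)) * (lift_rep X \<phi> a * lift_rep X \<phi> (prod.swap a)))"
        using diagram_autD(2)[OF \<sigma>]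
        by (intro sum.cong refl)
          (auto simp: in_arrows_def \<epsilon> swap_map_prod lift_pull[OF X \<sigma>] swap_arrows map_prod_inv[OF diagram_autD(1)[OF \<sigma>]]
            simp del: map_prod_simp)
    qed
    then show ?thesis
      using m diagram_autD(3)[OF diagram_aut_inv[OF X \<sigma>] j] by (simp add: moment_vanishes_def)
  qed
  then show ?thesis
    using moment_zero_set_iff[OF pull_in_rep_space[OF X \<sigma> r]] by (simp add: moment_vanishes_def)
qed

lemma pull_gauge_eq:
  assumes X: "valid_triple X" and \<sigma>: "diagram_aut X \<sigma>" and g: "gauge_eq X \<phi> \<phi>'"
  shows "gauge_eq X (pull X \<sigma> \<phi>) (pull X \<sigma> \<phi>')"
proof -
  obtain h h' where h: "gauge_pair X h h'" "\<And>a. a \<in> arrows X \<Longrightarrow> lift_rep X \<phi>' a = pair_act h h' (lift_rep X \<phi>) a"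
    using g by (auto simp: gauge_eq_def)
  note i = diagram_autD[OF diagram_aut_inv[OF X \<sigma>]]
  have "gauge_pair X (h \<circ> perm_inv \<sigma>) (h' \<circ> perm_inv \<sigma>)"
    unfolding gauge_pair_def
  proof
    fix j assume j: "j \<in> verts X"
    show "un (dims X j) * (h \<circ> perm_inv \<sigma>) j = (h \<circ> perm_inv \<sigma>) j \<and>
        (h \<circ> perm_inv \<sigma>) j * un (dims X j) = (h \<circ> perm_inv \<sigma>) j \<and>
        un (dims X j) * (h' \<circ> perm_inv \<sigma>) j = (h' \<circ> perm_inv \<sigma>) j \<and>
        (h' \<circ> perm_inv \<sigma>) j * un (dims X j) = (h' \<circ> perm_inv \<sigma>) j \<and>
        (h \<circ> perm_inv \<sigma>) j * (h' \<circ> perm_inv \<sigma>) j = un (dims X j) \<and>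
        (h' \<circ> perm_inv \<sigma>) j * (h \<circ> perm_inv \<sigma>) j = un (dims X j)"
      using h(1)[unfolded gauge_pair_def, rule_format, OF i(3)[OF j]] by (simp only: i(4)[OF j] o_apply)
  qed
  moreover have "lift_rep X (pull X \<sigma> \<phi>') a = pair_act (h \<circ> perm_inv \<sigma>) (h' \<circ> perm_inv \<sigma>) (lift_rep X (pull X \<sigma> \<phi>)) a"
    if a: "a \<in> arrows X" for a
    using lift_pull[OF X \<sigma> a] h(2)[OF i(2)[OF a]] by (cases a) (simp add: pair_act_def)
  ultimately show ?thesis unfolding gauge_eq_def by blast
qed

text \<open>\<open>pull\<close> is linear in the entries and preserves both the zero fibre and gauge
  equivalence. Hence it descends to the quotient, and points not separated by invariants have images
  not separated by invariants.\<close>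

lemma pull_invariant:
  assumes X: "valid_triple X" and \<sigma>: "diagram_aut X \<sigma>"
    and \<epsilon>: "\<And>a. a \<in> arrows X \<Longrightarrow> \<epsilon> (map_prod \<sigma> \<sigma> a) = \<epsilon> a" and f: "f \<in> invariant_funs X \<epsilon>"
  shows "(\<lambda>\<phi>\<in>moment_zero_set X \<epsilon>. f (pull X \<sigma> \<phi>)) \<in> invariant_funs X \<epsilon>"
proof -
  note i = diagram_autD[OF diagram_aut_inv[OF X \<sigma>]]
  note pm = pull_moment_zero[OF X \<sigma>, of \<epsilon>, OF \<epsilon>]
  obtain q where q: "q \<in> generated_algebra (rep_coords X)" "f = restrict q (moment_zero_set X \<epsilon>)"
    using f by (auto simp: invariant_funs_def regular_moment_zero_variety)
  have "\<exists>q'\<in>generated_algebra (rep_coords X). \<forall>\<phi>\<in>moment_zero_set X \<epsilon>. q (pull X \<sigma> \<phi>) = q' \<phi>"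
  proof (rule generated_algebra_substitute[OF _ q(1)])
    fix b assume "b \<in> rep_coords X"
    then obtain a k l where b: "b = (\<lambda>\<phi>. \<phi> a $$ (k, l))" "a \<in> arrows X" "k < dims X (snd a)" "l < dims X (fst a)"
      by (auto simp: rep_coords_def)
    let ?a = "map_prod (perm_inv \<sigma>) (perm_inv \<sigma>) a"
    have "(\<lambda>\<phi>. \<phi> ?a $$ (k, l)) \<in> rep_coords X"
      using i(2)[OF b(2)] i(4)[OF arrows_ends(1)[OF X b(2)]] i(4)[OF arrows_ends(2)[OF X b(2)]] b(3,4)
      unfolding rep_coords_def mem_Collect_eq by (intro exI[of _ ?a] exI[of _ k] exI[of _ l]) simp
    then show "\<exists>q'\<in>generated_algebra (rep_coords X). \<forall>\<phi>\<in>moment_zero_set X \<epsilon>. b (pull X \<sigma> \<phi>) = q' \<phi>"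
      by (intro bexI[of _ "\<lambda>\<phi>. \<phi> ?a $$ (k, l)"] generated_algebra.gen) (auto simp: b pull_def)
  qed
  then obtain q' where q': "q' \<in> generated_algebra (rep_coords X)"
    "\<And>\<phi>. \<phi> \<in> moment_zero_set X \<epsilon> \<Longrightarrow> q (pull X \<sigma> \<phi>) = q' \<phi>" by blast
  have "(\<lambda>\<phi>\<in>moment_zero_set X \<epsilon>. f (pull X \<sigma> \<phi>)) = restrict q' (moment_zero_set X \<epsilon>)"
    using q'(2) pm by (auto simp: q(2))
  then have "(\<lambda>\<phi>\<in>moment_zero_set X \<epsilon>. f (pull X \<sigma> \<phi>)) \<in> regular (moment_zero_variety X \<epsilon>)"
    using q'(1) by (simp add: regular_moment_zero_variety)
  moreover have "f (pull X \<sigma> \<phi>') = f (pull X \<sigma> \<phi>)"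
    if "\<phi> \<in> moment_zero_set X \<epsilon>" "\<phi>' \<in> moment_zero_set X \<epsilon>" "gauge_eq X \<phi> \<phi>'" for \<phi> \<phi>'
    using f pm that pull_gauge_eq[OF X \<sigma> that(3)] by (simp add: invariant_funs_iff[OF X])
  ultimately show ?thesis by (simp add: invariant_funs_iff[OF X])
qed

text \<open>The automorphism permutes the summands, and the signs agree because
  \<open>\<epsilon>\<close> is invariant under it.\<close>

lemma pull_symplectic:
  assumes X: "valid_triple X" and \<sigma>: "diagram_aut X \<sigma>"
    and \<epsilon>: "\<And>a. a \<in> arrows X \<Longrightarrow> \<epsilon> (map_prod \<sigma> \<sigma> a) = \<epsilon> a"
  shows "symp_form X \<epsilon> (pull X \<sigma> \<phi>) (pull X \<sigma> \<psi>) = symp_form X \<epsilon> \<phi> \<psi>"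
  unfolding symp_form_def
proof (rule sum.reindex_bij_betw[OF bij_betw_arrows[OF X \<sigma>], symmetric, THEN trans])
  show "(\<Sum>a\<in>arrows X. of_int (\<epsilon> (map_prod \<sigma> \<sigma> a)) *
        mat_tr (pull X \<sigma> \<phi> (map_prod \<sigma> \<sigma> a) * pull X \<sigma> \<psi> (prod.swap (map_prod \<sigma> \<sigma> a)))) =
    (\<Sum>a\<in>arrows X. of_int (\<epsilon> a) * mat_tr (\<phi> a * \<psi> (prod.swap a)))"
    using diagram_autD(2)[OF \<sigma>]
    by (intro sum.cong refl)
      (auto simp: \<epsilon> swap_map_prod pull_def swap_arrows map_prod_inv[OF diagram_autD(1)[OF \<sigma>]]
        simp del: map_prod_simp)
qed

lemma pull_comp:
  assumes X: "valid_triple X" and \<sigma>: "diagram_aut X \<sigma>" and \<tau>: "diagram_aut X \<tau>"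
  shows "pull X (\<sigma> \<circ> \<tau>) \<phi> = pull X \<sigma> (pull X \<tau> \<phi>)"
proof -
  have "perm_inv (\<sigma> \<circ> \<tau>) = perm_inv \<tau> \<circ> perm_inv \<sigma>"
    using diagram_autD(1)[OF \<sigma>] diagram_autD(1)[OF \<tau>] by (rule o_inv_distrib)
  then show ?thesis
    using diagram_autD(2)[OF diagram_aut_inv[OF X \<sigma>]] by (auto simp: pull_def fun_eq_iff)
qed

lemma pull_id:
  assumes "\<phi> \<in> rep_space X"
  shows "pull X id \<phi> = \<phi>"
proof
  fix a show "pull X id \<phi> a = \<phi> a"
    using PiE_arb[OF assms[unfolded rep_space_def], of a] by (simp add: pull_def map_prod.id)
qed

definition point :: "complex \<Rightarrow> complex \<Rightarrow> complex vec" where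
  "point x y = vec 2 (\<lambda>i. if i = 0 then x else y)"

lemma point_simps [simp]: "point x y \<in> carrier_vec 2" "point x y $ 0 = x" "point x y $ 1 = y" "point x y $ Suc 0 = y"
  by (simp_all add: point_def)

lemma plane_eqI:
  assumes "v \<in> carrier_vec 2" "w \<in> carrier_vec 2" "v $ 0 = w $ 0" "v $ 1 = w $ 1"
  shows "v = w"
  by (rule eq_vecI) (use assms in \<open>auto simp: less_2_cases'\<close>)

lemma act_coords:
  assumes g: "g \<in> carrier SU2" and v: "v \<in> carrier_vec 2"
  shows "(g *\<^sub>v v) $ 0 = act_fst g (v $ 0) (v $ 1)" "(g *\<^sub>v v) $ 1 = act_snd g (v $ 0) (v $ 1)"
    "g *\<^sub>v v \<in> carrier_vec 2" "(g *\<^sub>v v) $ Suc 0 = act_snd g (v $ 0) (v $ 1)"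
proof -
  obtain a b c d where "g = mat22 a b c d" using mat22_eqI[OF SU2_carrier_mat[OF g]] by blast
  then show "(g *\<^sub>v v) $ 0 = act_fst g (v $ 0) (v $ 1)" "(g *\<^sub>v v) $ 1 = act_snd g (v $ 0) (v $ 1)"
    "(g *\<^sub>v v) $ Suc 0 = act_snd g (v $ 0) (v $ 1)"
    using mat22_vec[OF v, of a b c d] by (simp_all only: act_fst_def act_snd_def mat22_simps)
  show "g *\<^sub>v v \<in> carrier_vec 2" by (rule mult_mat_vec_carrier[OF SU2_carrier_mat[OF g] v])
qed

lemma SU2_act_assoc:
  "g \<in> carrier SU2 \<Longrightarrow> h \<in> carrier SU2 \<Longrightarrow> v \<in> carrier_vec 2 \<Longrightarrow> (g * h) *\<^sub>v v = g *\<^sub>v (h *\<^sub>v v)"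
  using assoc_mult_mat_vec[of g 2 2 h 2 v] SU2_carrier_mat by blast

text \<open>Adds the group \<Omega>. \<open>twisted\<close> says that the permutation which the
  given \<open>\<alpha>\<close> assigns to the coset of \<open>g\<close> is the one that
  \<open>g\<close> realizes on the slice.\<close>

locale mckay_action = mckay_slice X \<epsilon> A1 A2
  for X \<epsilon> A1 A2 +
  fixes \<alpha> :: "complex mat set \<Rightarrow> nat \<Rightarrow> nat"
  assumes diag: "diagram_action X \<alpha>"
    and big: "subgroup (big_grp X) SU2"
    and normal: "small_grp X \<lhd> SU2\<lparr>carrier := big_grp X\<rparr>"
    and auts: "\<And>\<sigma>. \<sigma> \<in> diagram_perms X \<Longrightarrow> diagram_aut X \<sigma>"
    and eps_inv: "\<And>\<sigma> a. \<sigma> \<in> diagram_perms X \<Longrightarrow> a \<in> arrows X \<Longrightarrow> \<epsilon> (map_prod \<sigma> \<sigma> a) = \<epsilon> a"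
    and twisted: "\<And>g. g \<in> big_grp X \<Longrightarrow> twisted_equivariant X A1 A2 g (\<alpha> (small_grp X #>\<^bsub>SU2\<^esub> g))"
begin

lemma small_subgroup: "subgroup (small_grp X) SU2"
  using SU2.incl_subgroup[OF big normal_imp_subgroup[OF normal]] .

lemma small_SU2: "g \<in> small_grp X \<Longrightarrow> g \<in> carrier SU2"
  using small by blast

lemma big_SU2: "g \<in> big_grp X \<Longrightarrow> g \<in> carrier SU2"
  using subgroup.subset[OF big] by blast

abbreviation \<Phi> where "\<Phi> v \<equiv> drop_rep X (slice (v $ 0) (v $ 1))"
abbreviation M0 where "M0 \<equiv> moment_zero_set X \<epsilon>"
abbreviation Inv where "Inv \<equiv> invariant_funs X \<epsilon>"

lemma slice_in_M0: "\<Phi> v \<in> M0"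
  by (rule drop_rep_in_moment_zero_set[OF padded_slice moment_vanishes_slice])

lemma lift_slice: "a \<in> arrows X \<Longrightarrow> lift_rep X (\<Phi> v) a = slice (v $ 0) (v $ 1) a"
  by (rule lift_drop_rep[OF padded_slice])

lemma slice_polynomial:
  assumes "f \<in> generated_algebra (rep_coords X)"
  shows "\<exists>q\<in>generated_algebra plane_coords. \<forall>v\<in>carrier_vec 2. f (\<Phi> v) = q v"
proof (rule generated_algebra_substitute[OF _ assms])
  fix b assume "b \<in> rep_coords X"
  then obtain a k l where b: "b = (\<lambda>\<phi>. \<phi> a $$ (k, l))" "a \<in> arrows X" "k < d (snd a)" "l < d (fst a)"
    by (auto simp: rep_coords_def)
  have "b (\<Phi> v) = v $ 0 * ent (A1 a) k l + v $ 1 * ent (A2 a) k l" for v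
    using b by (simp add: drop_rep_def to_mat_def slice_rep_def)
  moreover have "(\<lambda>v. v $ 0) \<in> generated_algebra plane_coords" "(\<lambda>v. v $ 1) \<in> generated_algebra plane_coords"
    by (auto simp: plane_coords_def intro: generated_algebra.gen)
  then have "(\<lambda>v. v $ 0 * ent (A1 a) k l + v $ 1 * ent (A2 a) k l) \<in> generated_algebra plane_coords"
    by (intro generated_algebra.add generated_algebra.mult generated_algebra.const)
  ultimately show "\<exists>q\<in>generated_algebra plane_coords. \<forall>v\<in>carrier_vec 2. b (\<Phi> v) = q v" by auto
qed

lemma slice_translate_gauge_eq:
  assumes g: "g \<in> carrier SU2" "twisted_equivariant X A1 A2 g \<sigma>" and \<sigma>: "diagram_aut X \<sigma>" and v: "v \<in> carrier_vec 2"
  shows "gauge_eq X (pull X \<sigma> (\<Phi> v)) (\<Phi> (g *\<^sub>v v))"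
proof -
  obtain h h' where h: "gauge_pair X h h'" "\<And>x y a. a \<in> arrows X \<Longrightarrow>
     slice (act_fst g x y) (act_snd g x y) (map_prod \<sigma> \<sigma> a) = pair_act h h' (slice x y) a"
    using g(2) unfolding twisted_equivariant_def by blast
  note i = diagram_autD[OF diagram_aut_inv[OF valid \<sigma>]]
  have "gauge_pair X (h \<circ> perm_inv \<sigma>) (h' \<circ> perm_inv \<sigma>)"
    unfolding gauge_pair_def
  proof
    fix j assume j: "j \<in> verts X"
    show "un (d j) * (h \<circ> perm_inv \<sigma>) j = (h \<circ> perm_inv \<sigma>) j \<and>
        (h \<circ> perm_inv \<sigma>) j * un (d j) = (h \<circ> perm_inv \<sigma>) j \<and>
        un (d j) * (h' \<circ> perm_inv \<sigma>) j = (h' \<circ> perm_inv \<sigma>) j \<and>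
        (h' \<circ> perm_inv \<sigma>) j * un (d j) = (h' \<circ> perm_inv \<sigma>) j \<and>
        (h \<circ> perm_inv \<sigma>) j * (h' \<circ> perm_inv \<sigma>) j = un (d j) \<and>
        (h' \<circ> perm_inv \<sigma>) j * (h \<circ> perm_inv \<sigma>) j = un (d j)"
      using h(1)[unfolded gauge_pair_def, rule_format, OF i(3)[OF j]] by (simp only: i(4)[OF j] o_apply)
  qed
  moreover have "lift_rep X (\<Phi> (g *\<^sub>v v)) a = pair_act (h \<circ> perm_inv \<sigma>) (h' \<circ> perm_inv \<sigma>) (lift_rep X (pull X \<sigma> (\<Phi> v))) a"
    if a: "a \<in> arrows X" for a
  proof -
    let ?b = "map_prod (perm_inv \<sigma>) (perm_inv \<sigma>) a"
    have b: "?b \<in> arrows X" "map_prod \<sigma> \<sigma> ?b = a"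
      using i(2)[OF a] map_prod_inv(1)[OF diagram_autD(1)[OF \<sigma>]] by auto
    have "lift_rep X (\<Phi> (g *\<^sub>v v)) a = slice (act_fst g (v $ 0) (v $ 1)) (act_snd g (v $ 0) (v $ 1)) (map_prod \<sigma> \<sigma> ?b)"
      by (simp only: lift_drop_rep[OF padded_slice a] b(2) act_coords[OF g(1) v])
    also have "\<dots> = pair_act h h' (slice (v $ 0) (v $ 1)) ?b" by (rule h(2)[OF b(1)])
    also have "\<dots> = pair_act (h \<circ> perm_inv \<sigma>) (h' \<circ> perm_inv \<sigma>) (lift_rep X (pull X \<sigma> (\<Phi> v))) a"
      using lift_slice[OF b(1), of v] by (simp add: lift_pull[OF valid \<sigma> a] pair_act_def)
    finally show ?thesis .
  qed
  ultimately show ?thesis unfolding gauge_eq_def by blast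
qed

lemma diagram_aut_id: "diagram_aut X id"
  by (auto simp: diagram_aut_def map_prod.id)

lemma slice_orbit_gauge_eq:
  assumes g: "g \<in> small_grp X" and v: "v \<in> carrier_vec 2"
  shows "gauge_eq X (\<Phi> v) (\<Phi> (g *\<^sub>v v))"
  using slice_translate_gauge_eq[OF small_SU2[OF g] equivariant[OF g] diagram_aut_id v]
  by (simp add: pull_id drop_rep_in_rep_space)

text \<open>By \<open>moment_zero_dichotomy\<close> a point of the zero fibre is gauge equivalent to
  a slice point or nilpotent; in the latter case invariants do not separate it from 0, which is the
  slice point at the origin.\<close>

lemma every_point_equivalent_to_slice:
  assumes \<phi>: "\<phi> \<in> M0"
  shows "\<exists>v\<in>carrier_vec 2. \<forall>f\<in>Inv. f (\<Phi> v) = f \<phi>"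
proof -
  have r: "\<phi> \<in> rep_space X" using \<phi> by (simp add: moment_zero_set_def)
  have m: "moment_vanishes X \<epsilon> (lift_rep X \<phi>)" using \<phi> moment_zero_set_iff[OF r] by blast
  consider x y h h' where "gauge_pair X h h'" "\<forall>a\<in>arrows X. lift_rep X \<phi> a = pair_act h h' (slice x y) a"
    | k where "nilpotent_rep X (lift_rep X \<phi>) k"
    using moment_zero_dichotomy[OF padded_lift_rep m] by blast
  then show ?thesis
  proof cases
    case 1
    have "gauge_eq X (\<Phi> (point x y)) \<phi>"
      unfolding gauge_eq_def using 1 lift_slice[of _ "point x y"] by (intro exI[of _ h] exI[of _ h']) (simp add: pair_act_def)
    then show ?thesis
      using \<phi> slice_in_M0[of "point x y"] invariant_funs_iff[OF valid]
      by (intro bexI[of _ "point x y"]) auto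
  next
    case 2
    have "nilpotent_rep X (lift_rep X \<phi>) (Suc k)"
      using 2 kernel_filtration_mono unfolding nilpotent_rep_def by blast
    from invariant_fun_nilpotent[OF valid _ padded_lift_rep m this]
    have "f \<phi> = f (drop_rep X (\<lambda>_. 0))" if "f \<in> Inv" for f
      using that by (simp add: drop_lift_rep[OF r])
    moreover have "\<Phi> (point 0 0) = drop_rep X (\<lambda>_. 0)"
      by (rule drop_rep_cong) (simp add: slice_rep_def sc_simps)
    ultimately show ?thesis using point_simps(1)[of 0 0] by metis
  qed
qed

subsection \<open>Invariant polynomials extend to invariant functions\<close>

text \<open>\<open>Z \<psi>\<close> is the polynomial \<open>p\<close> evaluated at the two commuting operators given by \<open>\<psi>\<close>.\<close>

definition realizes :: "(complex vec \<Rightarrow> complex) \<Rightarrow> ((nat \<times> nat \<Rightarrow> m3) \<Rightarrow> (nat \<Rightarrow> m3) \<Rightarrow> nat \<Rightarrow> m3) \<Rightarrow> bool" where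
  "realizes p Z \<longleftrightarrow> (\<forall>\<psi>. fv.lin (Z \<psi>)) \<and>
     (\<forall>\<psi> T. padded_rep X \<psi> \<longrightarrow> T \<in> W \<longrightarrow> Z \<psi> T \<in> W) \<and>
     (\<forall>\<psi> T. \<forall>v\<in>carrier_vec 2. joint_eigen \<psi> T (v $ 0) (v $ 1) \<longrightarrow> Z \<psi> T = (\<lambda>i. sc (p v) * T i)) \<and>
     (\<forall>\<psi> \<psi>' h h' T. gauge_pair X h h' \<longrightarrow> padded_rep X \<psi> \<longrightarrow> padded_rep X \<psi>' \<longrightarrow>
        (\<forall>a\<in>arrows X. \<psi>' a = pair_act h h' \<psi> a) \<longrightarrow> T \<in> W \<longrightarrow>
        Z \<psi>' (\<lambda>i. h i * T i) = (\<lambda>i. h i * Z \<psi> T i)) \<and>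
     (\<forall>Tf. (\<forall>i k l. (\<lambda>\<phi>. ent (Tf \<phi> i) k l) \<in> generated_algebra (rep_coords X)) \<longrightarrow>
        (\<forall>i k l. (\<lambda>\<phi>. ent (Z (lift_rep X \<phi>) (Tf \<phi>) i) k l) \<in> generated_algebra (rep_coords X)))"

lemma realizesD:
  assumes "realizes p Z"
  shows "fv.lin (Z \<psi>)" "padded_rep X \<psi> \<Longrightarrow> T \<in> W \<Longrightarrow> Z \<psi> T \<in> W"
    "v \<in> carrier_vec 2 \<Longrightarrow> joint_eigen \<psi> T (v $ 0) (v $ 1) \<Longrightarrow> Z \<psi> T = (\<lambda>i. sc (p v) * T i)"
    "gauge_pair X h h' \<Longrightarrow> padded_rep X \<psi> \<Longrightarrow> padded_rep X \<psi>' \<Longrightarrow>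
        (\<And>a. a \<in> arrows X \<Longrightarrow> \<psi>' a = pair_act h h' \<psi> a) \<Longrightarrow> T \<in> W \<Longrightarrow>
        Z \<psi>' (\<lambda>i. h i * T i) = (\<lambda>i. h i * Z \<psi> T i)"
    "(\<And>i k l. (\<lambda>\<phi>. ent (Tf \<phi> i) k l) \<in> generated_algebra (rep_coords X)) \<Longrightarrow>
        (\<lambda>\<phi>. ent (Z (lift_rep X \<phi>) (Tf \<phi>) i) k l) \<in> generated_algebra (rep_coords X)"
proof -
  note r = assms[unfolded realizes_def]
  show "fv.lin (Z \<psi>)" using r by blast
  show "padded_rep X \<psi> \<Longrightarrow> T \<in> W \<Longrightarrow> Z \<psi> T \<in> W" using r by blast
  show "v \<in> carrier_vec 2 \<Longrightarrow> joint_eigen \<psi> T (v $ 0) (v $ 1) \<Longrightarrow> Z \<psi> T = (\<lambda>i. sc (p v) * T i)"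
    using r by blast
  show "gauge_pair X h h' \<Longrightarrow> padded_rep X \<psi> \<Longrightarrow> padded_rep X \<psi>' \<Longrightarrow>
        (\<And>a. a \<in> arrows X \<Longrightarrow> \<psi>' a = pair_act h h' \<psi> a) \<Longrightarrow> T \<in> W \<Longrightarrow>
        Z \<psi>' (\<lambda>i. h i * T i) = (\<lambda>i. h i * Z \<psi> T i)"
    using r[THEN conjunct2, THEN conjunct2, THEN conjunct2, THEN conjunct1, rule_format, of h h' \<psi> \<psi>' T] by blast
  show "(\<And>i k l. (\<lambda>\<phi>. ent (Tf \<phi> i) k l) \<in> generated_algebra (rep_coords X)) \<Longrightarrow>
        (\<lambda>\<phi>. ent (Z (lift_rep X \<phi>) (Tf \<phi>) i) k l) \<in> generated_algebra (rep_coords X)"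
    using r[THEN conjunct2, THEN conjunct2, THEN conjunct2, THEN conjunct2, rule_format, of Tf i k l] by blast
qed

lemma polynomial_entries_mult:
  assumes "\<And>k l. (\<lambda>\<phi>. ent (F \<phi>) k l) \<in> generated_algebra B" "\<And>k l. (\<lambda>\<phi>. ent (G \<phi>) k l) \<in> generated_algebra B"
  shows "(\<lambda>\<phi>. ent (F \<phi> * G \<phi>) k l) \<in> generated_algebra B"
  unfolding ent_mult by (intro generated_algebra_sum generated_algebra.mult assms)

lemma realizes_coord:
  assumes C: "\<And>a. a \<in> arrows X \<Longrightarrow> C a * un (d (snd a)) = C a"
    and e: "\<And>\<psi> T v. v \<in> carrier_vec 2 \<Longrightarrow> joint_eigen \<psi> T (v $ 0) (v $ 1) \<Longrightarrow> path_op X C \<psi> T = (\<lambda>i. sc (p v) * T i)"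
  shows "realizes p (path_op X C)"
  unfolding realizes_def
proof (intro conjI allI impI ballI)
  show "fv.lin (path_op X C \<psi>)" for \<psi> by (rule lin_path_op)
  show "path_op X C \<psi> T \<in> W" if "padded_rep X \<psi>" for \<psi> T using path_op_closed[OF that C] .
  show "path_op X C \<psi> T = (\<lambda>i. sc (p v) * T i)" if "v \<in> carrier_vec 2" "joint_eigen \<psi> T (v $ 0) (v $ 1)" for \<psi> T v
    by (rule e[OF that])
next
  fix \<psi> \<psi>' h h' T
  assume h: "gauge_pair X h h'" "\<forall>a\<in>arrows X. \<psi>' a = pair_act h h' \<psi> a" and T: "T \<in> W"
  show "path_op X C \<psi>' (\<lambda>i. h i * T i) = (\<lambda>i. h i * path_op X C \<psi> T i)"
  proof
    fix j
    have "\<psi>' a * (h (fst a) * T (fst a)) * C a = h j * (\<psi> a * T (fst a) * C a)" if a: "a \<in> in_arrows X j" for a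
    proof -
      have "\<psi>' a * (h (fst a) * T (fst a)) * C a = h j * (\<psi> a * ((h' (fst a) * h (fst a)) * T (fst a)) * C a)"
        using h(2) in_arrowsD(1,2)[OF a] by (simp add: pair_act_def mult.assoc)
      also have "(h' (fst a) * h (fst a)) * T (fst a) = T (fst a)"
        using h(1) in_arrowsD(3)[OF a] W_pad(1)[OF T] by (simp add: gauge_pair_def)
      finally show ?thesis .
    qed
    then show "path_op X C \<psi>' (\<lambda>i. h i * T i) j = h j * path_op X C \<psi> T j"
      by (simp add: path_op_def sum_distrib_left)
  qed
next
  fix Tf :: "quiver_rep \<Rightarrow> nat \<Rightarrow> m3" and i k l :: nat
  assume Tf: "\<forall>i k l. (\<lambda>\<phi>. ent (Tf \<phi> i) k l) \<in> generated_algebra (rep_coords X)"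
  show "(\<lambda>\<phi>. ent (path_op X C (lift_rep X \<phi>) (Tf \<phi>) i) k l) \<in> generated_algebra (rep_coords X)"
  proof (cases "i \<in> verts X")
    case True
    have "(\<lambda>\<phi>. \<Sum>a\<in>in_arrows X i. ent (lift_rep X \<phi> a * Tf \<phi> (fst a) * C a) k l) \<in> generated_algebra (rep_coords X)"
      by (intro generated_algebra_sum polynomial_entries_mult generated_algebra.const ent_lift_rep_polynomial in_arrowsD(1))
        (use Tf in blast)+
    then show ?thesis using True by (simp add: path_op_def ent_sum)
  qed (simp add: path_op_def generated_algebra.const)
qed

text \<open>Coordinates are realized by the two operators, sums by sums and products by composition.
  \<open>Z\<close> depends on the way \<open>p\<close> is written, since it acts for all padded
  \<open>\<psi>\<close> and the operators are known to commute only on the zero fibre; existence is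
  all that is claimed.\<close>

lemma polynomial_realized:
  assumes "p \<in> generated_algebra plane_coords"
  shows "\<exists>Z. realizes p Z"
  using assms
proof induction
  case (const c)
  have "realizes (\<lambda>_. c) (\<lambda>\<psi> T i. sc c * T i)"
    unfolding realizes_def
  proof (intro conjI allI impI ballI)
    show "fv.lin (\<lambda>T i. sc c * T i)"
      by (simp add: fv.lin_def fun_eq_iff distrib_left sc_sc mult.commute)
    show "(\<lambda>i. sc c * T i) \<in> W" if "T \<in> W" for T
      using fv.subspace_scale[OF subspace_test_space that] .
    show "(\<lambda>i. sc c * (h i * T i)) = (\<lambda>i. h i * (sc c * T i))" for h T :: "nat \<Rightarrow> m3"
      by (simp add: sc_commute_left)
    show "(\<lambda>\<phi>. ent (sc c * Tf \<phi> i) k l) \<in> generated_algebra (rep_coords X)"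
      if "\<forall>i k l. (\<lambda>\<phi>. ent (Tf \<phi> i) k l) \<in> generated_algebra (rep_coords X)"
      for Tf :: "quiver_rep \<Rightarrow> nat \<Rightarrow> m3" and i k l :: nat
      using that by (simp add: generated_algebra.mult generated_algebra.const)
  qed simp
  then show ?case by blast
next
  case (gen p)
  then consider "p = (\<lambda>v. v $ 0)" | "p = (\<lambda>v. v $ 1)" by (auto simp: plane_coords_def)
  then show ?case
  proof cases
    case 1
    then have "realizes p (path_op X C1)"
      by (intro realizes_coord) (auto simp: C_pad joint_eigen_def)
    then show ?thesis by blast
  next
    case 2
    then have "realizes p (path_op X C2)"
      by (intro realizes_coord) (auto simp: C_pad joint_eigen_def)
    then show ?thesis by blast
  qed
next
  case (add p q)
  then obtain Z Z' where Z: "realizes p Z" "realizes q Z'" by blast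
  note D = realizesD[OF Z(1)] and D' = realizesD[OF Z(2)]
  have "realizes (\<lambda>v. p v + q v) (\<lambda>\<psi> T i. Z \<psi> T i + Z' \<psi> T i)"
    unfolding realizes_def
  proof (intro conjI allI impI ballI)
    show "fv.lin (\<lambda>T i. Z \<psi> T i + Z' \<psi> T i)" for \<psi>
      using D(1)[of \<psi>] D'(1)[of \<psi>] by (simp add: fv.lin_def fun_eq_iff distrib_left)
    show "(\<lambda>i. Z \<psi> T i + Z' \<psi> T i) \<in> W" if "padded_rep X \<psi>" "T \<in> W" for \<psi> T
      using fv.subspace_add[OF subspace_test_space D(2)[OF that] D'(2)[OF that]] by (simp add: plus_fun_def)
    show "(\<lambda>i. Z \<psi> T i + Z' \<psi> T i) = (\<lambda>i. sc (p v + q v) * T i)"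
      if "v \<in> carrier_vec 2" "joint_eigen \<psi> T (v $ 0) (v $ 1)" for \<psi> T v
      using D(3)[OF that] D'(3)[OF that] by (simp add: sc_simps distrib_right)
    show "(\<lambda>i. Z \<psi>' (\<lambda>i. h i * T i) i + Z' \<psi>' (\<lambda>i. h i * T i) i) = (\<lambda>i. h i * (Z \<psi> T i + Z' \<psi> T i))"
      if "gauge_pair X h h'" "padded_rep X \<psi>" "padded_rep X \<psi>'" "\<forall>a\<in>arrows X. \<psi>' a = pair_act h h' \<psi> a" "T \<in> W"
      for \<psi> \<psi>' h h' T
      using D(4)[OF that(1-3) _ that(5)] D'(4)[OF that(1-3) _ that(5)] that(4) by (simp add: distrib_left)
    show "(\<lambda>\<phi>. ent (Z (lift_rep X \<phi>) (Tf \<phi>) i + Z' (lift_rep X \<phi>) (Tf \<phi>) i) k l) \<in> generated_algebra (rep_coords X)"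
      if "\<forall>i k l. (\<lambda>\<phi>. ent (Tf \<phi> i) k l) \<in> generated_algebra (rep_coords X)" for Tf i k l
      using D(5)[of Tf i k l] D'(5)[of Tf i k l] that by (simp add: generated_algebra.add)
  qed
  then show ?case by blast
next
  case (mult p q)
  then obtain Z Z' where Z: "realizes p Z" "realizes q Z'" by blast
  note D = realizesD[OF Z(1)] and D' = realizesD[OF Z(2)]
  have "realizes (\<lambda>v. p v * q v) (\<lambda>\<psi> T. Z \<psi> (Z' \<psi> T))"
    unfolding realizes_def
  proof (intro conjI allI impI ballI)
    show "fv.lin (\<lambda>T. Z \<psi> (Z' \<psi> T))" for \<psi>
      using D(1)[of \<psi>] D'(1)[of \<psi>] by (simp add: fv.lin_def)
    show "Z \<psi> (Z' \<psi> T) \<in> W" if "padded_rep X \<psi>" "T \<in> W" for \<psi> T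
      using D(2)[OF that(1) D'(2)[OF that]] .
    show "Z \<psi> (Z' \<psi> T) = (\<lambda>i. sc (p v * q v) * T i)"
      if "v \<in> carrier_vec 2" "joint_eigen \<psi> T (v $ 0) (v $ 1)" for \<psi> T v
      using D(3)[OF that] D'(3)[OF that] fv.lin_scale[OF D(1)[of \<psi>], of "q v" T]
      by (simp add: sc_sc mult.commute)
    show "Z \<psi>' (Z' \<psi>' (\<lambda>i. h i * T i)) = (\<lambda>i. h i * Z \<psi> (Z' \<psi> T) i)"
      if "gauge_pair X h h'" "padded_rep X \<psi>" "padded_rep X \<psi>'" "\<forall>a\<in>arrows X. \<psi>' a = pair_act h h' \<psi> a" "T \<in> W"
      for \<psi> \<psi>' h h' T
      using D(4)[OF that(1-3) _ D'(2)[OF that(2,5)]] D'(4)[OF that(1-3) _ that(5)] that(4) by simp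
    show "(\<lambda>\<phi>. ent (Z (lift_rep X \<phi>) (Z' (lift_rep X \<phi>) (Tf \<phi>)) i) k l) \<in> generated_algebra (rep_coords X)"
      if "\<forall>i k l. (\<lambda>\<phi>. ent (Tf \<phi> i) k l) \<in> generated_algebra (rep_coords X)" for Tf i k l
      using D(5)[of "\<lambda>\<phi>. Z' (lift_rep X \<phi>) (Tf \<phi>)" i k l] D'(5)[of Tf] that by blast
  qed
  then show ?case by blast
qed

text \<open>Supported at the vertex 0, where the space is a line: a gauge transformation acts on
  this family by a number, so a matrix coefficient taken there can be gauge invariant.\<close>

definition base_vector :: "nat \<Rightarrow> m3" where
  "base_vector i = (if i = 0 then un 1 else 0)"

lemma zero_vert: "0 \<in> verts X" "d 0 = 1"
  using valid dims_imaginary_root(1)[OF valid] by (cases X; simp)+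

lemma base_vector_W: "base_vector \<in> W"
  using zero_vert by (auto simp: base_vector_def test_space_def un_idem)

text \<open>For v \<noteq> 0 the joint eigenvectors with eigenvalues g v span W, and p(g v) = p(v),
  so \<open>Z\<close> is the scalar p(v) on W. At v = 0 the slice point is zero and every family is
  a joint eigenvector with eigenvalue 0.\<close>

lemma realized_on_slice:
  assumes Z: "realizes p Z" and p: "\<And>g v. g \<in> small_grp X \<Longrightarrow> v \<in> carrier_vec 2 \<Longrightarrow> p (g *\<^sub>v v) = p v"
    and v: "v \<in> carrier_vec 2" and T: "T \<in> W"
  shows "Z (lift_rep X (\<Phi> v)) T = (\<lambda>i. sc (p v) * T i)"
proof (cases "v $ 0 \<noteq> 0 \<or> v $ 1 \<noteq> 0")
  case True
  let ?\<psi> = "lift_rep X (\<Phi> v)" and ?I = "\<lambda>i. if i \<in> verts X then un (d i) else 0"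
  have m: "slice_morphism ?\<psi> ?I (v $ 0) (v $ 1)"
    using identity_slice_morphism lift_slice by (simp add: slice_morphism_def)
  obtain S R where S: "finite S" "S \<subseteq> small_grp X"
    "\<And>g. g \<in> small_grp X \<Longrightarrow> (\<lambda>i. ?I i * R g i) \<in> W"
    "\<And>g. g \<in> small_grp X \<Longrightarrow> slice_morphism ?\<psi> (\<lambda>i. ?I i * R g i) (act_fst g (v $ 0) (v $ 1)) (act_snd g (v $ 0) (v $ 1))"
    "\<And>U. U \<in> W \<Longrightarrow> \<exists>c. U = (\<Sum>g\<in>S. (\<lambda>i. sc (c g) * (?I i * R g i)))"
    by (rule translates_span[OF padded_lift_rep identity_in_W identity_nz m True], rule that, assumption+)
  define e where "e g = (\<lambda>i. ?I i * R g i)" for g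
  note S' = S(3-5)[folded e_def]
  have ev: "Z ?\<psi> (e g) = (\<lambda>i. sc (p v) * e g i)" if g: "g \<in> small_grp X" for g
    using realizesD(3)[OF Z act_coords(3)[OF small_SU2[OF g] v]] p[OF g v]
      morphism_imp_joint_eigen[OF S'(1)[OF g] S'(2)[OF g]]
    by (simp add: act_coords[OF small_SU2[OF g] v])
  obtain c where c: "T = (\<Sum>g\<in>S. (\<lambda>i. sc (c g) * e g i))" using S'(3)[OF T] by (auto simp: e_def)
  have "Z ?\<psi> T = (\<Sum>g\<in>S. (\<lambda>i. sc (c g) * (sc (p v) * e g i)))"
    unfolding c fv.lin_sum[OF realizesD(1)[OF Z]]
    by (rule sum.cong) (use ev S(2) in \<open>auto simp: fv.lin_scale[OF realizesD(1)[OF Z]]\<close>)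
  also have "\<dots> = (\<lambda>i. sc (p v) * T i)"
    unfolding c by (simp add: fun_eq_iff sum_fun_apply sum_distrib_left sc_sc mult.commute)
  finally show ?thesis .
next
  case False
  have "joint_eigen (lift_rep X (\<Phi> v)) T (v $ 0) (v $ 1)"
    using False arrows_ends[OF valid] lift_slice[of _ v]
    by (intro morphism_imp_joint_eigen[OF T]) (simp add: slice_morphism_def slice_rep_def sc_simps)
  from realizesD(3)[OF Z v this] show ?thesis .
qed

text \<open>The coefficient of \<open>Z\<close> at \<open>base_vector\<close> is polynomial in the
  representation. A gauge transformation multiplies \<open>base_vector\<close> and the component at
  0 of its image by the same nonzero number, so the coefficient is invariant, and on the slice it is
  \<open>p\<close> by \<open>realized_on_slice\<close>.\<close>

lemma invariant_polynomial_extends: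
  assumes p: "p \<in> generated_algebra plane_coords"
    and inv: "\<And>g v. g \<in> small_grp X \<Longrightarrow> v \<in> carrier_vec 2 \<Longrightarrow> p (g *\<^sub>v v) = p v"
  shows "\<exists>f\<in>Inv. \<forall>v\<in>carrier_vec 2. f (\<Phi> v) = p v"
proof -
  obtain Z where Z: "realizes p Z" using polynomial_realized[OF p] by blast
  define q where "q \<phi> = ent (Z (lift_rep X \<phi>) base_vector 0) 0 0" for \<phi>
  have poly: "q \<in> generated_algebra (rep_coords X)"
    unfolding q_def by (rule realizesD(5)[OF Z]) (rule generated_algebra.const)
  have "q \<phi>' = q \<phi>" if "gauge_eq X \<phi> \<phi>'" for \<phi> \<phi>'
  proof -
    obtain h h' where h: "gauge_pair X h h'" "\<And>a. a \<in> arrows X \<Longrightarrow> lift_rep X \<phi>' a = pair_act h h' (lift_rep X \<phi>) a"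
      using \<open>gauge_eq X \<phi> \<phi>'\<close> by (auto simp: gauge_eq_def)
    define c where "c = ent (h 0) 0 0"
    have h0: "un 1 * h 0 = h 0" "h 0 * un 1 = h 0" "h' 0 * h 0 = un 1"
      using h(1) zero_vert by (auto simp: gauge_pair_def)
    have hc: "h 0 = sc c * un 1"
      using h0(1,2) unfolding un_left_iff un_right_iff
      by (intro m3_eqI) (auto simp: c_def ent_un less_3_cases)
    have "c \<noteq> 0"
    proof
      assume "c = 0"
      then have "ent (un 1) 0 0 = ent 0 0 0" using h0(3) hc by (simp add: sc_simps)
      then show False by (simp add: ent_un)
    qed
    have "(\<lambda>i. h i * base_vector i) = (\<lambda>i. sc c * base_vector i)"
      by (auto simp: base_vector_def hc mult.assoc un_idem)
    then have "(\<lambda>i. sc c * Z (lift_rep X \<phi>') base_vector i) = (\<lambda>i. h i * Z (lift_rep X \<phi>) base_vector i)"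
      using realizesD(4)[OF Z h(1) padded_lift_rep padded_lift_rep h(2) base_vector_W]
        fv.lin_scale[OF realizesD(1)[OF Z], of "lift_rep X \<phi>'" c base_vector] by simp
    from fun_cong[OF this, of 0]
    have "sc c * Z (lift_rep X \<phi>') base_vector 0 = sc c * (un 1 * Z (lift_rep X \<phi>) base_vector 0)"
      by (simp add: hc mult.assoc)
    from arg_cong[OF this, of "\<lambda>M. ent M 0 0"] have "c * q \<phi>' = c * q \<phi>"
      by (simp add: q_def ent_un_left)
    then show ?thesis using \<open>c \<noteq> 0\<close> by simp
  qed
  then have "restrict q M0 \<in> Inv"
    using poly by (auto simp: invariant_funs_iff[OF valid] regular_moment_zero_variety)
  moreover have "restrict q M0 (\<Phi> v) = p v" if "v \<in> carrier_vec 2" for v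
    using realized_on_slice[OF Z inv that base_vector_W] slice_in_M0
    by (simp add: q_def base_vector_def ent_un)
  ultimately show ?thesis by blast
qed

end

section \<open>Separation of orbits and the isomorphism of the two quotients\<close>

lemma finite_linear_roots:
  fixes A B :: complex
  assumes "A \<noteq> 0 \<or> B \<noteq> 0"
  shows "finite {s. A + s * B = 0}"
proof (cases "B = 0")
  case False
  have "s = - A / B" if "A + s * B = 0" for s
  proof -
    have "s * B = - A" using that by (simp add: eq_neg_iff_add_eq_0 add.commute)
    then show ?thesis using False by (metis nonzero_eq_divide_eq)
  qed
  then have "{s. A + s * B = 0} \<subseteq> {- A / B}" by blast
  then show ?thesis using finite_subset by blast
qed (use assms in simp)

context mckay_action
begin

lemma plane_orbit_eq: "plane_orbit X v = {g *\<^sub>v v |g. g \<in> small_grp X}"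
  by (simp add: plane_orbit_def orbit_def)

text \<open>The norm over \<Gamma> of an affine function vanishing at v is invariant and vanishes at
  v through the factor of the identity. The slope \<open>s\<close> of the function is chosen outside
  the finite sets \<open>bad g\<close>, so that it vanishes at no point g w.\<close>

lemma invariant_polynomial_separates:
  assumes v: "v \<in> carrier_vec 2" and w: "w \<in> carrier_vec 2" and n: "v \<notin> plane_orbit X w"
  shows "\<exists>p\<in>generated_algebra plane_coords.
    (\<forall>g\<in>small_grp X. \<forall>u\<in>carrier_vec 2. p (g *\<^sub>v u) = p u) \<and> p v \<noteq> p w"
proof -
  define bad where "bad g = {s. act_fst g (w $ 0) (w $ 1) - v $ 0 + s * (act_snd g (w $ 0) (w $ 1) - v $ 1) = 0}" for g
  have "finite (bad g)" if g: "g \<in> small_grp X" for g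
  proof -
    have "g *\<^sub>v w \<noteq> v" using n g by (auto simp: plane_orbit_eq)
    then have ne: "act_fst g (w $ 0) (w $ 1) - v $ 0 \<noteq> 0 \<or> act_snd g (w $ 0) (w $ 1) - v $ 1 \<noteq> 0"
      using plane_eqI[OF act_coords(3)[OF small_SU2[OF g] w] v] act_coords(1,2)[OF small_SU2[OF g] w] by auto
    show ?thesis unfolding bad_def by (rule finite_linear_roots[OF ne])
  qed
  then have "finite (\<Union>g\<in>small_grp X. bad g)" using finite_small by blast
  then obtain s where s: "s \<notin> (\<Union>g\<in>small_grp X. bad g)"
    using ex_new_if_finite[OF infinite_UNIV_char_0] by blast
  define l where "l x y = x + s * y - (v $ 0 + s * v $ 1)" for x y
  define p where "p u = (\<Prod>g\<in>small_grp X. l (act_fst g (u $ 0) (u $ 1)) (act_snd g (u $ 0) (u $ 1)))" for u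
  have x: "(\<lambda>v. v $ 0) \<in> generated_algebra plane_coords" and y: "(\<lambda>v. v $ 1) \<in> generated_algebra plane_coords"
    by (auto simp: plane_coords_def intro: generated_algebra.gen)
  have "p \<in> generated_algebra plane_coords"
    unfolding p_def l_def act_fst_def act_snd_def diff_conv_add_uminus
    by (intro generated_algebra_prod generated_algebra.add generated_algebra.mult generated_algebra.const x y)
  moreover have "p (g *\<^sub>v u) = p u" if g: "g \<in> small_grp X" and u: "u \<in> carrier_vec 2" for g u
    unfolding p_def
  proof (rule prod.reindex_bij_witness[of _ "\<lambda>k. k * inv\<^bsub>SU2\<^esub> g" "\<lambda>k. k * g"])
    note gS = small_SU2[OF g]
    fix k assume k: "k \<in> small_grp X"
    note kS = small_SU2[OF k]
    show "k * g * inv\<^bsub>SU2\<^esub> g = k" "k * inv\<^bsub>SU2\<^esub> g * g = k"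
      using SU2.m_assoc[OF kS gS SU2.inv_closed[OF gS]] SU2.m_assoc[OF kS SU2.inv_closed[OF gS] gS]
        SU2.r_inv[OF gS] SU2.l_inv[OF gS] SU2.r_one[OF kS] by simp_all
    show "k * g \<in> small_grp X" "k * inv\<^bsub>SU2\<^esub> g \<in> small_grp X"
      using subgroup.m_closed[OF small_subgroup k] g subgroup.m_inv_closed[OF small_subgroup g] by simp_all
    have kg: "k * g \<in> carrier SU2" using SU2.m_closed[OF kS gS] by simp
    show "l (act_fst (k * g) (u $ 0) (u $ 1)) (act_snd (k * g) (u $ 0) (u $ 1)) =
      l (act_fst k ((g *\<^sub>v u) $ 0) ((g *\<^sub>v u) $ 1)) (act_snd k ((g *\<^sub>v u) $ 0) ((g *\<^sub>v u) $ 1))"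
      unfolding act_coords(1,2)[OF kg u, symmetric] act_coords(1,2)[OF kS act_coords(3)[OF gS u], symmetric]
      by (simp only: SU2_act_assoc[OF kS gS u])
  qed
  moreover have "p v = 0"
    unfolding p_def
  proof (rule prod_zero[OF finite_small], rule bexI)
    show "1\<^sub>m 2 \<in> small_grp X" using subgroup.one_closed[OF small_subgroup] by simp
    show "l (act_fst (1\<^sub>m 2) (v $ 0) (v $ 1)) (act_snd (1\<^sub>m 2) (v $ 0) (v $ 1)) = 0"
      by (simp add: l_def act_fst_def act_snd_def)
  qed
  moreover have "p w \<noteq> 0"
    using s finite_small by (auto simp: p_def bad_def l_def algebra_simps)
  ultimately show ?thesis by (intro bexI[of _ p]) auto
qed

lemma slice_equivalent_iff:
  assumes v: "v \<in> carrier_vec 2" and w: "w \<in> carrier_vec 2"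
  shows "(\<forall>f\<in>Inv. f (\<Phi> v) = f (\<Phi> w)) \<longleftrightarrow> v \<in> plane_orbit X w"
proof
  assume eq: "\<forall>f\<in>Inv. f (\<Phi> v) = f (\<Phi> w)"
  show "v \<in> plane_orbit X w"
  proof (rule ccontr)
    assume "v \<notin> plane_orbit X w"
    from invariant_polynomial_separates[OF v w this] obtain p where p: "p \<in> generated_algebra plane_coords"
      "\<And>g u. g \<in> small_grp X \<Longrightarrow> u \<in> carrier_vec 2 \<Longrightarrow> p (g *\<^sub>v u) = p u" "p v \<noteq> p w" by blast
    from invariant_polynomial_extends[OF p(1,2)] obtain f where
      f: "f \<in> Inv" "\<forall>v\<in>carrier_vec 2. f (\<Phi> v) = p v" by blast
    show False using f p(3) eq v w by metis
  qed
next
  assume "v \<in> plane_orbit X w"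
  then obtain g where g: "g \<in> small_grp X" "v = g *\<^sub>v w" by (auto simp: plane_orbit_eq)
  have "gauge_eq X (\<Phi> w) (\<Phi> v)" unfolding g(2) by (rule slice_orbit_gauge_eq[OF g(1) w])
  then show "\<forall>f\<in>Inv. f (\<Phi> v) = f (\<Phi> w)"
    using slice_in_M0[of v] slice_in_M0[of w] invariant_funs_iff[OF valid] by blast
qed

lemma git_class_cong: "\<forall>f\<in>Inv. f \<phi> = f \<phi>' \<Longrightarrow> git_class X \<epsilon> \<phi> = git_class X \<epsilon> \<phi>'"
  unfolding git_class_def by metis

text \<open>By \<open>quot_iso_class\<close> the plane points whose slice lies in a given class form
  a single orbit; so the map is defined without choosing representatives.\<close>

definition quot_iso :: "quiver_rep set \<Rightarrow> complex vec set" where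
  "quot_iso c = {w \<in> carrier_vec 2. \<Phi> w \<in> c}"

lemma quot_iso_class:
  assumes v: "v \<in> carrier_vec 2" and e: "\<And>f. f \<in> Inv \<Longrightarrow> f (\<Phi> v) = f \<phi>"
  shows "quot_iso (git_class X \<epsilon> \<phi>) = plane_orbit X v"
proof -
  have "w \<in> quot_iso (git_class X \<epsilon> \<phi>) \<longleftrightarrow> w \<in> plane_orbit X v" if w: "w \<in> carrier_vec 2" for w
  proof -
    have "w \<in> quot_iso (git_class X \<epsilon> \<phi>) \<longleftrightarrow> (\<forall>f\<in>Inv. f (\<Phi> w) = f \<phi>)"
      using w slice_in_M0[of w] by (simp add: quot_iso_def git_class_def)
    also have "\<dots> \<longleftrightarrow> (\<forall>f\<in>Inv. f (\<Phi> w) = f (\<Phi> v))" using e by metis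
    finally show ?thesis using slice_equivalent_iff[OF w v] by blast
  qed
  moreover have "plane_orbit X v \<subseteq> carrier_vec 2"
    using act_coords(3)[OF small_SU2 v] by (auto simp: plane_orbit_eq)
  ultimately show ?thesis unfolding quot_iso_def by blast
qed

lemma quot_iso_slice:
  assumes v: "v \<in> carrier_vec 2"
  shows "quot_iso (git_class X \<epsilon> (\<Phi> v)) = plane_orbit X v"
  by (rule quot_iso_class[OF v refl])

lemma class_of_slice:
  assumes "\<phi> \<in> M0"
  obtains v where "v \<in> carrier_vec 2" "\<And>f. f \<in> Inv \<Longrightarrow> f (\<Phi> v) = f \<phi>" "git_class X \<epsilon> \<phi> = git_class X \<epsilon> (\<Phi> v)"
proof -
  obtain v where v: "v \<in> carrier_vec 2" "\<And>f. f \<in> Inv \<Longrightarrow> f (\<Phi> v) = f \<phi>"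
    using every_point_equivalent_to_slice[OF assms] by blast
  moreover have "git_class X \<epsilon> \<phi> = git_class X \<epsilon> (\<Phi> v)" using v(2)[symmetric] by (intro git_class_cong) blast
  ultimately show thesis by (rule that)
qed

lemma points_eq:
  "points (git_quotient X \<epsilon>) = git_class X \<epsilon> ` M0" "points (simple_singularity X) = plane_orbit X ` carrier_vec 2"
  by (simp_all add: git_quotient_def simple_singularity_def quotient_variety_def regular_moment_zero_variety regular_plane)

lemma bij_quot_iso: "bij_betw quot_iso (points (git_quotient X \<epsilon>)) (points (simple_singularity X))"
  unfolding points_eq bij_betw_def
proof
  show "inj_on quot_iso (git_class X \<epsilon> ` M0)"
  proof (rule inj_onI)
    fix c c' assume c: "c \<in> git_class X \<epsilon> ` M0" "c' \<in> git_class X \<epsilon> ` M0" and eq: "quot_iso c = quot_iso c'"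
    obtain v where v: "v \<in> carrier_vec 2" "c = git_class X \<epsilon> (\<Phi> v)" using c(1) class_of_slice by (metis imageE)
    obtain w where w: "w \<in> carrier_vec 2" "c' = git_class X \<epsilon> (\<Phi> w)" using c(2) class_of_slice by (metis imageE)
    have "v \<in> quot_iso c" using v slice_in_M0[of v] by (simp add: quot_iso_def git_class_def)
    then have "v \<in> plane_orbit X w" using eq quot_iso_slice[OF w(1)] w(2) by simp
    then have "\<forall>f\<in>Inv. f (\<Phi> v) = f (\<Phi> w)" using slice_equivalent_iff[OF v(1) w(1)] by blast
    from git_class_cong[OF this] show "c = c'" by (simp only: v(2) w(2))
  qed
  show "quot_iso ` git_class X \<epsilon> ` M0 = plane_orbit X ` carrier_vec 2"
  proof (intro equalityI subsetI)
    fix P assume "P \<in> quot_iso ` git_class X \<epsilon> ` M0"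
    then obtain \<phi> where "\<phi> \<in> M0" "P = quot_iso (git_class X \<epsilon> \<phi>)" by blast
    then show "P \<in> plane_orbit X ` carrier_vec 2"
      using class_of_slice quot_iso_slice by (metis image_eqI)
  next
    fix P assume "P \<in> plane_orbit X ` carrier_vec 2"
    then obtain v where "v \<in> carrier_vec 2" "P = plane_orbit X v" by blast
    then show "P \<in> quot_iso ` git_class X \<epsilon> ` M0"
      using quot_iso_slice slice_in_M0[of v] by (metis image_eqI)
  qed
qed

text \<open>Restriction to the slice turns invariant functions into \<Gamma>-invariant polynomials
  on the plane, and \<open>invariant_polynomial_extends\<close> leads back.\<close>

lemma variety_iso_quot: "variety_iso (git_quotient X \<epsilon>) (simple_singularity X) quot_iso"
  unfolding variety_iso_def
proof (intro conjI ballI bij_quot_iso)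
  fix h assume "h \<in> regular (simple_singularity X)"
  then have "restrict (h \<circ> plane_orbit X) (carrier_vec 2) \<in> regular plane"
    by (simp add: simple_singularity_def quotient_variety_def regular_plane(2))
  then obtain p where p: "p \<in> generated_algebra plane_coords"
    "restrict (h \<circ> plane_orbit X) (carrier_vec 2) = restrict p (carrier_vec 2)"
    by (auto simp: regular_plane(1))
  have hp: "p v = h (plane_orbit X v)" if "v \<in> carrier_vec 2" for v
    using fun_cong[OF p(2), of v] that by simp
  have "p (g *\<^sub>v v) = p v" if g: "g \<in> small_grp X" and v: "v \<in> carrier_vec 2" for g v
  proof -
    have gv: "g *\<^sub>v v \<in> carrier_vec 2" by (rule act_coords(3)[OF small_SU2[OF g] v])
    have "g *\<^sub>v v \<in> plane_orbit X v" using g by (auto simp: plane_orbit_eq)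
    then have "\<forall>f\<in>Inv. f (\<Phi> (g *\<^sub>v v)) = f (\<Phi> v)" using slice_equivalent_iff[OF gv v] by blast
    from git_class_cong[OF this] have "plane_orbit X (g *\<^sub>v v) = plane_orbit X v"
      using quot_iso_slice[OF gv] quot_iso_slice[OF v] by simp
    then show ?thesis using hp[OF gv] hp[OF v] by simp
  qed
  from invariant_polynomial_extends[OF p(1) this] obtain f where
    f: "f \<in> Inv" "\<And>v. v \<in> carrier_vec 2 \<Longrightarrow> f (\<Phi> v) = p v" by blast
  have "h (quot_iso (git_class X \<epsilon> \<phi>)) = f \<phi>" if "\<phi> \<in> M0" for \<phi>
  proof -
    obtain v where v: "v \<in> carrier_vec 2" "\<And>f. f \<in> Inv \<Longrightarrow> f (\<Phi> v) = f \<phi>"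
      using class_of_slice[OF \<open>\<phi> \<in> M0\<close>] by blast
    show ?thesis using quot_iso_class[of v \<phi>, OF v] hp[OF v(1)] f(2)[OF v(1)] v(2)[OF f(1)] by simp
  qed
  moreover obtain q where "q \<in> generated_algebra (rep_coords X)" "f = restrict q M0"
    using f(1) by (auto simp: invariant_funs_def regular_moment_zero_variety)
  ultimately have "restrict (restrict (h \<circ> quot_iso) (git_class X \<epsilon> ` M0) \<circ> git_class X \<epsilon>) M0 = f"
    by (auto simp: fun_eq_iff)
  then show "restrict (h \<circ> quot_iso) (points (git_quotient X \<epsilon>)) \<in> regular (git_quotient X \<epsilon>)"
    using f(1) unfolding points_eq
    by (simp add: git_quotient_def quotient_variety_def regular_moment_zero_variety(2) invariant_funs_def)
next
  fix f assume "f \<in> regular (git_quotient X \<epsilon>)"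
  then have "restrict (f \<circ> git_class X \<epsilon>) M0 \<in> regular (moment_zero_variety X \<epsilon>)"
    by (simp add: git_quotient_def quotient_variety_def regular_moment_zero_variety(2))
  then obtain q where q: "q \<in> generated_algebra (rep_coords X)"
    "restrict (f \<circ> git_class X \<epsilon>) M0 = restrict q M0"
    by (auto simp: regular_moment_zero_variety(1))
  obtain p where p: "p \<in> generated_algebra plane_coords" "\<And>v. v \<in> carrier_vec 2 \<Longrightarrow> q (\<Phi> v) = p v"
    using slice_polynomial[OF q(1)] by blast
  let ?pts = "points (git_quotient X \<epsilon>)"
  have "f (inv_into ?pts quot_iso (plane_orbit X v)) = p v" if v: "v \<in> carrier_vec 2" for v
  proof -
    have "git_class X \<epsilon> (\<Phi> v) \<in> ?pts" using slice_in_M0[of v] by (simp add: points_eq)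
    then have "inv_into ?pts quot_iso (quot_iso (git_class X \<epsilon> (\<Phi> v))) = git_class X \<epsilon> (\<Phi> v)"
      using bij_quot_iso by (intro inv_into_f_f) (simp_all add: bij_betw_def)
    then have "inv_into ?pts quot_iso (plane_orbit X v) = git_class X \<epsilon> (\<Phi> v)"
      by (simp only: quot_iso_slice[OF v])
    then show ?thesis
      using fun_cong[OF q(2), of "\<Phi> v"] slice_in_M0[of v] p(2)[OF v] by simp
  qed
  then have "restrict (restrict (f \<circ> inv_into ?pts quot_iso) (plane_orbit X ` carrier_vec 2) \<circ> plane_orbit X) (carrier_vec 2) =
      restrict p (carrier_vec 2)"
    by (auto simp: fun_eq_iff)
  then show "restrict (f \<circ> inv_into ?pts quot_iso) (points (simple_singularity X)) \<in> regular (simple_singularity X)"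
    using p(1) unfolding points_eq(2)
    by (simp add: simple_singularity_def quotient_variety_def regular_plane)
qed

section \<open>The action of \<Omega> on the quotient\<close>

lemma group_Omega: "group (Omega X)"
  unfolding Omega_def by (rule normal.factorgroup_is_group[OF normal])

lemma Omega_cosets:
  assumes "\<omega> \<in> carrier (Omega X)"
  obtains g where "g \<in> big_grp X" "\<omega> = small_grp X #>\<^bsub>SU2\<^esub> g"
  using assms by (auto simp: Omega_def carrier_FactGroup r_coset_def)

lemma alpha_hom:
  assumes "\<omega> \<in> carrier (Omega X)"
  shows "\<alpha> \<omega> \<in> diagram_perms X"
    "\<omega>' \<in> carrier (Omega X) \<Longrightarrow> \<alpha> (\<omega> \<otimes>\<^bsub>Omega X\<^esub> \<omega>') = \<alpha> \<omega> \<circ> \<alpha> \<omega>'"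
  using diag assms by (auto simp: diagram_action_def iso_def hom_def diagram_sym_grp_def)

lemma natural_act_orbit:
  assumes g: "g \<in> big_grp X" and v: "v \<in> carrier_vec 2"
  shows "natural_act (small_grp X #>\<^bsub>SU2\<^esub> g) (plane_orbit X v) = plane_orbit X (g *\<^sub>v v)"
proof (intro equalityI subsetI)
  note gS = big_SU2[OF g]
  fix u assume "u \<in> natural_act (small_grp X #>\<^bsub>SU2\<^esub> g) (plane_orbit X v)"
  then obtain k k' where k: "k \<in> small_grp X" "k' \<in> small_grp X" "u = (k * g) *\<^sub>v (k' *\<^sub>v v)"
    by (auto simp: natural_act_def plane_orbit_eq r_coset_def)
  \<comment> \<open>Normality moves the inner factor of \<Gamma> to the left of \<open>g\<close>: k
    g k' v = k m g v with \<open>m\<close> in \<Gamma>.\<close>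
  define m where "m = g * k' * inv\<^bsub>SU2\<^esub> g"
  have "m \<in> small_grp X"
    using normal.inv_op_closed2[OF normal, of g k'] g k(2) SU2.m_inv_consistent[OF big g] by (simp add: m_def)
  note kS = small_SU2[OF k(1)] and kS' = small_SU2[OF k(2)] and mS = small_SU2[OF this]
  have "m * g = g * k'"
    using SU2.m_assoc[OF SU2.m_closed[OF gS kS'] SU2.inv_closed[OF gS] gS] SU2.l_inv[OF gS]
      SU2.r_one[OF SU2.m_closed[OF gS kS']] by (simp add: m_def)
  moreover have "u = k *\<^sub>v ((g * k') *\<^sub>v v)"
    using k(3) SU2_act_assoc[OF kS gS act_coords(3)[OF kS' v]] SU2_act_assoc[OF gS kS' v] by simp
  ultimately have "u = k *\<^sub>v (m *\<^sub>v (g *\<^sub>v v))" using SU2_act_assoc[OF mS gS v] by simp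
  then have "u = (k * m) *\<^sub>v (g *\<^sub>v v)" using SU2_act_assoc[OF kS mS act_coords(3)[OF gS v]] by simp
  moreover have "k * m \<in> small_grp X"
    using subgroup.m_closed[OF small_subgroup k(1) \<open>m \<in> small_grp X\<close>] by simp
  ultimately show "u \<in> plane_orbit X (g *\<^sub>v v)" by (auto simp: plane_orbit_eq)
next
  note gS = big_SU2[OF g]
  fix u assume "u \<in> plane_orbit X (g *\<^sub>v v)"
  then obtain k where k: "k \<in> small_grp X" "u = k *\<^sub>v (g *\<^sub>v v)" by (auto simp: plane_orbit_eq)
  have "u = (k * g) *\<^sub>v v" using SU2_act_assoc[OF small_SU2[OF k(1)] gS v] k(2) by simp
  moreover have "k * g \<in> small_grp X #>\<^bsub>SU2\<^esub> g" using k(1) by (auto simp: r_coset_def)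
  moreover have "v \<in> plane_orbit X v"
    using subgroup.one_closed[OF small_subgroup] v by (auto simp: plane_orbit_eq intro!: exI[of _ "1\<^sub>m 2"])
  ultimately show "u \<in> natural_act (small_grp X #>\<^bsub>SU2\<^esub> g) (plane_orbit X v)"
    by (auto simp: natural_act_def)
qed

theorem symplectic_action_exists:
  "\<exists>\<rho>. lifted_action X \<alpha> \<rho> \<and> symplectic_action X \<epsilon> \<rho> \<and> induces_natural_action X \<epsilon> \<rho>"
proof -
  \<comment> \<open>The restriction makes each map extensional, as membership in the group of
    bijections of \<open>rep_space X\<close> demands.\<close>
  define \<rho> where "\<rho> \<omega> = restrict (pull X (\<alpha> \<omega>)) (rep_space X)" for \<omega>
  have aut: "diagram_aut X (\<alpha> \<omega>)" if "\<omega> \<in> carrier (Omega X)" for \<omega>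
    using auts alpha_hom(1)[OF that] by blast
  have eps_a: "\<epsilon> (map_prod (\<alpha> \<omega>) (\<alpha> \<omega>) a) = \<epsilon> a" if "\<omega> \<in> carrier (Omega X)" "a \<in> arrows X" for \<omega> a
    using eps_inv[OF alpha_hom(1)[OF that(1)] that(2)] .
  have closed: "\<rho> \<omega> \<phi> \<in> rep_space X" if "\<omega> \<in> carrier (Omega X)" "\<phi> \<in> rep_space X" for \<omega> \<phi>
    using pull_in_rep_space[OF valid aut[OF that(1)] that(2)] that(2) by (simp add: \<rho>_def)
  have bij: "\<rho> \<omega> \<in> Bij (rep_space X)" if \<omega>: "\<omega> \<in> carrier (Omega X)" for \<omega>
  proof -
    have "bij_betw (\<rho> \<omega>) (rep_space X) (rep_space X)"
    proof (rule bij_betwI[where g = "pull X (perm_inv (\<alpha> \<omega>))"])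
      note a = aut[OF \<omega>] and a' = diagram_aut_inv[OF valid aut[OF \<omega>]]
      note b = diagram_autD(1)[OF a]
      have "perm_inv (\<alpha> \<omega>) \<circ> \<alpha> \<omega> = id" "\<alpha> \<omega> \<circ> perm_inv (\<alpha> \<omega>) = id"
        using b by (auto simp: fun_eq_iff bij_is_inj bij_is_surj surj_f_inv_f)
      then show "pull X (perm_inv (\<alpha> \<omega>)) (\<rho> \<omega> \<phi>) = \<phi>" "\<rho> \<omega> (pull X (perm_inv (\<alpha> \<omega>)) \<phi>) = \<phi>"
        if "\<phi> \<in> rep_space X" for \<phi>
        using that pull_comp[OF valid a' a, of \<phi>] pull_comp[OF valid a a', of \<phi>] pull_id[OF that]
          pull_in_rep_space[OF valid a' that] by (simp_all add: \<rho>_def)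
      show "\<rho> \<omega> \<in> rep_space X \<rightarrow> rep_space X" using closed[OF \<omega>] by blast
      show "pull X (perm_inv (\<alpha> \<omega>)) \<in> rep_space X \<rightarrow> rep_space X"
        using pull_in_rep_space[OF valid a'] by blast
    qed
    then show ?thesis by (simp add: Bij_def \<rho>_def)
  qed
  have "group_action (Omega X) (rep_space X) \<rho>"
    unfolding group_action_def group_hom_def group_hom_axioms_def
  proof (intro conjI group_Omega group_BijGroup homI)
    show "\<rho> \<omega> \<in> carrier (BijGroup (rep_space X))" if "\<omega> \<in> carrier (Omega X)" for \<omega>
      using bij[OF that] by (simp add: BijGroup_def)
    fix \<omega> \<omega>' assume \<omega>: "\<omega> \<in> carrier (Omega X)" "\<omega>' \<in> carrier (Omega X)"
    have "\<rho> (\<omega> \<otimes>\<^bsub>Omega X\<^esub> \<omega>') = compose (rep_space X) (\<rho> \<omega>) (\<rho> \<omega>')"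
    proof
      fix \<phi>
      show "\<rho> (\<omega> \<otimes>\<^bsub>Omega X\<^esub> \<omega>') \<phi> = compose (rep_space X) (\<rho> \<omega>) (\<rho> \<omega>') \<phi>"
        using alpha_hom(2)[OF \<omega>] pull_comp[OF valid aut[OF \<omega>(1)] aut[OF \<omega>(2)], of \<phi>] closed[OF \<omega>(2), of \<phi>]
        by (auto simp: \<rho>_def compose_def)
    qed
    then show "\<rho> (\<omega> \<otimes>\<^bsub>Omega X\<^esub> \<omega>') = \<rho> \<omega> \<otimes>\<^bsub>BijGroup (rep_space X)\<^esub> \<rho> \<omega>'"
      using bij[OF \<omega>(1)] bij[OF \<omega>(2)] by (simp add: BijGroup_def)
  qed
  moreover have "\<rho> \<omega> \<phi> (map_prod (\<alpha> \<omega>) (\<alpha> \<omega>) a) = 1 \<cdot>\<^sub>m \<phi> a"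
    if "\<omega> \<in> carrier (Omega X)" "a \<in> arrows X" "\<phi> \<in> rep_space X" for \<omega> a \<phi>
  proof -
    note b = diagram_autD(1,2)[OF aut[OF that(1)]]
    have "\<rho> \<omega> \<phi> (map_prod (\<alpha> \<omega>) (\<alpha> \<omega>) a) = \<phi> a"
      using b(2)[OF that(2)] map_prod_inv(2)[OF b(1), of a] that(3) by (simp add: \<rho>_def pull_def)
    moreover have "1 \<cdot>\<^sub>m \<phi> a = \<phi> a" by (rule eq_matI) auto
    ultimately show ?thesis by simp
  qed
  ultimately have "lifted_action X \<alpha> \<rho>"
    unfolding lifted_action_def by (intro conjI exI[of _ "\<lambda>_ _. 1"]) auto
  moreover have "symplectic_action X \<epsilon> \<rho>"
    unfolding symplectic_action_def
  proof (intro ballI)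
    fix \<omega> \<phi> \<psi> assume \<omega>: "\<omega> \<in> carrier (Omega X)" and "\<phi> \<in> rep_space X" "\<psi> \<in> rep_space X"
    then show "symp_form X \<epsilon> (\<rho> \<omega> \<phi>) (\<rho> \<omega> \<psi>) = symp_form X \<epsilon> \<phi> \<psi>"
      using pull_symplectic[of X "\<alpha> \<omega>" \<epsilon> \<phi> \<psi>, OF valid aut[OF \<omega>] eps_a[OF \<omega>]] by (simp add: \<rho>_def)
  qed
  moreover have "induces_natural_action X \<epsilon> \<rho>"
    unfolding induces_natural_action_def
  proof (intro exI conjI ballI, rule variety_iso_quot)
    fix \<omega> \<phi> assume \<omega>: "\<omega> \<in> carrier (Omega X)" and \<phi>: "\<phi> \<in> M0"
    note a = aut[OF \<omega>] and e = eps_a[OF \<omega>]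
    have r: "\<phi> \<in> rep_space X" using \<phi> by (simp add: moment_zero_set_def)
    have \<rho>: "\<rho> \<omega> \<phi> = pull X (\<alpha> \<omega>) \<phi>" using r by (simp add: \<rho>_def)
    show "\<rho> \<omega> \<phi> \<in> M0" unfolding \<rho> by (rule pull_moment_zero[of X "\<alpha> \<omega>" \<epsilon>, OF valid a e \<phi>])
    obtain g where g: "g \<in> big_grp X" "\<omega> = small_grp X #>\<^bsub>SU2\<^esub> g" by (rule Omega_cosets[OF \<omega>])
    obtain v where v: "v \<in> carrier_vec 2" "\<And>f. f \<in> Inv \<Longrightarrow> f (\<Phi> v) = f \<phi>"
      using class_of_slice[OF \<phi>] by blast
    have gv: "g *\<^sub>v v \<in> carrier_vec 2" by (rule act_coords(3)[OF big_SU2[OF g(1)] v(1)])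
    \<comment> \<open>\<open>v\<close> represents \<open>\<phi>\<close> only up to invariants. Since
      \<open>f\<close> composed with \<open>pull\<close> is again invariant, \<open>\<phi>\<close>
      may be replaced by the slice point also after the action.\<close>
    have eqf: "f (\<Phi> (g *\<^sub>v v)) = f (pull X (\<alpha> \<omega>) \<phi>)" if f: "f \<in> Inv" for f
    proof -
      have "gauge_eq X (pull X (\<alpha> \<omega>) (\<Phi> v)) (\<Phi> (g *\<^sub>v v))"
        using slice_translate_gauge_eq[OF big_SU2[OF g(1)] twisted[OF g(1)] _ v(1)] a g(2) by simp
      then have "f (\<Phi> (g *\<^sub>v v)) = f (pull X (\<alpha> \<omega>) (\<Phi> v))"
        using f slice_in_M0[of "g *\<^sub>v v"] pull_moment_zero[of X "\<alpha> \<omega>" \<epsilon>, OF valid a e slice_in_M0[of v]]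
          invariant_funs_iff[OF valid] by blast
      also have "\<dots> = f (pull X (\<alpha> \<omega>) \<phi>)"
        using v(2)[OF pull_invariant[of X "\<alpha> \<omega>" \<epsilon> f, OF valid a e f]] \<phi> slice_in_M0[of v] by simp
      finally show ?thesis .
    qed
    have q: "quot_iso (git_class X \<epsilon> (pull X (\<alpha> \<omega>) \<phi>)) = plane_orbit X (g *\<^sub>v v)"
      "quot_iso (git_class X \<epsilon> \<phi>) = plane_orbit X v"
      by (rule quot_iso_class[OF gv], erule eqf) (rule quot_iso_class[OF v(1)], erule v(2))
    show "quot_iso (git_class X \<epsilon> (\<rho> \<omega> \<phi>)) = natural_act \<omega> (quot_iso (git_class X \<epsilon> \<phi>))"
      unfolding \<rho> q by (simp only: g(2) natural_act_orbit[OF g(1) v(1)])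
  qed
  ultimately show ?thesis by blast
qed

end

section \<open>Reduction to generators\<close>

lemma act_mult:
  assumes "g \<in> carrier SU2" "h \<in> carrier SU2"
  shows "act_fst (g * h) x y = act_fst g (act_fst h x y) (act_snd h x y)"
    "act_snd (g * h) x y = act_snd g (act_fst h x y) (act_snd h x y)"
proof -
  obtain a b c d where g: "g = mat22 a b c d" using mat22_eqI[OF SU2_carrier_mat[OF assms(1)]] by blast
  obtain a' b' c' d' where h: "h = mat22 a' b' c' d'" using mat22_eqI[OF SU2_carrier_mat[OF assms(2)]] by blast
  show "act_fst (g * h) x y = act_fst g (act_fst h x y) (act_snd h x y)"
    "act_snd (g * h) x y = act_snd g (act_fst h x y) (act_snd h x y)"
    by (simp_all add: g h mat22_mult act_fst_def act_snd_def algebra_simps)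
qed

lemma act_one: "act_fst (1\<^sub>m 2) x y = x" "act_snd (1\<^sub>m 2) x y = y"
  by (simp_all add: act_fst_def act_snd_def)

lemma gauge_pair_reindex:
  assumes "gauge_pair X h h'" "\<And>i. i \<in> verts X \<Longrightarrow> \<sigma> i \<in> verts X" "\<And>i. i \<in> verts X \<Longrightarrow> dims X (\<sigma> i) = dims X i"
  shows "gauge_pair X (\<lambda>i. h (\<sigma> i)) (\<lambda>i. h' (\<sigma> i))"
  unfolding gauge_pair_def
proof
  fix j assume j: "j \<in> verts X"
  show "un (dims X j) * h (\<sigma> j) = h (\<sigma> j) \<and> h (\<sigma> j) * un (dims X j) = h (\<sigma> j) \<and>
      un (dims X j) * h' (\<sigma> j) = h' (\<sigma> j) \<and> h' (\<sigma> j) * un (dims X j) = h' (\<sigma> j) \<and>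
      h (\<sigma> j) * h' (\<sigma> j) = un (dims X j) \<and> h' (\<sigma> j) * h (\<sigma> j) = un (dims X j)"
    using assms(1)[unfolded gauge_pair_def, rule_format, OF assms(2)[OF j]] by (simp only: assms(3)[OF j])
qed

lemma padded_slice_rep:
  assumes "padded_rep X A1" "padded_rep X A2"
  shows "padded_rep X (slice_rep A1 A2 x y)"
  using assms by (simp add: padded_rep_def slice_rep_def distrib_left distrib_right sc_commute_left mult.assoc)

lemma twisted_equivariant_one:
  assumes "valid_triple X" "padded_rep X A1" "padded_rep X A2"
  shows "twisted_equivariant X A1 A2 (1\<^sub>m 2) id"
  unfolding twisted_equivariant_def
proof (intro exI conjI allI ballI)
  show "gauge_pair X (\<lambda>i. un (dims X i)) (\<lambda>i. un (dims X i))" by (simp add: gauge_pair_def un_idem)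
  fix x y a assume "a \<in> arrows X"
  then show "slice_rep A1 A2 (act_fst (1\<^sub>m 2) x y) (act_snd (1\<^sub>m 2) x y) (map_prod id id a) =
      pair_act (\<lambda>i. un (dims X i)) (\<lambda>i. un (dims X i)) (slice_rep A1 A2 x y) a"
    using padded_slice_rep[OF assms(2,3), of x y] by (simp add: act_one map_prod.id pair_act_def padded_rep_def)
qed

lemma twisted_equivariant_mult:
  assumes X: "valid_triple X" and g: "g \<in> carrier SU2" "twisted_equivariant X A1 A2 g \<sigma>"
    and k: "k \<in> carrier SU2" "twisted_equivariant X A1 A2 k \<tau>" and \<sigma>: "diagram_aut X \<sigma>"
  shows "twisted_equivariant X A1 A2 (k * g) (\<tau> \<circ> \<sigma>)"
proof -
  obtain h h' where h: "gauge_pair X h h'" "\<And>x y a. a \<in> arrows X \<Longrightarrow>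
     slice_rep A1 A2 (act_fst g x y) (act_snd g x y) (map_prod \<sigma> \<sigma> a) = pair_act h h' (slice_rep A1 A2 x y) a"
    using g(2) unfolding twisted_equivariant_def by blast
  obtain l l' where l: "gauge_pair X l l'" "\<And>x y a. a \<in> arrows X \<Longrightarrow>
     slice_rep A1 A2 (act_fst k x y) (act_snd k x y) (map_prod \<tau> \<tau> a) = pair_act l l' (slice_rep A1 A2 x y) a"
    using k(2) unfolding twisted_equivariant_def by blast
  note s = diagram_autD[OF \<sigma>]
  show ?thesis
    unfolding twisted_equivariant_def
  proof (intro exI conjI allI ballI)
    show "gauge_pair X (\<lambda>i. l (\<sigma> i) * h i) (\<lambda>i. h' i * l' (\<sigma> i))"
      by (rule gauge_pair_mult[OF gauge_pair_reindex[OF l(1) s(3,4)] h(1)])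
    fix x y a assume a: "a \<in> arrows X"
    have "map_prod (\<tau> \<circ> \<sigma>) (\<tau> \<circ> \<sigma>) a = map_prod \<tau> \<tau> (map_prod \<sigma> \<sigma> a)" by (cases a) simp
    then show "slice_rep A1 A2 (act_fst (k * g) x y) (act_snd (k * g) x y) (map_prod (\<tau> \<circ> \<sigma>) (\<tau> \<circ> \<sigma>) a) =
        pair_act (\<lambda>i. l (\<sigma> i) * h i) (\<lambda>i. h' i * l' (\<sigma> i)) (slice_rep A1 A2 x y) a"
      using l(2)[OF s(2)[OF a]] h(2)[OF a]
      by (simp add: act_mult[OF k(1) g(1)] pair_act_def mult.assoc)
  qed
qed

lemma twisted_equivariant_inv:
  assumes X: "valid_triple X" and A: "padded_rep X A1" "padded_rep X A2"
    and g: "g \<in> carrier SU2" "twisted_equivariant X A1 A2 g \<sigma>" and \<sigma>: "diagram_aut X \<sigma>"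
  shows "twisted_equivariant X A1 A2 (inv\<^bsub>SU2\<^esub> g) (perm_inv \<sigma>)"
proof -
  obtain h h' where h: "gauge_pair X h h'" "\<And>x y a. a \<in> arrows X \<Longrightarrow>
     slice_rep A1 A2 (act_fst g x y) (act_snd g x y) (map_prod \<sigma> \<sigma> a) = pair_act h h' (slice_rep A1 A2 x y) a"
    using g(2) unfolding twisted_equivariant_def by blast
  note s = diagram_autD[OF diagram_aut_inv[OF X \<sigma>]]
  let ?p = "perm_inv \<sigma>"
  show ?thesis
    unfolding twisted_equivariant_def
  proof (intro exI conjI allI ballI)
    show "gauge_pair X (\<lambda>i. h' (?p i)) (\<lambda>i. h (?p i))"
      by (rule gauge_pair_reindex[OF gauge_pair_sym[OF h(1)] s(3,4)])
    fix x y b assume b: "b \<in> arrows X"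
    define a u v where "a = map_prod ?p ?p b" and "u = act_fst (inv\<^bsub>SU2\<^esub> g) x y" and "v = act_snd (inv\<^bsub>SU2\<^esub> g) x y"
    have a: "a \<in> arrows X" "map_prod \<sigma> \<sigma> a = b" "snd a = ?p (snd b)" "fst a = ?p (fst b)"
      using s(2)[OF b] map_prod_inv(1)[OF diagram_autD(1)[OF \<sigma>]] by (auto simp: a_def)
    have uv: "act_fst g u v = x" "act_snd g u v = y"
      using act_mult[OF g(1) SU2.inv_closed[OF g(1)], of x y] SU2.r_inv[OF g(1)] act_one by (simp_all add: u_def v_def)
    have "slice_rep A1 A2 x y b = pair_act h h' (slice_rep A1 A2 u v) a"
      using h(2)[OF a(1), of u v] by (simp add: uv a(2))
    then have "h' (snd a) * slice_rep A1 A2 x y b * h (fst a) =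
        (h' (snd a) * h (snd a)) * slice_rep A1 A2 u v a * (h' (fst a) * h (fst a))"
      by (simp add: pair_act_def mult.assoc)
    also have "\<dots> = slice_rep A1 A2 u v a"
      using h(1) arrows_ends[OF X a(1)] padded_slice_rep[OF A, of u v] a(1)
      by (simp add: gauge_pair_def padded_rep_def)
    finally show "slice_rep A1 A2 (act_fst (inv\<^bsub>SU2\<^esub> g) x y) (act_snd (inv\<^bsub>SU2\<^esub> g) x y) (map_prod ?p ?p b) =
        pair_act (\<lambda>i. h' (?p i)) (\<lambda>i. h (?p i)) (slice_rep A1 A2 x y) b"
      by (simp add: a_def u_def v_def pair_act_def)
  qed
qed

text \<open>Induction on words, first in the conjugated and then in the conjugating element. The
  inverse of a generator is itself a letter of such words, hence the second conjugation
  condition.\<close>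

lemma normal_from_generators:
  assumes S: "S \<subseteq> carrier SU2" and S': "S' \<subseteq> carrier SU2" and sub: "S \<subseteq> generate SU2 S'"
    and c: "\<And>s t. s \<in> S' \<Longrightarrow> t \<in> S \<Longrightarrow> s * t * inv\<^bsub>SU2\<^esub> s \<in> generate SU2 S"
    and c': "\<And>s t. s \<in> S' \<Longrightarrow> t \<in> S \<Longrightarrow> inv\<^bsub>SU2\<^esub> s * t * s \<in> generate SU2 S"
  shows "generate SU2 S \<lhd> SU2\<lparr>carrier := generate SU2 S'\<rparr>"
proof -
  have sg: "subgroup (generate SU2 S) SU2" and sg': "subgroup (generate SU2 S') SU2"
    using SU2.generate_is_subgroup S S' by auto
  interpret B: group "SU2\<lparr>carrier := generate SU2 S'\<rparr>" by (rule SU2.subgroup_imp_group[OF sg'])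
  have car: "x \<in> carrier SU2" if "x \<in> generate SU2 S" for x using subgroup.subset[OF sg] that by blast
  have car': "x \<in> carrier SU2" if "x \<in> generate SU2 S'" for x using subgroup.subset[OF sg'] that by blast
  have step: "g * h * inv\<^bsub>SU2\<^esub> g \<in> generate SU2 S"
    if g: "g \<in> carrier SU2" and gen: "\<And>t. t \<in> S \<Longrightarrow> g * t * inv\<^bsub>SU2\<^esub> g \<in> generate SU2 S" and h: "h \<in> generate SU2 S" for g h
    using h
  proof (induction h rule: generate.induct)
    case one
    then show ?case using SU2.r_inv[OF g] SU2.r_one[OF g] subgroup.one_closed[OF sg] by simp
  next
    case (incl h) then show ?case by (rule gen)
  next
    case (inv h)
    then have hS: "h \<in> carrier SU2" using S by blast
    have "inv\<^bsub>SU2\<^esub> (g \<otimes>\<^bsub>SU2\<^esub> h \<otimes>\<^bsub>SU2\<^esub> inv\<^bsub>SU2\<^esub> g) = g \<otimes>\<^bsub>SU2\<^esub> inv\<^bsub>SU2\<^esub> h \<otimes>\<^bsub>SU2\<^esub> inv\<^bsub>SU2\<^esub> g"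
      using g hS by (simp only: SU2.inv_mult_group SU2.m_closed SU2.inv_closed SU2.inv_inv SU2.m_assoc)
    then show ?case using subgroup.m_inv_closed[OF sg gen[OF inv]] by simp
  next
    case (eng h1 h2)
    note h1 = car[OF eng(1)] and h2 = car[OF eng(2)]
    have "g \<otimes>\<^bsub>SU2\<^esub> (h1 \<otimes>\<^bsub>SU2\<^esub> h2) \<otimes>\<^bsub>SU2\<^esub> inv\<^bsub>SU2\<^esub> g =
        (g \<otimes>\<^bsub>SU2\<^esub> h1 \<otimes>\<^bsub>SU2\<^esub> inv\<^bsub>SU2\<^esub> g) \<otimes>\<^bsub>SU2\<^esub> (g \<otimes>\<^bsub>SU2\<^esub> h2 \<otimes>\<^bsub>SU2\<^esub> inv\<^bsub>SU2\<^esub> g)"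
      using g h1 h2 by (simp add: SU2.inv_solve_left SU2.m_assoc del: SU2_simps)
    then show ?case using subgroup.m_closed[OF sg eng(3,4)] by simp
  qed
  have main: "g * h * inv\<^bsub>SU2\<^esub> g \<in> generate SU2 S" if "g \<in> generate SU2 S'" "h \<in> generate SU2 S" for g h
    using that
  proof (induction g arbitrary: h rule: generate.induct)
    case one
    then show ?case using car[OF one] SU2.l_one[OF car[OF one]] SU2.r_one[OF car[OF one]] SU2.inv_one by simp
  next
    case (incl g)
    then show ?case using step[of g h] c S' by blast
  next
    case (inv g)
    then have gS: "g \<in> carrier SU2" using S' by blast
    then show ?case using step[OF SU2.inv_closed[OF gS] _ inv(2)] c'[OF inv(1)] by simp
  next
    case (eng g1 g2)
    note g = car'[OF eng(1)] car'[OF eng(2)]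
    have "(g1 \<otimes>\<^bsub>SU2\<^esub> g2) \<otimes>\<^bsub>SU2\<^esub> h \<otimes>\<^bsub>SU2\<^esub> inv\<^bsub>SU2\<^esub> (g1 \<otimes>\<^bsub>SU2\<^esub> g2) =
        g1 \<otimes>\<^bsub>SU2\<^esub> (g2 \<otimes>\<^bsub>SU2\<^esub> h \<otimes>\<^bsub>SU2\<^esub> inv\<^bsub>SU2\<^esub> g2) \<otimes>\<^bsub>SU2\<^esub> inv\<^bsub>SU2\<^esub> g1"
      using g car[OF eng(5)] by (simp only: SU2.inv_mult_group SU2.m_closed SU2.inv_closed SU2.m_assoc)
    then show ?case using eng(3)[OF eng(4)[OF eng(5)]] by simp
  qed
  show ?thesis
  proof (rule B.normal_invI)
    show "subgroup (generate SU2 S) (SU2\<lparr>carrier := generate SU2 S'\<rparr>)"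
      by (rule SU2.subgroup_incl[OF sg sg' SU2.generate_subgroup_incl[OF sub sg']])
    fix x h assume x: "x \<in> carrier (SU2\<lparr>carrier := generate SU2 S'\<rparr>)" and h: "h \<in> generate SU2 S"
    then show "x \<otimes>\<^bsub>SU2\<lparr>carrier := generate SU2 S'\<rparr>\<^esub> h \<otimes>\<^bsub>SU2\<lparr>carrier := generate SU2 S'\<rparr>\<^esub>
        inv\<^bsub>SU2\<lparr>carrier := generate SU2 S'\<rparr>\<^esub> x \<in> generate SU2 S"
      using main[OF _ h] SU2.m_inv_consistent[OF sg'] by simp
  qed
qed

text \<open>The data of \<open>mckay_slice\<close> with equivariance and normality checked on
  generators only. The names are primed because \<open>mckay_slice\<close> becomes a
  sublocale.\<close>

locale mckay_generators =
  fixes X :: mckay_triple and \<epsilon> :: "nat \<times> nat \<Rightarrow> int" and A1 A2 :: "nat \<times> nat \<Rightarrow> m3" and S S' :: "complex mat set"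
  assumes valid': "valid_triple X"
    and orient': "orientation X \<epsilon>"
    and padded': "padded_rep X A1" "padded_rep X A2"
    and wedge': "\<And>a b. a \<in> arrows X \<Longrightarrow> b \<in> arrows X \<Longrightarrow> snd a = fst b \<Longrightarrow>
      A1 b * A2 a - A2 b * A1 a =
      (if b = prod.swap a then sc (of_int (\<epsilon> b) * of_nat (dims X (fst b))) * un (dims X (snd b)) else 0)"
    and square': "\<And>j. j \<in> verts X \<Longrightarrow>
      (\<Sum>a\<in>in_arrows X j. sc (of_int (\<epsilon> a)) * (A1 a * A2 (prod.swap a))) = sc (of_nat (dims X j)) * un (dims X j)"
      "\<And>j. j \<in> verts X \<Longrightarrow>
      (\<Sum>a\<in>in_arrows X j. sc (of_int (\<epsilon> a)) * (A2 a * A1 (prod.swap a))) = - (sc (of_nat (dims X j)) * un (dims X j))"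
      "\<And>j. j \<in> verts X \<Longrightarrow> (\<Sum>a\<in>in_arrows X j. sc (of_int (\<epsilon> a)) * (A1 a * A1 (prod.swap a))) = 0"
      "\<And>j. j \<in> verts X \<Longrightarrow> (\<Sum>a\<in>in_arrows X j. sc (of_int (\<epsilon> a)) * (A2 a * A2 (prod.swap a))) = 0"
    and gens: "S \<subseteq> carrier SU2" "S' \<subseteq> carrier SU2" "small_grp X = generate SU2 S" "big_grp X = generate SU2 S'"
    and sub: "S \<subseteq> big_grp X"
    and conj: "\<And>s t. s \<in> S' \<Longrightarrow> t \<in> S \<Longrightarrow> s * t * inv\<^bsub>SU2\<^esub> s \<in> small_grp X"
      "\<And>s t. s \<in> S' \<Longrightarrow> t \<in> S \<Longrightarrow> inv\<^bsub>SU2\<^esub> s * t * s \<in> small_grp X"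
    and equivariant': "\<And>s. s \<in> S \<Longrightarrow> twisted_equivariant X A1 A2 s id"
    and large': "\<exists>K\<subseteq>small_grp X. finite K \<and> (\<Sum>i\<in>verts X. (dims X i)\<^sup>2) \<le> card K"
    and auts': "\<And>\<sigma>. \<sigma> \<in> diagram_perms X \<Longrightarrow> diagram_aut X \<sigma>"
    and eps_inv': "\<And>\<sigma> a. \<sigma> \<in> diagram_perms X \<Longrightarrow> a \<in> arrows X \<Longrightarrow> \<epsilon> (map_prod \<sigma> \<sigma> a) = \<epsilon> a"
begin

lemma small_sub: "subgroup (small_grp X) SU2" and big_sub: "subgroup (big_grp X) SU2"
  using SU2.generate_is_subgroup gens by auto

lemma id_aut: "diagram_aut X id"
  by (auto simp: diagram_aut_def map_prod.id)

lemma small_equivariant: "g \<in> small_grp X \<Longrightarrow> twisted_equivariant X A1 A2 g id"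
  unfolding gens(3)
proof (induction g rule: generate.induct)
  case one
  show ?case using twisted_equivariant_one[OF valid' padded'] by (simp only: SU2_simps)
next
  case (incl g) then show ?case by (rule equivariant')
next
  case (inv g)
  then have "g \<in> carrier SU2" using gens(1) by blast
  from twisted_equivariant_inv[OF valid' padded' this equivariant'[OF inv] id_aut] show ?case by (simp only: inv_id)
next
  case (eng g h)
  have "g \<in> carrier SU2" "h \<in> carrier SU2" using SU2.generate_in_carrier[OF gens(1)] eng(1,2) by auto
  from twisted_equivariant_mult[OF valid' this(2) eng(4) this(1) eng(3) id_aut] show ?case by (simp only: SU2_simps comp_id)
qed

sublocale mckay_slice X \<epsilon> A1 A2
proof
  show "small_grp X \<subseteq> carrier SU2" by (rule subgroup.subset[OF small_sub])
qed (fact valid' orient' padded' wedge' square' small_equivariant large')+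

lemma normal_small: "small_grp X \<lhd> SU2\<lparr>carrier := big_grp X\<rparr>"
  using normal_from_generators[of S S'] gens sub conj by simp

abbreviation coset where "coset g \<equiv> small_grp X #>\<^bsub>SU2\<^esub> g"

lemma coset_Omega: "g \<in> big_grp X \<Longrightarrow> coset g \<in> carrier (Omega X)"
  by (auto simp: Omega_def carrier_FactGroup r_coset_def)

lemma coset_mult:
  assumes "g \<in> big_grp X" "h \<in> big_grp X"
  shows "coset g \<otimes>\<^bsub>Omega X\<^esub> coset h = coset (g * h)"
  using normal.rcos_sum[OF normal_small, of g h] assms by (simp add: Omega_def r_coset_def set_mult_def)

context
  fixes \<alpha>
  assumes \<alpha>: "diagram_action X \<alpha>"
begin

lemma alpha_perm: "g \<in> big_grp X \<Longrightarrow> \<alpha> (coset g) \<in> diagram_perms X"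
  and alpha_mult: "g \<in> big_grp X \<Longrightarrow> h \<in> big_grp X \<Longrightarrow> \<alpha> (coset (g * h)) = \<alpha> (coset g) \<circ> \<alpha> (coset h)"
  using \<alpha> coset_Omega[of g] coset_Omega[of h] coset_mult[of g h]
  by (auto simp: diagram_action_def iso_def hom_def diagram_sym_grp_def) metis

text \<open>The image of the neutral coset is an idempotent bijection, hence \<open>id\<close>; this
  uses only the multiplicativity of \<open>\<alpha>\<close> and no group structure on its
  target.\<close>

lemma alpha_small:
  assumes "g \<in> small_grp X"
  shows "\<alpha> (coset g) = id"
proof -
  have one: "1\<^sub>m 2 \<in> small_grp X" "1\<^sub>m 2 \<in> big_grp X"
    using subgroup.one_closed[OF small_sub] subgroup.one_closed[OF big_sub] by auto
  have "coset g = coset (1\<^sub>m 2)"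
    using SU2.coset_join2[OF _ small_sub assms] SU2.coset_join2[OF _ small_sub one(1)]
      assms one(1) subgroup.subset[OF small_sub] by blast
  moreover have "\<alpha> (coset (1\<^sub>m 2)) = \<alpha> (coset (1\<^sub>m 2)) \<circ> \<alpha> (coset (1\<^sub>m 2))"
    using alpha_mult[OF one(2) one(2)] by simp
  moreover have "bij (\<alpha> (coset (1\<^sub>m 2)))"
    using auts'[OF alpha_perm[OF one(2)]] by (simp add: diagram_aut_def)
  ultimately show ?thesis by (metis (no_types, lifting) bij_is_surj comp_apply eq_id_iff surjD)
qed

lemma alpha_id_imp_small:
  assumes g: "g \<in> big_grp X" and "\<alpha> (coset g) = id"
  shows "g \<in> small_grp X"
proof -
  have one: "1\<^sub>m 2 \<in> small_grp X" "1\<^sub>m 2 \<in> big_grp X"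
    using subgroup.one_closed[OF small_sub] subgroup.one_closed[OF big_sub] by auto
  have "inj_on \<alpha> (carrier (Omega X))" using \<alpha> by (simp add: diagram_action_def iso_def bij_betw_def)
  then have "coset g = coset (1\<^sub>m 2)"
    using coset_Omega[OF g] coset_Omega[OF one(2)] alpha_small[OF one(1)] assms(2) by (simp add: inj_on_def)
  moreover have "coset (1\<^sub>m 2) = small_grp X"
    using SU2.coset_join2[OF _ small_sub one(1)] subgroup.subset[OF small_sub] one(1) by blast
  ultimately show ?thesis
    using SU2.rcos_self[OF _ small_sub] subgroup.subset[OF big_sub] g by blast
qed

lemma alpha_inv:
  assumes g: "g \<in> big_grp X"
  shows "\<alpha> (coset (inv\<^bsub>SU2\<^esub> g)) = perm_inv (\<alpha> (coset g))"
proof -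
  have gS: "g \<in> carrier SU2" using subgroup.subset[OF big_sub] g by blast
  have i: "inv\<^bsub>SU2\<^esub> g \<in> big_grp X" by (rule subgroup.m_inv_closed[OF big_sub g])
  have "\<alpha> (coset g) \<circ> \<alpha> (coset (inv\<^bsub>SU2\<^esub> g)) = \<alpha> (coset (1\<^sub>m 2))"
    using alpha_mult[OF g i] SU2.r_inv[OF gS] by simp
  then have "\<alpha> (coset g) \<circ> \<alpha> (coset (inv\<^bsub>SU2\<^esub> g)) = id"
    using alpha_small subgroup.one_closed[OF small_sub] by simp
  moreover have "\<alpha> (coset (inv\<^bsub>SU2\<^esub> g)) \<circ> \<alpha> (coset g) = id"
    using alpha_mult[OF i g] SU2.l_inv[OF gS] alpha_small subgroup.one_closed[OF small_sub] by simp
  ultimately show ?thesis using inv_unique_comp by metis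
qed

theorem action_from_generators:
  assumes tw: "\<And>s. s \<in> S' \<Longrightarrow> twisted_equivariant X A1 A2 s (\<alpha> (coset s))"
  shows "\<exists>\<rho>. lifted_action X \<alpha> \<rho> \<and> symplectic_action X \<epsilon> \<rho> \<and> induces_natural_action X \<epsilon> \<rho>"
proof -
  have S'_big: "s \<in> big_grp X" if "s \<in> S'" for s using that gens(4) by (auto intro: generate.incl)
  have "twisted_equivariant X A1 A2 g (\<alpha> (coset g))" if "g \<in> big_grp X" for g
    using that unfolding gens(4)
  proof (induction g rule: generate.induct)
    case one
    show ?case
      using twisted_equivariant_one[OF valid' padded'] alpha_small[OF subgroup.one_closed[OF small_sub]]
      by (simp only: SU2_simps)
  next
    case (incl g) then show ?case by (rule tw)
  next
    case (inv g)
    then have "g \<in> carrier SU2" using gens(2) by blast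
    from twisted_equivariant_inv[OF valid' padded' this tw[OF inv] auts'[OF alpha_perm[OF S'_big[OF inv]]]]
    show ?case by (simp only: alpha_inv[OF S'_big[OF inv]])
  next
    case (eng g h)
    have c: "g \<in> carrier SU2" "h \<in> carrier SU2" using SU2.generate_in_carrier[OF gens(2)] eng(1,2) by auto
    have b: "g \<in> big_grp X" "h \<in> big_grp X" using eng(1,2) gens(4) by auto
    from twisted_equivariant_mult[OF valid' c(2) eng(4) c(1) eng(3) auts'[OF alpha_perm[OF b(2)]]]
    show ?case by (simp only: SU2_simps alpha_mult[OF b])
  qed
  then interpret mckay_action X \<epsilon> A1 A2 \<alpha>
    by (intro mckay_action.intro mckay_action_axioms.intro mckay_slice_axioms \<alpha> big_sub normal_small auts' eps_inv')
  show ?thesis by (rule symplectic_action_exists)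
qed

text \<open>As \<open>\<alpha>\<close> is injective, it is \<open>id\<close> exactly on the coset
  \<Gamma>. With only two permutations available, a generator outside \<Gamma> must be sent to
  \<open>\<tau>\<close>.\<close>

theorem action_order_two:
  assumes perms: "diagram_perms X = {id, \<tau>}"
    and tw: "\<And>s. s \<in> S' \<Longrightarrow> s \<in> small_grp X \<or> twisted_equivariant X A1 A2 s \<tau>"
  shows "\<exists>\<rho>. lifted_action X \<alpha> \<rho> \<and> symplectic_action X \<epsilon> \<rho> \<and> induces_natural_action X \<epsilon> \<rho>"
proof (rule action_from_generators)
  fix s assume s: "s \<in> S'"
  then have b: "s \<in> big_grp X" using gens(4) by (auto intro: generate.incl)
  consider "\<alpha> (coset s) = id" | "\<alpha> (coset s) = \<tau>" "\<alpha> (coset s) \<noteq> id"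
    using alpha_perm[OF b] perms by auto
  then show "twisted_equivariant X A1 A2 s (\<alpha> (coset s))"
  proof cases
    case 1
    then show ?thesis using small_equivariant[OF alpha_id_imp_small[OF b 1]] by (simp only: 1)
  next
    case 2
    then have "s \<notin> small_grp X" using alpha_small by blast
    then show ?thesis using tw[OF s] 2(1) by simp
  qed
qed

end

end

section \<open>The generators of the finite groups\<close>

lemma rot_SU2: "rot n \<in> carrier SU2"
  unfolding SU2_iff rot_def
  by (intro exI[of _ "cis (2 * pi / real n)"] exI[of _ 0]) (simp add: mat22_eq_iff cis_cnj cis_mult)

lemma matJ_SU2: "matJ \<in> carrier SU2"
  unfolding SU2_iff matJ_def by (intro exI[of _ 0] exI[of _ 1]) (simp add: mat22_eq_iff)

lemma SU2_inv_mat22: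
  assumes "mat22 a b c d \<in> carrier SU2"
  shows "inv\<^bsub>SU2\<^esub> (mat22 a b c d) = mat22 d (- b) (- c) a"
proof (rule SU2.inv_equality[OF _ assms])
  obtain p q where pq: "mat22 a b c d = mat22 p q (- cnj q) (cnj p)" "p * cnj p + q * cnj q = 1"
    using assms by (auto simp: SU2_iff)
  then have e: "p = a" "q = b" "c = - cnj b" "d = cnj a" by (auto simp: mat22_eq_iff)
  show "mat22 d (- b) (- c) a \<otimes>\<^bsub>SU2\<^esub> mat22 a b c d = \<one>\<^bsub>SU2\<^esub>"
    using pq(2) by (simp add: e mat22_mult mat22_one mat22_eq_iff algebra_simps)
  show "mat22 d (- b) (- c) a \<in> carrier SU2"
    unfolding SU2_iff using pq(2)
    by (intro exI[of _ "cnj a"] exI[of _ "- b"]) (simp add: e mat22_eq_iff mult.commute)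
qed

lemma rot_inv: "inv\<^bsub>SU2\<^esub> (rot n) = mat22 (cis (- (2 * pi / real n))) 0 0 (cis (2 * pi / real n))"
  using SU2_inv_mat22 rot_SU2[of n] by (simp add: rot_def)

lemma matJ_inv: "inv\<^bsub>SU2\<^esub> matJ = mat22 0 (- 1) 1 0"
  using SU2_inv_mat22 matJ_SU2 by (simp add: matJ_def)

definition rot_pow :: "nat \<Rightarrow> nat \<Rightarrow> complex mat" where
  "rot_pow n k = mat22 (cis (2 * pi * real k / real n)) 0 0 (cis (- (2 * pi * real k / real n)))"

lemma rot_pow_in_generate:
  assumes "rot n \<in> S"
  shows "rot_pow n k \<in> generate SU2 S"
proof (induction k)
  case 0
  have "rot_pow n 0 = 1\<^sub>m 2" by (simp add: rot_pow_def mat22_one)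
  then show ?case using generate.one[of SU2 S] by simp
next
  case (Suc k)
  have "rot_pow n (Suc k) = rot n * rot_pow n k"
    by (simp add: rot_pow_def rot_def mat22_mult cis_mult mat22_eq_iff add_divide_distrib algebra_simps)
  then show ?case using generate.eng[OF generate.incl[OF assms] Suc] by simp
qed

lemma cis_roots_inj:
  assumes "n > 0"
  shows "inj_on (\<lambda>k. cis (2 * pi * real k / real n)) {..<n}"
  using bij_betw_roots_unity[OF assms] by (simp add: bij_betw_def)

lemma rot_pow_inj: "n > 0 \<Longrightarrow> inj_on (rot_pow n) {..<n}"
  using cis_roots_inj[of n] by (auto simp: inj_on_def rot_pow_def mat22_eq_iff)

text \<open>The powers of the rotation are diagonal and their products with \<open>matJ\<close>
  antidiagonal, which gives 2 n distinct elements.\<close>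

lemma dihedral_large:
  assumes n: "n > 0" and S: "rot n \<in> S" "matJ \<in> S"
  shows "\<exists>K\<subseteq>generate SU2 S. finite K \<and> 2 * n \<le> card K"
proof -
  define K where "K = rot_pow n ` {..<n} \<union> (\<lambda>k. rot_pow n k * matJ) ` {..<n}"
  have J: "rot_pow n k * matJ = mat22 0 (cis (2 * pi * real k / real n)) (- cis (- (2 * pi * real k / real n))) 0" for k
    by (simp add: rot_pow_def matJ_def mat22_mult mat22_eq_iff)
  have "inj_on (\<lambda>k. rot_pow n k * matJ) {..<n}"
    using cis_roots_inj[OF n] by (auto simp: inj_on_def J mat22_eq_iff)
  moreover have "rot_pow n ` {..<n} \<inter> (\<lambda>k. rot_pow n k * matJ) ` {..<n} = {}"
    unfolding J by (auto simp: rot_pow_def mat22_eq_iff)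
  ultimately have "card K = 2 * n"
    unfolding K_def using rot_pow_inj[OF n] by (subst card_Un_disjoint) (auto simp: card_image)
  moreover have "K \<subseteq> generate SU2 S"
    using rot_pow_in_generate[OF S(1)] generate.eng[OF rot_pow_in_generate[OF S(1)] generate.incl[OF S(2)]]
    by (auto simp: K_def)
  ultimately show ?thesis by (intro exI[of _ K]) (auto simp: K_def)
qed

definition scal :: "complex \<Rightarrow> m3" where
  "scal c = M3 c 0 0 0 0 0 0 0 0"

lemma scal_ops: "scal a * scal b = scal (a * b)" "scal a - scal b = scal (a - b)" "scal a + scal b = scal (a + b)"
  "sc k * scal a = scal (k * a)" "scal 0 = 0" "un (Suc 0) = scal 1" "un 1 = scal 1" "- scal a = scal (- a)"
  by (simp_all add: scal_def M3_ops un_M3 sc_def)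

section \<open>Type \<open>A\<close>\<close>

context
  fixes r :: nat
  assumes r: "r \<ge> 2"
begin

definition fwd :: "nat \<times> nat \<Rightarrow> bool" where
  "fwd a \<longleftrightarrow> snd a = (if fst a = 2 * r - 1 then 0 else fst a + 1)"

text \<open>With all weights 1 the slice would fit the orientation that is positive on every forward
  arrow. \<open>A_eps\<close> is negative on forward arrows of the second half of the cycle, and the
  weight i there supplies the sign through i^2 = -1.\<close>

definition wgt :: "nat \<Rightarrow> complex" where
  "wgt i = (if i < r then 1 else \<i>)"

definition A_A1 :: "nat \<times> nat \<Rightarrow> m3" where
  "A_A1 a = (if fwd a then scal (wgt (fst a)) else 0)"

definition A_A2 :: "nat \<times> nat \<Rightarrow> m3" where
  "A_A2 a = (if fwd a then 0 else scal (wgt (snd a)))"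

text \<open>The flip turns forward arrows into backward ones, so an orientation invariant under it
  cannot be constant around the cycle. It changes sign at the vertices 0 and r, the two fixed points
  of the flip.\<close>

definition A_eps :: "nat \<times> nat \<Rightarrow> int" where
  "A_eps a = (if fwd a then if fst a < r then 1 else - 1 else if snd a < r then - 1 else 1)"

lemma A_arrows_iff:
  "(i, j) \<in> arrows (A_Z2 r) \<longleftrightarrow> i < 2 * r \<and> j < 2 * r \<and> (fwd (i, j) \<or> fwd (j, i))"
proof -
  have m: "(k + 1) mod (2 * r) = (if k = 2 * r - 1 then 0 else k + 1)" if "k < 2 * r" for k
    using that r by auto
  have "(i, j) \<in> arrows (A_Z2 r) \<longleftrightarrow>
      (i < 2 * r \<and> j = (i + 1) mod (2 * r)) \<or> (j < 2 * r \<and> i = (j + 1) mod (2 * r))"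
    by (auto simp: arrows_def)
  also have "\<dots> \<longleftrightarrow> (i < 2 * r \<and> fwd (i, j)) \<or> (j < 2 * r \<and> fwd (j, i))"
    using m by (auto simp: fwd_def)
  also have "\<dots> \<longleftrightarrow> i < 2 * r \<and> j < 2 * r \<and> (fwd (i, j) \<or> fwd (j, i))"
    by (auto simp: fwd_def)
  finally show ?thesis .
qed

lemma fwd_iff: "fwd (i, j) \<longleftrightarrow> i = 2 * r - 1 \<and> j = 0 \<or> i \<noteq> 2 * r - 1 \<and> j = Suc i"
  by (simp add: fwd_def)

lemma fwd_asym: "fwd (i, j) \<Longrightarrow> \<not> fwd (j, i)"
  using r by (auto simp: fwd_def split: if_splits)

lemma fwd_functional: "fwd (i, j) \<Longrightarrow> fwd (i, k) \<Longrightarrow> j = k"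
  by (auto simp: fwd_def split: if_splits)

lemma fwd_injective: "i < 2 * r \<Longrightarrow> k < 2 * r \<Longrightarrow> fwd (i, j) \<Longrightarrow> fwd (k, j) \<Longrightarrow> i = k"
  by (auto simp: fwd_def split: if_splits)

lemma A_in_arrows:
  assumes j: "j < 2 * r"
  obtains p q where "in_arrows (A_Z2 r) j = {(p, j), (q, j)}" "p \<noteq> q" "fwd (p, j)" "\<not> fwd (q, j)" "fwd (j, q)" "\<not> fwd (j, p)"
proof -
  define p where "p = (if j = 0 then 2 * r - 1 else j - 1)"
  define q where "q = (if j = 2 * r - 1 then 0 else j + 1)"
  have pq: "p < 2 * r" "q < 2 * r" "fwd (p, j)" "fwd (j, q)" using j r by (auto simp: p_def q_def fwd_def)
  have "(i, k) \<in> in_arrows (A_Z2 r) j \<longleftrightarrow> (i, k) \<in> {(p, j), (q, j)}" for i k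
    using pq j fwd_functional[of j q i] fwd_injective[of i p j] by (auto simp: in_arrows_def A_arrows_iff)
  then have "in_arrows (A_Z2 r) j = {(p, j), (q, j)}" by auto
  moreover have "p \<noteq> q" using pq fwd_asym by auto
  ultimately show thesis using that pq fwd_asym by blast
qed

lemma wgt_square: "wgt i * wgt i = (if i < r then 1 else - 1)" "wgt i * (wgt i * z) = (if i < r then z else - z)"
  by (simp_all add: wgt_def flip: mult.assoc)

lemma A_square:
  assumes j: "j \<in> verts (A_Z2 r)"
  shows "(\<Sum>a\<in>in_arrows (A_Z2 r) j. sc (of_int (A_eps a)) * (A_A1 a * A_A2 (prod.swap a))) = sc (of_nat (dims (A_Z2 r) j)) * un (dims (A_Z2 r) j)"
    "(\<Sum>a\<in>in_arrows (A_Z2 r) j. sc (of_int (A_eps a)) * (A_A2 a * A_A1 (prod.swap a))) = - (sc (of_nat (dims (A_Z2 r) j)) * un (dims (A_Z2 r) j))"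
    "(\<Sum>a\<in>in_arrows (A_Z2 r) j. sc (of_int (A_eps a)) * (A_A1 a * A_A1 (prod.swap a))) = 0"
    "(\<Sum>a\<in>in_arrows (A_Z2 r) j. sc (of_int (A_eps a)) * (A_A2 a * A_A2 (prod.swap a))) = 0"
proof -
  have "j < 2 * r" using j by simp
  then obtain p q where *: "in_arrows (A_Z2 r) j = {(p, j), (q, j)}" "p \<noteq> q" "fwd (p, j)" "\<not> fwd (q, j)" "fwd (j, q)" "\<not> fwd (j, p)"
    by (rule A_in_arrows)
  show "(\<Sum>a\<in>in_arrows (A_Z2 r) j. sc (of_int (A_eps a)) * (A_A1 a * A_A2 (prod.swap a))) = sc (of_nat (dims (A_Z2 r) j)) * un (dims (A_Z2 r) j)"
    "(\<Sum>a\<in>in_arrows (A_Z2 r) j. sc (of_int (A_eps a)) * (A_A2 a * A_A1 (prod.swap a))) = - (sc (of_nat (dims (A_Z2 r) j)) * un (dims (A_Z2 r) j))"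
    "(\<Sum>a\<in>in_arrows (A_Z2 r) j. sc (of_int (A_eps a)) * (A_A1 a * A_A1 (prod.swap a))) = 0"
    "(\<Sum>a\<in>in_arrows (A_Z2 r) j. sc (of_int (A_eps a)) * (A_A2 a * A_A2 (prod.swap a))) = 0"
    using * by (simp_all add: A_A1_def A_A2_def A_eps_def scal_ops wgt_square)
qed

lemma A_wedge:
  assumes a: "a \<in> arrows (A_Z2 r)" and b: "b \<in> arrows (A_Z2 r)" and ab: "snd a = fst b"
  shows "A_A1 b * A_A2 a - A_A2 b * A_A1 a =
    (if b = prod.swap a then sc (of_int (A_eps b) * of_nat (dims (A_Z2 r) (fst b))) * un (dims (A_Z2 r) (snd b)) else 0)"
proof -
  obtain i j l where ij: "a = (i, j)" "b = (j, l)" using ab by (cases a; cases b) auto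
  have bounds: "i < 2 * r" "j < 2 * r" "l < 2 * r" "fwd (i, j) \<or> fwd (j, i)" "fwd (j, l) \<or> fwd (l, j)"
    using a b by (auto simp: ij A_arrows_iff)
  \<comment> \<open>A path of two arrows either keeps its direction or turns back at once; as the
    cycle has at least four vertices, it returns to its start only in the second case.\<close>
  then consider "fwd (i, j)" "\<not> fwd (j, i)" "fwd (j, l)" "l \<noteq> i"
    | "fwd (i, j)" "\<not> fwd (j, l)" "l = i"
    | "fwd (j, i)" "\<not> fwd (i, j)" "fwd (j, l)" "l = i"
    | "\<not> fwd (i, j)" "\<not> fwd (j, l)" "l \<noteq> i"
    using fwd_asym fwd_functional fwd_injective by metis
  then show ?thesis
    by cases (simp_all add: ij A_A1_def A_A2_def A_eps_def scal_ops wgt_square)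
qed

definition A_flip :: "nat \<Rightarrow> nat" where
  "A_flip i = (if 1 \<le> i \<and> i < 2 * r then 2 * r - i else i)"

lemma A_perms: "diagram_perms (A_Z2 r) = {id, A_flip}"
  by (auto simp: A_flip_def fun_eq_iff)

lemma A_flip_flip: "A_flip (A_flip i) = i"
  by (auto simp: A_flip_def)

lemma A_flip_less: "A_flip i < 2 * r \<longleftrightarrow> i < 2 * r"
  by (auto simp: A_flip_def)

lemma A_flip_fwd: "i < 2 * r \<Longrightarrow> j < 2 * r \<Longrightarrow> fwd (A_flip i, A_flip j) \<longleftrightarrow> fwd (j, i)"
  using r by (auto simp: fwd_def A_flip_def split: if_splits)

lemma A_auts:
  assumes "\<sigma> \<in> diagram_perms (A_Z2 r)"
  shows "diagram_aut (A_Z2 r) \<sigma>"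
proof -
  have "diagram_aut (A_Z2 r) A_flip"
    unfolding diagram_aut_def
  proof (intro conjI ballI)
    show "bij A_flip" using A_flip_flip by (rule involuntory_imp_bij)
    have "A_flip ` {..<2 * r} \<subseteq> {..<2 * r}" using A_flip_less by auto
    moreover have "i \<in> A_flip ` {..<2 * r}" if "i < 2 * r" for i
      using A_flip_flip[of i] A_flip_less[of i] that by (metis image_eqI lessThan_iff)
    ultimately show "A_flip ` verts (A_Z2 r) = verts (A_Z2 r)" by auto
    fix a assume "a \<in> arrows (A_Z2 r)"
    then show "map_prod A_flip A_flip a \<in> arrows (A_Z2 r)"
      by (cases a) (auto simp: A_arrows_iff A_flip_less A_flip_fwd)
  qed simp
  moreover have "diagram_aut (A_Z2 r) id" by (auto simp: diagram_aut_def map_prod.id)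
  ultimately show ?thesis using assms unfolding A_perms by blast
qed

lemma A_eps_inv:
  assumes "\<sigma> \<in> diagram_perms (A_Z2 r)" "a \<in> arrows (A_Z2 r)"
  shows "A_eps (map_prod \<sigma> \<sigma> a) = A_eps a"
proof -
  have "A_eps (map_prod A_flip A_flip a) = A_eps a"
  proof -
    obtain i j where a: "a = (i, j)" by (cases a)
    have ij: "i < 2 * r" "j < 2 * r" "fwd (i, j) \<or> fwd (j, i)" using assms(2) by (auto simp: a A_arrows_iff)
    \<comment> \<open>The flip sends the forward arrow from k to l to a backward arrow whose
      opposite starts at \<open>A_flip l\<close>, in the other half of the cycle.\<close>
    have fl: "A_flip l < r \<longleftrightarrow> \<not> k < r" if "fwd (k, l)" "k < 2 * r" for k l
      using that r by (auto simp: A_flip_def fwd_def split: if_splits)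
    show ?thesis
      using ij fwd_asym[of i j] fwd_asym[of j i] fl[of i j] fl[of j i] by (auto simp: a A_eps_def A_flip_fwd)
  qed
  then show ?thesis using assms(1) unfolding A_perms by (auto simp: map_prod.id)
qed

lemma A_padded: "padded_rep (A_Z2 r) A_A1" "padded_rep (A_Z2 r) A_A2"
  by (simp_all add: padded_rep_def A_A1_def A_A2_def scal_ops)

lemma A_orientation: "orientation (A_Z2 r) A_eps"
  unfolding orientation_def
proof
  fix a assume "a \<in> arrows (A_Z2 r)"
  then show "A_eps a \<in> {1, - 1} \<and> A_eps (prod.swap a) = - A_eps a"
    using fwd_asym by (cases a) (auto simp: A_eps_def A_arrows_iff)
qed

text \<open>Vertex \<open>i\<close> carries the character of the cyclic group that takes the value
  cis (i t) on the generator, so forward arrows scale by cis t and backward ones by its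
  inverse.\<close>

lemma A_twisted_rot: "twisted_equivariant (A_Z2 r) A_A1 A_A2 (rot (2 * r)) id"
  unfolding twisted_equivariant_def
proof -
  define t where "t = 2 * pi / real (2 * r)"
  let ?h = "\<lambda>i. scal (cis (real i * t))" and ?h' = "\<lambda>i. scal (cis (- (real i * t)))"
  have "gauge_pair (A_Z2 r) ?h ?h'" by (simp add: gauge_pair_def scal_ops cis_mult)
  moreover have "slice_rep A_A1 A_A2 (act_fst (rot (2 * r)) x y) (act_snd (rot (2 * r)) x y) (map_prod id id a) =
      pair_act ?h ?h' (slice_rep A_A1 A_A2 x y) a" if "a \<in> arrows (A_Z2 r)" for x y a
  proof -
  note that
  moreover obtain i j where a: "a = (i, j)" by (cases a)
  ultimately have ij: "i < 2 * r" "j < 2 * r" "fwd (i, j) \<or> fwd (j, i)" by (auto simp: A_arrows_iff)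
  \<comment> \<open>Only the arrow from 2 r - 1 to 0 closes the cycle; there the angle 2 r t is a
    full turn.\<close>
  have step: "cis (real l * t) = cis (real (Suc k) * t)" if "fwd (k, l)" "k < 2 * r" for k l
  proof (cases "k = 2 * r - 1")
    case True
    then have "real (Suc k) * t = 2 * pi" "l = 0" using r that by (auto simp: fwd_def of_nat_diff t_def)
    then show ?thesis by simp
  qed (use that in \<open>simp add: fwd_def\<close>)
  have up: "cis (real l * t) * cis (- (real k * t)) = cis t" if "fwd (k, l)" "k < 2 * r" for k l
  proof -
    have "real (Suc k) * t + - (real k * t) = t" by (simp add: algebra_simps)
    then show ?thesis unfolding step[OF that] cis_mult by (simp only:)
  qed
  have down: "cis (real k * t) * cis (- (real l * t)) = cis (- t)" if "fwd (k, l)" "k < 2 * r" for k l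
    using arg_cong[OF up[OF that], of cnj] by (simp only: complex_cnj_mult cis_cnj minus_minus mult.commute)
  have act: "act_fst (rot (2 * r)) x y = cis t * x" "act_snd (rot (2 * r)) x y = cis (- t) * y"
    by (simp_all add: act_fst_def act_snd_def rot_def t_def)
  show ?thesis
  proof (cases "fwd (i, j)")
    case True
    have eq: "cis t * x * wgt i = cis (real j * t) * (x * wgt i) * cis (- (real i * t))"
      using arg_cong[OF up[OF True ij(1)], of "\<lambda>z. z * (x * wgt i)"] by (simp only: mult_ac)
    from True show ?thesis
      by (simp add: a slice_rep_def pair_act_def A_A1_def A_A2_def scal_ops act eq)
  next
    case False
    then have "fwd (j, i)" using ij by blast
    from down[OF this ij(2)] have eq: "cis (- t) * y * wgt j = cis (real j * t) * (y * wgt j) * cis (- (real i * t))"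
      using arg_cong[of _ _ "\<lambda>z. z * (y * wgt j)"] by (simp only: mult_ac)
    from False show ?thesis
      by (simp add: a slice_rep_def pair_act_def A_A1_def A_A2_def scal_ops act eq)
  qed
  qed
  ultimately show "\<exists>h h'. gauge_pair (A_Z2 r) h h' \<and> (\<forall>x y. \<forall>a\<in>arrows (A_Z2 r).
      slice_rep A_A1 A_A2 (act_fst (rot (2 * r)) x y) (act_snd (rot (2 * r)) x y) (map_prod id id a) =
      pair_act h h' (slice_rep A_A1 A_A2 x y) a)" by blast
qed

text \<open>Up to sign \<open>matJ\<close> exchanges x and y, and with them forward and backward
  arrows. The flip replaces the weight 1 of an arrow by i and conversely; to match this, the gauge
  factor picks up - i with each step away from the vertex 0 and i with each step towards it.
  Accordingly \<open>?m i\<close> is the distance of \<open>i\<close> from 0 on the cycle.\<close>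

lemma A_twisted_J: "twisted_equivariant (A_Z2 r) A_A1 A_A2 matJ A_flip"
  unfolding twisted_equivariant_def
proof (intro exI conjI allI ballI)
  let ?m = "\<lambda>i. min i (2 * r - i)"
  let ?h = "\<lambda>i. scal ((- \<i>) ^ ?m i)" and ?h' = "\<lambda>i. scal (\<i> ^ ?m i)"
  have pw: "(- \<i>) ^ k * \<i> ^ k = 1" for k by (simp flip: power_mult_distrib)
  show "gauge_pair (A_Z2 r) ?h ?h'" using pw by (simp add: gauge_pair_def scal_ops mult.commute)
  fix x y a assume "a \<in> arrows (A_Z2 r)"
  moreover obtain i j where a: "a = (i, j)" by (cases a)
  ultimately have ij: "i < 2 * r" "j < 2 * r" "fwd (i, j) \<or> fwd (j, i)" by (auto simp: A_arrows_iff)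
  have up: "- wgt (A_flip l) = (- \<i>) ^ ?m l * \<i> ^ ?m k * wgt k"
    and down: "wgt (A_flip l) = (- \<i>) ^ ?m k * \<i> ^ ?m l * wgt k" if f: "fwd (k, l)" "k < 2 * r" for k l
  proof -
    consider "k < r" "l = Suc k" "?m k = k" "?m l = Suc k" "A_flip l = 2 * r - Suc k" "\<not> A_flip l < r"
      | m where "\<not> k < r" "?m k = Suc m" "?m l = m" "A_flip l < r"
    proof (cases "k < r")
      case True
      then have "l = Suc k" using f r by (auto simp: fwd_iff)
      then show thesis using True by (intro that(1)) (auto simp: A_flip_def)
    next
      case False
      then show thesis using f r by (intro that(2)[of "2 * r - k - 1"]) (auto simp: fwd_iff A_flip_def)
    qed
    note c = this
    show "- wgt (A_flip l) = (- \<i>) ^ ?m l * \<i> ^ ?m k * wgt k"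
      using c
    proof cases
      case 1
      then have "(- \<i>) ^ ?m k * \<i> ^ ?m l * wgt k = ((- \<i>) ^ k * \<i> ^ k) * \<i>"
        "(- \<i>) ^ ?m l * \<i> ^ ?m k * wgt k = ((- \<i>) ^ k * \<i> ^ k) * - \<i>"
        by (simp_all only: wgt_def if_True power_Suc mult_ac mult_1_left)
      then show ?thesis using 1 pw[of k] by (simp add: wgt_def)
    next
      case 2
      then have "(- \<i>) ^ ?m l * \<i> ^ ?m k * wgt k = ((- \<i>) ^ m * \<i> ^ m) * (\<i> * \<i>)"
        by (simp only: wgt_def if_False power_Suc mult_ac)
      then show ?thesis using 2 pw[of m] by (simp add: wgt_def)
    qed
    show "wgt (A_flip l) = (- \<i>) ^ ?m k * \<i> ^ ?m l * wgt k"
      using c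
    proof cases
      case 1
      then have "(- \<i>) ^ ?m k * \<i> ^ ?m l * wgt k = ((- \<i>) ^ k * \<i> ^ k) * \<i>"
        "(- \<i>) ^ ?m l * \<i> ^ ?m k * wgt k = ((- \<i>) ^ k * \<i> ^ k) * - \<i>"
        by (simp_all only: wgt_def if_True power_Suc mult_ac mult_1_left)
      then show ?thesis using 1 pw[of k] by (simp add: wgt_def)
    next
      case 2
      then have "(- \<i>) ^ ?m k * \<i> ^ ?m l * wgt k = ((- \<i>) ^ m * \<i> ^ m) * (- \<i> * \<i>)"
        by (simp only: wgt_def if_False power_Suc mult_ac)
      then show ?thesis using 2 pw[of m] by (simp add: wgt_def)
    qed
  qed
  show "slice_rep A_A1 A_A2 (act_fst matJ x y) (act_snd matJ x y) (map_prod A_flip A_flip a) =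
      pair_act ?h ?h' (slice_rep A_A1 A_A2 x y) a"
  proof (cases "fwd (i, j)")
    case True
    then have "\<not> fwd (A_flip i, A_flip j)" using A_flip_fwd[OF ij(1,2)] fwd_asym by blast
    moreover have eq: "- (x * wgt (A_flip j)) = (- \<i>) ^ ?m j * (x * wgt i) * \<i> ^ ?m i"
      using arg_cong[OF up[OF True ij(1)], of "\<lambda>z. x * z"] by (simp only: mult_minus_left mult_minus_right mult_ac)
    ultimately show ?thesis using True
      unfolding slice_rep_def pair_act_def A_A1_def A_A2_def a act_snd_def matJ_def
      by (simp add: scal_ops eq[simplified])
  next
    case False
    then have f: "fwd (j, i)" using ij by blast
    then have "fwd (A_flip i, A_flip j)" using A_flip_fwd[OF ij(1,2)] by blast
    moreover have eq: "y * wgt (A_flip i) = (- \<i>) ^ ?m j * (y * wgt j) * \<i> ^ ?m i"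
      using arg_cong[OF down[OF f ij(2)], of "\<lambda>z. y * z"] by (simp only: mult_ac)
    ultimately show ?thesis using False
      unfolding slice_rep_def pair_act_def A_A1_def A_A2_def a act_fst_def matJ_def
      by (simp add: scal_ops eq)
  qed
qed

lemma A_generators: "mckay_generators (A_Z2 r) A_eps A_A1 A_A2 {rot (2 * r)} {rot (2 * r), matJ}"
proof
  show "valid_triple (A_Z2 r)" using r by simp
  show "orientation (A_Z2 r) A_eps" by (rule A_orientation)
  show "small_grp (A_Z2 r) = generate SU2 {rot (2 * r)}" by (simp add: cyclic_grp_def)
  show "big_grp (A_Z2 r) = generate SU2 {rot (2 * r), matJ}" by (simp add: binary_dihedral_grp_def)
  show "{rot (2 * r)} \<subseteq> big_grp (A_Z2 r)" by (auto simp: binary_dihedral_grp_def intro: generate.incl)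
  have R: "rot (2 * r) \<in> small_grp (A_Z2 r)" "inv\<^bsub>SU2\<^esub> (rot (2 * r)) \<in> small_grp (A_Z2 r)"
    by (auto simp: cyclic_grp_def intro: generate.incl generate.inv)
  have c: "rot (2 * r) * rot (2 * r) * inv\<^bsub>SU2\<^esub> (rot (2 * r)) = rot (2 * r)"
    "inv\<^bsub>SU2\<^esub> (rot (2 * r)) * rot (2 * r) * rot (2 * r) = rot (2 * r)"
    "matJ * rot (2 * r) * inv\<^bsub>SU2\<^esub> matJ = inv\<^bsub>SU2\<^esub> (rot (2 * r))"
    "inv\<^bsub>SU2\<^esub> matJ * rot (2 * r) * matJ = inv\<^bsub>SU2\<^esub> (rot (2 * r))"
    unfolding rot_inv matJ_inv unfolding rot_def matJ_def
    by (simp_all add: mat22_mult mat22_eq_iff cis_mult)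
  show "s * t * inv\<^bsub>SU2\<^esub> s \<in> small_grp (A_Z2 r)" "inv\<^bsub>SU2\<^esub> s * t * s \<in> small_grp (A_Z2 r)"
    if "s \<in> {rot (2 * r), matJ}" "t \<in> {rot (2 * r)}" for s t
    using that R c by auto
  have "rot_pow (2 * r) ` {..<2 * r} \<subseteq> small_grp (A_Z2 r)"
    using rot_pow_in_generate[of "2 * r" "{rot (2 * r)}"] by (auto simp: cyclic_grp_def)
  moreover have "card (rot_pow (2 * r) ` {..<2 * r}) = 2 * r"
    using rot_pow_inj[of "2 * r"] r by (simp add: card_image)
  ultimately show "\<exists>K\<subseteq>small_grp (A_Z2 r). finite K \<and> (\<Sum>i\<in>verts (A_Z2 r). (dims (A_Z2 r) i)\<^sup>2) \<le> card K"
    by (intro exI[of _ "rot_pow (2 * r) ` {..<2 * r}"]) simp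
qed (use A_padded A_wedge A_square A_auts A_eps_inv rot_SU2 matJ_SU2 A_twisted_rot in auto)

lemma A_main:
  assumes "diagram_action (A_Z2 r) \<alpha>"
  shows "\<exists>\<epsilon> \<rho>. orientation (A_Z2 r) \<epsilon> \<and> lifted_action (A_Z2 r) \<alpha> \<rho> \<and> symplectic_action (A_Z2 r) \<epsilon> \<rho> \<and>
    induces_natural_action (A_Z2 r) \<epsilon> \<rho>"
proof -
  have "rot (2 * r) \<in> small_grp (A_Z2 r)" by (auto simp: cyclic_grp_def intro: generate.incl)
  then have "\<exists>\<rho>. lifted_action (A_Z2 r) \<alpha> \<rho> \<and> symplectic_action (A_Z2 r) A_eps \<rho> \<and> induces_natural_action (A_Z2 r) A_eps \<rho>"
    using A_twisted_J by (intro mckay_generators.action_order_two[OF A_generators assms A_perms]) auto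
  then show ?thesis using A_orientation by blast
qed

end

definition colm :: "complex \<Rightarrow> complex \<Rightarrow> m3" where "colm x y = M3 x 0 0 y 0 0 0 0 0"
definition rowm :: "complex \<Rightarrow> complex \<Rightarrow> m3" where "rowm x y = M3 x y 0 0 0 0 0 0 0"
definition sqm :: "complex \<Rightarrow> complex \<Rightarrow> complex \<Rightarrow> complex \<Rightarrow> m3" where "sqm a b c d = M3 a b 0 c d 0 0 0 0"

lemmas small_defs = colm_def rowm_def sqm_def scal_def un_M3 sc_def

lemma small_ops:
  "sqm a b c d * colm x y = colm (a * x + b * y) (c * x + d * y)"
  "rowm x y * sqm a b c d = rowm (x * a + y * c) (x * b + y * d)"
  "sqm a b c d * sqm a' b' c' d' = sqm (a * a' + b * c') (a * b' + b * d') (c * a' + d * c') (c * b' + d * d')"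
  "colm x y * scal k = colm (x * k) (y * k)" "scal k * rowm x y = rowm (k * x) (k * y)"
  "sc k * colm x y = colm (k * x) (k * y)" "sc k * rowm x y = rowm (k * x) (k * y)"
  "sc k * sqm a b c d = sqm (k * a) (k * b) (k * c) (k * d)"
  "colm x y + colm x' y' = colm (x + x') (y + y')" "rowm x y + rowm x' y' = rowm (x + x') (y + y')"
  "sqm a b c d + sqm a' b' c' d' = sqm (a + a') (b + b') (c + c') (d + d')"
  "colm x y = colm x' y' \<longleftrightarrow> x = x' \<and> y = y'" "rowm x y = rowm x' y' \<longleftrightarrow> x = x' \<and> y = y'"
  "sqm a b c d = sqm a' b' c' d' \<longleftrightarrow> a = a' \<and> b = b' \<and> c = c' \<and> d = d'"
  by (simp_all add: small_defs M3_ops)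

section \<open>Type \<open>D\<close>\<close>

text \<open>\<open>eta s\<close> is a square root of (-1)^s and \<open>eta' s\<close> its inverse.
  They come from the characters at the last two leaves: on \<open>matJ\<close> these take the values
  plus or minus 1 for even s and plus or minus i for odd s.\<close>

definition eta :: "nat \<Rightarrow> complex" where "eta s = (if even s then 1 else \<i>)"
definition eta' :: "nat \<Rightarrow> complex" where "eta' s = (if even s then 1 else - \<i>)"

lemma eta: "eta s * eta' s = 1" "eta' s * eta s = 1" "(- 1) ^ s * eta' s = eta s" "eta' s * (- 1) ^ s = eta s"
  "eta s * (- 1) ^ s = eta' s"
  by (simp_all add: eta_def eta'_def)

text \<open>Along the chain, v = (x, y) acts by diag(x, y) upwards and by diag(2 y, - 2 x)
  downwards; the factor 2 is the dimension demanded by \<open>wedge\<close>. The two leaves at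
  either end differ by the sign of the second component.\<close>

fun D_slice1 :: "nat \<Rightarrow> nat \<times> nat \<Rightarrow> m3" where
  "D_slice1 s (i, j) = (if i = 0 then colm 1 0 else if i = 1 then colm 1 0 else if i = s + 3 then colm 0 (- eta' s)
     else if i = s + 4 then colm 0 (eta' s) else if j = 0 then rowm 0 (- 1) else if j = 1 then rowm 0 1
     else if j = s + 3 then rowm 1 0 else if j = s + 4 then rowm 1 0
     else if i < j then sqm 1 0 0 0 else sqm 0 0 0 (- 2))"

fun D_slice2 :: "nat \<Rightarrow> nat \<times> nat \<Rightarrow> m3" where
  "D_slice2 s (i, j) = (if i = 0 then colm 0 1 else if i = 1 then colm 0 (- 1) else if i = s + 3 then colm 1 0
     else if i = s + 4 then colm 1 0 else if j = 0 then rowm 1 0 else if j = 1 then rowm 1 0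
     else if j = s + 3 then rowm 0 (eta s) else if j = s + 4 then rowm 0 (- eta s)
     else if i < j then sqm 0 0 0 1 else sqm 2 0 0 0)"

fun D_eps :: "nat \<times> nat \<Rightarrow> int" where
  "D_eps (i, j) = (if i < j then 1 else - 1)"

context
  fixes s :: nat
begin

text \<open>With r = s + 3 all vertex numbers are sums, free of truncated subtraction.\<close>

abbreviation DX where "DX \<equiv> D_Z2 (s + 3)"
abbreviation D_A1 where "D_A1 \<equiv> D_slice1 s"
abbreviation D_A2 where "D_A2 \<equiv> D_slice2 s"

lemma D_arrow_iff: "(i, j) \<in> arrows DX \<longleftrightarrow>
    i = 0 \<and> j = 2 \<or> i = 1 \<and> j = 2 \<or> i = s + 2 \<and> j = s + 3 \<or> i = s + 2 \<and> j = s + 4 \<or>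
    (\<exists>k<s. i = k + 2 \<and> j = k + 3) \<or>
    j = 0 \<and> i = 2 \<or> j = 1 \<and> i = 2 \<or> j = s + 2 \<and> i = s + 3 \<or> j = s + 2 \<and> i = s + 4 \<or>
    (\<exists>k<s. j = k + 2 \<and> i = k + 3)"
proof -
  have mem: "(k, l) \<in> {(i, i + 1) |i. 2 \<le> i \<and> i < s + 2} \<longleftrightarrow> (\<exists>m<s. k = m + 2 \<and> l = m + 3)" for k l
  proof
    assume "(k, l) \<in> {(i, i + 1) |i. 2 \<le> i \<and> i < s + 2}"
    then show "\<exists>m<s. k = m + 2 \<and> l = m + 3" by (intro exI[of _ "k - 2"]) auto
  next
    assume "\<exists>m<s. k = m + 2 \<and> l = m + 3"
    then show "(k, l) \<in> {(i, i + 1) |i. 2 \<le> i \<and> i < s + 2}" by auto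
  qed
  have e: "s + 3 - 1 = s + 2" "s + 3 + 1 = s + 4" by simp_all
  show ?thesis
    unfolding arrows_def half_edges.simps
    by (simp only: Un_iff converse_iff insert_iff empty_iff prod.inject mem disj_assoc simp_thms e)
qed

lemma D_arrow_cases:
  assumes "(i, j) \<in> arrows DX"
  obtains "i = 0" "j = 2" | "i = 1" "j = 2" | "i = s + 2" "j = s + 3" | "i = s + 2" "j = s + 4"
    | k where "k < s" "i = k + 2" "j = k + 3"
    | "j = 0" "i = 2" | "j = 1" "i = 2" | "j = s + 2" "i = s + 3" | "j = s + 2" "i = s + 4"
    | k where "k < s" "j = k + 2" "i = k + 3"
  using assms unfolding D_arrow_iff by blast

lemma D_wedge:
  assumes a: "a \<in> arrows DX" and b: "b \<in> arrows DX" and ab: "snd a = fst b"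
  shows "D_A1 b * D_A2 a - D_A2 b * D_A1 a =
    (if b = prod.swap a then sc (of_int (D_eps b) * of_nat (dims DX (fst b))) * un (dims DX (snd b)) else 0)"
proof -
  obtain i j l where ij: "a = (i, j)" "b = (j, l)" using ab by (cases a; cases b) auto
  have "(i, j) \<in> arrows DX" using a ij by simp
  then show ?thesis
  proof (cases rule: D_arrow_cases)
    case 1
    have "(j, l) \<in> arrows DX" using b ij by simp
    then show ?thesis by (cases rule: D_arrow_cases) (simp_all add: ij 1 small_defs M3_ops eta)
  next
    case 2
    have "(j, l) \<in> arrows DX" using b ij by simp
    then show ?thesis by (cases rule: D_arrow_cases) (simp_all add: ij 2 small_defs M3_ops eta)
  next
    case 3
    have "(j, l) \<in> arrows DX" using b ij by simp
    then show ?thesis by (cases rule: D_arrow_cases) (simp_all add: ij 3 small_defs M3_ops eta)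
  next
    case 4
    have "(j, l) \<in> arrows DX" using b ij by simp
    then show ?thesis by (cases rule: D_arrow_cases) (simp_all add: ij 4 small_defs M3_ops eta)
  next
    case (5 k)
    have "(j, l) \<in> arrows DX" using b ij by simp
    then show ?thesis by (cases rule: D_arrow_cases) (use 5 in \<open>simp_all add: ij small_defs M3_ops eta\<close>)
  next
    case 6
    have "(j, l) \<in> arrows DX" using b ij by simp
    then show ?thesis by (cases rule: D_arrow_cases) (simp_all add: ij 6 small_defs M3_ops eta)
  next
    case 7
    have "(j, l) \<in> arrows DX" using b ij by simp
    then show ?thesis by (cases rule: D_arrow_cases) (simp_all add: ij 7 small_defs M3_ops eta)
  next
    case 8
    have "(j, l) \<in> arrows DX" using b ij by simp
    then show ?thesis by (cases rule: D_arrow_cases) (use 8 in \<open>simp_all add: ij small_defs M3_ops eta\<close>)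
  next
    case 9
    have "(j, l) \<in> arrows DX" using b ij by simp
    then show ?thesis by (cases rule: D_arrow_cases) (use 9 in \<open>simp_all add: ij small_defs M3_ops eta\<close>)
  next
    case (10 k)
    have "(j, l) \<in> arrows DX" using b ij by simp
    then show ?thesis by (cases rule: D_arrow_cases) (use 10 in \<open>simp_all add: ij small_defs M3_ops eta\<close>)
  qed
qed

lemma D_padded: "padded_rep DX D_A1" "padded_rep DX D_A2"
proof -
  have "un (dims DX (snd a)) * D_A1 a = D_A1 a \<and> D_A1 a * un (dims DX (fst a)) = D_A1 a \<and>
    un (dims DX (snd a)) * D_A2 a = D_A2 a \<and> D_A2 a * un (dims DX (fst a)) = D_A2 a" if "a \<in> arrows DX" for a
  proof -
    obtain i j where a: "a = (i, j)" by (cases a)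
    have "(i, j) \<in> arrows DX" using that a by simp
    then show ?thesis by (cases rule: D_arrow_cases) (simp_all add: a small_defs M3_ops)
  qed
  then show "padded_rep DX D_A1" "padded_rep DX D_A2" by (auto simp: padded_rep_def)
qed

lemma D_orientation: "orientation DX D_eps"
  unfolding orientation_def
proof
  fix a assume "a \<in> arrows DX"
  moreover obtain i j where a: "a = (i, j)" by (cases a)
  ultimately have "(i, j) \<in> arrows DX" by simp
  then show "D_eps a \<in> {1, - 1} \<and> D_eps (prod.swap a) = - D_eps a"
    by (cases rule: D_arrow_cases) (simp_all add: a)
qed

lemma D_in_arrows:
  "in_arrows DX 0 = {(2, 0)}" "in_arrows DX 1 = {(2, 1)}"
  "in_arrows DX (s + 3) = {(s + 2, s + 3)}" "in_arrows DX (s + 4) = {(s + 2, s + 4)}"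
  "s = 0 \<Longrightarrow> in_arrows DX 2 = {(0, 2), (1, 2), (3, 2), (4, 2)}"
  "s > 0 \<Longrightarrow> in_arrows DX 2 = {(0, 2), (1, 2), (3, 2)}"
  "s > 0 \<Longrightarrow> in_arrows DX (s + 2) = {(s + 1, s + 2), (s + 3, s + 2), (s + 4, s + 2)}"
  "k + 1 < s \<Longrightarrow> in_arrows DX (k + 3) = {(k + 2, k + 3), (k + 4, k + 3)}"
proof -
  have ext: "in_arrows DX j = B" if "\<And>i l. (i, l) \<in> arrows DX \<and> l = j \<longleftrightarrow> (i, l) \<in> B" for j B
  proof (rule Set.set_eqI)
    fix a :: "nat \<times> nat"
    obtain i l where a: "a = (i, l)" by (cases a)
    show "a \<in> in_arrows DX j \<longleftrightarrow> a \<in> B" using that[of i l] by (simp add: in_arrows_def a)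
  qed
  show "in_arrows DX 0 = {(2, 0)}" "in_arrows DX 1 = {(2, 1)}"
    "in_arrows DX (s + 3) = {(s + 2, s + 3)}" "in_arrows DX (s + 4) = {(s + 2, s + 4)}"
    by (rule ext; auto simp: D_arrow_iff)+
  show "in_arrows DX 2 = {(0, 2), (1, 2), (3, 2), (4, 2)}" if "s = 0"
    by (rule ext, unfold D_arrow_iff) (use that in auto)
  show "in_arrows DX 2 = {(0, 2), (1, 2), (3, 2)}" if "s > 0"
    by (rule ext, unfold D_arrow_iff) (use that in auto)
  show "in_arrows DX (s + 2) = {(s + 1, s + 2), (s + 3, s + 2), (s + 4, s + 2)}" if s: "s > 0"
  proof (rule ext)
    fix i l
    obtain m where m: "s = Suc m" using s by (metis gr0_implies_Suc)
    show "(i, l) \<in> arrows DX \<and> l = s + 2 \<longleftrightarrow> (i, l) \<in> {(s + 1, s + 2), (s + 3, s + 2), (s + 4, s + 2)}"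
      unfolding D_arrow_iff unfolding m by auto
  qed
  show "in_arrows DX (k + 3) = {(k + 2, k + 3), (k + 4, k + 3)}" if k: "k + 1 < s"
  proof (rule ext)
    fix i l
    show "(i, l) \<in> arrows DX \<and> l = k + 3 \<longleftrightarrow> (i, l) \<in> {(k + 2, k + 3), (k + 4, k + 3)}"
    proof (cases "l = k + 3")
      case True
      have "k + 3 = m + 3 \<longleftrightarrow> m = k" "k + 3 = m + 2 \<longleftrightarrow> m = k + 1" for m by auto
      then have "(\<exists>m<s. i = m + 2 \<and> k + 3 = m + 3) \<longleftrightarrow> i = k + 2" "(\<exists>m<s. k + 3 = m + 2 \<and> i = m + 3) \<longleftrightarrow> i = k + 4"
        using k by auto
      then show ?thesis unfolding D_arrow_iff True using k by auto
    qed simp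
  qed
qed

lemma D_vert_cases:
  assumes "j \<in> verts DX"
  obtains "j = 0" | "j = 1" | "j = s + 3" | "j = s + 4" | "s = 0" "j = 2" | "s > 0" "j = 2" | "s > 0" "j = s + 2"
    | k where "k + 1 < s" "j = k + 3"
proof -
  have "j \<le> s + 4" using assms by simp
  then consider "j \<le> 1" | "j = 2" | "j \<ge> s + 2" "j \<noteq> 2" | "3 \<le> j" "j < s + 2" by linarith
  then show thesis
  proof cases
    case 1 then show ?thesis using that(1,2) by linarith
  next
    case 2 then show ?thesis using that(5,6) by blast
  next
    case 3
    then have "j = s + 2 \<and> s > 0 \<or> j = s + 3 \<or> j = s + 4" using \<open>j \<le> s + 4\<close> by auto
    then show ?thesis using that(3,4,7) by blast
  next
    case 4
    then show ?thesis using that(8)[of "j - 3"] by simp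
  qed
qed

lemma D_square:
  assumes j: "j \<in> verts DX"
  shows "(\<Sum>a\<in>in_arrows DX j. sc (of_int (D_eps a)) * (D_A1 a * D_A2 (prod.swap a))) = sc (of_nat (dims DX j)) * un (dims DX j) \<and>
    (\<Sum>a\<in>in_arrows DX j. sc (of_int (D_eps a)) * (D_A2 a * D_A1 (prod.swap a))) = - (sc (of_nat (dims DX j)) * un (dims DX j)) \<and>
    (\<Sum>a\<in>in_arrows DX j. sc (of_int (D_eps a)) * (D_A1 a * D_A1 (prod.swap a))) = 0 \<and>
    (\<Sum>a\<in>in_arrows DX j. sc (of_int (D_eps a)) * (D_A2 a * D_A2 (prod.swap a))) = 0"
proof -
  show ?thesis
    using j
  proof (cases rule: D_vert_cases)
    case 1 show ?thesis unfolding 1 D_in_arrows(1) by (simp add: small_defs M3_ops eta del: sum_constant)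
  next
    case 2 show ?thesis unfolding 2 D_in_arrows(2) by (simp add: small_defs M3_ops eta del: sum_constant)
  next
    case 3 show ?thesis unfolding 3 D_in_arrows(3) by (simp add: small_defs M3_ops eta del: sum_constant)
  next
    case 4 show ?thesis unfolding 4 D_in_arrows(4) by (simp add: small_defs M3_ops eta del: sum_constant)
  next
    case 5 show ?thesis unfolding 5(2) D_in_arrows(5)[OF 5(1)] using 5(1) by (simp add: small_defs M3_ops eta del: sum_constant)
  next
    case 6 show ?thesis unfolding 6(2) D_in_arrows(6)[OF 6(1)] using 6(1) by (simp add: small_defs M3_ops eta del: sum_constant)
  next
    case 7 show ?thesis unfolding 7(2) D_in_arrows(7)[OF 7(1)] using 7(1) by (simp add: small_defs M3_ops eta del: sum_constant)
  next
    case (8 k) show ?thesis unfolding 8(2) D_in_arrows(8)[OF 8(1)] using 8(1) by (simp add: small_defs M3_ops eta del: sum_constant)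
  qed
qed

definition D_flip :: "nat \<Rightarrow> nat" where "D_flip = transpose (s + 3) (s + 4)"

lemma D_perms: "diagram_perms DX = {id, D_flip}"
  by (simp add: D_flip_def add.commute)

lemma D_flip_simps: "D_flip (s + 3) = s + 4" "D_flip (s + 4) = s + 3" "i \<noteq> s + 3 \<Longrightarrow> i \<noteq> s + 4 \<Longrightarrow> D_flip i = i"
  by (simp_all add: D_flip_def transpose_def)

lemma D_flip_arrows:
  assumes "(i, j) \<in> arrows DX"
  shows "(D_flip i, D_flip j) \<in> arrows DX \<and> D_eps (D_flip i, D_flip j) = D_eps (i, j)"
  using assms by (cases rule: D_arrow_cases) (auto simp: D_flip_def transpose_def D_arrow_iff)

lemma D_auts:
  assumes "\<sigma> \<in> diagram_perms DX"
  shows "diagram_aut DX \<sigma>"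
proof -
  have "diagram_aut DX D_flip"
    unfolding diagram_aut_def
  proof (intro conjI ballI)
    show "bij D_flip" by (simp add: D_flip_def)
    show "D_flip ` verts DX = verts DX" unfolding D_flip_def by (rule transpose_image_eq) auto
    show "map_prod D_flip D_flip a \<in> arrows DX" if "a \<in> arrows DX" for a
      using that D_flip_arrows by (cases a) auto
    show "dims DX (D_flip i) = dims DX i" for i by (auto simp: D_flip_def transpose_def)
  qed
  moreover have "diagram_aut DX id" by (auto simp: diagram_aut_def map_prod.id)
  ultimately show ?thesis using assms unfolding D_perms by blast
qed

lemma D_eps_inv:
  assumes "\<sigma> \<in> diagram_perms DX" "a \<in> arrows DX"
  shows "D_eps (map_prod \<sigma> \<sigma> a) = D_eps a"
proof -
  obtain i j where a: "a = (i, j)" by (cases a)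
  have "D_eps (D_flip i, D_flip j) = D_eps (i, j)" using D_flip_arrows assms(2) a by blast
  then show ?thesis using assms(1) unfolding D_perms a by (auto simp: map_prod.id simp del: D_eps.simps)
qed

lemma D_flip_fixed: "D_flip 0 = 0" "D_flip 1 = 1" "D_flip 2 = 2" "D_flip (s + 2) = s + 2"
  "k < s \<Longrightarrow> D_flip (k + 2) = k + 2" "k < s \<Longrightarrow> D_flip (k + 3) = k + 3"
  by (simp_all add: D_flip_def transpose_def)

text \<open>The chain vertex \<open>j\<close> carries the two-dimensional representation in which
  diag(c, c') acts by the powers of exponent j - 1, whence the shift.\<close>

definition D_gauge :: "m3 \<Rightarrow> m3 \<Rightarrow> (nat \<Rightarrow> m3) \<Rightarrow> m3 \<Rightarrow> m3 \<Rightarrow> nat \<Rightarrow> m3" where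
  "D_gauge g0 g1 gm gr gr' j = (if j = 0 then g0 else if j = 1 then g1 else if j = s + 3 then gr
     else if j = s + 4 then gr' else gm (j - 1))"

lemma D_gauge_simps:
  "D_gauge g0 g1 gm gr gr' 0 = g0" "D_gauge g0 g1 gm gr gr' 1 = g1"
  "D_gauge g0 g1 gm gr gr' (s + 3) = gr" "D_gauge g0 g1 gm gr gr' (s + 4) = gr'"
  "D_gauge g0 g1 gm gr gr' (s + 2) = gm (Suc s)"
  "D_gauge g0 g1 gm gr gr' 2 = gm 1"
  "k < s \<Longrightarrow> D_gauge g0 g1 gm gr gr' (k + 2) = gm (Suc k)"
  "k < s \<Longrightarrow> D_gauge g0 g1 gm gr gr' (k + 3) = gm (Suc (Suc k))"
  by (simp_all add: D_gauge_def eval_nat_numeral)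

lemma D_slice_values:
  "slice_rep D_A1 D_A2 x y (0, 2) = colm x y" "slice_rep D_A1 D_A2 x y (1, 2) = colm x (- y)"
  "slice_rep D_A1 D_A2 x y (s + 2, s + 3) = rowm x (eta s * y)"
  "slice_rep D_A1 D_A2 x y (s + 2, s + 4) = rowm x (- eta s * y)"
  "k < s \<Longrightarrow> slice_rep D_A1 D_A2 x y (k + 2, k + 3) = sqm x 0 0 y"
  "slice_rep D_A1 D_A2 x y (2, 0) = rowm y (- x)" "slice_rep D_A1 D_A2 x y (2, 1) = rowm y x"
  "slice_rep D_A1 D_A2 x y (s + 3, s + 2) = colm y (- eta' s * x)"
  "slice_rep D_A1 D_A2 x y (s + 4, s + 2) = colm y (eta' s * x)"
  "k < s \<Longrightarrow> slice_rep D_A1 D_A2 x y (k + 3, k + 2) = sqm (2 * y) 0 0 (- 2 * x)"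
  by (simp_all add: slice_rep_def small_ops)

text \<open>At the last two leaves the gauge factor is \<open>e\<close>, with inverse
  \<open>\<delta> * e\<close>. For \<delta> = 1 the leaves are kept; \<delta> = -1 changes the sign
  of the second component, which is what distinguishes them. The instances are the rotation in
  \<Gamma>, with e = -1, and its square root in \<Gamma>', with e = i.\<close>

lemma D_twisted_diag:
  assumes cc: "c * c' = 1" and e: "c ^ (s + 2) = e" "c' ^ (s + 2) = \<delta> * e"
    and \<sigma>: "\<delta> = 1 \<and> \<sigma> = id \<or> \<delta> = - 1 \<and> \<sigma> = D_flip"
  shows "twisted_equivariant DX D_A1 D_A2 (mat22 c 0 0 c') \<sigma>"
  unfolding twisted_equivariant_def
proof (intro exI conjI allI ballI)
  let ?h = "D_gauge (scal 1) (scal 1) (\<lambda>m. sqm (c ^ m) 0 0 (c' ^ m)) (scal e) (scal e)"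
  let ?h' = "D_gauge (scal 1) (scal 1) (\<lambda>m. sqm (c' ^ m) 0 0 (c ^ m)) (scal (\<delta> * e)) (scal (\<delta> * e))"
  have cm: "c ^ m * c' ^ m = 1" "c' ^ m * c ^ m = 1" for m
    using cc by (simp_all flip: power_mult_distrib add: mult.commute)
  have ee: "e * (\<delta> * e) = 1" "\<delta> * e * e = 1"
    using cm[of "s + 2"] unfolding e by simp_all
  show "gauge_pair DX ?h ?h'"
    unfolding gauge_pair_def
    by (auto simp: D_gauge_def small_defs M3_ops cm ee)
  fix x y a assume "a \<in> arrows DX"
  moreover obtain i j where a: "a = (i, j)" by (cases a)
  ultimately have ar: "(i, j) \<in> arrows DX" by simp
  have p: "c ^ Suc m * u * c' ^ m = c * u" "c' ^ Suc m * u * c ^ m = c' * u"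
    "c ^ m * u * c' ^ Suc m = c' * u" "c' ^ m * u * c ^ Suc m = c * u" for u m
  proof -
    have "c ^ Suc m * u * c' ^ m = c * u * (c ^ m * c' ^ m)" "c' ^ Suc m * u * c ^ m = c' * u * (c ^ m * c' ^ m)"
      "c ^ m * u * c' ^ Suc m = c' * u * (c ^ m * c' ^ m)" "c' ^ m * u * c ^ Suc m = c * u * (c ^ m * c' ^ m)"
      by (simp_all add: mult_ac)
    then show "c ^ Suc m * u * c' ^ m = c * u" "c' ^ Suc m * u * c ^ m = c' * u"
      "c ^ m * u * c' ^ Suc m = c' * u" "c' ^ m * u * c ^ Suc m = c * u" by (simp_all add: cm)
  qed
  \<comment> \<open>For the arrows between the chain and its last two leaves, where the exponents s
    + 1 and s + 2 meet.\<close>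
  have en: "e * u * c' ^ Suc s = c * u" "e * u * c ^ Suc s = \<delta> * (c' * u)"
    "c ^ Suc s * u * (\<delta> * e) = c' * u" "c' ^ Suc s * u * (\<delta> * e) = \<delta> * (c * u)" for u
  proof -
    have d: "\<delta> * \<delta> = 1" using \<sigma> by auto
    have e': "e = \<delta> * c' ^ (s + 2)" using e(2) d by (metis mult.assoc mult_1_left)
    have "e * u * c' ^ Suc s = c * u * (c ^ Suc s * c' ^ Suc s)"
      unfolding e(1)[symmetric] by (simp add: mult_ac)
    then show "e * u * c' ^ Suc s = c * u" unfolding cm by simp
    have "e * u * c ^ Suc s = \<delta> * (c' * u) * (c ^ Suc s * c' ^ Suc s)"
      unfolding e' by (simp add: mult_ac)
    then show "e * u * c ^ Suc s = \<delta> * (c' * u)" unfolding cm by simp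
    have "c ^ Suc s * u * (\<delta> * e) = c' * u * (c ^ Suc s * c' ^ Suc s)"
      unfolding e(2)[symmetric] by (simp add: mult_ac)
    then show "c ^ Suc s * u * (\<delta> * e) = c' * u" unfolding cm by simp
    have "c' ^ Suc s * u * (\<delta> * e) = \<delta> * (c * u) * (c ^ Suc s * c' ^ Suc s)"
      unfolding e(1)[symmetric] by (simp add: mult_ac)
    then show "c' ^ Suc s * u * (\<delta> * e) = \<delta> * (c * u)" unfolding cm by simp
  qed
  have act: "act_fst (mat22 c 0 0 c') x y = c * x" "act_snd (mat22 c 0 0 c') x y = c' * y"
    by (simp_all add: act_fst_def act_snd_def)
  have en': "\<delta>' = \<delta> \<Longrightarrow> c ^ Suc s * u * (\<delta>' * e) = c' * u" "\<delta>' = \<delta> \<Longrightarrow> c' ^ Suc s * u * (\<delta>' * e) = \<delta>' * (c * u)" for u \<delta>'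
    using en(3,4) by auto
  note rules = a act pair_act_def fst_conv snd_conv map_prod_simp id_apply D_gauge_simps D_flip_simps(1,2) D_flip_fixed
    D_slice_values small_ops power_one_right mult_zero_left mult_zero_right add_0_left add_0_right p en en'
  show "slice_rep D_A1 D_A2 (act_fst (mat22 c 0 0 c') x y) (act_snd (mat22 c 0 0 c') x y) (map_prod \<sigma> \<sigma> a) =
      pair_act ?h ?h' (slice_rep D_A1 D_A2 x y) a"
    using ar
  proof (cases rule: D_arrow_cases)
    case 1 show ?thesis using \<sigma> by (elim disjE conjE; simp only: rules 1; simp add: mult_ac)
  next
    case 2 show ?thesis using \<sigma> by (elim disjE conjE; simp only: rules 2; simp add: mult_ac)
  next
    case 3 show ?thesis using \<sigma> by (elim disjE conjE; simp only: rules 3; simp add: mult_ac)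
  next
    case 4 show ?thesis using \<sigma> by (elim disjE conjE; simp only: rules 4; simp add: mult_ac)
  next
    case (5 k) show ?thesis using \<sigma> by (elim disjE conjE; simp only: rules 5; simp add: mult_ac)
  next
    case 6 show ?thesis using \<sigma> by (elim disjE conjE; simp only: rules 6; simp add: mult_ac)
  next
    case 7 show ?thesis using \<sigma> by (elim disjE conjE; simp only: rules 7; simp add: mult_ac)
  next
    case 8 show ?thesis using \<sigma> by (elim disjE conjE; simp only: rules 8; simp add: mult_ac)
  next
    case 9 show ?thesis using \<sigma> by (elim disjE conjE; simp only: rules 9; simp add: mult_ac)
  next
    case (10 k) show ?thesis using \<sigma> by (elim disjE conjE; simp only: rules 10; simp add: mult_ac)
  qed
qed

text \<open>\<open>matJ\<close> exchanges the two basis lines at each vertex of the chain, with a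
  sign depending on the vertex, and acts on the leaves by the four characters of the binary dihedral
  group.\<close>

lemma D_twisted_J: "twisted_equivariant DX D_A1 D_A2 matJ id"
  unfolding twisted_equivariant_def
proof (intro exI conjI allI ballI)
  let ?h = "D_gauge (scal 1) (scal (- 1)) (\<lambda>m. sqm 0 1 ((- 1) ^ m) 0) (scal (eta' s)) (scal (- eta' s))"
  let ?h' = "D_gauge (scal 1) (scal (- 1)) (\<lambda>m. sqm 0 ((- 1) ^ m) 1 0) (scal (eta s)) (scal (- eta s))"
  show "gauge_pair DX ?h ?h'"
    unfolding gauge_pair_def by (auto simp: D_gauge_def small_defs M3_ops eta)
  fix x y a assume "a \<in> arrows DX"
  moreover obtain i j where a: "a = (i, j)" by (cases a)
  ultimately have ar: "(i, j) \<in> arrows DX" by simp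
  have act: "act_fst matJ x y = y" "act_snd matJ x y = - x"
    by (simp_all add: act_fst_def act_snd_def matJ_def)
  note rules = a act pair_act_def fst_conv snd_conv map_prod_simp id_apply D_gauge_simps
    D_slice_values small_ops power_one_right
  have e: "(- 1) ^ s * (eta' s * u) = eta s * u" "eta' s * ((- 1) ^ s * u) = eta s * u" "eta' s * (eta s * u) = u"
    "eta s * (eta' s * u) = u" "eta s * ((- 1) ^ s * u) = eta' s * u" for u
    by (simp_all add: eta_def eta'_def)
  show "slice_rep D_A1 D_A2 (act_fst matJ x y) (act_snd matJ x y) (map_prod id id a) =
      pair_act ?h ?h' (slice_rep D_A1 D_A2 x y) a"
    using ar
  proof (cases rule: D_arrow_cases)
    case 1 show ?thesis by (simp only: rules 1; simp)
  next
    case 2 show ?thesis by (simp only: rules 2; simp)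
  next
    case 3 show ?thesis by (simp only: rules 3; simp add: e eta mult_ac)
  next
    case 4 show ?thesis by (simp only: rules 4; simp add: e eta mult_ac)
  next
    case (5 k) show ?thesis by (simp only: rules 5; simp add: mult_ac)
  next
    case 6 show ?thesis by (simp only: rules 6; simp)
  next
    case 7 show ?thesis by (simp only: rules 7; simp)
  next
    case 8 show ?thesis by (simp only: rules 8; simp add: e eta mult_ac)
  next
    case 9 show ?thesis by (simp only: rules 9; simp add: e eta mult_ac)
  next
    case (10 k) show ?thesis by (simp only: rules 10; simp add: mult_ac)
  qed
qed

lemma rot_mat22: "rot n = mat22 (cis (2 * pi / real n)) 0 0 (cis (- (2 * pi / real n)))"
  by (rule rot_def)

lemma D_twisted_rot: "twisted_equivariant DX D_A1 D_A2 (rot (2 * (s + 2))) id"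
  unfolding rot_mat22
proof (rule D_twisted_diag[where e = "- 1" and \<delta> = 1])
  have t: "real (s + 2) * (2 * pi / real (2 * (s + 2))) = pi" by (simp add: field_simps)
  show "cis (2 * pi / real (2 * (s + 2))) ^ (s + 2) = - 1"
    unfolding DeMoivre t by simp
  show "cis (- (2 * pi / real (2 * (s + 2)))) ^ (s + 2) = 1 * - 1"
    unfolding DeMoivre mult_minus_right t by (simp add: complex_eq_iff)
qed (simp_all add: cis_mult)

lemma D_twisted_rot_flip: "twisted_equivariant DX D_A1 D_A2 (rot (2 * (2 * (s + 2)))) D_flip"
  unfolding rot_mat22
proof (rule D_twisted_diag[where e = "\<i>" and \<delta> = "- 1"])
  have t: "real (s + 2) * (2 * pi / real (2 * (2 * (s + 2)))) = pi / 2" by (simp add: field_simps)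
  show "cis (2 * pi / real (2 * (2 * (s + 2)))) ^ (s + 2) = \<i>"
    unfolding DeMoivre t by simp
  show "cis (- (2 * pi / real (2 * (2 * (s + 2))))) ^ (s + 2) = - 1 * \<i>"
    unfolding DeMoivre mult_minus_right t by (simp add: complex_eq_iff)
qed (simp_all add: cis_mult)

lemma D_dim_sum: "(\<Sum>i\<in>verts DX. (dims DX i)\<^sup>2) = 2 * (2 * (s + 2))"
proof -
  have v: "verts DX = {0, 1, s + 3, s + 4} \<union> {2..s + 2}" by auto
  have "(\<Sum>i\<in>{0, 1, s + 3, s + 4}. (dims DX i)\<^sup>2) = 4" by simp
  moreover have "(\<Sum>i\<in>{2..s + 2}. (dims DX i)\<^sup>2) = (\<Sum>i\<in>{2..s + 2}. 4)"
    by (rule sum.cong) auto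
  ultimately show ?thesis unfolding v by (subst sum.union_disjoint) auto
qed

lemma D_generators:
  "mckay_generators DX D_eps D_A1 D_A2 {rot (2 * (s + 2)), matJ} {rot (2 * (2 * (s + 2))), matJ}"
proof
  let ?R = "rot (2 * (s + 2))" and ?Q = "rot (2 * (2 * (s + 2)))"
  show small: "small_grp DX = generate SU2 {?R, matJ}" by (simp add: binary_dihedral_grp_def)
  show big: "big_grp DX = generate SU2 {?Q, matJ}" by (simp add: binary_dihedral_grp_def)
  \<comment> \<open>Half the angle of \<open>?R\<close>, so that the generator of the smaller group
    is the square of that of the larger one.\<close>
  define q where "q = 2 * pi / real (2 * (2 * (s + 2)))"
  have "2 * pi / z = 2 * pi / (2 * z) + 2 * pi / (2 * z)" for z :: real by simp
  from this[of "real (2 * (s + 2))"] have th: "2 * pi / real (2 * (s + 2)) = q + q"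
    by (simp only: q_def of_nat_mult of_nat_numeral)
  have m: "?Q = mat22 (cis q) 0 0 (cis (- q))" "inv\<^bsub>SU2\<^esub> ?Q = mat22 (cis (- q)) 0 0 (cis q)"
    "?R = mat22 (cis (q + q)) 0 0 (cis (- (q + q)))" "inv\<^bsub>SU2\<^esub> ?R = mat22 (cis (- (q + q))) 0 0 (cis (q + q))"
    unfolding rot_inv unfolding rot_def th q_def[symmetric] by simp_all
  have RQ: "?R = ?Q * ?Q"
    unfolding m by (simp add: mat22_mult mat22_eq_iff cis_mult)
  have "?Q * ?Q \<in> generate SU2 {?Q, matJ}"
    using generate.eng[of ?Q SU2 "{?Q, matJ}" ?Q] generate.incl[of ?Q "{?Q, matJ}" SU2] by simp
  then show "{?R, matJ} \<subseteq> big_grp DX" unfolding big RQ by (auto intro: generate.incl)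
  have R: "?R \<in> generate SU2 {?R, matJ}" "inv\<^bsub>SU2\<^esub> ?R \<in> generate SU2 {?R, matJ}" "matJ \<in> generate SU2 {?R, matJ}"
    by (auto intro: generate.incl generate.inv)
  have RJ: "?R * matJ \<in> generate SU2 {?R, matJ}" "inv\<^bsub>SU2\<^esub> ?R * matJ \<in> generate SU2 {?R, matJ}"
    using generate.eng[OF R(1,3)] generate.eng[OF R(2,3)] by simp_all
  have c: "?Q * ?R * inv\<^bsub>SU2\<^esub> ?Q = ?R" "inv\<^bsub>SU2\<^esub> ?Q * ?R * ?Q = ?R"
    "matJ * ?R * inv\<^bsub>SU2\<^esub> matJ = inv\<^bsub>SU2\<^esub> ?R" "inv\<^bsub>SU2\<^esub> matJ * ?R * matJ = inv\<^bsub>SU2\<^esub> ?R"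
    "?Q * matJ * inv\<^bsub>SU2\<^esub> ?Q = ?R * matJ" "inv\<^bsub>SU2\<^esub> ?Q * matJ * ?Q = inv\<^bsub>SU2\<^esub> ?R * matJ"
    "matJ * matJ * inv\<^bsub>SU2\<^esub> matJ = matJ" "inv\<^bsub>SU2\<^esub> matJ * matJ * matJ = matJ"
    unfolding m(2,4) matJ_inv unfolding m(1,3) matJ_def
    by (simp_all add: mat22_mult mat22_eq_iff cis_mult)
  show "p * t * inv\<^bsub>SU2\<^esub> p \<in> small_grp DX" "inv\<^bsub>SU2\<^esub> p * t * p \<in> small_grp DX"
    if "p \<in> {?Q, matJ}" "t \<in> {?R, matJ}" for p t
    using that R RJ c unfolding small by auto
  show "\<exists>K\<subseteq>small_grp DX. finite K \<and> (\<Sum>i\<in>verts DX. (dims DX i)\<^sup>2) \<le> card K"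
    unfolding D_dim_sum small by (rule dihedral_large) auto
  show "twisted_equivariant DX D_A1 D_A2 g id" if "g \<in> {?R, matJ}" for g
    using that D_twisted_rot D_twisted_J by auto
  show "valid_triple DX" by simp
qed (use D_padded D_wedge D_square D_auts D_eps_inv rot_SU2 matJ_SU2 D_orientation in blast)+

lemma D_main_shifted:
  assumes "diagram_action DX \<alpha>"
  shows "\<exists>\<epsilon> \<rho>. orientation DX \<epsilon> \<and> lifted_action DX \<alpha> \<rho> \<and> symplectic_action DX \<epsilon> \<rho> \<and>
    induces_natural_action DX \<epsilon> \<rho>"
proof -
  have "matJ \<in> small_grp DX" by (auto simp: binary_dihedral_grp_def intro: generate.incl)
  then have "\<exists>\<rho>. lifted_action DX \<alpha> \<rho> \<and> symplectic_action DX D_eps \<rho> \<and> induces_natural_action DX D_eps \<rho>"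
    using D_twisted_rot_flip by (intro mckay_generators.action_order_two[OF D_generators assms D_perms]) blast
  then show ?thesis using D_orientation by blast
qed

end

section \<open>Type \<open>E\<^sub>6\<close>\<close>

lemma rot_4: "rot 4 = mat22 \<i> 0 0 (- \<i>)"
proof -
  have "2 * pi / real 4 = pi / 2" by simp
  then show ?thesis unfolding rot_def by (simp add: mat22_eq_iff complex_eq_iff)
qed

definition xi :: complex where "xi = cis (2 * pi / real 8)"
definition xi' :: complex where "xi' = cis (- (2 * pi / real 8))"

lemma rot_8: "rot 8 = mat22 xi 0 0 xi'"
  by (simp add: rot_def xi_def xi'_def)

lemma xi: "xi * xi' = 1" "xi' * xi = 1" "xi * xi = \<i>" "xi' * xi' = - \<i>" "\<i> * xi' = xi" "\<i> * xi = - xi'"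
proof -
  show "xi * xi' = 1" "xi' * xi = 1" by (simp_all add: xi_def xi'_def cis_mult)
  have "2 * pi / real 8 + 2 * pi / real 8 = pi / 2" by simp
  then show a: "xi * xi = \<i>" by (simp only: xi_def cis_mult) simp
  show "xi' * xi' = - \<i>"
    using arg_cong[OF a, of cnj] by (simp add: xi_def xi'_def cis_cnj)
  then show "\<i> * xi' = xi" "\<i> * xi = - xi'"
    using a \<open>xi * xi' = 1\<close> by (metis mult.assoc mult.commute mult_1_left, metis \<open>xi' * xi = 1\<close> minus_minus mult.assoc mult_1_left mult_1_right mult_minus_left mult.commute)
qed

lemma xi_pull: "xi * z * xi = \<i> * z" "xi' * z * xi' = - \<i> * z" "xi * z * xi' = z" "xi' * z * xi = z"
proof -
  have "xi * z * xi = (xi * xi) * z" "xi' * z * xi' = (xi' * xi') * z" "xi * z * xi' = (xi * xi') * z"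
    "xi' * z * xi = (xi * xi') * z" by (simp_all add: mult_ac)
  then show "xi * z * xi = \<i> * z" "xi' * z * xi' = - \<i> * z" "xi * z * xi' = z" "xi' * z * xi = z"
    by (simp_all add: xi)
qed

lemma matH_SU2: "matH \<in> carrier SU2"
  unfolding SU2_iff matH_def
  by (intro exI[of _ "(1 + \<i>) / 2"]) (simp add: mat22_eq_iff complex_eq_iff)

lemma matH_inv: "inv\<^bsub>SU2\<^esub> matH = mat22 ((1 - \<i>) / 2) (- ((1 + \<i>) / 2)) (- ((- 1 + \<i>) / 2)) ((1 + \<i>) / 2)"
  using SU2_inv_mat22 matH_SU2 unfolding matH_def by blast

lemma rot_4_inv: "inv\<^bsub>SU2\<^esub> (rot 4) = mat22 (- \<i>) 0 0 \<i>"
  using SU2_inv_mat22 rot_SU2[of 4] unfolding rot_4 by simp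

lemma rot_8_inv: "inv\<^bsub>SU2\<^esub> (rot 8) = mat22 xi' 0 0 xi"
  using SU2_inv_mat22 rot_SU2[of 8] unfolding rot_8 by simp

text \<open>A primitive cube root of unity. Powers are kept reduced by w^2 = - 1 - w; thus
  \<open>wp k\<close> and \<open>wm k\<close> below are w^k and w^(- k) for k < 3.\<close>

definition w :: complex where "w = Complex (- 1 / 2) (sqrt 3 / 2)"

lemma w: "w * w = - 1 - w" "w * (w * z) = - z - w * z"
proof -
  show s: "w * w = - 1 - w" by (simp add: w_def complex_eq_iff)
  have "w * (w * z) = (w * w) * z" by simp
  then show "w * (w * z) = - z - w * z" by (simp add: s algebra_simps)
qed

definition wp :: "nat \<Rightarrow> complex" where "wp k = (if k = 0 then 1 else if k = 1 then w else - 1 - w)"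
definition wm :: "nat \<Rightarrow> complex" where "wm k = (if k = 0 then 1 else if k = 1 then - 1 - w else w)"

lemma wp_wm: "wp k * wm k = 1" "wm k * wp k = 1" "wp k * wp k = wm k" "wm k * wm k = wp k"
  by (simp_all add: wp_def wm_def w algebra_simps)

lemma wp_wm_left: "wp k * (wm k * z) = z" "wm k * (wp k * z) = z" "wp k * (wp k * z) = wm k * z" "wm k * (wm k * z) = wp k * z"
  by (simp_all add: wp_wm flip: mult.assoc)

lemma ex_less_3: "(\<exists>k<3. P k) \<longleftrightarrow> P 0 \<or> P 1 \<or> P (2 :: nat)"
  by (auto simp: less_3_cases)

text \<open>Orthogonality of the characters of the cyclic group of order 3: the summands are the
  powers of w^(k - l). It makes paths through the centre from one branch to another cancel in
  \<open>E_wedge\<close>.\<close>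

lemma wp_wm_orthogonal:
  "k < 3 \<Longrightarrow> l < 3 \<Longrightarrow> 1 + (wp k * wm l + wm k * wp l) = (if k = l then 3 else 0)"
  by (auto simp: wp_def wm_def w less_3_cases algebra_simps)

text \<open>In the combination of \<open>tall1\<close> and \<open>tall2\<close> with coefficients x
  and y, the rows are the row vector (y, - x) times the inverses of the quaternions i, j, k, with
  weights 1, \<open>p\<close>, \<open>q\<close>. In that of \<open>wide1\<close> and
  \<open>wide2\<close> the columns are i, j, k applied to (x, y), weighted in the same way.\<close>

definition tall1 :: "complex \<Rightarrow> complex \<Rightarrow> m3" where "tall1 p q = M3 0 (- \<i>) 0 (- p) 0 0 (\<i> * q) 0 0"
definition tall2 :: "complex \<Rightarrow> complex \<Rightarrow> m3" where "tall2 p q = M3 (- \<i>) 0 0 0 (- p) 0 0 (- \<i> * q) 0"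
definition wide1 :: "complex \<Rightarrow> complex \<Rightarrow> m3" where "wide1 p q = M3 \<i> 0 0 0 (- p) (\<i> * q) 0 0 0"
definition wide2 :: "complex \<Rightarrow> complex \<Rightarrow> m3" where "wide2 p q = M3 0 p (\<i> * q) (- \<i>) 0 0 0 0 0"

lemmas e6_defs = tall1_def tall2_def wide1_def wide2_def colm_def rowm_def

text \<open>The vertex \<open>6\<close> carries the adjoint representation with basis \<open>i, j, k\<close>, and the branches
  differ by twisting with powers of \<open>diag(1, w, w\<^sup>2)\<close>.\<close>

fun E_A1 :: "nat \<times> nat \<Rightarrow> m3" where
  "E_A1 (i, j) = (if i < 3 then colm 1 0 else if j < 3 then rowm 0 1
     else if j = 6 then tall1 (wp (i - 3)) (wm (i - 3)) else wide1 (wm (j - 3)) (wp (j - 3)))"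

fun E_A2 :: "nat \<times> nat \<Rightarrow> m3" where
  "E_A2 (i, j) = (if i < 3 then colm 0 1 else if j < 3 then rowm (- 1) 0
     else if j = 6 then tall2 (wp (i - 3)) (wm (i - 3)) else wide2 (wm (j - 3)) (wp (j - 3)))"

text \<open>Positive on the arrows leading away from the central vertex, hence insensitive to an
  exchange of branches.\<close>

fun E_eps :: "nat \<times> nat \<Rightarrow> int" where
  "E_eps (i, j) = (if i > j then 1 else - 1)"

lemma E_arrow_iff: "(i, j) \<in> arrows E6_Z2 \<longleftrightarrow>
   (\<exists>k<3. i = k \<and> j = k + 3 \<or> i = k + 3 \<and> j = k \<or> i = k + 3 \<and> j = 6 \<or> i = 6 \<and> j = k + 3)"
proof -
  have "(i, j) \<in> arrows E6_Z2 \<longleftrightarrow> (i, j) \<in> {(6, 3), (3, 0), (6, 4), (4, 1), (6, 5), (5, 2)} \<or>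
      (j, i) \<in> {(6, 3), (3, 0), (6, 4), (4, 1), (6, 5), (5, 2)}"
    unfolding arrows_def half_edges.simps by (simp only: Un_iff converse_iff)
  then show ?thesis unfolding ex_less_3 by auto
qed

lemma E_arrow_cases:
  assumes "a \<in> arrows E6_Z2"
  obtains k where "k < 3" "a = (k, k + 3)" | k where "k < 3" "a = (k + 3, k)"
    | k where "k < 3" "a = (k + 3, 6)" | k where "k < 3" "a = (6, k + 3)"
  using assms by (cases a) (auto simp: E_arrow_iff)

lemma E_values:
  "k < 3 \<Longrightarrow> E_A1 (k, k + 3) = colm 1 0" "k < 3 \<Longrightarrow> E_A2 (k, k + 3) = colm 0 1"
  "k < 3 \<Longrightarrow> E_A1 (k + 3, k) = rowm 0 1" "k < 3 \<Longrightarrow> E_A2 (k + 3, k) = rowm (- 1) 0"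
  "k < 3 \<Longrightarrow> E_A1 (k + 3, 6) = tall1 (wp k) (wm k)" "k < 3 \<Longrightarrow> E_A2 (k + 3, 6) = tall2 (wp k) (wm k)"
  "k < 3 \<Longrightarrow> E_A1 (6, k + 3) = wide1 (wm k) (wp k)" "k < 3 \<Longrightarrow> E_A2 (6, k + 3) = wide2 (wm k) (wp k)"
  "k < 3 \<Longrightarrow> E_eps (k, k + 3) = - 1" "k < 3 \<Longrightarrow> E_eps (k + 3, k) = 1"
  "k < 3 \<Longrightarrow> E_eps (k + 3, 6) = - 1" "k < 3 \<Longrightarrow> E_eps (6, k + 3) = 1"
  "k < 3 \<Longrightarrow> dims E6_Z2 k = 1" "k < 3 \<Longrightarrow> dims E6_Z2 (k + 3) = 2" "dims E6_Z2 6 = 3"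
  by simp_all

lemma E_wedge:
  assumes a: "a \<in> arrows E6_Z2" and b: "b \<in> arrows E6_Z2" and ab: "snd a = fst b"
  shows "E_A1 b * E_A2 a - E_A2 b * E_A1 a =
    (if b = prod.swap a then sc (of_int (E_eps b) * of_nat (dims E6_Z2 (fst b))) * un (dims E6_Z2 (snd b)) else 0)"
  using a
proof (cases rule: E_arrow_cases)
  case (1 k)
  then consider "b = (k + 3, k)" | "b = (k + 3, 6)" using b ab by (cases b) (auto simp: E_arrow_iff)
  then show ?thesis
    by cases (use 1 in \<open>simp_all add: E_values e6_defs M3_ops un_M3 sc_def del: E_A1.simps E_A2.simps E_eps.simps dims.simps\<close>)
next
  case (2 k)
  then have "b = (k, k + 3)" using b ab by (cases b) (auto simp: E_arrow_iff)
  then show ?thesis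
    using 2 by (simp add: E_values e6_defs M3_ops un_M3 sc_def del: E_A1.simps E_A2.simps E_eps.simps dims.simps)
next
  case (3 k)
  then obtain l where l: "b = (6, l + 3)" "l < 3" using b ab by (cases b) (auto simp: E_arrow_iff)
  \<comment> \<open>A path through the centre from branch k to branch l; the three summands come
    from the basis vectors i, j, k.\<close>
  have "E_A1 b * E_A2 a - E_A2 b * E_A1 a = sc (1 + (wp k * wm l + wm k * wp l)) * un 2"
    using 3 l by (simp add: E_values e6_defs M3_ops un_M3 sc_def algebra_simps del: E_A1.simps E_A2.simps)
  then show ?thesis
    using 3 l unfolding wp_wm_orthogonal[OF 3(1) l(2)]
    by (auto simp: E_values sc_simps simp del: E_A1.simps E_A2.simps E_eps.simps dims.simps)
next
  case (4 k)
  then consider "b = (k + 3, k)" | "b = (k + 3, 6)" using b ab by (cases b) (auto simp: E_arrow_iff)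
  then show ?thesis
    by cases (use 4 in \<open>simp_all add: E_values e6_defs M3_ops un_M3 sc_def wp_wm wp_wm_left algebra_simps
      del: E_A1.simps E_A2.simps E_eps.simps dims.simps\<close>)
qed

lemma E_padded: "padded_rep E6_Z2 E_A1" "padded_rep E6_Z2 E_A2"
proof -
  have "un (dims E6_Z2 (snd a)) * E_A1 a = E_A1 a \<and> E_A1 a * un (dims E6_Z2 (fst a)) = E_A1 a \<and>
    un (dims E6_Z2 (snd a)) * E_A2 a = E_A2 a \<and> E_A2 a * un (dims E6_Z2 (fst a)) = E_A2 a" if "a \<in> arrows E6_Z2" for a
    using that by (cases rule: E_arrow_cases)
      (simp_all add: E_values e6_defs M3_ops un_M3 del: E_A1.simps E_A2.simps dims.simps)
  then show "padded_rep E6_Z2 E_A1" "padded_rep E6_Z2 E_A2" by (auto simp: padded_rep_def)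
qed

lemma E_orientation: "orientation E6_Z2 E_eps"
  unfolding orientation_def
proof
  fix a assume "a \<in> arrows E6_Z2"
  then show "E_eps a \<in> {1, - 1} \<and> E_eps (prod.swap a) = - E_eps a"
    by (cases rule: E_arrow_cases) simp_all
qed

lemma E_in_arrows:
  "k < 3 \<Longrightarrow> in_arrows E6_Z2 k = {(k + 3, k)}" "k < 3 \<Longrightarrow> in_arrows E6_Z2 (k + 3) = {(k, k + 3), (6, k + 3)}"
  "in_arrows E6_Z2 6 = {(0 + 3, 6), (1 + 3, 6), (2 + 3, 6)}"
proof -
  have ext: "in_arrows E6_Z2 j = B" if "\<And>i l. (i, l) \<in> arrows E6_Z2 \<and> l = j \<longleftrightarrow> (i, l) \<in> B" for j B
  proof (rule Set.set_eqI)
    fix a :: "nat \<times> nat"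
    obtain i l where a: "a = (i, l)" by (cases a)
    show "a \<in> in_arrows E6_Z2 j \<longleftrightarrow> a \<in> B" using that[of i l] by (simp add: in_arrows_def a)
  qed
  show "in_arrows E6_Z2 k = {(k + 3, k)}" if "k < 3"
    by (rule ext, unfold E_arrow_iff, use that in auto)
  show "in_arrows E6_Z2 (k + 3) = {(k, k + 3), (6, k + 3)}" if "k < 3"
    by (rule ext, unfold E_arrow_iff, use that in auto)
  show "in_arrows E6_Z2 6 = {(0 + 3, 6), (1 + 3, 6), (2 + 3, 6)}"
    by (rule ext, unfold E_arrow_iff ex_less_3) auto
qed

lemma E_square:
  assumes j: "j \<in> verts E6_Z2"
  shows "(\<Sum>a\<in>in_arrows E6_Z2 j. sc (of_int (E_eps a)) * (E_A1 a * E_A2 (prod.swap a))) = sc (of_nat (dims E6_Z2 j)) * un (dims E6_Z2 j) \<and>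
    (\<Sum>a\<in>in_arrows E6_Z2 j. sc (of_int (E_eps a)) * (E_A2 a * E_A1 (prod.swap a))) = - (sc (of_nat (dims E6_Z2 j)) * un (dims E6_Z2 j)) \<and>
    (\<Sum>a\<in>in_arrows E6_Z2 j. sc (of_int (E_eps a)) * (E_A1 a * E_A1 (prod.swap a))) = 0 \<and>
    (\<Sum>a\<in>in_arrows E6_Z2 j. sc (of_int (E_eps a)) * (E_A2 a * E_A2 (prod.swap a))) = 0"
proof -
  have "j < 3 \<or> (\<exists>k<3. j = k + 3) \<or> j = 6"
    using j by (auto intro: exI[of _ "j - 3"])
  then consider "j < 3" | k where "k < 3" "j = k + 3" | "j = 6" by blast
  then show ?thesis
  proof cases
    case 1
    show ?thesis unfolding E_in_arrows(1)[OF 1] using 1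
      by (simp add: E_values e6_defs M3_ops un_M3 sc_def del: sum_constant E_A1.simps E_A2.simps E_eps.simps dims.simps)
  next
    case (2 k)
    show ?thesis unfolding 2(2) E_in_arrows(2)[OF 2(1)] using 2(1)
      by (simp add: E_values e6_defs M3_ops un_M3 sc_def wp_wm wp_wm_left algebra_simps
          del: sum_constant E_A1.simps E_A2.simps E_eps.simps dims.simps)
  next
    case 3
    show ?thesis unfolding 3 E_in_arrows(3)
      by (simp add: e6_defs M3_ops un_M3 sc_def wp_def wm_def w algebra_simps)
  qed
qed

definition E_flip :: "nat \<Rightarrow> nat" where "E_flip = transpose 1 2 \<circ> transpose 4 5"

lemma E_flip_values: "E_flip 0 = 0" "E_flip 1 = 2" "E_flip (Suc 0) = 2" "E_flip 2 = 1" "E_flip 3 = 3" "E_flip 4 = 5" "E_flip 5 = 4" "E_flip 6 = 6"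
  by (simp_all add: E_flip_def transpose_def)

lemma E_flip_arrows:
  assumes "(i, j) \<in> arrows E6_Z2"
  shows "(E_flip i, E_flip j) \<in> arrows E6_Z2 \<and> E_eps (E_flip i, E_flip j) = E_eps (i, j)"
proof -
  have "\<exists>k<3. i = k \<and> j = k + 3 \<or> i = k + 3 \<and> j = k \<or> i = k + 3 \<and> j = 6 \<or> i = 6 \<and> j = k + 3"
    using assms E_arrow_iff by blast
  then show ?thesis unfolding E_arrow_iff ex_less_3 by (elim disjE) (simp_all add: E_flip_values)
qed

lemma E_auts:
  assumes "\<sigma> \<in> diagram_perms E6_Z2"
  shows "diagram_aut E6_Z2 \<sigma>"
proof -
  have "diagram_aut E6_Z2 E_flip"
    unfolding diagram_aut_def
  proof (intro conjI ballI)
    show "bij E_flip" unfolding E_flip_def by (intro bij_comp) simp_all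
    have v: "verts E6_Z2 = {0, 1, 2, 3, 4, 5, 6}" by auto
    show "E_flip ` verts E6_Z2 = verts E6_Z2" unfolding v by (auto simp: E_flip_values)
    show "map_prod E_flip E_flip a \<in> arrows E6_Z2" if "a \<in> arrows E6_Z2" for a
      using that E_flip_arrows by (cases a) auto
    show "dims E6_Z2 (E_flip i) = dims E6_Z2 i" for i by (auto simp: E_flip_def transpose_def)
  qed
  moreover have "diagram_aut E6_Z2 id" by (auto simp: diagram_aut_def map_prod.id)
  ultimately show ?thesis using assms by (auto simp: E_flip_def)
qed

lemma E_eps_inv:
  assumes "\<sigma> \<in> diagram_perms E6_Z2" "a \<in> arrows E6_Z2"
  shows "E_eps (map_prod \<sigma> \<sigma> a) = E_eps a"
proof -
  obtain i j where a: "a = (i, j)" by (cases a)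
  have "E_eps (E_flip i, E_flip j) = E_eps (i, j)" using E_flip_arrows assms(2) a by blast
  then show ?thesis using assms(1) unfolding a by (auto simp: map_prod.id E_flip_def simp del: E_eps.simps)
qed

text \<open>\<open>R\<close> is the action of \<open>g\<close> by conjugation on the span of i, j,
  k; branch k carries the character value \<open>\<chi> k\<close> at its leaf and
  \<open>\<chi> k\<close> times the matrix of \<open>g\<close> at its middle vertex. The conditions
  \<open>t1\<close> to \<open>w2\<close> are the coefficients of x and y in the equivariance along
  the arrows at the centre.\<close>

lemma E_twisted:
  assumes g: "g = mat22 a b c d" and det: "a * d - b * c = 1"
    and \<sigma>: "\<And>k. k < 3 \<Longrightarrow> \<tau> k < 3" "\<And>k. k < 3 \<Longrightarrow> \<sigma> k = \<tau> k" "\<And>k. k < 3 \<Longrightarrow> \<sigma> (k + 3) = \<tau> k + 3" "\<sigma> 6 = 6"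
    and R: "un 3 * R = R" "R * un 3 = R" "un 3 * R' = R'" "R' * un 3 = R'" "R * R' = un 3" "R' * R = un 3"
    and \<chi>: "\<And>k. k < 3 \<Longrightarrow> \<chi> k * \<chi>' k = 1"
    and t1: "\<And>k. k < 3 \<Longrightarrow> sc a * tall1 (wp (\<tau> k)) (wm (\<tau> k)) + sc c * tall2 (wp (\<tau> k)) (wm (\<tau> k)) =
      sc (\<chi>' k) * (R * tall1 (wp k) (wm k) * sqm d (- b) (- c) a)"
    and t2: "\<And>k. k < 3 \<Longrightarrow> sc b * tall1 (wp (\<tau> k)) (wm (\<tau> k)) + sc d * tall2 (wp (\<tau> k)) (wm (\<tau> k)) =
      sc (\<chi>' k) * (R * tall2 (wp k) (wm k) * sqm d (- b) (- c) a)"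
    and w1: "\<And>k. k < 3 \<Longrightarrow> sc a * wide1 (wm (\<tau> k)) (wp (\<tau> k)) + sc c * wide2 (wm (\<tau> k)) (wp (\<tau> k)) =
      sc (\<chi> k) * (sqm a b c d * wide1 (wm k) (wp k) * R')"
    and w2: "\<And>k. k < 3 \<Longrightarrow> sc b * wide1 (wm (\<tau> k)) (wp (\<tau> k)) + sc d * wide2 (wm (\<tau> k)) (wp (\<tau> k)) =
      sc (\<chi> k) * (sqm a b c d * wide2 (wm k) (wp k) * R')"
  shows "twisted_equivariant E6_Z2 E_A1 E_A2 g \<sigma>"
  unfolding twisted_equivariant_def
proof (intro exI conjI allI ballI)
  define h where "h i = (if i < 3 then scal (\<chi> i) else if i < 6 then sc (\<chi> (i - 3)) * sqm a b c d else R)" for i :: nat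
  define h' where "h' i = (if i < 3 then scal (\<chi>' i) else if i < 6 then sc (\<chi>' (i - 3)) * sqm d (- b) (- c) a else R')" for i :: nat
  have hv: "k < 3 \<Longrightarrow> h k = scal (\<chi> k)" "k < 3 \<Longrightarrow> h (k + 3) = sc (\<chi> k) * sqm a b c d" "h 6 = R"
    "k < 3 \<Longrightarrow> h' k = scal (\<chi>' k)" "k < 3 \<Longrightarrow> h' (k + 3) = sc (\<chi>' k) * sqm d (- b) (- c) a" "h' 6 = R'" for k
    by (auto simp: h_def h'_def)
  show "gauge_pair E6_Z2 h h'"
    unfolding gauge_pair_def
  proof
    fix i assume "i \<in> verts E6_Z2"
    then have "i < 3 \<or> (\<exists>k<3. i = k + 3) \<or> i = 6" by (auto intro: exI[of _ "i - 3"])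
    then consider "i < 3" | k where "k < 3" "i = k + 3" | "i = 6" by blast
    then show "un (dims E6_Z2 i) * h i = h i \<and> h i * un (dims E6_Z2 i) = h i \<and> un (dims E6_Z2 i) * h' i = h' i \<and>
        h' i * un (dims E6_Z2 i) = h' i \<and> h i * h' i = un (dims E6_Z2 i) \<and> h' i * h i = un (dims E6_Z2 i)"
    proof cases
      case 1
      then show ?thesis using \<chi>[OF 1] by (simp add: E_values hv scal_ops mult.commute del: dims.simps)
    next
      case (2 k)
      have "\<chi>' k * \<chi> k = 1" using \<chi>[OF 2(1)] by (simp add: mult.commute)
      moreover have "sqm a b c d * sqm d (- b) (- c) a = un 2" "sqm d (- b) (- c) a * sqm a b c d = un 2"
        using det by (simp_all add: sqm_def M3_ops un_M3 algebra_simps)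
      moreover have "un 2 * sqm p q r s = sqm p q r s" "sqm p q r s * un 2 = sqm p q r s" for p q r s
        by (simp_all add: sqm_def M3_ops un_M3)
      ultimately show ?thesis
        using \<chi>[OF 2(1)] unfolding 2(2) hv(2,5)[OF 2(1)] E_values(14)[OF 2(1)]
        by (simp only: sc_commute_left[of "un 2"] mult.assoc[of "sc _" _ "un 2"] scalars_pull sc_simps(2) mult_1_left simp_thms)
    next
      case 3 then show ?thesis using R by (simp add: E_values hv del: dims.simps)
    qed
  qed
  fix x y e assume e: "e \<in> arrows E6_Z2"
  have act: "act_fst g x y = a * x + b * y" "act_snd g x y = c * x + d * y"
    by (simp_all add: g act_fst_def act_snd_def)
  have sc_out: "M * (sc p * N) * L = sc p * (M * N * L)" for M N L p
    by (simp only: sc_commute_left[of M] mult.assoc)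
  have sc_mid: "sc p * (sc q * M) = sc q * (sc p * M)" for p q M
    by (rule sc_commute_left)
  have mix: "sc (a * x + b * y) * P + sc (c * x + d * y) * Q = sc x * (sc a * P + sc c * Q) + sc y * (sc b * P + sc d * Q)" for P Q
    by (simp add: sc_simps distrib_left distrib_right mult.assoc[symmetric] add.assoc)
      (simp add: sc_simps(4)[symmetric] mult.commute)
  have sv: "k < 3 \<Longrightarrow> slice_rep E_A1 E_A2 u v (k, k + 3) = colm u v"
    "k < 3 \<Longrightarrow> slice_rep E_A1 E_A2 u v (k + 3, k) = rowm (- v) u" for k u v
    unfolding slice_rep_def by (simp_all only: E_values small_ops) simp_all
  have cancel: "\<chi> k * (p * (q * \<chi>' k)) = p * q" "\<chi> k * (p * (\<chi>' k * q)) = p * q" if "k < 3" for k p q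
  proof -
    have "\<chi> k * (p * (q * \<chi>' k)) = (\<chi> k * \<chi>' k) * (p * q)" "\<chi> k * (p * (\<chi>' k * q)) = (\<chi> k * \<chi>' k) * (p * q)"
      by (simp_all only: mult_ac)
    then show "\<chi> k * (p * (q * \<chi>' k)) = p * q" "\<chi> k * (p * (\<chi>' k * q)) = p * q" using \<chi>[OF that] by simp_all
  qed
  show "slice_rep E_A1 E_A2 (act_fst g x y) (act_snd g x y) (map_prod \<sigma> \<sigma> e) = pair_act h h' (slice_rep E_A1 E_A2 x y) e"
    using e
  proof (cases rule: E_arrow_cases)
    case (1 k)
    show ?thesis
      unfolding 1(2) pair_act_def fst_conv snd_conv map_prod_simp \<sigma>(2,3)[OF 1(1)] sv(1)[OF 1(1)] sv(1)[OF \<sigma>(1)[OF 1(1)]]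
        hv(2,4)[OF 1(1)] act small_ops
      by (simp add: distrib_right mult.assoc cancel[OF 1(1)])
  next
    case (2 k)
    show ?thesis
      unfolding 2(2) pair_act_def fst_conv snd_conv map_prod_simp \<sigma>(2,3)[OF 2(1)] sv(2)[OF 2(1)] sv(2)[OF \<sigma>(1)[OF 2(1)]]
        hv(1,5)[OF 2(1)] act small_ops
      by (simp add: distrib_right mult.assoc cancel[OF 2(1)])
  next
    case (3 k)
    show ?thesis
      unfolding 3(2) pair_act_def fst_conv snd_conv map_prod_simp \<sigma>(3)[OF 3(1)] \<sigma>(4) slice_rep_def
        E_values(5,6)[OF 3(1)] E_values(5,6)[OF \<sigma>(1)[OF 3(1)]] hv(3) hv(5)[OF 3(1)] act mix t1[OF 3(1)] t2[OF 3(1)]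
        distrib_left distrib_right sc_commute_left[of "_ * _" "\<chi>' k"] sc_commute_left[of R] mult.assoc[of "sc _"]
      by (rule arg_cong2[where f = "(+)"] sc_mid)+
  next
    case (4 k)
    show ?thesis
      unfolding 4(2) pair_act_def fst_conv snd_conv map_prod_simp \<sigma>(3)[OF 4(1)] \<sigma>(4) slice_rep_def
        E_values(7,8)[OF 4(1)] E_values(7,8)[OF \<sigma>(1)[OF 4(1)]] hv(6) hv(2)[OF 4(1)] act mix w1[OF 4(1)] w2[OF 4(1)]
        distrib_left distrib_right mult.assoc[of "sc _"] sc_commute_left[of "sqm _ _ _ _"]
      by (rule arg_cong2[where f = "(+)"] sc_mid)+
  qed
qed

lemmas e6_twist_simps = e6_defs sqm_def M3_ops un_M3 sc_def

lemma ii_pull: "\<i> * z * \<i> = - z" "\<i> * (\<i> * z) = - z"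
proof -
  have "\<i> * z * \<i> = (\<i> * \<i>) * z" "\<i> * (\<i> * z) = (\<i> * \<i>) * z" by (simp_all only: mult_ac)
  then show "\<i> * z * \<i> = - z" "\<i> * (\<i> * z) = - z" by simp_all
qed

lemma xi_ii: "xi * \<i> = - xi'" "xi' * \<i> = xi" "xi * (\<i> * z) = - (xi' * z)" "xi' * (\<i> * z) = xi * z"
  "\<i> * z * xi = - (xi' * z)" "\<i> * z * xi' = xi * z"
proof -
  show a: "xi * \<i> = - xi'" "xi' * \<i> = xi" using xi(5,6) by (simp_all add: mult.commute)
  have "xi * (\<i> * z) = (xi * \<i>) * z" "xi' * (\<i> * z) = (xi' * \<i>) * z"
    "\<i> * z * xi = (xi * \<i>) * z" "\<i> * z * xi' = (xi' * \<i>) * z" by (simp_all only: mult_ac)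
  then show "xi * (\<i> * z) = - (xi' * z)" "xi' * (\<i> * z) = xi * z"
    "\<i> * z * xi = - (xi' * z)" "\<i> * z * xi' = xi * z" unfolding a by simp_all
qed

lemma E_twisted_rot: "twisted_equivariant E6_Z2 E_A1 E_A2 (rot 4) id"
  by (rule E_twisted[OF rot_4, where \<tau> = id and \<chi> = "\<lambda>_. 1" and \<chi>' = "\<lambda>_. 1"
        and R = "M3 1 0 0 0 (- 1) 0 0 0 (- 1)" and R' = "M3 1 0 0 0 (- 1) 0 0 0 (- 1)"])
    (simp_all add: e6_twist_simps ii_pull)

lemma E_twisted_J: "twisted_equivariant E6_Z2 E_A1 E_A2 matJ id"
  by (rule E_twisted[OF matJ_def, where \<tau> = id and \<chi> = "\<lambda>_. 1" and \<chi>' = "\<lambda>_. 1"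
        and R = "M3 (- 1) 0 0 0 1 0 0 0 (- 1)" and R' = "M3 (- 1) 0 0 0 1 0 0 0 (- 1)"])
    (simp_all add: e6_twist_simps)

lemma half_i: "(1 + \<i>) / 2 * ((1 - \<i>) / 2) - (1 + \<i>) / 2 * ((- 1 + \<i>) / 2) = 1"
  by (simp add: complex_eq_iff)

text \<open>Conjugation by \<open>matH\<close> permutes i, j, k cyclically. This shifts the weights
  (1, w^k, w^(2 k)) of branch k, which amounts to a factor that is a power of w and accounts for the
  characters \<open>wm\<close> and \<open>wp\<close>.\<close>

lemma E_twisted_H: "twisted_equivariant E6_Z2 E_A1 E_A2 matH id"
  by (rule E_twisted[OF matH_def half_i, where \<tau> = id and \<chi> = wm and \<chi>' = wp
        and R = "M3 0 0 1 1 0 0 0 1 0" and R' = "M3 0 1 0 0 0 1 1 0 0"])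
    (simp_all add: e6_twist_simps wp_wm wp_wm_left algebra_simps add_divide_distrib diff_divide_distrib ii_pull)

text \<open>Conjugation by \<open>rot 8\<close> fixes i and exchanges j and k up to sign. So it
  exchanges the weights w^k and w^(- k), that is, the branches 1 and 2.\<close>

lemma E_twisted_rot_flip: "twisted_equivariant E6_Z2 E_A1 E_A2 (rot 8) E_flip"
proof -
  have t: "k < 3 \<Longrightarrow> transpose 1 2 k < 3" "k < 3 \<Longrightarrow> E_flip k = transpose 1 2 k"
    "k < 3 \<Longrightarrow> E_flip (k + 3) = transpose 1 2 k + 3"
    "k < 3 \<Longrightarrow> wp (transpose 1 2 k) = wm k" "k < 3 \<Longrightarrow> wm (transpose 1 2 k) = wp k" for k :: nat
    by (auto simp: less_3_cases E_flip_def transpose_def wp_def wm_def)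
  show ?thesis
    by (rule E_twisted[OF rot_8, where \<tau> = "transpose 1 2" and \<chi> = "\<lambda>_. 1" and \<chi>' = "\<lambda>_. 1"
          and R = "M3 1 0 0 0 0 (- 1) 0 1 0" and R' = "M3 1 0 0 0 0 1 0 (- 1) 0"])
      (simp_all only: t E_flip_values, simp_all add: e6_twist_simps xi xi_pull xi_ii mult.commute[of "wp _" xi'] mult.commute[of "wm _" xi'] mult.commute[of "wp _" xi] mult.commute[of "wm _" xi])
qed

text \<open>The three sets lie in different right cosets of \<open>Q\<close>. For the quaternion
  group and \<open>matH\<close> this yields at least 24 elements of the binary tetrahedral group, as
  many as W has dimensions.\<close>

lemma (in group) three_cosets_card:
  assumes Q: "subgroup Q G" and K: "K \<subseteq> Q" "finite K"
    and h: "h \<in> carrier G" "h \<notin> Q" "h \<otimes> h \<notin> Q"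
  shows "card (K \<union> (\<lambda>q. q \<otimes> h) ` K \<union> (\<lambda>q. q \<otimes> (h \<otimes> h)) ` K) = 3 * card K"
proof -
  have c: "q \<in> carrier G" if "q \<in> K" for q using that K(1) subgroup.subset[OF Q] by blast
  have out: "k \<in> Q" if "q \<in> K" "q' \<in> K" "q = q' \<otimes> k" "k \<in> carrier G" for q q' k
  proof -
    have "k = inv q' \<otimes> q" using that(3,4) c[OF that(2)] by (simp add: m_assoc[symmetric])
    then show ?thesis using that(1,2) K(1) subgroup.m_closed[OF Q subgroup.m_inv_closed[OF Q]] by blast
  qed
  have step: "q = q' \<otimes> h" if "q \<in> K" "q' \<in> K" "q \<otimes> h = q' \<otimes> (h \<otimes> h)" for q q'
    using that(3) c[OF that(1)] c[OF that(2)] h(1) right_cancel[of h q "q' \<otimes> h"] by (simp only: m_assoc m_closed simp_thms)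
  have inj: "inj_on (\<lambda>q. q \<otimes> k) K" if "k \<in> carrier G" for k
    using that c by (intro inj_onI) simp
  have d: "K \<inter> (\<lambda>q. q \<otimes> h) ` K = {}" "(K \<union> (\<lambda>q. q \<otimes> h) ` K) \<inter> (\<lambda>q. q \<otimes> (h \<otimes> h)) ` K = {}"
  proof -
    show "K \<inter> (\<lambda>q. q \<otimes> h) ` K = {}" using out[OF _ _ _ h(1)] h(2) by blast
    show "(K \<union> (\<lambda>q. q \<otimes> h) ` K) \<inter> (\<lambda>q. q \<otimes> (h \<otimes> h)) ` K = {}"
      using out[OF _ _ _ m_closed[OF h(1) h(1)]] out[OF _ _ step h(1)] h(2,3) by blast
  qed
  show ?thesis
    using K(2) d card_image[OF inj[of h]] card_image[OF inj[of "h \<otimes> h"]] h(1) by (simp add: card_Un_disjoint)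
qed

text \<open>An invariant that is easy to carry through words in the generators. The shape of the
  matrices excludes \<open>matH\<close> and its square, the fourth powers exclude
  \<open>rot 8\<close>.\<close>

lemma Q8_monomial:
  assumes "g \<in> generate SU2 {rot 4, matJ}"
  shows "\<exists>a b. a ^ 4 = 1 \<and> b ^ 4 = 1 \<and> (g = mat22 a 0 0 b \<or> g = mat22 0 a b 0)"
  using assms
proof (induction g rule: generate.induct)
  case one
  show ?case by (intro exI[of _ 1]) (simp add: mat22_one)
next
  case (incl g)
  have i: "\<i> ^ 4 = 1" "(- \<i>) ^ 4 = 1" "(- 1 :: complex) ^ 4 = 1" by (simp_all add: power4_eq_xxxx)
  from incl show ?case
  proof (elim insertE emptyE)
    assume "g = rot 4" then show ?thesis by (intro exI[of _ \<i>] exI[of _ "- \<i>"]) (simp add: rot_4 i)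
  next
    assume "g = matJ" then show ?thesis by (intro exI[of _ 1] exI[of _ "- 1"]) (simp add: matJ_def i)
  qed
next
  case (inv g)
  have i: "\<i> ^ 4 = 1" "(- \<i>) ^ 4 = 1" "(- 1 :: complex) ^ 4 = 1" by (simp_all add: power4_eq_xxxx)
  from inv show ?case
  proof (elim insertE emptyE)
    assume "g = rot 4" then show ?thesis by (intro exI[of _ "- \<i>"] exI[of _ \<i>]) (simp add: rot_4_inv i)
  next
    assume "g = matJ" then show ?thesis by (intro exI[of _ "- 1"] exI[of _ 1]) (simp add: matJ_inv i)
  qed
next
  case (eng g h)
  obtain a b where g: "a ^ 4 = 1" "b ^ 4 = 1" "g = mat22 a 0 0 b \<or> g = mat22 0 a b 0" using eng(3) by blast
  obtain c d where h: "c ^ 4 = 1" "d ^ 4 = 1" "h = mat22 c 0 0 d \<or> h = mat22 0 c d 0" using eng(4) by blast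
  have p: "(a * c) ^ 4 = 1" "(b * d) ^ 4 = 1" "(a * d) ^ 4 = 1" "(b * c) ^ 4 = 1"
    using g h by (simp_all add: power_mult_distrib)
  have "g * h = mat22 (a * c) 0 0 (b * d) \<or> g * h = mat22 0 (a * c) (b * d) 0 \<or>
      g * h = mat22 0 (a * d) (b * c) 0 \<or> g * h = mat22 (a * d) 0 0 (b * c)"
    using g(3) h(3) by (auto simp: mat22_mult mat22_eq_iff)
  then show ?case using p by (simp only: SU2_simps) blast
qed

lemma not_in_Q8: "a \<noteq> 0 \<Longrightarrow> b \<noteq> 0 \<Longrightarrow> mat22 a b c d \<notin> generate SU2 {rot 4, matJ}"
  using Q8_monomial[of "mat22 a b c d"] by (auto simp: mat22_eq_iff)

lemma matH_square: "matH * matH = mat22 ((- 1 + \<i>) / 2) ((1 + \<i>) / 2) ((- 1 + \<i>) / 2) ((- 1 - \<i>) / 2)"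
  unfolding matH_def by (simp add: mat22_mult mat22_eq_iff complex_eq_iff)

lemma matH_not_in_Q8: "matH \<notin> generate SU2 {rot 4, matJ}" "matH * matH \<notin> generate SU2 {rot 4, matJ}"
  unfolding matH_square unfolding matH_def by (rule not_in_Q8; simp add: complex_eq_iff)+

lemma rot_8_conj:
  "rot 8 * rot 4 * inv\<^bsub>SU2\<^esub> (rot 8) = rot 4" "inv\<^bsub>SU2\<^esub> (rot 8) * rot 4 * rot 8 = rot 4"
  "rot 8 * matJ * inv\<^bsub>SU2\<^esub> (rot 8) = rot 4 * matJ" "inv\<^bsub>SU2\<^esub> (rot 8) * matJ * rot 8 = inv\<^bsub>SU2\<^esub> (rot 4) * matJ"
  unfolding rot_8_inv rot_4_inv unfolding rot_8 rot_4 matJ_def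
  by (simp_all add: mat22_mult mat22_eq_iff xi xi_pull)

text \<open>The right sides are words in \<open>rot 4\<close>, \<open>matJ\<close>,
  \<open>matH\<close> and their inverses, which exhibits the conjugates as elements of the binary
  tetrahedral group.\<close>

lemma rot_8_conj_matH:
  "rot 8 * matH * inv\<^bsub>SU2\<^esub> (rot 8) = matJ * inv\<^bsub>SU2\<^esub> matH * inv\<^bsub>SU2\<^esub> matJ"
  "inv\<^bsub>SU2\<^esub> (rot 8) * matH * rot 8 = rot 4 * (matJ * (inv\<^bsub>SU2\<^esub> matH * (inv\<^bsub>SU2\<^esub> matJ * inv\<^bsub>SU2\<^esub> (rot 4))))"
  unfolding rot_8_inv rot_4_inv matJ_inv matH_inv unfolding rot_8 rot_4 matJ_def matH_def
  by (simp_all add: mat22_mult mat22_eq_iff xi_pull) (simp_all add: algebra_simps add_divide_distrib diff_divide_distrib)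

lemma E_generators: "mckay_generators E6_Z2 E_eps E_A1 E_A2 {rot 4, matJ, matH} {rot 8, rot 4, matJ, matH}"
proof
  let ?S = "{rot 4, matJ, matH}" and ?S' = "{rot 8, rot 4, matJ, matH}"
  show small: "small_grp E6_Z2 = generate SU2 ?S" by (simp add: binary_tetrahedral_grp_def)
  show big: "big_grp E6_Z2 = generate SU2 ?S'" by (simp add: binary_octahedral_grp_def)
  show "?S \<subseteq> big_grp E6_Z2" unfolding big by (auto intro: generate.incl)
  show S: "?S \<subseteq> carrier SU2" and "?S' \<subseteq> carrier SU2" using rot_SU2 matJ_SU2 matH_SU2 by auto
  have sg: "subgroup (generate SU2 ?S) SU2" by (rule SU2.generate_is_subgroup[OF S])
  have cl: "g * h \<in> generate SU2 ?S" if "g \<in> generate SU2 ?S" "h \<in> generate SU2 ?S" for g h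
    using subgroup.m_closed[OF sg that] by simp
  note iv = subgroup.m_inv_closed[OF sg]
  have g: "rot 4 \<in> generate SU2 ?S" "matJ \<in> generate SU2 ?S" "matH \<in> generate SU2 ?S"
    by (auto intro: generate.incl)
  show "s * t * inv\<^bsub>SU2\<^esub> s \<in> small_grp E6_Z2" "inv\<^bsub>SU2\<^esub> s * t * s \<in> small_grp E6_Z2"
    if s: "s \<in> ?S'" and t: "t \<in> ?S" for s t
  proof -
    have tS: "t \<in> generate SU2 ?S" using t by (rule generate.incl)
    have "s * t * inv\<^bsub>SU2\<^esub> s \<in> generate SU2 ?S \<and> inv\<^bsub>SU2\<^esub> s * t * s \<in> generate SU2 ?S"
    proof (cases "s = rot 8")
      case True
      show ?thesis using t unfolding True
        by (elim insertE emptyE) (simp_all only: rot_8_conj rot_8_conj_matH, auto intro!: cl iv g)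
    next
      case False
      then have "s \<in> generate SU2 ?S" using s by (auto intro: generate.incl)
      then show ?thesis by (intro conjI cl iv tS)
    qed
    then show "s * t * inv\<^bsub>SU2\<^esub> s \<in> small_grp E6_Z2" "inv\<^bsub>SU2\<^esub> s * t * s \<in> small_grp E6_Z2" unfolding small by blast+
  qed
  show "\<exists>K\<subseteq>small_grp E6_Z2. finite K \<and> (\<Sum>i\<in>verts E6_Z2. (dims E6_Z2 i)\<^sup>2) \<le> card K"
  proof -
    have v: "verts E6_Z2 = {0, 1, 2, 3, 4, 5, 6}" by auto
    obtain K where K: "K \<subseteq> generate SU2 {rot 4, matJ}" "finite K" "8 \<le> card K"
      using dihedral_large[of 4 "{rot 4, matJ}"] by auto
    have Q: "subgroup (generate SU2 {rot 4, matJ}) SU2" using SU2.generate_is_subgroup rot_SU2 matJ_SU2 by simp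
    have sub: "generate SU2 {rot 4, matJ} \<subseteq> generate SU2 ?S" by (rule SU2.mono_generate) auto
    let ?K = "K \<union> (\<lambda>q. q * matH) ` K \<union> (\<lambda>q. q * (matH * matH)) ` K"
    have "card ?K = 3 * card K"
      using SU2.three_cosets_card[OF Q K(1,2) matH_SU2] matH_not_in_Q8 by simp
    moreover have "?K \<subseteq> generate SU2 ?S" using K(1) sub cl g by blast
    ultimately show ?thesis unfolding small v using K by (intro exI[of _ ?K]) simp
  qed
  show "twisted_equivariant E6_Z2 E_A1 E_A2 g id" if "g \<in> ?S" for g
    using that E_twisted_rot E_twisted_J E_twisted_H by auto
  show "valid_triple E6_Z2" by simp
qed (use E_padded E_wedge E_square E_auts E_eps_inv E_orientation in blast)+

lemma E_main:
  assumes "diagram_action E6_Z2 \<alpha>"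
  shows "\<exists>\<epsilon> \<rho>. orientation E6_Z2 \<epsilon> \<and> lifted_action E6_Z2 \<alpha> \<rho> \<and> symplectic_action E6_Z2 \<epsilon> \<rho> \<and>
    induces_natural_action E6_Z2 \<epsilon> \<rho>"
proof -
  have p: "diagram_perms E6_Z2 = {id, E_flip}" by (simp add: E_flip_def)
  have "{rot 4, matJ, matH} \<subseteq> small_grp E6_Z2" by (auto simp: binary_tetrahedral_grp_def intro: generate.incl)
  then have "\<exists>\<rho>. lifted_action E6_Z2 \<alpha> \<rho> \<and> symplectic_action E6_Z2 E_eps \<rho> \<and> induces_natural_action E6_Z2 E_eps \<rho>"
    using E_twisted_rot_flip by (intro mckay_generators.action_order_two[OF E_generators assms p]) blast
  then show ?thesis using E_orientation by blast
qed

section \<open>Type \<open>D\<^sub>4\<close> with the symmetric group\<close>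

text \<open>The isomorphism \<open>\<alpha>\<close> is one of six, which differ by conjugation with
  a permutation \<open>p\<close> of the vertices 1, 3, 4. Reading the slice along \<open>p\<close>
  replaces \<open>\<sigma>\<close> by its conjugate \<open>\<tau>\<close>.\<close>

lemma twisted_equivariant_relabel:
  assumes p: "diagram_aut X p" and t: "twisted_equivariant X A1 A2 g \<sigma>" and c: "p \<circ> \<tau> = \<sigma> \<circ> p"
  shows "twisted_equivariant X (\<lambda>a. A1 (map_prod p p a)) (\<lambda>a. A2 (map_prod p p a)) g \<tau>"
proof -
  obtain h h' where h: "gauge_pair X h h'" "\<And>x y a. a \<in> arrows X \<Longrightarrow>
     slice_rep A1 A2 (act_fst g x y) (act_snd g x y) (map_prod \<sigma> \<sigma> a) = pair_act h h' (slice_rep A1 A2 x y) a"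
    using t unfolding twisted_equivariant_def by blast
  note s = diagram_autD[OF p]
  have c': "p (\<tau> i) = \<sigma> (p i)" for i using fun_cong[OF c, of i] by simp
  show ?thesis
    unfolding twisted_equivariant_def
  proof (intro exI conjI allI ballI)
    show "gauge_pair X (\<lambda>i. h (p i)) (\<lambda>i. h' (p i))" by (rule gauge_pair_reindex[OF h(1) s(3,4)])
    fix x y a assume a: "a \<in> arrows X"
    have "map_prod p p (map_prod \<tau> \<tau> a) = map_prod \<sigma> \<sigma> (map_prod p p a)" by (cases a) (simp add: c')
    then show "slice_rep (\<lambda>a. A1 (map_prod p p a)) (\<lambda>a. A2 (map_prod p p a)) (act_fst g x y) (act_snd g x y) (map_prod \<tau> \<tau> a) =
        pair_act (\<lambda>i. h (p i)) (\<lambda>i. h' (p i)) (slice_rep (\<lambda>a. A1 (map_prod p p a)) (\<lambda>a. A2 (map_prod p p a)) x y) a"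
      using h(2)[OF s(2)[OF a], of x y] by (simp add: slice_rep_def pair_act_def)
  qed
qed

text \<open>The relations on the slice are local in the quiver and the signs are invariant under
  \<open>p\<close>, so the relabelled slice satisfies them for the same groups.\<close>

lemma mckay_generators_relabel:
  assumes gen: "mckay_generators X \<epsilon> A1 A2 S S'" and p: "diagram_aut X p"
    and inv: "\<And>a. a \<in> arrows X \<Longrightarrow> \<epsilon> (map_prod p p a) = \<epsilon> a"
  shows "mckay_generators X \<epsilon> (\<lambda>a. A1 (map_prod p p a)) (\<lambda>a. A2 (map_prod p p a)) S S'"
proof -
  interpret mckay_generators X \<epsilon> A1 A2 S S' by (rule gen)
  note s = diagram_autD[OF p]
  have inj: "p i = p j \<longleftrightarrow> i = j" for i j using s(1) by (auto simp: bij_def inj_def)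
  have sw: "map_prod p p (prod.swap a) = prod.swap (map_prod p p a)" for a by (cases a) simp
  have eq: "map_prod p p b = map_prod p p a \<longleftrightarrow> b = a" for a b by (cases a; cases b) (simp add: inj)
  have in_arr: "bij_betw (map_prod p p) (in_arrows X j) (in_arrows X (p j))" if j: "j \<in> verts X" for j
    unfolding bij_betw_def
  proof
    show "inj_on (map_prod p p) (in_arrows X j)" by (simp add: inj_on_def eq)
    note si = diagram_autD[OF diagram_aut_inv[OF valid' p]]
    show "map_prod p p ` in_arrows X j = in_arrows X (p j)"
    proof
      show "map_prod p p ` in_arrows X j \<subseteq> in_arrows X (p j)" using s(2) by (auto simp: in_arrows_def)
      show "in_arrows X (p j) \<subseteq> map_prod p p ` in_arrows X j"
      proof
        fix b assume b: "b \<in> in_arrows X (p j)"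
        define c where "c = map_prod (perm_inv p) (perm_inv p) b"
        have e: "map_prod p p c = b" unfolding c_def by (rule map_prod_inv(1)[OF s(1)])
        have bA: "b \<in> arrows X" "snd b = p j" using b by (simp_all add: in_arrows_def)
        have "p (snd c) = snd (map_prod p p c)" by simp
        then have "snd c = j" unfolding e bA(2) inj .
        moreover have "c \<in> arrows X" unfolding c_def by (rule si(2)[OF bA(1)])
        ultimately show "b \<in> map_prod p p ` in_arrows X j" using e by (intro image_eqI[of _ _ c]) (simp_all add: in_arrows_def)
      qed
    qed
  qed
  have sq: "(\<Sum>a\<in>in_arrows X j. sc (of_int (\<epsilon> a)) * (B1 (map_prod p p a) * B2 (map_prod p p (prod.swap a)))) =
      (\<Sum>a\<in>in_arrows X (p j). sc (of_int (\<epsilon> a)) * (B1 a * B2 (prod.swap a)))" if j: "j \<in> verts X"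
    for j :: nat and B1 B2 :: "nat \<times> nat \<Rightarrow> m3"
    by (subst sum.reindex_bij_betw[OF in_arr[OF j], symmetric], rule sum.cong[OF refl])
      (simp add: sw inv in_arrows_def)
  show ?thesis
  proof
    show "padded_rep X (\<lambda>a. A1 (map_prod p p a))" "padded_rep X (\<lambda>a. A2 (map_prod p p a))"
    proof -
      have "un (dims X (snd a)) * B (map_prod p p a) = B (map_prod p p a) \<and> B (map_prod p p a) * un (dims X (fst a)) = B (map_prod p p a)"
        if "padded_rep X B" "a \<in> arrows X" for B a
        using that(1)[unfolded padded_rep_def, rule_format, OF s(2)[OF that(2)]] arrows_ends[OF valid' that(2)] by (simp add: s(4))
      then show "padded_rep X (\<lambda>a. A1 (map_prod p p a))" "padded_rep X (\<lambda>a. A2 (map_prod p p a))"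
        using padded' unfolding padded_rep_def by blast+
    qed
    show "A1 (map_prod p p b) * A2 (map_prod p p a) - A2 (map_prod p p b) * A1 (map_prod p p a) =
        (if b = prod.swap a then sc (of_int (\<epsilon> b) * of_nat (dims X (fst b))) * un (dims X (snd b)) else 0)"
      if a: "a \<in> arrows X" and b: "b \<in> arrows X" and ab: "snd a = fst b" for a b
    proof -
      have "snd (map_prod p p a) = fst (map_prod p p b)" using ab by simp
      from wedge'[OF s(2)[OF a] s(2)[OF b] this] show ?thesis
        unfolding sw[symmetric] eq inv[OF b] fst_map_prod snd_map_prod s(4)[OF arrows_ends(1)[OF valid' b]]
          s(4)[OF arrows_ends(2)[OF valid' b]] .
    qed
    show "twisted_equivariant X (\<lambda>a. A1 (map_prod p p a)) (\<lambda>a. A2 (map_prod p p a)) g id" if "g \<in> S" for g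
      by (rule twisted_equivariant_relabel[OF p equivariant'[OF that]]) simp
    show "(\<Sum>a\<in>in_arrows X j. sc (of_int (\<epsilon> a)) * (A1 (map_prod p p a) * A2 (map_prod p p (prod.swap a)))) = sc (of_nat (dims X j)) * un (dims X j)"
      "(\<Sum>a\<in>in_arrows X j. sc (of_int (\<epsilon> a)) * (A2 (map_prod p p a) * A1 (map_prod p p (prod.swap a)))) = - (sc (of_nat (dims X j)) * un (dims X j))"
      "(\<Sum>a\<in>in_arrows X j. sc (of_int (\<epsilon> a)) * (A1 (map_prod p p a) * A1 (map_prod p p (prod.swap a)))) = 0"
      "(\<Sum>a\<in>in_arrows X j. sc (of_int (\<epsilon> a)) * (A2 (map_prod p p a) * A2 (map_prod p p (prod.swap a)))) = 0"
      if j: "j \<in> verts X" for j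
      unfolding sq[OF j] square'[OF s(3)[OF j]] s(4)[OF j] by (rule refl)+
  qed (fact valid' orient' gens sub conj large' auts' eps_inv')+
qed

definition qcol :: "nat \<Rightarrow> complex \<Rightarrow> complex \<Rightarrow> m3" where
  "qcol l x y = (if l = 0 then colm x y else if l = 1 then colm (\<i> * x) (- \<i> * y)
     else if l = 3 then colm y (- x) else colm (\<i> * y) (\<i> * x))"

definition qrow :: "nat \<Rightarrow> complex \<Rightarrow> complex \<Rightarrow> m3" where
  "qrow l x y = (if l = 0 then rowm y (- x) else if l = 1 then rowm (- \<i> * y) (- \<i> * x)
     else if l = 3 then rowm (- x) (- y) else rowm (\<i> * x) (- \<i> * y))"

lemma qcol_values: "qcol 0 x y = colm x y" "qcol 1 x y = colm (\<i> * x) (- \<i> * y)" "qcol 3 x y = colm y (- x)"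
    "qcol 4 x y = colm (\<i> * y) (\<i> * x)"
  and qrow_values: "qrow 0 x y = rowm y (- x)" "qrow 1 x y = rowm (- \<i> * y) (- \<i> * x)" "qrow 3 x y = rowm (- x) (- y)"
    "qrow 4 x y = rowm (\<i> * x) (- \<i> * y)"
  by (simp_all add: qcol_def qrow_def)

text \<open>With \<open>v = (x, y)\<close>, \<open>w = (y, - x)\<close> and the quaternions \<open>q = 1, i, j, k\<close> at the leaves
  \<open>0, 1, 3, 4\<close>, the maps into and out of the central vertex are \<open>q v\<close> and \<open>w q\<^sup>-\<^sup>1\<close>.\<close>

fun Q_A1 :: "nat \<times> nat \<Rightarrow> m3" where
  "Q_A1 (i, j) = (if j = 2 then qcol i 1 0 else qrow j 1 0)"

fun Q_A2 :: "nat \<times> nat \<Rightarrow> m3" where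
  "Q_A2 (i, j) = (if j = 2 then qcol i 0 1 else qrow j 0 1)"

fun Q_eps :: "nat \<times> nat \<Rightarrow> int" where
  "Q_eps (i, j) = (if j = 2 then 1 else - 1)"

abbreviation leaves :: "nat set" where "leaves \<equiv> {0, 1, 3, 4}"

lemma Q_arrow_iff: "(i, j) \<in> arrows D4_S3 \<longleftrightarrow> i \<in> leaves \<and> j = 2 \<or> i = 2 \<and> j \<in> leaves"
proof -
  have "(i, j) \<in> arrows D4_S3 \<longleftrightarrow> (i, j) \<in> {(2, 0), (2, 1), (2, 3), (2, 4)} \<or> (j, i) \<in> {(2, 0), (2, 1), (2, 3), (2, 4)}"
    unfolding arrows_def half_edges.simps by (simp only: Un_iff converse_iff)
  then show ?thesis by auto
qed

lemma Q_arrow_cases: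
  assumes "a \<in> arrows D4_S3"
  obtains l where "l \<in> leaves" "a = (l, 2)" | l where "l \<in> leaves" "a = (2, l)"
  using assms by (cases a) (auto simp: Q_arrow_iff)

lemma Q_values:
  "Q_A1 (l, 2) = qcol l 1 0" "Q_A2 (l, 2) = qcol l 0 1" "Q_eps (l, 2) = 1" "dims D4_S3 2 = 2"
  "l \<in> leaves \<Longrightarrow> Q_A1 (2, l) = qrow l 1 0" "l \<in> leaves \<Longrightarrow> Q_A2 (2, l) = qrow l 0 1"
  "l \<in> leaves \<Longrightarrow> Q_eps (2, l) = - 1" "l \<in> leaves \<Longrightarrow> dims D4_S3 l = 1"
  by auto

lemma Q_slice_values:
  "slice_rep Q_A1 Q_A2 x y (l, 2) = qcol l x y" "l \<in> leaves \<Longrightarrow> slice_rep Q_A1 Q_A2 x y (2, l) = qrow l x y"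
  by (auto simp: slice_rep_def qcol_def qrow_def small_ops)

lemma Q_wedge:
  assumes a: "a \<in> arrows D4_S3" and b: "b \<in> arrows D4_S3" and ab: "snd a = fst b"
  shows "Q_A1 b * Q_A2 a - Q_A2 b * Q_A1 a =
    (if b = prod.swap a then sc (of_int (Q_eps b) * of_nat (dims D4_S3 (fst b))) * un (dims D4_S3 (snd b)) else 0)"
  using a
proof (cases rule: Q_arrow_cases)
  case (1 l)
  then obtain m where m: "m \<in> leaves" "b = (2, m)" using b ab by (cases b) (auto simp: Q_arrow_iff)
  show ?thesis
    using 1(1) m(1) unfolding 1(2) m(2) fst_conv snd_conv prod.swap_def Q_values(1-4) Q_values(5-8)[OF m(1)]
    by (elim insertE emptyE) (simp_all add: qcol_def qrow_def small_defs M3_ops)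
next
  case (2 l)
  then have m: "b = (l, 2)" using b ab by (cases b) (auto simp: Q_arrow_iff)
  show ?thesis
    using 2(1) unfolding 2(2) m fst_conv snd_conv prod.swap_def Q_values(1-4) Q_values(5-8)[OF 2(1)]
    by (elim insertE emptyE) (simp_all add: qcol_def qrow_def small_defs M3_ops)
qed

lemma Q_padded: "padded_rep D4_S3 Q_A1" "padded_rep D4_S3 Q_A2"
proof -
  have "un (dims D4_S3 (snd a)) * Q_A1 a = Q_A1 a \<and> Q_A1 a * un (dims D4_S3 (fst a)) = Q_A1 a \<and>
    un (dims D4_S3 (snd a)) * Q_A2 a = Q_A2 a \<and> Q_A2 a * un (dims D4_S3 (fst a)) = Q_A2 a" if "a \<in> arrows D4_S3" for a
    using that by (cases rule: Q_arrow_cases) (auto simp: qcol_def qrow_def small_defs M3_ops)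
  then show "padded_rep D4_S3 Q_A1" "padded_rep D4_S3 Q_A2" by (auto simp: padded_rep_def)
qed

lemma Q_orientation: "orientation D4_S3 Q_eps"
  unfolding orientation_def
proof
  fix a assume "a \<in> arrows D4_S3"
  then show "Q_eps a \<in> {1, - 1} \<and> Q_eps (prod.swap a) = - Q_eps a"
    by (cases rule: Q_arrow_cases) auto
qed

lemma Q_in_arrows: "in_arrows D4_S3 2 = {(0, 2), (1, 2), (3, 2), (4, 2)}"
  "l \<in> leaves \<Longrightarrow> in_arrows D4_S3 l = {(2, l)}"
proof -
  have ext: "in_arrows D4_S3 j = B" if "\<And>i l. (i, l) \<in> arrows D4_S3 \<and> l = j \<longleftrightarrow> (i, l) \<in> B" for j B
  proof (rule Set.set_eqI)
    fix a :: "nat \<times> nat"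
    obtain i l where a: "a = (i, l)" by (cases a)
    show "a \<in> in_arrows D4_S3 j \<longleftrightarrow> a \<in> B" using that[of i l] by (simp add: in_arrows_def a)
  qed
  show "in_arrows D4_S3 2 = {(0, 2), (1, 2), (3, 2), (4, 2)}"
    by (rule ext, unfold Q_arrow_iff) auto
  show "in_arrows D4_S3 l = {(2, l)}" if "l \<in> leaves"
    by (rule ext, unfold Q_arrow_iff) (use that in auto)
qed

lemma Q_square:
  assumes j: "j \<in> verts D4_S3"
  shows "(\<Sum>a\<in>in_arrows D4_S3 j. sc (of_int (Q_eps a)) * (Q_A1 a * Q_A2 (prod.swap a))) = sc (of_nat (dims D4_S3 j)) * un (dims D4_S3 j) \<and>
    (\<Sum>a\<in>in_arrows D4_S3 j. sc (of_int (Q_eps a)) * (Q_A2 a * Q_A1 (prod.swap a))) = - (sc (of_nat (dims D4_S3 j)) * un (dims D4_S3 j)) \<and>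
    (\<Sum>a\<in>in_arrows D4_S3 j. sc (of_int (Q_eps a)) * (Q_A1 a * Q_A1 (prod.swap a))) = 0 \<and>
    (\<Sum>a\<in>in_arrows D4_S3 j. sc (of_int (Q_eps a)) * (Q_A2 a * Q_A2 (prod.swap a))) = 0"
proof -
  have "j \<in> leaves \<or> j = 2" using j by auto
  then show ?thesis
  proof
    assume l: "j \<in> leaves"
    show ?thesis unfolding Q_in_arrows(2)[OF l] using l
      by (auto simp: qcol_def qrow_def small_defs M3_ops simp del: sum_constant)
  next
    assume l: "j = 2"
    show ?thesis unfolding l Q_in_arrows(1)
      by (simp add: qcol_def qrow_def small_defs M3_ops del: sum_constant)
  qed
qed

text \<open>A normal form, by the values at 1, 3 and 4, in which the six permutations and their
  products can be compared directly.\<close>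

definition tri :: "nat \<Rightarrow> nat \<Rightarrow> nat \<Rightarrow> nat \<Rightarrow> nat" where
  "tri a b c = id(1 := a, 3 := b, 4 := c)"

lemma tri_values: "tri a b c 0 = 0" "tri a b c 1 = a" "tri a b c (Suc 0) = a" "tri a b c 2 = 2" "tri a b c 3 = b" "tri a b c 4 = c"
  by (simp_all add: tri_def)

lemma tri_comp: "tri a b c \<circ> tri a' b' c' = tri (tri a b c a') (tri a b c b') (tri a b c c')"
  by (auto simp: tri_def fun_eq_iff)

lemma tri_eq: "tri a b c = tri a' b' c' \<longleftrightarrow> a = a' \<and> b = b' \<and> c = c'"
  by (metis tri_values(2,5,6))

lemma tri_id: "id = tri 1 3 4"
  by (auto simp: tri_def fun_eq_iff)

lemma permutes_134:
  assumes "p permutes {1, 3, 4 :: nat}"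
  shows "p \<in> {tri 1 3 4, tri 1 4 3, tri 3 1 4, tri 3 4 1, tri 4 1 3, tri 4 3 1}"
proof -
  have v: "p 1 \<in> {1, 3, 4}" "p 3 \<in> {1, 3, 4}" "p 4 \<in> {1, 3, 4}" using permutes_in_image[OF assms] by blast+
  have i: "inj p" by (rule permutes_inj[OF assms])
  have d: "p 1 \<noteq> p 3" "p 1 \<noteq> p 4" "p 3 \<noteq> p 4" using injD[OF i, of 1 3] injD[OF i, of 1 4] injD[OF i, of 3 4] by auto
  have "p = tri (p 1) (p 3) (p 4)" using permutes_not_in[OF assms] by (auto simp: tri_def fun_eq_iff)
  moreover have "tri (p 1) (p 3) (p 4) \<in> {tri 1 3 4, tri 1 4 3, tri 3 1 4, tri 3 4 1, tri 4 1 3, tri 4 3 1}"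
    using v d unfolding tri_eq insert_iff by auto
  ultimately show ?thesis by metis
qed

lemma tri_permutes:
  assumes "p \<in> {tri 1 3 4, tri 1 4 3, tri 3 1 4, tri 3 4 1, tri 4 1 3, tri 4 3 1}"
  shows "p permutes {1, 3, 4}"
proof (rule bij_imp_permutes)
  show "bij_betw p {1, 3, 4} {1, 3, 4}"
    using assms by (auto simp: bij_betw_def inj_on_def tri_values)
  show "p x = x" if "x \<notin> {1, 3, 4}" for x using assms that by (auto simp: tri_def)
qed

text \<open>S3 acts simply transitively by conjugation on the six pairs of a transposition and a
  3-cycle. The target pair consists of the permutations that \<open>rot 8\<close> and
  \<open>matH\<close> induce on the slice.\<close>

lemma S3_generators_conjugate:
  assumes "t permutes {1, 3, 4}" "c permutes {1, 3, 4}" "t \<noteq> id" "t \<circ> t = id" "c \<noteq> id" "c \<circ> c \<circ> c = id"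
  shows "\<exists>p. p permutes {1, 3, 4} \<and> p \<circ> t = tri 1 4 3 \<circ> p \<and> p \<circ> c = tri 3 4 1 \<circ> p"
proof -
  have t: "t \<in> {tri 1 4 3, tri 3 1 4, tri 4 3 1}"
    using permutes_134[OF assms(1)] assms(3,4)
    by (elim insertE emptyE) (simp_all add: tri_id tri_comp tri_values tri_eq)
  have c: "c \<in> {tri 3 4 1, tri 4 1 3}"
    using permutes_134[OF assms(2)] assms(5,6)
    by (elim insertE emptyE) (simp_all add: tri_id tri_comp tri_values tri_eq)
  have "\<exists>p\<in>{tri 1 3 4, tri 1 4 3, tri 3 1 4, tri 3 4 1, tri 4 1 3, tri 4 3 1}. p \<circ> t = tri 1 4 3 \<circ> p \<and> p \<circ> c = tri 3 4 1 \<circ> p"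
    using t c by (elim insertE emptyE) (simp_all add: tri_comp tri_values tri_eq)
  then show ?thesis using tri_permutes by blast
qed

lemma Q_perm_leaves:
  assumes "\<sigma> permutes {1, 3, 4}"
  shows "\<sigma> 2 = 2" "l \<in> leaves \<Longrightarrow> \<sigma> l \<in> leaves"
  using permutes_134[OF assms] by (auto simp: tri_values)

lemma Q_auts:
  assumes "\<sigma> \<in> diagram_perms D4_S3"
  shows "diagram_aut D4_S3 \<sigma>"
  unfolding diagram_aut_def
proof (intro conjI ballI)
  have p: "\<sigma> permutes {1, 3, 4}" using assms by simp
  show "bij \<sigma>" by (rule permutes_bij[OF p])
  have v: "verts D4_S3 = {0, 1, 2, 3, 4}" by auto
  show "\<sigma> ` verts D4_S3 = verts D4_S3" unfolding v using permutes_134[OF p] by (auto simp: tri_values)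
  show "map_prod \<sigma> \<sigma> a \<in> arrows D4_S3" if "a \<in> arrows D4_S3" for a
    using that Q_perm_leaves[OF p] by (cases rule: Q_arrow_cases) (simp_all only: map_prod_simp Q_arrow_iff, blast+)
  show "dims D4_S3 (\<sigma> i) = dims D4_S3 i" for i
    using Q_perm_leaves(1)[OF p] inj_eq[OF permutes_inj[OF p], of i 2] by simp
qed

lemma Q_eps_inv:
  assumes "\<sigma> \<in> diagram_perms D4_S3" "a \<in> arrows D4_S3"
  shows "Q_eps (map_prod \<sigma> \<sigma> a) = Q_eps a"
proof -
  have p: "\<sigma> permutes {1, 3, 4}" using assms by simp
  show ?thesis using Q_perm_leaves(1)[OF p] inj_eq[OF permutes_inj[OF p], of _ 2] by (cases a) simp
qed

text \<open>With q_l the quaternion at the leaf \<open>l\<close>, both \<open>col\<close> and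
  \<open>row\<close> express that g q_l g^-1 is s_l times the quaternion at \<sigma>(l). The signs
  are their own inverses and so serve in both halves of the gauge pair.\<close>

lemma Q_twisted:
  assumes g: "g = mat22 a b c d" and det: "a * d - b * c = 1"
    and s: "\<And>l. s l * s l = 1" and \<sigma>: "\<sigma> 2 = 2" "\<And>l. l \<in> leaves \<Longrightarrow> \<sigma> l \<in> leaves"
    and col: "\<And>l x y. l \<in> leaves \<Longrightarrow> qcol (\<sigma> l) (a * x + b * y) (c * x + d * y) = sqm a b c d * qcol l x y * scal (s l)"
    and row: "\<And>l x y. l \<in> leaves \<Longrightarrow> qrow (\<sigma> l) (a * x + b * y) (c * x + d * y) = scal (s l) * qrow l x y * sqm d (- b) (- c) a"
  shows "twisted_equivariant D4_S3 Q_A1 Q_A2 g \<sigma>"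
  unfolding twisted_equivariant_def
proof (intro exI conjI allI ballI)
  let ?h = "\<lambda>i. if i = 2 then sqm a b c d else scal (s i)" and ?h' = "\<lambda>i. if i = 2 then sqm d (- b) (- c) a else scal (s i)"
  show "gauge_pair D4_S3 ?h ?h'"
    unfolding gauge_pair_def using det by (auto simp: small_defs M3_ops s algebra_simps)
  fix x y e assume e: "e \<in> arrows D4_S3"
  have act: "act_fst g x y = a * x + b * y" "act_snd g x y = c * x + d * y"
    by (simp_all add: g act_fst_def act_snd_def)
  show "slice_rep Q_A1 Q_A2 (act_fst g x y) (act_snd g x y) (map_prod \<sigma> \<sigma> e) = pair_act ?h ?h' (slice_rep Q_A1 Q_A2 x y) e"
    using e
  proof (cases rule: Q_arrow_cases)
    case (1 l)
    then have "l \<noteq> 2" by auto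
    then show ?thesis
      unfolding 1(2) by (simp add: pair_act_def Q_slice_values \<sigma>(1) act col[OF 1(1)] del: insert_iff)
  next
    case (2 l)
    then have "l \<noteq> 2" by auto
    then show ?thesis
      unfolding 2(2) by (simp add: pair_act_def Q_slice_values(2)[OF 2(1)] Q_slice_values(2)[OF \<sigma>(2)[OF 2(1)]] \<sigma>(1) act row[OF 2(1)] del: insert_iff)
  qed
qed

lemmas q_simps = qcol_values qrow_values tri_values small_ops

lemma Q_twisted_rot: "twisted_equivariant D4_S3 Q_A1 Q_A2 (rot 4) id"
  by (rule Q_twisted[OF rot_4, where s = "\<lambda>l. if l \<in> {0, 1} then 1 else - 1"])
    (simp, simp, simp, simp, (elim insertE emptyE; simp add: q_simps qcol_def qrow_def ii_pull)+)

lemma Q_twisted_J: "twisted_equivariant D4_S3 Q_A1 Q_A2 matJ id"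
  by (rule Q_twisted[OF matJ_def, where s = "\<lambda>l. if l \<in> {0, 3} then 1 else - 1"])
    (simp, simp, simp, simp, (elim insertE emptyE; simp add: q_simps qcol_def qrow_def ii_pull)+)

text \<open>Conjugation by \<open>rot 8\<close> maps i to i, j to k and k to - j, whence the single
  sign at the leaf 4.\<close>

lemma Q_twisted_rot_flip: "twisted_equivariant D4_S3 Q_A1 Q_A2 (rot 8) (tri 1 4 3)"
  by (rule Q_twisted[OF rot_8, where s = "\<lambda>l. if l = 4 then - 1 else 1"])
    (simp add: xi, simp, simp add: tri_values, force simp: tri_values,
      (elim insertE emptyE; simp add: q_simps qcol_def qrow_def xi xi_ii(1,2,5,6) mult.assoc[symmetric])+)

text \<open>Conjugation by \<open>matH\<close> maps i to j, j to k and k to i, all without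
  signs.\<close>

lemma Q_twisted_H: "twisted_equivariant D4_S3 Q_A1 Q_A2 matH (tri 3 4 1)"
  by (rule Q_twisted[OF matH_def half_i, where s = "\<lambda>l. 1"])
    (simp, simp add: tri_values, force simp: tri_values,
      (elim insertE emptyE; simp add: q_simps qcol_def qrow_def ii_pull algebra_simps add_divide_distrib diff_divide_distrib)+)

lemma matH_conj:
  "matH * rot 4 * inv\<^bsub>SU2\<^esub> matH = matJ" "inv\<^bsub>SU2\<^esub> matH * rot 4 * matH = rot 4 * matJ"
  "matH * matJ * inv\<^bsub>SU2\<^esub> matH = rot 4 * matJ" "inv\<^bsub>SU2\<^esub> matH * matJ * matH = rot 4"
  unfolding matH_inv unfolding rot_4 matJ_def matH_def
  by (simp_all add: mat22_mult mat22_eq_iff complex_eq_iff)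

lemma D4_small: "small_grp D4_S3 = generate SU2 {rot 4, matJ}"
  by (simp add: binary_dihedral_grp_def)

lemma Q_generators: "mckay_generators D4_S3 Q_eps Q_A1 Q_A2 {rot 4, matJ} {rot 8, rot 4, matJ, matH}"
proof
  let ?S = "{rot 4, matJ}" and ?S' = "{rot 8, rot 4, matJ, matH}"
  show "small_grp D4_S3 = generate SU2 ?S" by (rule D4_small)
  show big: "big_grp D4_S3 = generate SU2 ?S'" by (simp add: binary_octahedral_grp_def)
  show "?S \<subseteq> big_grp D4_S3" unfolding big by (auto intro: generate.incl)
  show S: "?S \<subseteq> carrier SU2" and "?S' \<subseteq> carrier SU2" using rot_SU2 matJ_SU2 matH_SU2 by auto
  have sg: "subgroup (generate SU2 ?S) SU2" by (rule SU2.generate_is_subgroup[OF S])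
  have cl: "g * h \<in> generate SU2 ?S" if "g \<in> generate SU2 ?S" "h \<in> generate SU2 ?S" for g h
    using subgroup.m_closed[OF sg that] by simp
  note iv = subgroup.m_inv_closed[OF sg]
  have g: "rot 4 \<in> generate SU2 ?S" "matJ \<in> generate SU2 ?S" by (auto intro: generate.incl)
  show "s * t * inv\<^bsub>SU2\<^esub> s \<in> small_grp D4_S3" "inv\<^bsub>SU2\<^esub> s * t * s \<in> small_grp D4_S3"
    if s: "s \<in> ?S'" and t: "t \<in> ?S" for s t
  proof -
    have tS: "t \<in> generate SU2 ?S" using t by (rule generate.incl)
    have "s * t * inv\<^bsub>SU2\<^esub> s \<in> generate SU2 ?S \<and> inv\<^bsub>SU2\<^esub> s * t * s \<in> generate SU2 ?S"
    proof (cases "s = rot 8 \<or> s = matH")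
      case True
      then show ?thesis using t
        by (elim disjE insertE emptyE) (simp_all only: rot_8_conj matH_conj, auto intro!: cl iv g)
    next
      case False
      then have "s \<in> generate SU2 ?S" using s by (auto intro: generate.incl)
      then show ?thesis by (intro conjI cl iv tS)
    qed
    then show "s * t * inv\<^bsub>SU2\<^esub> s \<in> small_grp D4_S3" "inv\<^bsub>SU2\<^esub> s * t * s \<in> small_grp D4_S3" unfolding D4_small by blast+
  qed
  show "\<exists>K\<subseteq>small_grp D4_S3. finite K \<and> (\<Sum>i\<in>verts D4_S3. (dims D4_S3 i)\<^sup>2) \<le> card K"
  proof -
    have v: "verts D4_S3 = {0, 1, 2, 3, 4}" by auto
    show ?thesis unfolding D4_small v using dihedral_large[of 4 ?S] by simp
  qed
  show "twisted_equivariant D4_S3 Q_A1 Q_A2 g id" if "g \<in> ?S" for g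
    using that Q_twisted_rot Q_twisted_J by auto
  show "valid_triple D4_S3" by simp
qed (use Q_padded Q_wedge Q_square Q_auts Q_eps_inv Q_orientation in blast)+

lemma rot_8_not_in_Q8: "rot 8 \<notin> generate SU2 {rot 4, matJ}"
proof
  assume "rot 8 \<in> generate SU2 {rot 4, matJ}"
  then have "xi ^ 4 = 1" using Q8_monomial[of "rot 8"] xi(1) by (auto simp: rot_8 mat22_eq_iff)
  then show False using xi(3) by (simp add: power4_eq_xxxx mult.assoc)
qed

lemma Q_main:
  assumes \<alpha>: "diagram_action D4_S3 \<alpha>"
  shows "\<exists>\<epsilon> \<rho>. orientation D4_S3 \<epsilon> \<and> lifted_action D4_S3 \<alpha> \<rho> \<and> symplectic_action D4_S3 \<epsilon> \<rho> \<and>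
    induces_natural_action D4_S3 \<epsilon> \<rho>"
proof -
  interpret Q: mckay_generators D4_S3 Q_eps Q_A1 Q_A2 "{rot 4, matJ}" "{rot 8, rot 4, matJ, matH}"
    by (rule Q_generators)
  let ?a = "\<lambda>g. \<alpha> (small_grp D4_S3 #>\<^bsub>SU2\<^esub> g)"
  have b: "g \<in> big_grp D4_S3" if "g \<in> {rot 8, rot 4, matJ, matH}" for g
    unfolding Q.gens(4) using that by (rule generate.incl)
  have mult: "?a (g * h) = ?a g \<circ> ?a h" if "g \<in> big_grp D4_S3" "h \<in> big_grp D4_S3" for g h
    by (rule Q.alpha_mult[OF \<alpha> that])
  have bc: "g * h \<in> big_grp D4_S3" if "g \<in> big_grp D4_S3" "h \<in> big_grp D4_S3" for g h
    using subgroup.m_closed[OF Q.big_sub that] by simp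
  \<comment> \<open>Modulo \<Gamma>, \<open>rot 8\<close> and \<open>matH\<close> have orders 2 and
    3: the square of the first is \<open>rot 4\<close>, the cube of the second is the square of
    \<open>rot 4\<close>.\<close>
  have r: "rot 8 * rot 8 = rot 4" unfolding rot_8 rot_4 by (simp add: mat22_mult mat22_eq_iff xi)
  have H: "matH * matH * matH = rot 4 * rot 4"
    unfolding matH_square unfolding matH_def rot_4 by (simp add: mat22_mult mat22_eq_iff complex_eq_iff)
  have g4: "rot 4 \<in> small_grp D4_S3" unfolding D4_small by (auto intro: generate.incl)
  have g44: "rot 4 * rot 4 \<in> small_grp D4_S3" using subgroup.m_closed[OF Q.small_sub g4 g4] by simp
  have "\<exists>p. p permutes {1, 3, 4} \<and> p \<circ> ?a (rot 8) = tri 1 4 3 \<circ> p \<and> p \<circ> ?a matH = tri 3 4 1 \<circ> p"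
  proof (rule S3_generators_conjugate)
    show "?a (rot 8) permutes {1, 3, 4}" "?a matH permutes {1, 3, 4}"
      using Q.alpha_perm[OF \<alpha> b] by (auto simp del: small_grp.simps)
    show "?a (rot 8) \<noteq> id"
      using Q.alpha_id_imp_small[OF \<alpha> b, of "rot 8"] rot_8_not_in_Q8 unfolding D4_small by blast
    show "?a matH \<noteq> id"
      using Q.alpha_id_imp_small[OF \<alpha> b, of matH] matH_not_in_Q8(1) unfolding D4_small by blast
    have "?a (rot 8) \<circ> ?a (rot 8) = ?a (rot 8 * rot 8)" using mult[OF b b] by simp
    then show "?a (rot 8) \<circ> ?a (rot 8) = id" unfolding r using Q.alpha_small[OF \<alpha> g4] by simp
    have "?a matH \<circ> ?a matH \<circ> ?a matH = ?a (matH * matH * matH)"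
      using mult[OF bc[OF b b] b, of matH matH matH] mult[OF b b, of matH matH] by simp
    then show "?a matH \<circ> ?a matH \<circ> ?a matH = id" unfolding H using Q.alpha_small[OF \<alpha> g44] by simp
  qed
  then obtain p where p: "p permutes {1, 3, 4}" "p \<circ> ?a (rot 8) = tri 1 4 3 \<circ> p" "p \<circ> ?a matH = tri 3 4 1 \<circ> p"
    by blast
  have pd: "p \<in> diagram_perms D4_S3" using p(1) by simp
  note aut = Q_auts[OF pd]
  note rel = mckay_generators_relabel[OF Q_generators aut Q_eps_inv[OF pd]]
  have "\<exists>\<rho>. lifted_action D4_S3 \<alpha> \<rho> \<and> symplectic_action D4_S3 Q_eps \<rho> \<and> induces_natural_action D4_S3 Q_eps \<rho>"
  proof (rule mckay_generators.action_from_generators[OF rel \<alpha>])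
    fix s assume "s \<in> {rot 8, rot 4, matJ, matH}"
    then consider "s = rot 8" | "s \<in> {rot 4, matJ}" | "s = matH" by blast
    then show "twisted_equivariant D4_S3 (\<lambda>a. Q_A1 (map_prod p p a)) (\<lambda>a. Q_A2 (map_prod p p a)) s (?a s)"
    proof cases
      case 1
      show ?thesis unfolding 1 by (rule twisted_equivariant_relabel[OF aut Q_twisted_rot_flip p(2)])
    next
      case 2
      then have "s \<in> small_grp D4_S3" unfolding D4_small by (rule generate.incl)
      moreover from this have "?a s = id" by (rule Q.alpha_small[OF \<alpha>])
      ultimately show ?thesis using mckay_generators.small_equivariant[OF rel] by simp
    next
      case 3
      show ?thesis unfolding 3 by (rule twisted_equivariant_relabel[OF aut Q_twisted_H p(3)])
    qed
  qed
  then show ?thesis using Q_orientation by blast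
qed

theorem mainTheorem4:
  fixes X :: mckay_triple and \<alpha> :: "complex mat set \<Rightarrow> nat \<Rightarrow> nat"
  assumes "valid_triple X"
    and "diagram_action X \<alpha>"
  shows "\<exists>\<epsilon> \<rho>. orientation X \<epsilon> \<and> lifted_action X \<alpha> \<rho> \<and> symplectic_action X \<epsilon> \<rho> \<and>
           induces_natural_action X \<epsilon> \<rho>"
proof (cases X)
  case (A_Z2 r)
  then show ?thesis using assms A_main by simp
next
  case (D_Z2 r)
  then have "r = r - 3 + 3" using assms(1) by simp
  then obtain s where "X = D_Z2 (s + 3)" using D_Z2 by metis
  then show ?thesis using assms(2) D_main_shifted by blast
next
  case E6_Z2
  then show ?thesis using assms(2) E_main by blast
next
  case D4_S3
  then show ?thesis using assms(2) Q_main by blast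
qed

end
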